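(* Let $\phi$ be a (real-valued) solution to the Benjamin-Ono equation $$(\partial_t+H\partial_x^2)\phi=\tfrac12\partial_x(\phi^2),\qquad\phi(0)=\phi_0,$$ whose initial data satisfies $\phi_0\in H^2(\mathbb{R})$ and $x\phi_0\in L^2(\mathbb{R})$. Then: a) $L\phi\in C_{loc}(\mathbb{R};L^2(\mathbb{R}))$, where $L=x-2tH\partial_x$. b) The expression $$G(\phi)=\int_{\mathbb{R}} x^2 m-4xt\,p+4t^2 e\;dx$$ is conserved along the flow, where $$m=\phi^2,\qquad p=\phi H\phi_x-\tfrac13\phi^3,\qquad e=\phi_x^2-\tfrac34\phi^2H\phi_x+\tfrac18\phi^4 .$$ c) We have the representation $$G(\phi)=\|L^{NL}\phi\|_{L^2}^2,\qquad\text{where}\qquad L^{NL}\phi=x\phi-2t\Big(H\phi_x-\tfrac18\big(3\phi^2-(H\phi)^2\big)\Big).$$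
   Context: $H$ denotes the Hilbert transform on the real line with Fourier symbol $-i\,\mathrm{sgn}\,\xi$, acting in the $x$ variable. The solution with $H^2$ data is the global solution $\phi\in C(\mathbb{R};H^2)$. At time $t$, $(L\phi)(t,x)=x\phi(t,x)-2t(H\phi_x)(t,x)$, and $G(\phi)$ is evaluated at time $t$ with the explicit factors of $t$ included; "conserved" means that $G(\phi)$ is independent of $t\in\mathbb{R}$. *)

theory Defs
  imports "HOL-Analysis.Analysis"
begin

text \<open>Elements of \<open>L\<^sup>2(\<real>)\<close> and \<open>H\<^sup>k(\<real>)\<close> are represented by Borel functions. Operators determined
  only up to null sets (\<open>weak_deriv\<close>, \<open>hilbert\<close>) pick an arbitrary representative; every notion
  below is insensitive to that choice.\<close>

definition square_integrable :: "(real \<Rightarrow> 'a::euclidean_space) \<Rightarrow> bool" where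
  "square_integrable f \<longleftrightarrow>
     f \<in> borel_measurable lborel \<and> integrable lborel (\<lambda>x. (norm (f x))\<^sup>2)"

definition norm_L2 :: "(real \<Rightarrow> 'a::euclidean_space) \<Rightarrow> real" where
  "norm_L2 f = sqrt (LINT x|lborel. (norm (f x))\<^sup>2)"

text \<open>The first conjunct is needed because \<open>norm_L2\<close> has the junk value \<open>0\<close> outside \<open>L\<^sup>2\<close>.\<close>

definition tendsto_L2 ::
  "('i \<Rightarrow> real \<Rightarrow> 'a::euclidean_space) \<Rightarrow> (real \<Rightarrow> 'a) \<Rightarrow> 'i filter \<Rightarrow> bool" where
  "tendsto_L2 u f F \<longleftrightarrow>
     (\<forall>\<^sub>F i in F. square_integrable (\<lambda>x. u i x - f x)) \<and>
     ((\<lambda>i. norm_L2 (\<lambda>x. u i x - f x)) \<longlongrightarrow> 0) F"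

definition continuous_L2 :: "(real \<Rightarrow> real \<Rightarrow> real) \<Rightarrow> bool" where
  "continuous_L2 u \<longleftrightarrow>
     (\<forall>t. square_integrable (u t)) \<and> (\<forall>t. tendsto_L2 u (u t) (at t))"

definition has_L2_deriv :: "(real \<Rightarrow> real \<Rightarrow> real) \<Rightarrow> (real \<Rightarrow> real) \<Rightarrow> real \<Rightarrow> bool" where
  "has_L2_deriv u v t \<longleftrightarrow>
     square_integrable v \<and> tendsto_L2 (\<lambda>h x. (u (t + h) x - u t x) / h) v (at 0)"

definition test_function :: "(real \<Rightarrow> real) \<Rightarrow> bool" where
  "test_function \<psi> \<longleftrightarrow>
     (\<forall>n x. (deriv ^^ n) \<psi> differentiable (at x)) \<and> (\<exists>R. \<forall>x. \<bar>x\<bar> > R \<longrightarrow> \<psi> x = 0)"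

definition locally_integrable :: "(real \<Rightarrow> real) \<Rightarrow> bool" where
  "locally_integrable f \<longleftrightarrow> (\<forall>a b. set_integrable lborel {a..b} f)"

definition has_weak_deriv :: "(real \<Rightarrow> real) \<Rightarrow> (real \<Rightarrow> real) \<Rightarrow> bool" where
  "has_weak_deriv f g \<longleftrightarrow>
     locally_integrable f \<and> locally_integrable g \<and>
     (\<forall>\<psi>. test_function \<psi> \<longrightarrow>
        (LINT x|lborel. f x * deriv \<psi> x) = - (LINT x|lborel. g x * \<psi> x))"

definition weak_deriv :: "(real \<Rightarrow> real) \<Rightarrow> real \<Rightarrow> real" where
  "weak_deriv f = (SOME g. has_weak_deriv f g)"

primrec sobolev :: "nat \<Rightarrow> (real \<Rightarrow> real) \<Rightarrow> bool" where
  "sobolev 0 f \<longleftrightarrow> square_integrable f"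
| "sobolev (Suc k) f \<longleftrightarrow> square_integrable f \<and> (\<exists>g. has_weak_deriv f g \<and> sobolev k g)"

definition norm_sobolev :: "nat \<Rightarrow> (real \<Rightarrow> real) \<Rightarrow> real" where
  "norm_sobolev k f = sqrt (\<Sum>j\<le>k. (norm_L2 ((weak_deriv ^^ j) f))\<^sup>2)"

definition continuous_sobolev :: "nat \<Rightarrow> (real \<Rightarrow> real \<Rightarrow> real) \<Rightarrow> bool" where
  "continuous_sobolev k u \<longleftrightarrow>
     (\<forall>t. sobolev k (u t)) \<and>
     (\<forall>t. ((\<lambda>s. norm_sobolev k (\<lambda>x. u s x - u t x)) \<longlongrightarrow> 0) (at t))"

text \<open>The Fourier transform on \<open>L\<^sup>2\<close>, as the \<open>L\<^sup>2\<close> limit of the Fourier integrals of the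
  truncations of \<open>f\<close>, with phase \<open>exp (- i x \<xi>)\<close>, so that \<open>\<partial>\<^sub>x\<close> has symbol \<open>i \<xi>\<close>. Its
  normalisation is irrelevant for Fourier multipliers.\<close>

definition has_fourier_transform :: "(real \<Rightarrow> complex) \<Rightarrow> (real \<Rightarrow> complex) \<Rightarrow> bool" where
  "has_fourier_transform f F \<longleftrightarrow>
     square_integrable f \<and> square_integrable F \<and>
     tendsto_L2 (\<lambda>R \<xi>. LINT x:{-R..R}|lborel. cis (- (x * \<xi>)) * f x) F at_top"

definition has_hilbert_transform :: "(real \<Rightarrow> real) \<Rightarrow> (real \<Rightarrow> real) \<Rightarrow> bool" where
  "has_hilbert_transform f g \<longleftrightarrow>
     (\<exists>F. has_fourier_transform (\<lambda>x. complex_of_real (f x)) F \<and>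
          has_fourier_transform (\<lambda>x. complex_of_real (g x))
            (\<lambda>\<xi>. - \<i> * complex_of_real (sgn \<xi>) * F \<xi>))"

definition hilbert :: "(real \<Rightarrow> real) \<Rightarrow> real \<Rightarrow> real" where
  "hilbert f = (SOME g. has_hilbert_transform f g)"

text \<open>Global strong solutions in \<open>C(\<real>; H\<^sup>2)\<close>. Since \<open>- H \<partial>\<^sub>x\<^sup>2 \<phi> + \<partial>\<^sub>x (\<phi>\<^sup>2) / 2\<close> is then in
  \<open>C(\<real>; L\<^sup>2)\<close>, reading \<open>\<partial>\<^sub>t\<close> as the derivative in \<open>L\<^sup>2\<close> is equivalent to the
  distributional reading.\<close>

definition benjamin_ono_solution :: "(real \<Rightarrow> real \<Rightarrow> real) \<Rightarrow> bool" where
  "benjamin_ono_solution \<phi> \<longleftrightarrow>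
     continuous_sobolev 2 \<phi> \<and>
     (\<forall>t. \<exists>\<phi>t. has_L2_deriv \<phi> \<phi>t t \<and>
        (AE x in lborel.
           \<phi>t x + hilbert ((weak_deriv ^^ 2) (\<phi> t)) x
             = 1/2 * weak_deriv (\<lambda>y. (\<phi> t y)\<^sup>2) x))"

definition L_op :: "(real \<Rightarrow> real \<Rightarrow> real) \<Rightarrow> real \<Rightarrow> real \<Rightarrow> real" where
  "L_op \<phi> t x = x * \<phi> t x - 2 * t * hilbert (weak_deriv (\<phi> t)) x"

definition L_NL :: "(real \<Rightarrow> real \<Rightarrow> real) \<Rightarrow> real \<Rightarrow> real \<Rightarrow> real" where
  "L_NL \<phi> t x =
     x * \<phi> t x
       - 2 * t * (hilbert (weak_deriv (\<phi> t)) x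
                  - 1/8 * (3 * (\<phi> t x)\<^sup>2 - (hilbert (\<phi> t) x)\<^sup>2))"

definition mass_density :: "(real \<Rightarrow> real) \<Rightarrow> real \<Rightarrow> real" where
  "mass_density f x = (f x)\<^sup>2"

definition momentum_density :: "(real \<Rightarrow> real) \<Rightarrow> real \<Rightarrow> real" where
  "momentum_density f x = f x * hilbert (weak_deriv f) x - 1/3 * (f x) ^ 3"

definition energy_density :: "(real \<Rightarrow> real) \<Rightarrow> real \<Rightarrow> real" where
  "energy_density f x =
     (weak_deriv f x)\<^sup>2 - 3/4 * (f x)\<^sup>2 * hilbert (weak_deriv f) x + 1/8 * (f x) ^ 4"

definition G_density :: "(real \<Rightarrow> real \<Rightarrow> real) \<Rightarrow> real \<Rightarrow> real \<Rightarrow> real" where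
  "G_density \<phi> t x =
     x\<^sup>2 * mass_density (\<phi> t) x - 4 * x * t * momentum_density (\<phi> t) x
       + 4 * t\<^sup>2 * energy_density (\<phi> t) x"

definition G_functional :: "(real \<Rightarrow> real \<Rightarrow> real) \<Rightarrow> real \<Rightarrow> real" where
  "G_functional \<phi> t = (LINT x|lborel. G_density \<phi> t x)"

end

theory Submission
  imports Defs "HOL-Probability.Probability" "HOL-Computational_Algebra.Polynomial"
begin

text \<open>
  Write \<open>m\<close>, \<open>p\<close>, \<open>e\<close> for the mass, momentum and energy densities and consider the moments
  \<open>A = \<integral> x\<^sup>2 m\<close>, \<open>B = \<integral> x p\<close>, \<open>E = \<integral> e\<close> of the solution at time \<open>t\<close>. Formally \<open>A' = 4 B\<close>, \<open>B' = 2 E\<close> and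
  \<open>E' = 0\<close>, so \<open>G = A - 4 t B + 4 t\<^sup>2 E\<close> has derivative \<open>0\<close>. The equation is the conservation law
  \<open>\<phi>\<^sub>t + \<partial>\<^sub>x (H \<phi>\<^sub>x - \<phi>\<^sup>2 / 2) = 0\<close>, and the second relation says that \<open>B'\<close> is the integral of the square of
  its flux plus a pairing of the flux with \<open>H \<phi>\<^sub>x\<close>.

  These relations are made rigorous by replacing \<open>x\<close> with the bounded weight \<open>w = sin (\<epsilon> x) / \<epsilon>\<close>. The
  equation then may be tested against everything that occurs, and the only new terms are commutators
  \<open>[H, w]\<close>. Multiplication by \<open>w\<close> shifts frequencies by \<open>\<plusminus>\<epsilon>\<close>, while the symbol of \<open>H\<close> is constant on each half-line;
  hence \<open>[H, w]\<close> only sees frequencies of size at most \<open>\<epsilon>\<close>, and composed with a derivative it is bounded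
  on \<open>L\<^sup>2\<close> uniformly in \<open>\<epsilon>\<close> and tends to \<open>0\<close> strongly (\<open>commutator_deriv_bound\<close>,
  \<open>commutator_deriv_tendsto\<close>). The uniform bound and Gronwall's inequality propagate \<open>x \<phi> \<in> L\<^sup>2\<close> from the
  initial time to all times (\<open>xf_L2\<close>). Dominated convergence in time then gives the integrated
  relations for \<open>A\<close> and \<open>B\<close>, so that \<open>A\<close> is a quadratic polynomial in \<open>t\<close> and \<open>G\<close> is constant
  (\<open>G_conserved\<close>). Continuity of \<open>t \<mapsto> x \<phi>(t)\<close> in \<open>L\<^sup>2\<close> follows from the continuity of its norm, which is the
  square root of that polynomial, together with weak lower semicontinuity (\<open>continuous_xf\<close>).

  The algebra behind \<open>E' = 0\<close> and behind the representation of \<open>G\<close> is complex analytic: \<open>\<phi> + \<i> H \<phi>\<close> has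
  only nonnegative frequencies, therefore so have its powers, and their integrals vanish. In real
  terms this is Cotlar's identity \<open>H (\<phi>\<^sup>2 - (H \<phi>)\<^sup>2) = 2 \<phi> H \<phi>\<close> (\<open>cotlar\<close>), which yields
  \<open>\<integral> \<phi>\<^sup>3 = 3 \<integral> \<phi> (H \<phi>)\<^sup>2\<close>, the same with the weight \<open>x\<close>, and \<open>\<integral> \<phi>\<^sup>4 + (H \<phi>)\<^sup>4 = 6 \<integral> \<phi>\<^sup>2 (H \<phi>)\<^sup>2\<close>. The first, applied to \<open>\<phi>\<^sub>x\<close>,
  kills the cubic part of \<open>E'\<close>; the other two turn the expansion of the square of \<open>L\<^sup>N\<^sup>L \<phi>\<close> into \<open>G\<close>.

  Underneath lie the Plancherel theorem for the Fourier transform defined by truncation, and the fact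
  that a weakly differentiable function is almost everywhere equal to an integral of its weak
  derivative. The former makes \<open>H\<close> an antisymmetric isometry commuting with \<open>\<partial>\<^sub>x\<close>; the latter gives the product
  rule, integration by parts on the line and the bound of the supremum by the \<open>H\<^sup>1\<close> norm.
\<close>

section \<open>Square-integrable functions\<close>

lemma integral_eqI: "(\<And>x. f x = g x) \<Longrightarrow> (LINT x|M. f x) = (LINT x|M. g x)"
  by (rule Bochner_Integration.integral_cong) auto

abbreviation L2 :: "(real \<Rightarrow> 'a::euclidean_space) \<Rightarrow> bool" where
  "L2 \<equiv> square_integrable"

lemma L2_measurable [measurable_dest]: "L2 f \<Longrightarrow> f \<in> borel_measurable borel"
  by (simp add: square_integrable_def)

lemma L2_integrable_sq: "L2 f \<Longrightarrow> integrable lborel (\<lambda>x. (norm (f x))\<^sup>2)"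
  by (simp add: square_integrable_def)

lemma L2_I: "f \<in> borel_measurable borel \<Longrightarrow> integrable lborel (\<lambda>x. (norm (f x))\<^sup>2) \<Longrightarrow> L2 f"
  by (simp add: square_integrable_def)

lemma L2_bound:
  fixes f :: "real \<Rightarrow> 'a::euclidean_space" and w :: "real \<Rightarrow> 'b::euclidean_space"
  assumes "L2 w" "f \<in> borel_measurable borel" "AE x in lborel. norm (f x) \<le> norm (w x)"
  shows "L2 f"
proof (rule L2_I)
  show "integrable lborel (\<lambda>x. (norm (f x))\<^sup>2)"
    by (rule Bochner_Integration.integrable_bound[OF L2_integrable_sq[OF assms(1)]])
       (use assms in \<open>auto intro: power_mono\<close>)
qed (fact assms)

lemma norm_L2_nonneg [simp]: "0 \<le> norm_L2 f"
  by (simp add: norm_L2_def)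

lemma norm_L2_sq: "(norm_L2 f)\<^sup>2 = (LINT x|lborel. (norm (f x))\<^sup>2)"
  by (simp add: norm_L2_def)

lemma norm_L2_norm: "norm_L2 (\<lambda>x. norm (f x)) = norm_L2 f"
  by (simp add: norm_L2_def)

lemma L2_norm: "L2 f \<Longrightarrow> L2 (\<lambda>x. norm (f x))"
  by (rule L2_bound[of f]) (auto simp: L2_measurable)

lemma norm_L2_zero [simp]: "norm_L2 (\<lambda>x. 0) = 0"
  by (simp add: norm_L2_def)

lemma norm_L2_mono:
  assumes "L2 w" "f \<in> borel_measurable borel" "AE x in lborel. norm (f x) \<le> norm (w x)"
  shows "norm_L2 f \<le> norm_L2 w"
  unfolding norm_L2_def
  by (intro real_sqrt_le_mono integral_mono_AE L2_integrable_sq L2_bound[OF assms] assms(1))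
     (use assms(3) in \<open>auto intro: power_mono\<close>)

lemma L2_mult_integrable:
  fixes f g :: "real \<Rightarrow> 'a::{real_normed_field,euclidean_space}"
  assumes "L2 f" "L2 g"
  shows "integrable lborel (\<lambda>x. f x * g x)"
proof (rule Bochner_Integration.integrable_bound)
  show "integrable lborel (\<lambda>x. (norm (f x))\<^sup>2 + (norm (g x))\<^sup>2)"
    using assms by (intro Bochner_Integration.integrable_add L2_integrable_sq)
  show "(\<lambda>x. f x * g x) \<in> borel_measurable lborel"
    using assms[THEN L2_measurable] by simp
  have "norm (f x * g x) \<le> norm ((norm (f x))\<^sup>2 + (norm (g x))\<^sup>2)" for x
    using sum_squares_bound[of "norm (f x)" "norm (g x)"] mult_nonneg_nonneg[OF norm_ge_zero[of "f x"] norm_ge_zero[of "g x"]]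
    unfolding norm_mult real_norm_def by linarith
  then show "AE x in lborel. norm (f x * g x) \<le> norm ((norm (f x))\<^sup>2 + (norm (g x))\<^sup>2)"
    by simp
qed

lemma quadratic_nonneg_discr:
  fixes A B C :: real
  assumes "\<And>t. 0 \<le> A - 2 * t * B + t\<^sup>2 * C" "0 \<le> C"
  shows "B\<^sup>2 \<le> A * C"
proof (cases "C = 0")
  case True
  have "B = 0"
  proof (rule ccontr)
    assume "B \<noteq> 0"
    then show False using assms(1)[of "(A+1)/(2*B)"] True by simp
  qed
  then show ?thesis using True by simp
next
  case False
  then have "C > 0" using assms(2) by simp
  have "0 \<le> (A - 2 * (B/C) * B + (B/C)\<^sup>2 * C) * C"
    using assms(1)[of "B/C"] \<open>C > 0\<close> by simp
  also have "\<dots> = A * C - B\<^sup>2"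
    using \<open>C > 0\<close> by (simp add: field_simps power2_eq_square)
  finally show ?thesis by simp
qed

lemma Cauchy_Schwarz_L2_real:
  fixes f g :: "real \<Rightarrow> real"
  assumes "L2 f" "L2 g"
  shows "\<bar>LINT x|lborel. f x * g x\<bar> \<le> norm_L2 f * norm_L2 g"
proof -
  have i: "integrable lborel (\<lambda>x. (f x)\<^sup>2)" "integrable lborel (\<lambda>x. (g x)\<^sup>2)"
    using assms[THEN L2_integrable_sq] by simp_all
  note j = L2_mult_integrable[OF assms]
  have "0 \<le> (LINT x|lborel. (f x)\<^sup>2) - 2 * t * (LINT x|lborel. f x * g x) + t\<^sup>2 * (LINT x|lborel. (g x)\<^sup>2)" for t
  proof -
    have "0 \<le> (LINT x|lborel. (f x - t * g x)\<^sup>2)" by simp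
    also have "\<dots> = (LINT x|lborel. (f x)\<^sup>2 - 2 * t * (f x * g x) + t\<^sup>2 * (g x)\<^sup>2)"
      by (intro integral_eqI) (simp add: algebra_simps power2_eq_square)
    finally show ?thesis using i j by simp
  qed
  from quadratic_nonneg_discr[OF this]
  have "(LINT x|lborel. f x * g x)\<^sup>2 \<le> (norm_L2 f * norm_L2 g)\<^sup>2"
    by (simp add: norm_L2_sq power_mult_distrib)
  then show ?thesis using abs_le_square_iff[of "LINT x|lborel. f x * g x" "norm_L2 f * norm_L2 g"] by simp
qed

lemma Cauchy_Schwarz_L2_norm:
  fixes f g :: "real \<Rightarrow> 'a::{real_normed_field,euclidean_space}"
  assumes "L2 f" "L2 g"
  shows "(LINT x|lborel. norm (f x) * norm (g x)) \<le> norm_L2 f * norm_L2 g"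
  using Cauchy_Schwarz_L2_real[OF L2_norm[OF assms(1)] L2_norm[OF assms(2)]]
  unfolding norm_L2_norm by linarith

lemma Cauchy_Schwarz_L2:
  fixes f g :: "real \<Rightarrow> 'a::{real_normed_field,euclidean_space}"
  assumes "L2 f" "L2 g"
  shows "norm (LINT x|lborel. f x * g x) \<le> norm_L2 f * norm_L2 g"
proof -
  have "norm (LINT x|lborel. f x * g x) \<le> (LINT x|lborel. norm (f x) * norm (g x))"
    using integral_norm_bound[of lborel "\<lambda>x. f x * g x"] by (simp add: norm_mult)
  also note Cauchy_Schwarz_L2_norm[OF assms]
  finally show ?thesis .
qed

lemma norm_L2_triangle_aux:
  fixes f g :: "real \<Rightarrow> 'a::euclidean_space"
  assumes "L2 f" "L2 g"
  shows "L2 (\<lambda>x. f x + g x) \<and> norm_L2 (\<lambda>x. f x + g x) \<le> norm_L2 f + norm_L2 g"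
proof -
  let ?a = "\<lambda>x. norm (f x)" and ?b = "\<lambda>x. norm (g x)"
  note [measurable] = assms[THEN L2_measurable]
  have i: "integrable lborel (\<lambda>x. (?a x)\<^sup>2)" "integrable lborel (\<lambda>x. (?b x)\<^sup>2)"
    using assms[THEN L2_integrable_sq] by simp_all
  have j: "integrable lborel (\<lambda>x. ?a x * ?b x)"
    by (rule L2_mult_integrable) (use assms L2_norm in auto)
  have eq: "(?a x + ?b x)\<^sup>2 = (?a x)\<^sup>2 + 2 * (?a x * ?b x) + (?b x)\<^sup>2" for x
    by (simp add: power2_sum)
  have int: "integrable lborel (\<lambda>x. (?a x + ?b x)\<^sup>2)"
    unfolding eq using i j by simp
  then have L: "L2 (\<lambda>x. ?a x + ?b x)"
    by (intro L2_I) auto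
  have AE: "AE x in lborel. norm (f x + g x) \<le> norm (?a x + ?b x)"
    using norm_triangle_ineq by (auto simp: abs_of_nonneg)
  have 1: "L2 (\<lambda>x. f x + g x)" by (rule L2_bound[OF L _ AE]) auto
  have "norm_L2 (\<lambda>x. f x + g x) \<le> norm_L2 (\<lambda>x. ?a x + ?b x)"
    by (rule norm_L2_mono[OF L _ AE]) auto
  also have "\<dots> \<le> norm_L2 f + norm_L2 g"
  proof (rule power2_le_imp_le)
    have "(norm_L2 (\<lambda>x. ?a x + ?b x))\<^sup>2 = (norm_L2 f)\<^sup>2 + 2 * (LINT x|lborel. ?a x * ?b x) + (norm_L2 g)\<^sup>2"
      using i j by (simp add: norm_L2_sq eq)
    also have "\<dots> \<le> (norm_L2 f)\<^sup>2 + 2 * (norm_L2 f * norm_L2 g) + (norm_L2 g)\<^sup>2"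
      using Cauchy_Schwarz_L2_real[OF L2_norm[OF assms(1)] L2_norm[OF assms(2)]]
      unfolding norm_L2_norm by linarith
    finally show "(norm_L2 (\<lambda>x. ?a x + ?b x))\<^sup>2 \<le> (norm_L2 f + norm_L2 g)\<^sup>2"
      by (simp add: power2_sum)
  qed simp
  finally show ?thesis using 1 by simp
qed

lemmas L2_add = norm_L2_triangle_aux[THEN conjunct1]
lemmas norm_L2_triangle = norm_L2_triangle_aux[THEN conjunct2]

lemma L2_mult_bounded:
  fixes b f :: "real \<Rightarrow> 'a::{real_normed_field,euclidean_space}"
  assumes "L2 f" "b \<in> borel_measurable borel" "AE x in lborel. norm (b x) \<le> c"
  shows "L2 (\<lambda>x. b x * f x) \<and> norm_L2 (\<lambda>x. b x * f x) \<le> \<bar>c\<bar> * norm_L2 f"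
proof -
  note [measurable] = assms(2) L2_measurable[OF assms(1)]
  have L: "L2 (\<lambda>x. c *\<^sub>R f x)"
    using L2_integrable_sq[OF assms(1)] by (intro L2_I) (auto simp: power_mult_distrib)
  have AE: "AE x in lborel. norm (b x * f x) \<le> norm (c *\<^sub>R f x)"
    using assms(3) by (auto simp: norm_mult intro!: mult_right_mono)
  have "norm_L2 (\<lambda>x. c *\<^sub>R f x) = \<bar>c\<bar> * norm_L2 f"
    by (simp add: norm_L2_def power_mult_distrib real_sqrt_mult)
  moreover have "(\<lambda>x. b x * f x) \<in> borel_measurable borel" by measurable
  ultimately show ?thesis
    using norm_L2_mono[OF L _ AE] L2_bound[OF L _ AE] by metis
qed

lemma L2_cmult:
  fixes f :: "real \<Rightarrow> 'a::{real_normed_field,euclidean_space}"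
  assumes "L2 f"
  shows "L2 (\<lambda>x. c * f x)"
  using L2_mult_bounded[OF assms, of "\<lambda>_. c" "norm c"] by simp

lemma norm_L2_cmult:
  fixes f :: "real \<Rightarrow> 'a::{real_normed_field,euclidean_space}"
  shows "norm_L2 (\<lambda>x. c * f x) = norm c * norm_L2 f"
  by (simp add: norm_L2_def norm_mult power_mult_distrib real_sqrt_mult)

lemma L2_uminus: "L2 f \<Longrightarrow> L2 (\<lambda>x. - f x)"
  by (rule L2_bound[of f]) (auto dest: L2_measurable)

lemma norm_L2_uminus [simp]: "norm_L2 (\<lambda>x. - f x) = norm_L2 f"
  by (simp add: norm_L2_def)

lemma norm_L2_minus_commute: "norm_L2 (\<lambda>x. f x - g x) = norm_L2 (\<lambda>x. g x - f x)"
  by (simp add: norm_L2_def norm_minus_commute)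

lemma L2_diff: "L2 f \<Longrightarrow> L2 g \<Longrightarrow> L2 (\<lambda>x. f x - g x)"
  using L2_add[OF _ L2_uminus, of f g] by simp

lemma norm_L2_triangle_diff: "L2 f \<Longrightarrow> L2 g \<Longrightarrow> norm_L2 (\<lambda>x. f x - g x) \<le> norm_L2 f + norm_L2 g"
  using norm_L2_triangle[OF _ L2_uminus, of f g] by simp

lemma norm_L2_triangle3:
  assumes "L2 f" "L2 g" "L2 h"
  shows "norm_L2 (\<lambda>x. f x - h x) \<le> norm_L2 (\<lambda>x. f x - g x) + norm_L2 (\<lambda>x. g x - h x)"
  using norm_L2_triangle[OF L2_diff[OF assms(1,2)] L2_diff[OF assms(2,3)]] by simp

lemma norm_L2_diff_ge: "L2 f \<Longrightarrow> L2 g \<Longrightarrow> \<bar>norm_L2 f - norm_L2 g\<bar> \<le> norm_L2 (\<lambda>x. f x - g x)"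
  using norm_L2_triangle[OF L2_diff, of f g g] norm_L2_triangle[OF L2_diff, of g f f]
  by (simp add: norm_L2_minus_commute[of g f] abs_le_iff)

lemma norm_L2_cong_AE:
  assumes "AE x in lborel. f x = g x" "f \<in> borel_measurable borel" "g \<in> borel_measurable borel"
  shows "norm_L2 f = norm_L2 g"
  unfolding norm_L2_def
  by (intro arg_cong[where f=sqrt] integral_cong_AE) (use assms in auto)

lemma L2_cong_AE:
  assumes "AE x in lborel. f x = g x" "g \<in> borel_measurable borel" "L2 f"
  shows "L2 g"
  by (rule L2_bound[OF assms(3,2)]) (use assms(1) in auto)

lemma norm_L2_eq_0D:
  assumes "L2 f" "norm_L2 f = 0"
  shows "AE x in lborel. f x = 0"
proof -
  have "(LINT x|lborel. (norm (f x))\<^sup>2) = 0"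
    using assms(2) norm_L2_sq[of f] by simp
  then have "AE x in lborel. (norm (f x))\<^sup>2 = 0"
    by (subst (asm) integral_nonneg_eq_0_iff_AE) (use L2_integrable_sq[OF assms(1)] in auto)
  then show ?thesis by simp
qed

lemma borel_measurable_cnj [measurable]:
  "f \<in> borel_measurable M \<Longrightarrow> (\<lambda>x. cnj (f x)) \<in> borel_measurable M"
  by (rule measurable_compose[OF _ borel_measurable_continuous_onI]) (auto intro: continuous_intros)

lemma L2_Re_Im_cnj: "L2 f \<Longrightarrow> L2 (\<lambda>x. Re (f x))" "L2 f \<Longrightarrow> L2 (\<lambda>x. Im (f x))"
  "L2 f \<Longrightarrow> L2 (\<lambda>x. cnj (f x))"
  by (rule L2_bound[of f]; auto dest!: L2_measurable intro: borel_measurable_cnj simp: abs_Re_le_cmod abs_Im_le_cmod)+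

lemma L2_of_real: "L2 f \<Longrightarrow> L2 (\<lambda>x. complex_of_real (f x))"
  by (rule L2_bound[of f]) (auto dest!: L2_measurable)

lemma L2_of_real_iff: "L2 (\<lambda>x. complex_of_real (f x)) \<longleftrightarrow> L2 f"
  using L2_of_real L2_Re_Im_cnj(1)[of "\<lambda>x. complex_of_real (f x)"] by auto

lemma norm_L2_of_real [simp]: "norm_L2 (\<lambda>x. complex_of_real (f x)) = norm_L2 f"
  by (simp add: norm_L2_def)

lemma tendsto_L2_mult:
  fixes u v :: "'i \<Rightarrow> real \<Rightarrow> 'a::{real_normed_field,euclidean_space}"
  assumes uv: "\<forall>\<^sub>F i in F. L2 (u i)" "\<forall>\<^sub>F i in F. L2 (v i)" and L: "L2 a" "L2 b"
    and lim: "((\<lambda>i. norm_L2 (\<lambda>x. u i x - a x)) \<longlongrightarrow> 0) F" "((\<lambda>i. norm_L2 (\<lambda>x. v i x - b x)) \<longlongrightarrow> 0) F"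
  shows "((\<lambda>i. LINT x|lborel. u i x * v i x) \<longlongrightarrow> (LINT x|lborel. a x * b x)) F"
proof (rule Lim_null[THEN iffD2], rule Lim_null_comparison)
  let ?U = "\<lambda>i. norm_L2 (\<lambda>x. u i x - a x)" and ?V = "\<lambda>i. norm_L2 (\<lambda>x. v i x - b x)"
  show "\<forall>\<^sub>F i in F. norm ((LINT x|lborel. u i x * v i x) - (LINT x|lborel. a x * b x))
      \<le> ?U i * ?V i + ?U i * norm_L2 b + norm_L2 a * ?V i"
    using uv
  proof eventually_elim
    case (elim i)
    note d = L2_diff[OF elim(1) L(1)] L2_diff[OF elim(2) L(2)]
    note c = d[THEN L2_mult_integrable, OF d(2)]
    have "(LINT x|lborel. u i x * v i x) - (LINT x|lborel. a x * b x)
      = (LINT x|lborel. u i x * v i x - a x * b x)"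
      using L2_mult_integrable[OF elim] L2_mult_integrable[OF L] by simp
    also have "\<dots> = (LINT x|lborel. (u i x - a x) * (v i x - b x) + (u i x - a x) * b x + a x * (v i x - b x))"
      by (intro integral_eqI) (simp add: algebra_simps)
    also have "\<dots> = (LINT x|lborel. (u i x - a x) * (v i x - b x)) + (LINT x|lborel. (u i x - a x) * b x)
       + (LINT x|lborel. a x * (v i x - b x))"
      using L2_mult_integrable[OF d] L2_mult_integrable[OF d(1) L(2)] L2_mult_integrable[OF L(1) d(2)]
      by simp
    finally show ?case
      using Cauchy_Schwarz_L2[OF d] Cauchy_Schwarz_L2[OF d(1) L(2)] Cauchy_Schwarz_L2[OF L(1) d(2)]
      by (auto intro!: order_trans[OF norm_triangle_ineq] add_mono)
  qed
  have "((\<lambda>i. ?U i * ?V i + ?U i * norm_L2 b + norm_L2 a * ?V i) \<longlongrightarrow> 0 * 0 + 0 * norm_L2 b + norm_L2 a * 0) F"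
    by (intro tendsto_intros lim)
  then show "((\<lambda>i. ?U i * ?V i + ?U i * norm_L2 b + norm_L2 a * ?V i) \<longlongrightarrow> 0) F" by simp
qed

lemma dominated_convergence_L2:
  fixes s :: "nat \<Rightarrow> real \<Rightarrow> 'a::euclidean_space" and w :: "real \<Rightarrow> 'b::euclidean_space"
  assumes w: "L2 w" and m: "\<And>n. s n \<in> borel_measurable borel" "f \<in> borel_measurable borel"
    and lim: "AE x in lborel. (\<lambda>n. s n x) \<longlonglongrightarrow> f x"
    and bd: "\<And>n. AE x in lborel. norm (s n x) \<le> norm (w x)"
  shows "L2 f" "(\<lambda>n. norm_L2 (\<lambda>x. s n x - f x)) \<longlonglongrightarrow> 0"
proof -
  have "AE x in lborel. \<forall>n. norm (s n x) \<le> norm (w x)"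
    using bd by (simp add: AE_all_countable)
  then have fb: "AE x in lborel. norm (f x) \<le> norm (w x)"
    using lim
  proof eventually_elim
    case (elim x)
    show ?case by (rule LIMSEQ_le_const2[OF tendsto_norm[OF elim(2)]]) (use elim(1) in simp)
  qed
  show Lf: "L2 f" by (rule L2_bound[OF w m(2) fb])
  have "(\<lambda>n. LINT x|lborel. (norm (s n x - f x))\<^sup>2) \<longlonglongrightarrow> (LINT x|(lborel::real measure). (0::real))"
  proof (rule integral_dominated_convergence)
    show "integrable lborel (\<lambda>x. 4 * (norm (w x))\<^sup>2)" using L2_integrable_sq[OF w] by simp
    show "AE x in lborel. (\<lambda>n. (norm (s n x - f x))\<^sup>2) \<longlonglongrightarrow> 0"
      using lim
    proof eventually_elim
      case (elim x)
      have "(\<lambda>n. (norm (s n x - f x))\<^sup>2) \<longlonglongrightarrow> (norm (f x - f x))\<^sup>2"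
        by (intro tendsto_intros elim)
      then show ?case by simp
    qed
    show "AE x in lborel. norm ((norm (s n x - f x))\<^sup>2) \<le> 4 * (norm (w x))\<^sup>2" for n
      using bd[of n] fb
    proof eventually_elim
      case (elim x)
      have "norm (s n x - f x) \<le> 2 * norm (w x)"
        using norm_triangle_ineq4[of "s n x" "f x"] elim by simp
      then have "(norm (s n x - f x))\<^sup>2 \<le> (2 * norm (w x))\<^sup>2" by (rule power_mono) simp
      then show ?case by (simp add: power_mult_distrib)
    qed
  qed (use m in auto)
  then have "(\<lambda>n. sqrt (LINT x|lborel. (norm (s n x - f x))\<^sup>2)) \<longlonglongrightarrow> sqrt 0"
    by (intro tendsto_intros) simp
  then show "(\<lambda>n. norm_L2 (\<lambda>x. s n x - f x)) \<longlonglongrightarrow> 0" by (simp add: norm_L2_def)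
qed

lemma Fatou_L2:
  fixes s :: "nat \<Rightarrow> real \<Rightarrow> 'a::euclidean_space"
  assumes s: "\<And>n. L2 (s n)" "f \<in> borel_measurable borel"
    and lim: "AE x in lborel. (\<lambda>n. s n x) \<longlonglongrightarrow> f x" and bd: "\<forall>\<^sub>F n in sequentially. norm_L2 (s n) \<le> c"
  shows "L2 f" "norm_L2 f \<le> c"
proof -
  obtain n0 where "norm_L2 (s n0) \<le> c" using eventually_happens'[OF sequentially_bot bd] by auto
  then have c0: "0 \<le> c" using norm_L2_nonneg[of "s n0"] by linarith
  note [measurable] = s(1)[THEN L2_measurable] s(2)
  have "(\<integral>\<^sup>+x. ennreal ((norm (f x))\<^sup>2) \<partial>lborel) \<le> (\<integral>\<^sup>+x. liminf (\<lambda>n. ennreal ((norm (s n x))\<^sup>2)) \<partial>lborel)"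
  proof (rule nn_integral_mono_AE)
    show "AE x in lborel. ennreal ((norm (f x))\<^sup>2) \<le> liminf (\<lambda>n. ennreal ((norm (s n x))\<^sup>2))"
      using lim
    proof eventually_elim
      case (elim x)
      have "(\<lambda>n. ennreal ((norm (s n x))\<^sup>2)) \<longlonglongrightarrow> ennreal ((norm (f x))\<^sup>2)"
        by (intro tendsto_intros elim)
      from lim_imp_Liminf[OF sequentially_bot this] show ?case by simp
    qed
  qed
  also have "\<dots> \<le> liminf (\<lambda>n. \<integral>\<^sup>+x. ennreal ((norm (s n x))\<^sup>2) \<partial>lborel)"
    by (rule nn_integral_liminf) measurable
  also have "\<dots> \<le> liminf (\<lambda>n. ennreal (c\<^sup>2))"
  proof (rule Liminf_mono)
    show "\<forall>\<^sub>F n in sequentially. (\<integral>\<^sup>+x. ennreal ((norm (s n x))\<^sup>2) \<partial>lborel) \<le> ennreal (c\<^sup>2)"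
      using bd
    proof eventually_elim
      case (elim n)
      have "(\<integral>\<^sup>+x. ennreal ((norm (s n x))\<^sup>2) \<partial>lborel) = ennreal ((norm_L2 (s n))\<^sup>2)"
        unfolding norm_L2_sq by (rule nn_integral_eq_integral[OF L2_integrable_sq[OF s(1)]]) (rule AE_I2, rule zero_le_power2)
      also have "\<dots> \<le> ennreal (c\<^sup>2)" using elim by (intro ennreal_leI power_mono norm_L2_nonneg)
      finally show ?case .
    qed
  qed
  also have "\<dots> = ennreal (c\<^sup>2)" by (rule Liminf_const) (rule sequentially_bot)
  finally have fin: "(\<integral>\<^sup>+x. ennreal ((norm (f x))\<^sup>2) \<partial>lborel) \<le> ennreal (c\<^sup>2)" .
  have int: "integrable lborel (\<lambda>x. (norm (f x))\<^sup>2)"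
  proof (rule integrableI_bounded)
    show "(\<integral>\<^sup>+x. ennreal (norm ((norm (f x))\<^sup>2)) \<partial>lborel) < \<infinity>"
      using le_less_trans[OF fin ennreal_less_top] by simp
  qed measurable
  show "L2 f" by (rule L2_I[OF s(2) int])
  have "(\<integral>\<^sup>+x. ennreal ((norm (f x))\<^sup>2) \<partial>lborel) = ennreal ((norm_L2 f)\<^sup>2)"
    unfolding norm_L2_sq by (rule nn_integral_eq_integral[OF int]) (rule AE_I2, rule zero_le_power2)
  then have "ennreal ((norm_L2 f)\<^sup>2) \<le> ennreal (c\<^sup>2)"
    using fin by metis
  then have "(norm_L2 f)\<^sup>2 \<le> c\<^sup>2" by (subst (asm) ennreal_le_iff) (rule zero_le_power2)
  then show "norm_L2 f \<le> c" using c0 by (rule power2_le_imp_le)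
qed

section \<open>Gaussians, completeness and translations\<close>

lemma gauss_integrable: "integrable lborel (\<lambda>x::real. exp (- x\<^sup>2 / 2))"
proof -
  have "integrable lborel (\<lambda>x. sqrt (2 * pi) * std_normal_density x)" by simp
  then show ?thesis by (simp add: std_normal_density_def)
qed

lemma L2_gauss: "L2 (\<lambda>x::real. exp (- x\<^sup>2 / 2))"
proof (rule L2_I)
  have "integrable lborel (\<lambda>x::real. (exp (- x\<^sup>2 / 2))\<^sup>2)"
  proof (rule Bochner_Integration.integrable_bound[OF gauss_integrable])
    show "AE x in lborel. norm ((exp (- x\<^sup>2 / 2))\<^sup>2) \<le> norm (exp (- x\<^sup>2 / 2) :: real)"
      by (rule AE_I2) (simp add: power_le_one_iff power2_eq_square)
  qed measurable
  then show "integrable lborel (\<lambda>x::real. (norm (exp (- x\<^sup>2 / 2)))\<^sup>2)" by simp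
qed measurable

text \<open>The characteristic function of the standard normal distribution.\<close>

lemma fourier_gauss:
  "(LINT x|lborel. cis (t * x) * complex_of_real (exp (- x\<^sup>2 / 2))) = sqrt (2 * pi) * exp (- t\<^sup>2 / 2)"
proof -
  have "complex_of_real (exp (- t\<^sup>2 / 2)) = (CLINT x|density lborel std_normal_density. iexp (t * x))"
    using fun_cong[OF char_std_normal_distribution, of t] by (simp add: char_def)
  also have "\<dots> = (LINT x|lborel. std_normal_density x *\<^sub>R iexp (t * x))"
    by (rule integral_density) auto
  also have "\<dots> = (LINT x|lborel. (1 / sqrt (2 * pi)) *\<^sub>R (cis (t * x) * complex_of_real (exp (- x\<^sup>2 / 2))))"
    by (intro integral_eqI)
       (simp add: std_normal_density_def cis_conv_exp scaleR_conv_of_real)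
  also have "\<dots> = (1 / sqrt (2 * pi)) *\<^sub>R (LINT x|lborel. cis (t * x) * complex_of_real (exp (- x\<^sup>2 / 2)))"
    by (rule integral_scaleR_right)
  finally show ?thesis by (simp add: scaleR_conv_of_real field_simps)
qed

text \<open>Against a Gaussian the sequence becomes Cauchy in \<open>L\<^sup>1\<close>, which provides a subsequence converging almost
  everywhere; Fatou's lemma upgrades this to convergence in norm.\<close>

lemma L2_complete:
  fixes s :: "nat \<Rightarrow> real \<Rightarrow> 'a::euclidean_space"
  assumes s: "\<And>n. L2 (s n)"
    and C: "\<And>e. 0 < e \<Longrightarrow> \<exists>N. \<forall>m\<ge>N. \<forall>n\<ge>N. norm_L2 (\<lambda>x. s m x - s n x) < e"
  obtains f where "L2 f" "(\<lambda>n. norm_L2 (\<lambda>x. s n x - f x)) \<longlonglongrightarrow> 0"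
proof -
  let ?w = "\<lambda>x::real. exp (- x\<^sup>2 / 2)"
  note [measurable] = s[THEN L2_measurable]
  have prod: "integrable lborel (\<lambda>x. ?w x *\<^sub>R u x) \<and> (LINT x|lborel. norm (?w x *\<^sub>R u x)) \<le> norm_L2 ?w * norm_L2 u"
    if u: "L2 u" for u :: "real \<Rightarrow> 'a"
  proof -
    note [measurable] = L2_measurable[OF u]
    have i: "integrable lborel (\<lambda>x. ?w x * norm (u x))"
      by (rule L2_mult_integrable[OF L2_gauss L2_norm[OF u]])
    have 1: "integrable lborel (\<lambda>x. ?w x *\<^sub>R u x)"
    proof (rule Bochner_Integration.integrable_bound[OF i])
      show "AE x in lborel. norm (?w x *\<^sub>R u x) \<le> norm (?w x * norm (u x))"
        by (rule AE_I2) simp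
    qed measurable
    have "(LINT x|lborel. norm (?w x *\<^sub>R u x)) = (LINT x|lborel. ?w x * norm (u x))" by simp
    also have "\<dots> \<le> norm_L2 ?w * norm_L2 u"
      using abs_le_D1[OF Cauchy_Schwarz_L2_real[OF L2_gauss L2_norm[OF u]]] by (simp only: norm_L2_norm)
    finally show ?thesis using 1 by simp
  qed
  have pos: "0 < norm_L2 ?w + 1" using norm_L2_nonneg[of ?w] by linarith
  obtain r where r: "strict_mono r" "AE x in lborel. Cauchy (\<lambda>i. ?w x *\<^sub>R s (r i) x)"
  proof (rule cauchy_L1_AE_cauchy_subseq[of lborel "\<lambda>n x. ?w x *\<^sub>R s n x"])
    show "integrable lborel (\<lambda>x. ?w x *\<^sub>R s n x)" for n using prod[OF s] by simp
    show "\<exists>N. \<forall>i\<ge>N. \<forall>j\<ge>N. LINT x|lborel. norm (?w x *\<^sub>R s i x - ?w x *\<^sub>R s j x) < e" if "0 < e" for e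
    proof -
      obtain N where N: "\<forall>m\<ge>N. \<forall>n\<ge>N. norm_L2 (\<lambda>x. s m x - s n x) < e / (norm_L2 ?w + 1)"
        using C[of "e / (norm_L2 ?w + 1)"] pos \<open>0 < e\<close> by auto
      have "LINT x|lborel. norm (?w x *\<^sub>R s i x - ?w x *\<^sub>R s j x) < e" if "i \<ge> N" "j \<ge> N" for i j
      proof -
        have "(LINT x|lborel. norm (?w x *\<^sub>R s i x - ?w x *\<^sub>R s j x)) \<le> norm_L2 ?w * norm_L2 (\<lambda>x. s i x - s j x)"
          using prod[OF L2_diff[OF s s], of i j] by (simp add: scaleR_diff_right)
        also have "\<dots> \<le> (norm_L2 ?w + 1) * norm_L2 (\<lambda>x. s i x - s j x)"
          by (intro mult_right_mono) auto
        also have "\<dots> < e" using N that pos by (simp add: field_simps)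
        finally show ?thesis .
      qed
      then show ?thesis by blast
    qed
  qed
  have conv: "AE x in lborel. convergent (\<lambda>i. s (r i) x)"
    using r(2)
  proof eventually_elim
    case (elim x)
    then obtain l where l: "(\<lambda>i. ?w x *\<^sub>R s (r i) x) \<longlonglongrightarrow> l"
      using Cauchy_convergent_iff convergent_def by blast
    have "(\<lambda>i. inverse (?w x) *\<^sub>R (?w x *\<^sub>R s (r i) x)) \<longlonglongrightarrow> inverse (?w x) *\<^sub>R l"
      by (intro tendsto_scaleR tendsto_const l)
    then show ?case by (simp add: convergent_def) blast
  qed
  define f where "f x = lim (\<lambda>i. s (r i) x)" for x
  have [measurable]: "f \<in> borel_measurable borel"
    unfolding f_def by (rule borel_measurable_lim_metric) measurable
  have lim: "AE x in lborel. (\<lambda>i. s (r i) x) \<longlonglongrightarrow> f x"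
    using conv by eventually_elim (simp add: f_def convergent_LIMSEQ_iff)
  have close: "L2 (\<lambda>x. s n x - f x) \<and> norm_L2 (\<lambda>x. s n x - f x) \<le> e"
    if N: "\<forall>m\<ge>N. \<forall>n\<ge>N. norm_L2 (\<lambda>x. s m x - s n x) < e" and n: "n \<ge> N" for n N e
  proof -
    have 1: "L2 (\<lambda>x. s n x - s (r m) x)" for m by (rule L2_diff[OF s s])
    have 2: "AE x in lborel. (\<lambda>m. s n x - s (r m) x) \<longlonglongrightarrow> s n x - f x"
      using lim by eventually_elim (intro tendsto_diff tendsto_const)
    have 3: "\<forall>\<^sub>F m in sequentially. norm_L2 (\<lambda>x. s n x - s (r m) x) \<le> e"
      using eventually_ge_at_top[of N]
    proof eventually_elim
      case (elim m)
      then have "r m \<ge> N" using seq_suble[OF r(1), of m] by linarith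
      then show ?case using N n by (auto intro: less_imp_le)
    qed
    have 4: "(\<lambda>x. s n x - f x) \<in> borel_measurable borel" by measurable
    show ?thesis
      using Fatou_L2[OF 1 4 2 3] by blast
  qed
  show ?thesis
  proof (rule that[of f])
    obtain N where N: "\<forall>m\<ge>N. \<forall>n\<ge>N. norm_L2 (\<lambda>x. s m x - s n x) < 1" using C[of 1] by auto
    from close[OF N order_refl] have "L2 (\<lambda>x. s N x - (s N x - f x))" by (rule L2_diff[OF s conjunct1])
    then show "L2 f" by simp
    show "(\<lambda>n. norm_L2 (\<lambda>x. s n x - f x)) \<longlonglongrightarrow> 0"
    proof (rule LIMSEQ_I)
      fix e :: real assume "0 < e"
      then obtain N where N: "\<forall>m\<ge>N. \<forall>n\<ge>N. norm_L2 (\<lambda>x. s m x - s n x) < e/2" using C[of "e/2"] by auto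
      have "norm (norm_L2 (\<lambda>x. s n x - f x) - 0) < e" if "n \<ge> N" for n
        using conjunct2[OF close[OF N that]] \<open>0 < e\<close> by simp
      then show "\<exists>no. \<forall>n\<ge>no. norm (norm_L2 (\<lambda>x. s n x - f x) - 0) < e" by blast
    qed
  qed
qed

text \<open>For an open set, points of the set stay inside under small translations, so the overlap of the set
  with its translate converges to the full measure by dominated convergence.\<close>

lemma translation_continuous_L1_indicator_open:
  fixes U :: "real set" and h :: "nat \<Rightarrow> real"
  assumes U: "open U" "emeasure lborel U < \<infinity>" and h: "h \<longlonglongrightarrow> 0"
  shows "(\<lambda>n. LINT x|lborel. \<bar>indicator U (x + h n) - indicator U x :: real\<bar>) \<longlonglongrightarrow> 0"
proof -
  let ?i = "\<lambda>x. indicator U x :: real"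
  have [measurable]: "U \<in> sets borel" using U by simp
  have int: "integrable lborel ?i" using U by (simp add: integrable_indicator_iff)
  have int': "integrable lborel (\<lambda>x. ?i (x + h n))" for n
    using lborel_integrable_real_affine[OF int, of 1 "h n"] by (simp add: add.commute)
  have eq': "(LINT x|lborel. ?i (x + h n)) = (LINT x|lborel. ?i x)" for n
    using lborel_integral_real_affine[of 1 ?i "h n"] by (simp add: add.commute)
  have intp: "integrable lborel (\<lambda>x. ?i (x + h n) * ?i x)" for n
  proof (rule Bochner_Integration.integrable_bound[OF int])
    show "AE x in lborel. norm (?i (x + h n) * ?i x) \<le> norm (?i x)"
      by (rule AE_I2) (simp add: indicator_def)
  qed measurable
  have lim: "(\<lambda>n. LINT x|lborel. ?i (x + h n) * ?i x) \<longlonglongrightarrow> (LINT x|lborel. ?i x)"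
  proof (rule integral_dominated_convergence[OF _ _ int])
    show "AE x in lborel. (\<lambda>n. ?i (x + h n) * ?i x) \<longlonglongrightarrow> ?i x"
    proof (rule AE_I2)
      fix x
      show "(\<lambda>n. ?i (x + h n) * ?i x) \<longlonglongrightarrow> ?i x"
      proof (cases "x \<in> U")
        case True
        have "(\<lambda>n. x + h n) \<longlonglongrightarrow> x + 0" by (intro tendsto_intros h)
        then have "\<forall>\<^sub>F n in sequentially. x + h n \<in> U"
          using True U(1) by (intro topological_tendstoD) auto
        then have "\<forall>\<^sub>F n in sequentially. ?i (x + h n) * ?i x = ?i x"
          by eventually_elim (simp add: True)
        then show ?thesis by (rule tendsto_eventually)
      qed simp
    qed
    show "AE x in lborel. norm (?i (x + h n) * ?i x) \<le> ?i x" for n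
      by (rule AE_I2) (simp add: indicator_def)
  qed measurable
  have "(LINT x|lborel. \<bar>?i (x + h n) - ?i x\<bar>) = 2 * (LINT x|lborel. ?i x) - 2 * (LINT x|lborel. ?i (x + h n) * ?i x)" for n
  proof -
    have "(LINT x|lborel. \<bar>?i (x + h n) - ?i x\<bar>) = (LINT x|lborel. ?i (x + h n) + ?i x - 2 * (?i (x + h n) * ?i x))"
      by (intro integral_eqI) (simp add: indicator_def)
    then show ?thesis using int int' eq' intp by simp
  qed
  moreover have "(\<lambda>n. 2 * (LINT x|lborel. ?i x) - 2 * (LINT x|lborel. ?i (x + h n) * ?i x)) \<longlonglongrightarrow> 2 * (LINT x|lborel. ?i x) - 2 * (LINT x|lborel. ?i x)"
    by (intro tendsto_diff tendsto_mult tendsto_const lim)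
  ultimately show ?thesis by simp
qed

lemma translation_integral:
  fixes f :: "real \<Rightarrow> 'b::{banach, second_countable_topology}"
  shows "(LINT x|lborel. f (x + h)) = (LINT x|lborel. f x)"
  using lborel_integral_real_affine[of 1 f h] by (simp add: add.commute)

lemma translation_integrable:
  fixes f :: "real \<Rightarrow> 'b::{banach, second_countable_topology}"
  shows "integrable lborel f \<Longrightarrow> integrable lborel (\<lambda>x. f (x + h))"
  using lborel_integrable_real_affine[of f 1 h] by (simp add: add.commute)

text \<open>Translations are isometries of \<open>L\<^sup>1\<close>, so continuity passes to limits.\<close>

lemma translation_continuous_L1_approx:
  fixes f :: "real \<Rightarrow> 'b::{banach, second_countable_topology}" and h :: "nat \<Rightarrow> real"
  assumes f: "integrable lborel f" and h: "h \<longlonglongrightarrow> 0"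
    and approx: "\<And>e. 0 < e \<Longrightarrow> \<exists>g. integrable lborel g \<and> (LINT x|lborel. norm (f x - g x)) \<le> e \<and>
        (\<lambda>n. LINT x|lborel. norm (g (x + h n) - g x)) \<longlonglongrightarrow> 0"
  shows "(\<lambda>n. LINT x|lborel. norm (f (x + h n) - f x)) \<longlonglongrightarrow> 0"
proof (rule LIMSEQ_I)
  fix e :: real assume e: "0 < e"
  obtain g where g: "integrable lborel g" "(LINT x|lborel. norm (f x - g x)) \<le> e/4"
    "(\<lambda>n. LINT x|lborel. norm (g (x + h n) - g x)) \<longlonglongrightarrow> 0"
    using approx[of "e/4"] e by auto
  obtain N where N: "\<And>n. n \<ge> N \<Longrightarrow> norm ((LINT x|lborel. norm (g (x + h n) - g x)) - 0) < e/4"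
    using LIMSEQ_D[OF g(3), of "e/4"] e by auto
  have "norm ((LINT x|lborel. norm (f (x + h n) - f x)) - 0) < e" if n: "n \<ge> N" for n
  proof -
    note fi = f translation_integrable[OF f, of "h n"] and gi = g(1) translation_integrable[OF g(1), of "h n"]
    have "(LINT x|lborel. norm (f (x + h n) - f x)) \<le>
      (LINT x|lborel. norm (f (x + h n) - g (x + h n)) + norm (g (x + h n) - g x) + norm (f x - g x))"
    proof (rule integral_mono)
      show "norm (f (x + h n) - f x) \<le> norm (f (x + h n) - g (x + h n)) + norm (g (x + h n) - g x) + norm (f x - g x)" for x
        using norm_triangle_ineq[of "f (x + h n) - g (x + h n)" "g (x + h n) - g x"]
          norm_triangle_ineq4[of "f (x + h n) - g x" "f x - g x"] by simp
    qed (use fi gi in auto)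
    also have "\<dots> = (LINT x|lborel. norm (f (x + h n) - g (x + h n))) + (LINT x|lborel. norm (g (x + h n) - g x)) + (LINT x|lborel. norm (f x - g x))"
      using fi gi by simp
    also have "(LINT x|lborel. norm (f (x + h n) - g (x + h n))) = (LINT x|lborel. norm (f x - g x))"
      by (rule translation_integral[of "\<lambda>x. norm (f x - g x)"])
    finally have "(LINT x|lborel. norm (f (x + h n) - f x)) \<le> e/4 + e/4 + e/4"
      using g(2) N[OF n] by simp
    then show ?thesis using e by simp
  qed
  then show "\<exists>no. \<forall>n\<ge>no. norm ((LINT x|lborel. norm (f (x + h n) - f x)) - 0) < e" by blast
qed

lemma translation_continuous_L1:
  fixes f :: "real \<Rightarrow> complex" and h :: "nat \<Rightarrow> real"
  assumes f: "integrable lborel f" and h: "h \<longlonglongrightarrow> 0"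
  shows "(\<lambda>n. LINT x|lborel. norm (f (x + h n) - f x)) \<longlonglongrightarrow> 0"
  using f
proof (induction rule: integrable_induct)
  case (base A c)
  then have [measurable]: "A \<in> sets borel" by simp
  have int: "integrable lborel (\<lambda>x. indicator A x *\<^sub>R c)" using base by (simp add: integrable_indicator_iff)
  show ?case
  proof (rule translation_continuous_L1_approx[OF int h])
    fix e :: real assume e: "0 < e"
    then have "0 < e / (norm c + 1)" by (simp add: add_nonneg_pos)
    then obtain U where U: "open U" "A \<subseteq> U" "emeasure lborel (U - A) < e / (norm c + 1)"
      using outer_regular_lborel[OF \<open>A \<in> sets borel\<close>] by metis
    have [measurable]: "U \<in> sets borel" using U by simp
    have "emeasure lborel U = emeasure lborel A + emeasure lborel (U - A)"
      using U(2) by (subst plus_emeasure) (auto intro!: arg_cong[where f="emeasure lborel"])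
    also have "\<dots> < \<infinity>" using base(2) U(3) less_trans[OF U(3) ennreal_less_top] by simp
    finally have fU: "emeasure lborel U < \<infinity>" .
    have "measure lborel (U - A) \<le> e / (norm c + 1)"
      unfolding measure_def using less_imp_le[OF U(3)] e by (intro enn2real_leI) auto
    then have "norm c * measure lborel (U - A) \<le> e"
    proof -
      have "norm c * measure lborel (U - A) \<le> (norm c + 1) * (e / (norm c + 1))"
        using \<open>measure lborel (U - A) \<le> e / (norm c + 1)\<close> by (intro mult_mono) auto
      also have "\<dots> = e" using norm_ge_zero[of c] by (simp add: field_simps add_nonneg_eq_0_iff)
      finally show ?thesis .
    qed
    moreover have "(LINT x|lborel. norm (indicator A x *\<^sub>R c - indicator U x *\<^sub>R c)) = norm c * measure lborel (U - A)"
    proof -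
      have "(LINT x|lborel. norm (indicator A x *\<^sub>R c - indicator U x *\<^sub>R c)) = (LINT x|lborel. norm c * indicator (U - A) x)"
        using U(2) by (intro integral_eqI) (auto simp: indicator_def)
      then show ?thesis by simp
    qed
    moreover have "(\<lambda>n. LINT x|lborel. norm (indicator U (x + h n) *\<^sub>R c - indicator U x *\<^sub>R c)) \<longlonglongrightarrow> 0"
    proof -
      have "(LINT x|lborel. norm (indicator U (x + h n) *\<^sub>R c - indicator U x *\<^sub>R c)) =
         (LINT x|lborel. \<bar>indicator U (x + h n) - indicator U x\<bar>) * norm c" for n
        by (simp flip: scaleR_diff_left)
      then show ?thesis
        using tendsto_mult_right[OF translation_continuous_L1_indicator_open[OF U(1) fU h], of "norm c"]
        by simp
    qed
    moreover have "integrable lborel (\<lambda>x. indicator U x *\<^sub>R c)"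
      using fU by (simp add: integrable_indicator_iff)
    ultimately show "\<exists>g. integrable lborel g \<and> (LINT x|lborel. norm (indicator A x *\<^sub>R c - g x)) \<le> e \<and>
        (\<lambda>n. LINT x|lborel. norm (g (x + h n) - g x)) \<longlonglongrightarrow> 0"
      by (intro exI[of _ "\<lambda>x. indicator U x *\<^sub>R c"]) simp
  qed
next
  case (add f g)
  show ?case
  proof (rule tendsto_sandwich[OF _ _ tendsto_const tendsto_add_zero[OF add.IH]])
    show "\<forall>\<^sub>F n in sequentially. 0 \<le> (LINT x|lborel. norm (f (x + h n) + g (x + h n) - (f x + g x)))"
      by simp
    have "(LINT x|lborel. norm (f (x + h n) + g (x + h n) - (f x + g x))) \<le>
       (LINT x|lborel. norm (f (x + h n) - f x) + norm (g (x + h n) - g x))" for n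
    proof (rule integral_mono)
      show "norm (f (x + h n) + g (x + h n) - (f x + g x)) \<le> norm (f (x + h n) - f x) + norm (g (x + h n) - g x)" for x
        using norm_triangle_ineq[of "f (x + h n) - f x" "g (x + h n) - g x"] by (simp add: algebra_simps)
    qed (use add.hyps translation_integrable[OF add.hyps(1)] translation_integrable[OF add.hyps(2)] in auto)
    then show "\<forall>\<^sub>F n in sequentially. (LINT x|lborel. norm (f (x + h n) + g (x + h n) - (f x + g x))) \<le>
       (LINT x|lborel. norm (f (x + h n) - f x)) + (LINT x|lborel. norm (g (x + h n) - g x))"
      using add.hyps translation_integrable[OF add.hyps(1)] translation_integrable[OF add.hyps(2)] by simp
  qed
next
  case (lim f s)
  note [measurable] = borel_measurable_integrable[OF lim.hyps(1)] borel_measurable_integrable[OF lim.hyps(4)]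
  have "(\<lambda>i. LINT x|lborel. norm (f x - s i x)) \<longlonglongrightarrow> (LINT x|(lborel::real measure). (0::real))"
  proof (rule integral_dominated_convergence)
    show "integrable lborel (\<lambda>x. 3 * norm (f x))" using lim.hyps(4) by simp
    show "AE x in lborel. (\<lambda>i. norm (f x - s i x)) \<longlonglongrightarrow> 0"
    proof (rule AE_I2)
      fix x
      have "(\<lambda>i. norm (f x - s i x)) \<longlonglongrightarrow> norm (f x - f x)"
        by (intro tendsto_norm tendsto_diff tendsto_const lim.hyps(2)) simp
      then show "(\<lambda>i. norm (f x - s i x)) \<longlonglongrightarrow> 0" by simp
    qed
    show "AE x in lborel. norm (norm (f x - s i x)) \<le> 3 * norm (f x)" for i
    proof (rule AE_I2)
      fix x
      show "norm (norm (f x - s i x)) \<le> 3 * norm (f x)"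
        using norm_triangle_ineq4[of "f x" "s i x"] lim.hyps(3)[of x i] by simp
    qed
  qed measurable
  then have L: "(\<lambda>i. LINT x|lborel. norm (f x - s i x)) \<longlonglongrightarrow> 0" by simp
  show ?case
  proof (rule translation_continuous_L1_approx[OF lim.hyps(4) h])
    fix e :: real assume "0 < e"
    then obtain i where "norm ((LINT x|lborel. norm (f x - s i x)) - 0) < e"
      using LIMSEQ_D[OF L \<open>0 < e\<close>] by (meson order_refl)
    then have "(LINT x|lborel. norm (f x - s i x)) \<le> e" by simp
    then show "\<exists>g. integrable lborel g \<and> (LINT x|lborel. norm (f x - g x)) \<le> e \<and>
        (\<lambda>n. LINT x|lborel. norm (g (x + h n) - g x)) \<longlonglongrightarrow> 0"
      by (intro exI[of _ "s i"] conjI lim.hyps(1) lim.IH)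
  qed
qed

section \<open>The Fourier integral and autocorrelations\<close>

definition fourier_integral :: "(real \<Rightarrow> complex) \<Rightarrow> real \<Rightarrow> complex" where
  "fourier_integral f \<xi> = (LINT x|lborel. cis (- (x * \<xi>)) * f x)"

lemma borel_measurable_cis [measurable]:
  "f \<in> borel_measurable M \<Longrightarrow> (\<lambda>x. cis (f x)) \<in> borel_measurable M"
  by (rule measurable_compose[OF _ borel_measurable_continuous_onI]) (auto intro: continuous_intros)

lemma cis_mult_integrable:
  assumes "integrable lborel f" "g \<in> borel_measurable borel"
  shows "integrable lborel (\<lambda>x. cis (g x) * f x)"
proof (rule Bochner_Integration.integrable_bound[OF assms(1)])
  show "(\<lambda>x. cis (g x) * f x) \<in> borel_measurable lborel"
    using assms borel_measurable_integrable[OF assms(1)] by measurable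
qed (simp add: norm_mult)

lemma fourier_integrable:
  "integrable lborel f \<Longrightarrow> integrable lborel (\<lambda>x. cis (- (x * \<xi>)) * f x)"
  by (rule cis_mult_integrable) measurable

lemma fourier_integral_measurable [measurable]:
  assumes [measurable]: "f \<in> borel_measurable borel"
  shows "fourier_integral f \<in> borel_measurable borel"
proof -
  have "(\<lambda>\<xi>. LINT x|lborel. cis (- (x * \<xi>)) * f x) \<in> borel_measurable lborel"
    by (rule lborel.borel_measurable_lebesgue_integral) measurable
  then show ?thesis by (simp add: fourier_integral_def[abs_def])
qed

lemma fourier_integral_add:
  "integrable lborel f \<Longrightarrow> integrable lborel g \<Longrightarrow>
    fourier_integral (\<lambda>x. f x + g x) \<xi> = fourier_integral f \<xi> + fourier_integral g \<xi>"
  unfolding fourier_integral_def using fourier_integrable[of f \<xi>] fourier_integrable[of g \<xi>]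
  by (simp add: distrib_left)

lemma fourier_integral_diff:
  "integrable lborel f \<Longrightarrow> integrable lborel g \<Longrightarrow>
    fourier_integral (\<lambda>x. f x - g x) \<xi> = fourier_integral f \<xi> - fourier_integral g \<xi>"
  unfolding fourier_integral_def using fourier_integrable[of f \<xi>] fourier_integrable[of g \<xi>]
  by (simp add: right_diff_distrib)

lemma fourier_integral_cmult: "fourier_integral (\<lambda>x. c * f x) \<xi> = c * fourier_integral f \<xi>"
proof -
  have "(LINT x|lborel. cis (- (x * \<xi>)) * (c * f x)) = (LINT x|lborel. c * (cis (- (x * \<xi>)) * f x))"
    by (intro integral_eqI) (simp add: mult.left_commute)
  then show ?thesis unfolding fourier_integral_def by simp
qed

lemma fourier_integral_cnj: "fourier_integral (\<lambda>x. cnj (f x)) \<xi> = cnj (fourier_integral f (- \<xi>))"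
proof -
  have "(LINT x|lborel. cis (- (x * \<xi>)) * cnj (f x)) = (LINT x|lborel. cnj (cis (- (x * - \<xi>)) * f x))"
    by (intro integral_eqI) (simp add: cis_cnj)
  also have "\<dots> = cnj (LINT x|lborel. cis (- (x * - \<xi>)) * f x)" by (rule Bochner_Integration.integral_cnj)
  finally show ?thesis unfolding fourier_integral_def .
qed

lemma fourier_integral_modulate:
  "fourier_integral (\<lambda>x. cis (a * x) * f x) \<xi> = fourier_integral f (\<xi> - a)"
  unfolding fourier_integral_def
  by (intro integral_eqI) (simp add: cis_mult algebra_simps flip: mult.assoc)

lemma norm_fourier_integral_le: "norm (fourier_integral f \<xi>) \<le> (LINT x|lborel. norm (f x))"
  unfolding fourier_integral_def
  using integral_norm_bound[of lborel "\<lambda>x. cis (- (x * \<xi>)) * f x"] by (simp add: norm_mult)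

lemma fourier_integral_continuous:
  assumes f: "integrable lborel f" and h: "h \<longlonglongrightarrow> \<xi>"
  shows "(\<lambda>n. fourier_integral f (h n)) \<longlonglongrightarrow> fourier_integral f \<xi>"
  unfolding fourier_integral_def
proof (rule integral_dominated_convergence)
  note [measurable] = borel_measurable_integrable[OF f]
  show "integrable lborel (\<lambda>x. norm (f x))" using f by simp
  show "AE x in lborel. (\<lambda>n. cis (- (x * h n)) * f x) \<longlonglongrightarrow> cis (- (x * \<xi>)) * f x"
  proof (rule AE_I2)
    fix x
    have "continuous_on UNIV (\<lambda>y. cis (- (x * y)))" by (intro continuous_intros)
    then have "isCont (\<lambda>y. cis (- (x * y))) \<xi>" by (simp add: continuous_on_eq_continuous_at)
    from isCont_tendsto_compose[OF this h]
    show "(\<lambda>n. cis (- (x * h n)) * f x) \<longlonglongrightarrow> cis (- (x * \<xi>)) * f x"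
      by (rule tendsto_mult_right)
  qed
  show "AE x in lborel. norm (cis (- (x * h n)) * f x) \<le> norm (f x)" for n
    by (simp add: norm_mult)
  show "(\<lambda>x. cis (- (x * \<xi>)) * f x) \<in> borel_measurable lborel" by measurable
  show "(\<lambda>x. cis (- (x * h n)) * f x) \<in> borel_measurable lborel" for n by measurable
qed

lemma integrable_prod:
  fixes f g :: "real \<Rightarrow> 'a::{real_normed_field,banach,second_countable_topology}"
  assumes f: "integrable lborel f" and g: "integrable lborel g"
  shows "integrable (lborel \<Otimes>\<^sub>M lborel) (\<lambda>(x, y). f x * g y)"
proof (rule lborel_pair.Fubini_integrable)
  note [measurable] = borel_measurable_integrable[OF f] borel_measurable_integrable[OF g]
  show "(\<lambda>(x, y). f x * g y) \<in> borel_measurable (lborel \<Otimes>\<^sub>M lborel)" by measurable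
  show "integrable lborel (\<lambda>x. LINT y|lborel. norm (case (x, y) of (x, y) \<Rightarrow> f x * g y))"
    using f by (simp add: norm_mult)
  show "AE x in lborel. integrable lborel (\<lambda>y. case (x, y) of (x, y) \<Rightarrow> f x * g y)"
    using g by simp
qed

text \<open>Fubini's theorem, the kernel being symmetric in its two arguments.\<close>

lemma fourier_multiplication_formula_L1:
  assumes f: "integrable lborel f" and g: "integrable lborel g"
  shows "(LINT \<xi>|lborel. fourier_integral f \<xi> * g \<xi>) = (LINT x|lborel. f x * fourier_integral g x)"
proof -
  note [measurable] = borel_measurable_integrable[OF f] borel_measurable_integrable[OF g]
  have int: "integrable (lborel \<Otimes>\<^sub>M lborel) (\<lambda>(x, \<xi>). cis (- (x * \<xi>)) * f x * g \<xi>)"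
  proof (rule Bochner_Integration.integrable_bound[OF integrable_prod[OF f g]])
    show "AE p in lborel \<Otimes>\<^sub>M lborel. norm (case p of (x, \<xi>) \<Rightarrow> cis (- (x * \<xi>)) * f x * g \<xi>)
        \<le> norm (case p of (x, y) \<Rightarrow> f x * g y)"
      by (rule AE_I2) (auto simp: norm_mult)
  qed measurable
  have "(LINT \<xi>|lborel. fourier_integral f \<xi> * g \<xi>) = (LINT \<xi>|lborel. LINT x|lborel. cis (- (x * \<xi>)) * f x * g \<xi>)"
    using fourier_integrable[OF f]
    by (intro integral_eqI) (simp add: fourier_integral_def)
  also have "\<dots> = (LINT x|lborel. LINT \<xi>|lborel. cis (- (x * \<xi>)) * f x * g \<xi>)"
    by (rule lborel_pair.Fubini_integral[OF int])
  also have "\<dots> = (LINT x|lborel. f x * fourier_integral g x)"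
  proof (intro integral_eqI)
    fix x
    have "(LINT \<xi>|lborel. cis (- (x * \<xi>)) * f x * g \<xi>) = (LINT \<xi>|lborel. f x * (cis (- (\<xi> * x)) * g \<xi>))"
      by (intro integral_eqI) (simp add: mult_ac)
    then show "(LINT \<xi>|lborel. cis (- (x * \<xi>)) * f x * g \<xi>) = f x * fourier_integral g x"
      by (simp add: fourier_integral_def)
  qed
  finally show ?thesis .
qed

text \<open>The convolution of \<open>f\<close> with the reflection of its conjugate; its Fourier integral is the squared
  modulus of that of \<open>f\<close>, and its value at \<open>0\<close> the squared norm.\<close>

definition autocorrelation :: "(real \<Rightarrow> complex) \<Rightarrow> real \<Rightarrow> complex" where
  "autocorrelation f z = (LINT x|lborel. f (x + z) * cnj (f x))"

lemma L2_translate: "L2 f \<Longrightarrow> L2 (\<lambda>x. f (x + z))"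
  by (rule L2_I) (auto dest: L2_measurable intro: translation_integrable[OF L2_integrable_sq])

lemma norm_L2_translate: "norm_L2 (\<lambda>x. f (x + z)) = norm_L2 f"
  unfolding norm_L2_def by (simp add: translation_integral[of "\<lambda>x. (norm (f x))\<^sup>2"])

lemma norm_L2_cnj [simp]: "norm_L2 (\<lambda>x. cnj (f x)) = norm_L2 f"
  by (simp add: norm_L2_def)

lemma norm_autocorrelation_le:
  assumes "L2 f"
  shows "norm (autocorrelation f z) \<le> (norm_L2 f)\<^sup>2"
  unfolding autocorrelation_def
  using Cauchy_Schwarz_L2[OF L2_translate[OF assms, of z] L2_Re_Im_cnj(3)[OF assms]]
  by (simp add: norm_L2_translate power2_eq_square)

lemma autocorrelation_0: "autocorrelation f 0 = (norm_L2 f)\<^sup>2"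
proof -
  have "(LINT x|lborel. f (x + 0) * cnj (f x)) = (LINT x|lborel. complex_of_real ((norm (f x))\<^sup>2))"
    by (intro integral_eqI) (simp add: complex_norm_square del: of_real_power)
  also have "\<dots> = complex_of_real (LINT x|lborel. (norm (f x))\<^sup>2)" by (rule integral_complex_of_real)
  finally show ?thesis unfolding autocorrelation_def norm_L2_sq .
qed

lemma autocorrelation_integrable:
  fixes f :: "real \<Rightarrow> complex"
  assumes f: "integrable lborel f"
  shows "integrable (lborel \<Otimes>\<^sub>M lborel) (\<lambda>(x, z). f (x + z) * cnj (f x))"
proof (rule lborel_pair.Fubini_integrable)
  note [measurable] = borel_measurable_integrable[OF f]
  show "(\<lambda>(x, z). f (x + z) * cnj (f x)) \<in> borel_measurable (lborel \<Otimes>\<^sub>M lborel)" by measurable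
  have "(LINT z|lborel. norm (f (x + z)) * norm (f x)) = (LINT z|lborel. norm (f z)) * norm (f x)" for x
    using translation_integral[of "\<lambda>z. norm (f z)" x] by (simp add: add.commute)
  then show "integrable lborel (\<lambda>x. LINT z|lborel. norm (case (x, z) of (x, z) \<Rightarrow> f (x + z) * cnj (f x)))"
    unfolding prod.case norm_mult complex_mod_cnj using f by (simp only: integrable_mult_right integrable_norm)
  show "AE x in lborel. integrable lborel (\<lambda>z. case (x, z) of (x, z) \<Rightarrow> f (x + z) * cnj (f x))"
    using translation_integrable[OF f] by (simp add: add.commute)
qed

lemma fourier_integral_autocorrelation:
  assumes f: "integrable lborel f"
  shows "integrable lborel (autocorrelation f)"
    and "fourier_integral (autocorrelation f) \<xi> = fourier_integral f \<xi> * cnj (fourier_integral f \<xi>)"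
proof -
  note [measurable] = borel_measurable_integrable[OF f]
  show "integrable lborel (autocorrelation f)"
    using lborel_pair.integrable_snd[OF autocorrelation_integrable[OF f]]
    by (simp add: autocorrelation_def[abs_def])
  have int: "integrable (lborel \<Otimes>\<^sub>M lborel) (\<lambda>(x, z). cis (- (z * \<xi>)) * (f (x + z) * cnj (f x)))"
  proof (rule Bochner_Integration.integrable_bound[OF autocorrelation_integrable[OF f]])
    show "AE p in lborel \<Otimes>\<^sub>M lborel. norm (case p of (x, z) \<Rightarrow> cis (- (z * \<xi>)) * (f (x + z) * cnj (f x)))
        \<le> norm (case p of (x, z) \<Rightarrow> f (x + z) * cnj (f x))"
      by (rule AE_I2) (auto simp: norm_mult)
  qed measurable
  have "fourier_integral (autocorrelation f) \<xi> = (LINT z|lborel. LINT x|lborel. cis (- (z * \<xi>)) * (f (x + z) * cnj (f x)))"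
    unfolding fourier_integral_def autocorrelation_def by simp
  also have "\<dots> = (LINT x|lborel. LINT z|lborel. cis (- (z * \<xi>)) * (f (x + z) * cnj (f x)))"
    by (rule lborel_pair.Fubini_integral[OF int])
  also have "\<dots> = (LINT x|lborel. fourier_integral f \<xi> * cnj (cis (- (x * \<xi>)) * f x))"
  proof (intro integral_eqI)
    fix x
    have "(LINT z|lborel. cis (- (z * \<xi>)) * (f (x + z) * cnj (f x)))
        = (LINT z|lborel. (cis (- ((z + x) * \<xi>)) * f (z + x)) * cnj (cis (- (x * \<xi>)) * f x))"
    proof (intro integral_eqI)
      fix z
      have "cis (- ((z + x) * \<xi>)) = cis (- (z * \<xi>)) * cis (- (x * \<xi>))"
        by (simp add: cis_mult algebra_simps)
      moreover have "cis (- (x * \<xi>)) * cis (x * \<xi>) = 1" by (simp add: cis_mult)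
      ultimately show "cis (- (z * \<xi>)) * (f (x + z) * cnj (f x))
          = cis (- ((z + x) * \<xi>)) * f (z + x) * cnj (cis (- (x * \<xi>)) * f x)"
        by (simp add: cis_cnj add.commute)
    qed
    also have "\<dots> = fourier_integral f \<xi> * cnj (cis (- (x * \<xi>)) * f x)"
      using translation_integral[of "\<lambda>z. cis (- (z * \<xi>)) * f z" x] by (simp add: fourier_integral_def)
    finally show "(LINT z|lborel. cis (- (z * \<xi>)) * (f (x + z) * cnj (f x)))
      = fourier_integral f \<xi> * cnj (cis (- (x * \<xi>)) * f x)" .
  qed
  also have "\<dots> = fourier_integral f \<xi> * (LINT x|lborel. cnj (cis (- (x * \<xi>)) * f x))" by simp
  also have "(LINT x|lborel. cnj (cis (- (x * \<xi>)) * f x)) = cnj (fourier_integral f \<xi>)"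
    unfolding fourier_integral_def by (rule Bochner_Integration.integral_cnj)
  finally show "fourier_integral (autocorrelation f) \<xi> = fourier_integral f \<xi> * cnj (fourier_integral f \<xi>)" .
qed

text \<open>Replacing the second factor by a bounded truncation costs little in \<open>L\<^sup>2\<close>, uniformly in the shift; for a
  bounded factor continuity of translations in \<open>L\<^sup>1\<close> suffices.\<close>

lemma autocorrelation_continuous_0:
  assumes f: "integrable lborel f" "L2 f" and h: "h \<longlonglongrightarrow> 0"
  shows "(\<lambda>n. autocorrelation f (h n)) \<longlonglongrightarrow> autocorrelation f 0"
proof (rule LIMSEQ_I)
  fix e :: real assume e: "0 < e"
  note [measurable] = L2_measurable[OF f(2)]
  define g where "g k x = (if norm (f x) \<le> real k then f x else 0)" for k x
  have [measurable]: "g k \<in> borel_measurable borel" for k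
    unfolding g_def[abs_def] by measurable
  have gle: "norm (g k x) \<le> norm (f x)" "norm (g k x) \<le> real k" for k x
    by (auto simp: g_def)
  have Lg: "L2 (g k)" for k by (rule L2_bound[OF f(2)]) (auto simp: gle)
  have "(\<lambda>k. norm_L2 (\<lambda>x. g k x - f x)) \<longlonglongrightarrow> 0"
  proof (rule dominated_convergence_L2[OF f(2)])
    show "AE x in lborel. (\<lambda>k. g k x) \<longlonglongrightarrow> f x"
    proof (rule AE_I2)
      fix x
      obtain k0 :: nat where "norm (f x) \<le> real k0" using real_arch_simple by blast
      then have "\<forall>\<^sub>F k in sequentially. g k x = f x"
        unfolding eventually_sequentially g_def by (intro exI[of _ k0]) auto
      then show "(\<lambda>k. g k x) \<longlonglongrightarrow> f x" by (rule tendsto_eventually)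
    qed
    show "AE x in lborel. norm (g k x) \<le> norm (f x)" for k using gle by simp
  qed measurable
  from LIMSEQ_D[OF this, of "e / (4 * (norm_L2 f + 1))"]
  obtain k where "norm_L2 (\<lambda>x. g k x - f x) < e / (4 * (norm_L2 f + 1))"
    using e norm_L2_nonneg[of f] by (force simp: add_nonneg_pos)
  then have k: "norm_L2 (\<lambda>x. g k x - f x) * (norm_L2 f + 1) \<le> e / 4"
    using norm_L2_nonneg[of f] by (simp add: field_simps)
  have "(\<lambda>n. real k * (LINT x|lborel. norm (f (x + h n) - f x))) \<longlonglongrightarrow> real k * 0"
    by (intro tendsto_mult tendsto_const translation_continuous_L1 f h)
  from LIMSEQ_D[OF this, of "e/4"] obtain N where
    N: "\<And>n. n \<ge> N \<Longrightarrow> real k * (LINT x|lborel. norm (f (x + h n) - f x)) < e/4"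
    using e by (force simp: abs_less_iff)
  have "norm (autocorrelation f (h n) - autocorrelation f 0) < e" if n: "n \<ge> N" for n
  proof -
    define d where "d x = f (x + h n) - f x" for x
    have Ld: "L2 d" unfolding d_def by (intro L2_diff L2_translate f)
    have id: "integrable lborel d" unfolding d_def by (intro Bochner_Integration.integrable_diff translation_integrable f)
    have nd: "norm_L2 d \<le> 2 * norm_L2 f"
      unfolding d_def using norm_L2_triangle_diff[OF L2_translate[OF f(2)] f(2), of "h n"]
      by (simp add: norm_L2_translate)
    note Lc = L2_Re_Im_cnj(3)[OF f(2)] L2_Re_Im_cnj(3)[OF Lg[of k]]
    have i1: "integrable lborel (\<lambda>x. d x * cnj (g k x))" by (rule L2_mult_integrable[OF Ld Lc(2)])
    have Lr: "L2 (\<lambda>x. cnj (f x - g k x))" by (intro L2_Re_Im_cnj(3) L2_diff f Lg)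
    have i2: "integrable lborel (\<lambda>x. d x * cnj (f x - g k x))" by (rule L2_mult_integrable[OF Ld Lr])
    have "autocorrelation f (h n) - autocorrelation f 0 = (LINT x|lborel. d x * cnj (f x))"
      unfolding autocorrelation_def d_def
      using L2_mult_integrable[OF L2_translate[OF f(2)] Lc(1), of "h n"] L2_mult_integrable[OF f(2) Lc(1)]
      by (simp add: left_diff_distrib)
    also have "\<dots> = (LINT x|lborel. d x * cnj (g k x) + d x * cnj (f x - g k x))"
      by (intro integral_eqI) (simp add: algebra_simps)
    also have "\<dots> = (LINT x|lborel. d x * cnj (g k x)) + (LINT x|lborel. d x * cnj (f x - g k x))"
      using i1 i2 by (rule Bochner_Integration.integral_add)
    finally have "norm (autocorrelation f (h n) - autocorrelation f 0) \<le>
       norm (LINT x|lborel. d x * cnj (g k x)) + norm (LINT x|lborel. d x * cnj (f x - g k x))"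
      by (simp add: norm_triangle_ineq)
    also have "norm (LINT x|lborel. d x * cnj (g k x)) \<le> real k * (LINT x|lborel. norm (d x))"
    proof -
      have "norm (LINT x|lborel. d x * cnj (g k x)) \<le> (LINT x|lborel. norm (d x * cnj (g k x)))"
        by (rule integral_norm_bound)
      also have "\<dots> \<le> (LINT x|lborel. real k * norm (d x))"
      proof (rule integral_mono)
        show "norm (d x * cnj (g k x)) \<le> real k * norm (d x)" for x
          using mult_right_mono[OF gle(2)[of k x] norm_ge_zero[of "d x"]] by (simp add: norm_mult mult.commute)
      qed (use i1 id in auto)
      finally show ?thesis by simp
    qed
    also have "\<dots> < e/4" using N[OF n] by (simp add: d_def)
    also have "norm (LINT x|lborel. d x * cnj (f x - g k x)) \<le> norm_L2 d * norm_L2 (\<lambda>x. g k x - f x)"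
      using Cauchy_Schwarz_L2[OF Ld Lr] by (simp add: norm_L2_minus_commute[of f] del: complex_cnj_diff)
    also have "\<dots> \<le> 2 * (norm_L2 (\<lambda>x. g k x - f x) * (norm_L2 f + 1))"
    proof -
      have "norm_L2 d * norm_L2 (\<lambda>x. g k x - f x) \<le> (2 * (norm_L2 f + 1)) * norm_L2 (\<lambda>x. g k x - f x)"
        using nd by (intro mult_right_mono) auto
      then show ?thesis by (simp only: mult_ac)
    qed
    also have "\<dots> \<le> e / 2" using k by simp
    finally show ?thesis using e by simp
  qed
  then show "\<exists>no. \<forall>n\<ge>no. norm (autocorrelation f (h n) - autocorrelation f 0) < e" by blast
qed

section \<open>The Plancherel theorem\<close>

lemma gauss_dilated_fourier:
  assumes "0 < d"
  shows "fourier_integral (\<lambda>\<xi>. complex_of_real (exp (- (d * \<xi>)\<^sup>2 / 2))) z = sqrt (2 * pi) / d * exp (- (z / d)\<^sup>2 / 2)"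
proof -
  have "(LINT \<xi>|lborel. cis (- (z / d) * \<xi>) * complex_of_real (exp (- \<xi>\<^sup>2 / 2)))
     = \<bar>d\<bar> *\<^sub>R (LINT \<xi>|lborel. cis (- (z / d) * (0 + d * \<xi>)) * complex_of_real (exp (- (0 + d * \<xi>)\<^sup>2 / 2)))"
    using assms by (intro lborel_integral_real_affine) simp
  also have "(LINT \<xi>|lborel. cis (- (z / d) * (0 + d * \<xi>)) * complex_of_real (exp (- (0 + d * \<xi>)\<^sup>2 / 2)))
     = fourier_integral (\<lambda>\<xi>. complex_of_real (exp (- (d * \<xi>)\<^sup>2 / 2))) z"
    unfolding fourier_integral_def using assms
    by (intro integral_eqI) (simp add: mult.commute)
  finally have "complex_of_real d * fourier_integral (\<lambda>\<xi>. complex_of_real (exp (- (d * \<xi>)\<^sup>2 / 2))) z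
      = sqrt (2 * pi) * exp (- (z / d)\<^sup>2 / 2)"
    using assms unfolding fourier_gauss by (simp add: scaleR_conv_of_real)
  then show ?thesis using assms by (simp add: field_simps)
qed

lemma gauss_dilated_integrable: "0 < d \<Longrightarrow> integrable lborel (\<lambda>\<xi>. exp (- (d * \<xi>)\<^sup>2 / 2))" for d :: real
  using lborel_integrable_real_affine[OF gauss_integrable, of d 0] by simp

text \<open>Fourier inversion at the single point \<open>0\<close> for the autocorrelation of \<open>f\<close>: pairing with ever wider
  Gaussians reproduces its value at \<open>0\<close> by continuity there, while on the Fourier side the pairing
  increases to the integral of the squared modulus.\<close>

theorem plancherel_L1_L2:
  assumes f: "integrable lborel f" "L2 f"
  shows "L2 (fourier_integral f)" "(norm_L2 (fourier_integral f))\<^sup>2 = 2 * pi * (norm_L2 f)\<^sup>2"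
proof -
  let ?C = "autocorrelation f"
  let ?d = "\<lambda>k::nat. 1 / real (Suc k)"
  note [measurable] = L2_measurable[OF f(2)]
  have mC [measurable]: "?C \<in> borel_measurable borel"
    using borel_measurable_integrable[OF fourier_integral_autocorrelation(1)[OF f(1)]] by simp
  let ?u = "\<lambda>k \<xi>. (norm (fourier_integral f \<xi>))\<^sup>2 * exp (- (?d k * \<xi>)\<^sup>2 / 2)"
  have key: "complex_of_real (LINT \<xi>|lborel. ?u k \<xi>)
      = sqrt (2 * pi) * (LINT x|lborel. ?C (?d k * x) * complex_of_real (exp (- x\<^sup>2 / 2)))" for k
  proof -
    let ?g = "\<lambda>\<xi>. complex_of_real (exp (- (?d k * \<xi>)\<^sup>2 / 2))"
    have d: "0 < ?d k" by simp
    have "complex_of_real (LINT \<xi>|lborel. ?u k \<xi>) = (LINT \<xi>|lborel. complex_of_real (?u k \<xi>))"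
      by (rule integral_complex_of_real[symmetric])
    also have "\<dots> = (LINT \<xi>|lborel. fourier_integral ?C \<xi> * ?g \<xi>)"
      unfolding fourier_integral_autocorrelation(2)[OF f(1)] of_real_mult complex_norm_square ..
    also have "\<dots> = (LINT x|lborel. ?C x * fourier_integral ?g x)"
    proof (rule fourier_multiplication_formula_L1)
      show "integrable lborel ?C" by (rule fourier_integral_autocorrelation(1)[OF f(1)])
      show "integrable lborel ?g" using gauss_dilated_integrable[OF d] by (rule integrable_of_real)
    qed
    also have "\<dots> = (LINT x|lborel. complex_of_real (sqrt (2 * pi) / ?d k) * (?C x * complex_of_real (exp (- (x / ?d k)\<^sup>2 / 2))))"
      unfolding gauss_dilated_fourier[OF d]
      by (intro integral_eqI) (simp only: of_real_mult mult_ac)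
    also have "\<dots> = complex_of_real (sqrt (2 * pi) / ?d k) * (LINT x|lborel. ?C x * complex_of_real (exp (- (x / ?d k)\<^sup>2 / 2)))"
      by simp
    also have "(LINT x|lborel. ?C x * complex_of_real (exp (- (x / ?d k)\<^sup>2 / 2)))
      = \<bar>?d k\<bar> *\<^sub>R (LINT x|lborel. ?C (0 + ?d k * x) * complex_of_real (exp (- ((0 + ?d k * x) / ?d k)\<^sup>2 / 2)))"
      by (rule lborel_integral_real_affine) simp
    also have "\<dots> = complex_of_real (?d k) * (LINT x|lborel. ?C (?d k * x) * complex_of_real (exp (- x\<^sup>2 / 2)))"
      by (simp add: scaleR_conv_of_real)
    finally show ?thesis by (simp add: field_simps del: of_nat_Suc)
  qed
  have lim: "(\<lambda>k. LINT x|lborel. ?C (?d k * x) * complex_of_real (exp (- x\<^sup>2 / 2)))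
      \<longlonglongrightarrow> (LINT x|lborel. ?C 0 * complex_of_real (exp (- x\<^sup>2 / 2)))"
  proof (rule integral_dominated_convergence)
    show "integrable lborel (\<lambda>x::real. (norm_L2 f)\<^sup>2 * exp (- x\<^sup>2 / 2))"
      using gauss_integrable by simp
    show "AE x in lborel. (\<lambda>k. ?C (?d k * x) * complex_of_real (exp (- x\<^sup>2 / 2))) \<longlonglongrightarrow> ?C 0 * complex_of_real (exp (- x\<^sup>2 / 2))"
    proof (rule AE_I2)
      fix x :: real
      have "(\<lambda>k. ?d k * x) \<longlonglongrightarrow> 0 * x" by (intro tendsto_mult tendsto_const LIMSEQ_Suc[OF lim_1_over_n])
      then have "(\<lambda>k. ?C (?d k * x)) \<longlonglongrightarrow> ?C 0" by (intro autocorrelation_continuous_0 f) simp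
      then show "(\<lambda>k. ?C (?d k * x) * complex_of_real (exp (- x\<^sup>2 / 2))) \<longlonglongrightarrow> ?C 0 * complex_of_real (exp (- x\<^sup>2 / 2))"
        by (intro tendsto_mult tendsto_const)
    qed
    show "AE x in lborel. norm (?C (?d k * x) * complex_of_real (exp (- x\<^sup>2 / 2))) \<le> (norm_L2 f)\<^sup>2 * exp (- x\<^sup>2 / 2)" for k
    proof (rule AE_I2)
      fix x :: real
      show "norm (?C (?d k * x) * complex_of_real (exp (- x\<^sup>2 / 2))) \<le> (norm_L2 f)\<^sup>2 * exp (- x\<^sup>2 / 2)"
        unfolding norm_mult norm_of_real
        by (intro mult_mono norm_autocorrelation_le f) auto
    qed
  qed measurable
  have gint: "(LINT x|lborel. complex_of_real (exp (- x\<^sup>2 / 2))) = sqrt (2 * pi)"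
    using fourier_gauss[of 0] by simp
  have "(LINT x|lborel. ?C 0 * complex_of_real (exp (- x\<^sup>2 / 2))) = ?C 0 * (LINT x|lborel. complex_of_real (exp (- x\<^sup>2 / 2)))"
    by (rule integral_mult_right_zero)
  also have "\<dots> = complex_of_real ((norm_L2 f)\<^sup>2 * sqrt (2 * pi))"
    unfolding gint autocorrelation_0 by simp
  finally have C0: "(LINT x|lborel. ?C 0 * complex_of_real (exp (- x\<^sup>2 / 2))) = complex_of_real ((norm_L2 f)\<^sup>2 * sqrt (2 * pi))" .
  have "(\<lambda>k. complex_of_real (LINT \<xi>|lborel. ?u k \<xi>)) \<longlonglongrightarrow> sqrt (2 * pi) * complex_of_real ((norm_L2 f)\<^sup>2 * sqrt (2 * pi))"
    unfolding key using lim unfolding C0 by (intro tendsto_mult tendsto_const)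
  then have "(\<lambda>k. complex_of_real (LINT \<xi>|lborel. ?u k \<xi>)) \<longlonglongrightarrow> complex_of_real (sqrt (2 * pi) * ((norm_L2 f)\<^sup>2 * sqrt (2 * pi)))"
    by (simp only: of_real_mult)
  then have ilim: "(\<lambda>k. LINT \<xi>|lborel. ?u k \<xi>) \<longlonglongrightarrow> sqrt (2 * pi) * ((norm_L2 f)\<^sup>2 * sqrt (2 * pi))"
    by (simp only: tendsto_of_real_iff)
  have bd: "norm (fourier_integral f \<xi>) \<le> (LINT x|lborel. norm (f x))" for \<xi>
    by (rule norm_fourier_integral_le)
  have int: "integrable lborel (?u k)" for k
  proof (rule Bochner_Integration.integrable_bound)
    show "integrable lborel (\<lambda>\<xi>. (LINT x|lborel. norm (f x))\<^sup>2 * exp (- (?d k * \<xi>)\<^sup>2 / 2))"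
      using gauss_dilated_integrable[of "?d k"] by simp
    show "AE \<xi> in lborel. norm (?u k \<xi>) \<le> norm ((LINT x|lborel. norm (f x))\<^sup>2 * exp (- (?d k * \<xi>)\<^sup>2 / 2))"
      by (rule AE_I2) (auto simp: abs_mult intro!: mult_right_mono power_mono bd)
  qed measurable
  have mono: "AE \<xi> in lborel. mono (\<lambda>k. ?u k \<xi>)"
  proof (rule AE_I2, rule monoI)
    fix \<xi> :: real and m n :: nat
    assume "m \<le> n"
    then have "(?d n * \<xi>)\<^sup>2 \<le> (?d m * \<xi>)\<^sup>2"
      unfolding power_mult_distrib by (intro mult_right_mono power_mono) (auto simp: frac_le)
    then show "?u m \<xi> \<le> ?u n \<xi>" by (intro mult_left_mono) auto
  qed
  have plim: "AE \<xi> in lborel. (\<lambda>k. ?u k \<xi>) \<longlonglongrightarrow> (norm (fourier_integral f \<xi>))\<^sup>2"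
  proof (rule AE_I2)
    fix \<xi> :: real
    have "(\<lambda>k. (norm (fourier_integral f \<xi>))\<^sup>2 * exp (- (?d k * \<xi>)\<^sup>2 / 2)) \<longlonglongrightarrow> (norm (fourier_integral f \<xi>))\<^sup>2 * exp (- (0 * \<xi>)\<^sup>2 / 2)"
      by (intro tendsto_intros LIMSEQ_Suc[OF lim_1_over_n]) auto
    then show "(\<lambda>k. ?u k \<xi>) \<longlonglongrightarrow> (norm (fourier_integral f \<xi>))\<^sup>2" by simp
  qed
  have meas: "(\<lambda>\<xi>. (norm (fourier_integral f \<xi>))\<^sup>2) \<in> borel_measurable lborel" by measurable
  show "L2 (fourier_integral f)"
    by (rule L2_I) (measurable, rule integrable_monotone_convergence[OF int mono plim ilim meas])
  have "sqrt (2 * pi) * ((norm_L2 f)\<^sup>2 * sqrt (2 * pi)) = 2 * pi * (norm_L2 f)\<^sup>2"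
    by (simp add: mult.assoc flip: power2_eq_square)
  then show "(norm_L2 (fourier_integral f))\<^sup>2 = 2 * pi * (norm_L2 f)\<^sup>2"
    unfolding norm_L2_sq[of "fourier_integral f"] using integral_monotone_convergence[OF int mono plim ilim meas] by simp
qed

lemma norm_fourier_integral_L2:
  assumes "integrable lborel f" "L2 f"
  shows "norm_L2 (fourier_integral f) = sqrt (2 * pi) * norm_L2 f"
proof -
  have "sqrt ((norm_L2 (fourier_integral f))\<^sup>2) = sqrt (2 * pi * (norm_L2 f)\<^sup>2)"
    unfolding plancherel_L1_L2(2)[OF assms] ..
  then show ?thesis by (simp add: real_sqrt_mult)
qed

definition truncate :: "real \<Rightarrow> (real \<Rightarrow> complex) \<Rightarrow> real \<Rightarrow> complex" where
  "truncate R f x = indicator {-R..R} x *\<^sub>R f x"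

lemma truncate_L2: "L2 f \<Longrightarrow> L2 (truncate R f)"
  by (rule L2_bound[of f]) (auto simp: truncate_def[abs_def] indicator_def dest: L2_measurable)

lemma L2_indicator_Icc: "L2 (indicator {a..b::real} :: real \<Rightarrow> real)"
proof (rule L2_I)
  have "(\<lambda>x. (norm (indicator {a..b} x :: real))\<^sup>2) = indicator {a..b}" by (auto simp: indicator_def)
  moreover have "emeasure lborel {a..b} < \<infinity>"
    by (rule emeasure_bounded_finite) (rule bounded_closed_interval)
  ultimately show "integrable lborel (\<lambda>x. (norm (indicator {a..b} x :: real))\<^sup>2)"
    by (simp add: integrable_indicator_iff)
qed measurable

lemma truncate_integrable:
  assumes "L2 f"
  shows "integrable lborel (truncate R f)"
proof -
  have "integrable lborel (\<lambda>x. complex_of_real (indicator {-R..R} x) * f x)"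
    by (rule L2_mult_integrable[OF L2_of_real[OF L2_indicator_Icc] assms])
  then show ?thesis by (simp add: truncate_def[abs_def] scaleR_conv_of_real)
qed

lemma truncate_tendsto:
  assumes f: "L2 f"
  shows "((\<lambda>R. norm_L2 (\<lambda>x. truncate R f x - f x)) \<longlongrightarrow> 0) at_top"
proof (rule tendsto_at_topI_sequentially)
  fix X :: "nat \<Rightarrow> real" assume X: "filterlim X at_top sequentially"
  show "(\<lambda>n. norm_L2 (\<lambda>x. truncate (X n) f x - f x)) \<longlonglongrightarrow> 0"
  proof (rule dominated_convergence_L2(2)[OF f])
    show "truncate (X n) f \<in> borel_measurable borel" for n by (rule L2_measurable[OF truncate_L2[OF f]])
    show "AE x in lborel. (\<lambda>n. truncate (X n) f x) \<longlonglongrightarrow> f x"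
    proof (rule AE_I2)
      fix x
      have "\<forall>\<^sub>F n in sequentially. \<bar>x\<bar> \<le> X n" using X by (simp add: filterlim_at_top)
      then have "\<forall>\<^sub>F n in sequentially. truncate (X n) f x = f x"
        by eventually_elim (auto simp: truncate_def indicator_def)
      then show "(\<lambda>n. truncate (X n) f x) \<longlonglongrightarrow> f x" by (rule tendsto_eventually)
    qed
    show "AE x in lborel. norm (truncate (X n) f x) \<le> norm (f x)" for n
      by (auto simp: truncate_def indicator_def)
  qed (use f in \<open>simp add: L2_measurable\<close>)
qed

lemma fourier_integral_truncate:
  "(LINT x:{-R..R}|lborel. cis (- (x * \<xi>)) * f x) = fourier_integral (truncate R f) \<xi>"
  unfolding set_lebesgue_integral_def fourier_integral_def truncate_def
  by (intro integral_eqI) simp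

text \<open>The integrals in the definition are Fourier integrals of truncations, which lie in \<open>L\<^sup>1 \<inter> L\<^sup>2\<close>; the eventual
  membership in \<open>L\<^sup>2\<close> that the definition asks for is automatic.\<close>

lemma has_fourier_transform_iff:
  assumes "L2 f"
  shows "has_fourier_transform f F \<longleftrightarrow>
    L2 F \<and> ((\<lambda>R. norm_L2 (\<lambda>\<xi>. fourier_integral (truncate R f) \<xi> - F \<xi>)) \<longlongrightarrow> 0) at_top"
proof -
  have "L2 F \<Longrightarrow> L2 (\<lambda>\<xi>. fourier_integral (truncate R f) \<xi> - F \<xi>)" for R
    by (intro L2_diff plancherel_L1_L2(1) truncate_integrable truncate_L2 assms)
  then show ?thesis
    unfolding has_fourier_transform_def tendsto_L2_def fourier_integral_truncate using assms by auto
qed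

lemma has_fourier_transform_L2: "has_fourier_transform f F \<Longrightarrow> L2 f" "has_fourier_transform f F \<Longrightarrow> L2 F"
  by (auto simp: has_fourier_transform_def)

lemma has_fourier_transform_tendsto:
  "has_fourier_transform f F \<Longrightarrow> ((\<lambda>R. norm_L2 (\<lambda>\<xi>. fourier_integral (truncate R f) \<xi> - F \<xi>)) \<longlongrightarrow> 0) at_top"
  using has_fourier_transform_iff[OF has_fourier_transform_L2(1)] by blast

lemma L2_fourier_truncate: "L2 f \<Longrightarrow> L2 (fourier_integral (truncate R f))"
  by (intro plancherel_L1_L2(1) truncate_integrable truncate_L2)

lemma norm_fourier_truncate_diff:
  assumes "L2 f"
  shows "norm_L2 (\<lambda>\<xi>. fourier_integral (truncate R f) \<xi> - fourier_integral (truncate S f) \<xi>)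
     = sqrt (2 * pi) * norm_L2 (\<lambda>x. truncate R f x - truncate S f x)"
proof -
  have "norm_L2 (fourier_integral (\<lambda>x. truncate R f x - truncate S f x))
     = sqrt (2 * pi) * norm_L2 (\<lambda>x. truncate R f x - truncate S f x)"
    by (intro norm_fourier_integral_L2 Bochner_Integration.integrable_diff L2_diff truncate_integrable truncate_L2 assms)
  moreover have "fourier_integral (\<lambda>x. truncate R f x - truncate S f x)
     = (\<lambda>\<xi>. fourier_integral (truncate R f) \<xi> - fourier_integral (truncate S f) \<xi>)"
    by (rule ext) (intro fourier_integral_diff truncate_integrable assms)
  ultimately show ?thesis by simp
qed

text \<open>By Plancherel the transforms of the truncations form a Cauchy family as the truncations do.\<close>

theorem fourier_transform_exists:
  assumes f: "L2 f"
  shows "\<exists>F. has_fourier_transform f F"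
proof -
  let ?T = "\<lambda>R. fourier_integral (truncate R f)" and ?e = "\<lambda>R. norm_L2 (\<lambda>x. truncate R f x - f x)"
  have e0: "(\<lambda>n. ?e (real n)) \<longlonglongrightarrow> 0"
    using truncate_tendsto[OF f] filterlim_compose filterlim_real_sequentially by blast
  have close: "norm_L2 (\<lambda>\<xi>. ?T R \<xi> - ?T S \<xi>) \<le> sqrt (2 * pi) * (?e R + ?e S)" for R S
    unfolding norm_fourier_truncate_diff[OF f]
    using norm_L2_triangle3[OF truncate_L2[OF f] f truncate_L2[OF f], of R S]
    by (intro mult_left_mono) (simp_all add: norm_L2_minus_commute[of f])
  obtain F where F: "L2 F" "(\<lambda>n. norm_L2 (\<lambda>\<xi>. ?T (real n) \<xi> - F \<xi>)) \<longlonglongrightarrow> 0"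
  proof (rule L2_complete[of "\<lambda>n. ?T (real n)"])
    show "L2 (?T (real n))" for n by (rule L2_fourier_truncate[OF f])
    fix e :: real assume e: "0 < e"
    have "0 < e / (4 * sqrt (2 * pi))" using e by simp
    from LIMSEQ_D[OF e0 this] obtain N where N: "\<And>n. n \<ge> N \<Longrightarrow> ?e (real n) < e / (4 * sqrt (2 * pi))" by auto
    have "norm_L2 (\<lambda>x. ?T (real m) x - ?T (real n) x) < e" if "m \<ge> N" "n \<ge> N" for m n
    proof -
      have "sqrt (2 * pi) * (?e (real m) + ?e (real n)) \<le> sqrt (2 * pi) * (e / (4 * sqrt (2 * pi)) + e / (4 * sqrt (2 * pi)))"
        using N[OF that(1)] N[OF that(2)] by (intro mult_left_mono add_mono) auto
      also have "\<dots> = e / 2" by (simp add: field_simps)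
      finally show ?thesis using close[of "real m" "real n"] e by simp
    qed
    then show "\<exists>N. \<forall>m\<ge>N. \<forall>n\<ge>N. norm_L2 (\<lambda>x. ?T (real m) x - ?T (real n) x) < e" by blast
  qed blast
  have bd: "norm_L2 (\<lambda>\<xi>. ?T R \<xi> - F \<xi>) \<le> sqrt (2 * pi) * ?e R" for R
  proof (rule LIMSEQ_le_const)
    show "(\<lambda>n. sqrt (2 * pi) * (?e R + ?e (real n)) + norm_L2 (\<lambda>\<xi>. ?T (real n) \<xi> - F \<xi>)) \<longlonglongrightarrow> sqrt (2 * pi) * ?e R"
    proof -
      have "(\<lambda>n. sqrt (2 * pi) * (?e R + ?e (real n)) + norm_L2 (\<lambda>\<xi>. ?T (real n) \<xi> - F \<xi>)) \<longlonglongrightarrow> sqrt (2 * pi) * (?e R + 0) + 0"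
        by (intro tendsto_add tendsto_mult tendsto_const e0 F(2))
      then show ?thesis by simp
    qed
    show "\<exists>N. \<forall>n\<ge>N. norm_L2 (\<lambda>\<xi>. ?T R \<xi> - F \<xi>) \<le> sqrt (2 * pi) * (?e R + ?e (real n)) + norm_L2 (\<lambda>\<xi>. ?T (real n) \<xi> - F \<xi>)"
    proof (intro exI allI impI)
      fix n :: nat
      show "norm_L2 (\<lambda>\<xi>. ?T R \<xi> - F \<xi>) \<le> sqrt (2 * pi) * (?e R + ?e (real n)) + norm_L2 (\<lambda>\<xi>. ?T (real n) \<xi> - F \<xi>)"
        using norm_L2_triangle3[OF L2_fourier_truncate[OF f] L2_fourier_truncate[OF f] F(1), of R "real n"] close[of R "real n"]
        by linarith
    qed
  qed
  have "((\<lambda>R. sqrt (2 * pi) * ?e R) \<longlongrightarrow> sqrt (2 * pi) * 0) at_top"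
    by (intro tendsto_mult tendsto_const truncate_tendsto f)
  then have z: "((\<lambda>R. sqrt (2 * pi) * ?e R) \<longlongrightarrow> 0) at_top" by simp
  have "\<forall>R. norm (norm_L2 (\<lambda>\<xi>. ?T R \<xi> - F \<xi>)) \<le> sqrt (2 * pi) * ?e R"
    unfolding real_norm_def abs_of_nonneg[OF norm_L2_nonneg] using bd by (rule allI)
  then have "((\<lambda>R. norm_L2 (\<lambda>\<xi>. ?T R \<xi> - F \<xi>)) \<longlongrightarrow> 0) at_top"
    by (rule Lim_null_comparison[OF always_eventually z])
  then show ?thesis using has_fourier_transform_iff[OF f] F(1) by blast
qed

section \<open>The Fourier transform on \<open>L\<^sup>2\<close>\<close>

abbreviation fourier :: "(real \<Rightarrow> complex) \<Rightarrow> (real \<Rightarrow> complex) \<Rightarrow> bool" where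
  "fourier \<equiv> has_fourier_transform"

lemmas fourier_L2 = has_fourier_transform_L2

lemma tendsto_norm_L2_unique:
  assumes ne: "F \<noteq> bot" and L: "\<And>i. L2 (u i)" "L2 f" "L2 g"
    and lim: "((\<lambda>i. norm_L2 (\<lambda>x. u i x - f x)) \<longlongrightarrow> 0) F" "((\<lambda>i. norm_L2 (\<lambda>x. u i x - g x)) \<longlongrightarrow> 0) F"
  shows "AE x in lborel. f x = g x"
proof -
  have "norm_L2 (\<lambda>x. f x - g x) \<le> 0"
  proof (rule tendsto_lowerbound[OF _ _ ne])
    show "((\<lambda>i. norm_L2 (\<lambda>x. u i x - f x) + norm_L2 (\<lambda>x. u i x - g x)) \<longlongrightarrow> 0) F"
      using tendsto_add[OF lim] by simp
    show "\<forall>\<^sub>F i in F. norm_L2 (\<lambda>x. f x - g x) \<le> norm_L2 (\<lambda>x. u i x - f x) + norm_L2 (\<lambda>x. u i x - g x)"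
      using norm_L2_triangle3[OF L(2) L(1) L(3)] by (simp add: norm_L2_minus_commute[of f])
  qed
  then have "norm_L2 (\<lambda>x. f x - g x) = 0" using norm_L2_nonneg[of "\<lambda>x. f x - g x"] by linarith
  from norm_L2_eq_0D[OF L2_diff[OF L(2,3)] this] show ?thesis by simp
qed

lemma fourier_unique:
  assumes "fourier f F" "fourier f G"
  shows "AE x in lborel. F x = G x"
  by (rule tendsto_norm_L2_unique[OF trivial_limit_at_top_linorder L2_fourier_truncate[OF fourier_L2(1)[OF assms(1)]]
        fourier_L2(2)[OF assms(1)] fourier_L2(2)[OF assms(2)] has_fourier_transform_tendsto[OF assms(1)]
        has_fourier_transform_tendsto[OF assms(2)]])

lemma fourier_cong_AE:
  assumes f: "fourier f F" and AE: "AE x in lborel. f x = g x" "AE x in lborel. F x = G x"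
    and [measurable]: "g \<in> borel_measurable borel" "G \<in> borel_measurable borel"
  shows "fourier g G"
proof -
  note [measurable] = L2_measurable[OF fourier_L2(1)[OF f]] L2_measurable[OF fourier_L2(2)[OF f]]
  have Lg: "L2 g" by (rule L2_cong_AE[OF AE(1) _ fourier_L2(1)[OF f]]) measurable
  have LG: "L2 G" by (rule L2_cong_AE[OF AE(2) _ fourier_L2(2)[OF f]]) measurable
  have "fourier_integral (truncate R f) = fourier_integral (truncate R g)" for R
  proof
    fix \<xi>
    show "fourier_integral (truncate R f) \<xi> = fourier_integral (truncate R g) \<xi>"
      unfolding fourier_integral_def truncate_def
    proof (rule integral_cong_AE)
      show "AE x in lborel. cis (- (x * \<xi>)) * (indicat_real {- R..R} x *\<^sub>R f x) = cis (- (x * \<xi>)) * (indicat_real {- R..R} x *\<^sub>R g x)"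
        using AE(1) by eventually_elim simp
    qed measurable
  qed
  moreover have "norm_L2 (\<lambda>\<xi>. fourier_integral (truncate R g) \<xi> - F \<xi>) = norm_L2 (\<lambda>\<xi>. fourier_integral (truncate R g) \<xi> - G \<xi>)" for R
  proof (rule norm_L2_cong_AE)
    show "AE x in lborel. fourier_integral (truncate R g) x - F x = fourier_integral (truncate R g) x - G x"
      using AE(2) by eventually_elim simp
    note [measurable] = L2_measurable[OF L2_fourier_truncate[OF Lg, of R]]
    show "(\<lambda>\<xi>. fourier_integral (truncate R g) \<xi> - F \<xi>) \<in> borel_measurable borel" by measurable
    show "(\<lambda>\<xi>. fourier_integral (truncate R g) \<xi> - G \<xi>) \<in> borel_measurable borel" by measurable
  qed
  ultimately show ?thesis
    unfolding has_fourier_transform_iff[OF Lg] using has_fourier_transform_tendsto[OF f] LG by simp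
qed

lemma fourier_L1:
  assumes f: "integrable lborel f" "L2 f"
  shows "fourier f (fourier_integral f)"
  unfolding has_fourier_transform_iff[OF f(2)]
proof
  show "L2 (fourier_integral f)" by (rule plancherel_L1_L2(1)[OF f])
  have "norm_L2 (\<lambda>\<xi>. fourier_integral (truncate R f) \<xi> - fourier_integral f \<xi>) = sqrt (2 * pi) * norm_L2 (\<lambda>x. truncate R f x - f x)" for R
  proof -
    have "norm_L2 (fourier_integral (\<lambda>x. truncate R f x - f x)) = sqrt (2 * pi) * norm_L2 (\<lambda>x. truncate R f x - f x)"
      by (intro norm_fourier_integral_L2 Bochner_Integration.integrable_diff L2_diff truncate_integrable truncate_L2 f)
    moreover have "fourier_integral (\<lambda>x. truncate R f x - f x) = (\<lambda>\<xi>. fourier_integral (truncate R f) \<xi> - fourier_integral f \<xi>)"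
      by (rule ext) (intro fourier_integral_diff truncate_integrable f)
    ultimately show ?thesis by simp
  qed
  then show "((\<lambda>R. norm_L2 (\<lambda>\<xi>. fourier_integral (truncate R f) \<xi> - fourier_integral f \<xi>)) \<longlongrightarrow> 0) at_top"
    using tendsto_mult_right_zero[OF truncate_tendsto[OF f(2)], of "sqrt (2 * pi)"] by simp
qed

lemma fourier_add:
  assumes f: "fourier f F" and g: "fourier g G"
  shows "fourier (\<lambda>x. f x + g x) (\<lambda>\<xi>. F \<xi> + G \<xi>)"
proof -
  note Lf = fourier_L2[OF f] and Lg = fourier_L2[OF g]
  have eq: "fourier_integral (truncate R (\<lambda>x. f x + g x)) \<xi> = fourier_integral (truncate R f) \<xi> + fourier_integral (truncate R g) \<xi>" for R \<xi>
    using fourier_integral_add[OF truncate_integrable[OF Lf(1), of R] truncate_integrable[OF Lg(1), of R], of \<xi>]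
    by (simp add: truncate_def[abs_def] scaleR_add_right)
  have bd: "norm_L2 (\<lambda>\<xi>. fourier_integral (truncate R f) \<xi> + fourier_integral (truncate R g) \<xi> - (F \<xi> + G \<xi>))
     \<le> norm_L2 (\<lambda>\<xi>. fourier_integral (truncate R f) \<xi> - F \<xi>) + norm_L2 (\<lambda>\<xi>. fourier_integral (truncate R g) \<xi> - G \<xi>)" for R
    using norm_L2_triangle[OF L2_diff[OF L2_fourier_truncate[OF Lf(1)] Lf(2)] L2_diff[OF L2_fourier_truncate[OF Lg(1)] Lg(2)], of R R]
    by (simp add: algebra_simps)
  have z: "((\<lambda>R. norm_L2 (\<lambda>\<xi>. fourier_integral (truncate R f) \<xi> - F \<xi>) + norm_L2 (\<lambda>\<xi>. fourier_integral (truncate R g) \<xi> - G \<xi>)) \<longlongrightarrow> 0) at_top"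
    using tendsto_add[OF has_fourier_transform_tendsto[OF f] has_fourier_transform_tendsto[OF g]] by simp
  show ?thesis
    unfolding has_fourier_transform_iff[OF L2_add[OF Lf(1) Lg(1)]] eq
  proof
    show "L2 (\<lambda>\<xi>. F \<xi> + G \<xi>)" by (rule L2_add[OF Lf(2) Lg(2)])
    have "\<forall>R. norm (norm_L2 (\<lambda>\<xi>. fourier_integral (truncate R f) \<xi> + fourier_integral (truncate R g) \<xi> - (F \<xi> + G \<xi>)))
       \<le> norm_L2 (\<lambda>\<xi>. fourier_integral (truncate R f) \<xi> - F \<xi>) + norm_L2 (\<lambda>\<xi>. fourier_integral (truncate R g) \<xi> - G \<xi>)"
      unfolding real_norm_def abs_of_nonneg[OF norm_L2_nonneg] using bd by (rule allI)
    then show "((\<lambda>R. norm_L2 (\<lambda>\<xi>. fourier_integral (truncate R f) \<xi> + fourier_integral (truncate R g) \<xi> - (F \<xi> + G \<xi>))) \<longlongrightarrow> 0) at_top"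
      by (rule Lim_null_comparison[OF always_eventually z])
  qed
qed

lemma fourier_cmult:
  assumes f: "fourier f F"
  shows "fourier (\<lambda>x. c * f x) (\<lambda>\<xi>. c * F \<xi>)"
proof -
  note Lf = fourier_L2[OF f]
  have eq: "fourier_integral (truncate R (\<lambda>x. c * f x)) \<xi> = c * fourier_integral (truncate R f) \<xi>" for R \<xi>
    using fourier_integral_cmult[of c "truncate R f" \<xi>] by (simp add: truncate_def[abs_def] scaleR_conv_of_real mult.left_commute)
  have "norm_L2 (\<lambda>\<xi>. c * fourier_integral (truncate R f) \<xi> - c * F \<xi>) = norm c * norm_L2 (\<lambda>\<xi>. fourier_integral (truncate R f) \<xi> - F \<xi>)" for R
    unfolding right_diff_distrib[symmetric] by (rule norm_L2_cmult)
  then show ?thesis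
    unfolding has_fourier_transform_iff[OF L2_cmult[OF Lf(1)]] eq
    using L2_cmult[OF Lf(2)] tendsto_mult_right_zero[OF has_fourier_transform_tendsto[OF f], of "norm c"] by simp
qed

lemma fourier_diff:
  assumes "fourier f F" "fourier g G"
  shows "fourier (\<lambda>x. f x - g x) (\<lambda>\<xi>. F \<xi> - G \<xi>)"
  using fourier_add[OF assms(1) fourier_cmult[OF assms(2), of "-1"]] by simp

lemma reflect_integral:
  fixes f :: "real \<Rightarrow> 'b::{banach, second_countable_topology}"
  shows "(LINT x|lborel. f (- x)) = (LINT x|lborel. f x)"
  using lborel_integral_real_affine[of "-1" f 0] by simp

lemma L2_reflect:
  assumes "L2 f" shows "L2 (\<lambda>x. f (- x))"
proof (rule L2_I)
  show "integrable lborel (\<lambda>x. (norm (f (- x)))\<^sup>2)"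
    using lborel_integrable_real_affine[OF L2_integrable_sq[OF assms], of "-1" 0] by simp
qed (use L2_measurable[OF assms] in measurable)

lemma norm_L2_reflect: "norm_L2 (\<lambda>x. f (- x)) = norm_L2 f"
  unfolding norm_L2_def by (simp add: reflect_integral[of "\<lambda>x. (norm (f x))\<^sup>2"])

lemma fourier_cnj:
  assumes f: "fourier f F"
  shows "fourier (\<lambda>x. cnj (f x)) (\<lambda>\<xi>. cnj (F (- \<xi>)))"
proof -
  note Lf = fourier_L2[OF f]
  have eq: "fourier_integral (truncate R (\<lambda>x. cnj (f x))) \<xi> = cnj (fourier_integral (truncate R f) (- \<xi>))" for R \<xi>
    using fourier_integral_cnj[of "truncate R f" \<xi>] by (simp add: truncate_def[abs_def])
  have "norm_L2 (\<lambda>\<xi>. cnj (fourier_integral (truncate R f) (- \<xi>)) - cnj (F (- \<xi>))) = norm_L2 (\<lambda>\<xi>. fourier_integral (truncate R f) \<xi> - F \<xi>)" for R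
    using norm_L2_reflect[of "\<lambda>\<xi>. fourier_integral (truncate R f) \<xi> - F \<xi>"]
      norm_L2_cnj[of "\<lambda>\<xi>. fourier_integral (truncate R f) (- \<xi>) - F (- \<xi>)"] by simp
  then show ?thesis
    unfolding has_fourier_transform_iff[OF L2_Re_Im_cnj(3)[OF Lf(1)]] eq
    using L2_Re_Im_cnj(3)[OF L2_reflect[OF Lf(2)]] has_fourier_transform_tendsto[OF f] by simp
qed

lemma L2_modulate: "L2 f \<Longrightarrow> L2 (\<lambda>x. cis (a * x) * f x)"
  using L2_mult_bounded[of f "\<lambda>x. cis (a * x)" 1] by simp

lemma fourier_modulate:
  assumes f: "fourier f F"
  shows "fourier (\<lambda>x. cis (a * x) * f x) (\<lambda>\<xi>. F (\<xi> - a))"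
proof -
  note Lf = fourier_L2[OF f]
  have eq: "fourier_integral (truncate R (\<lambda>x. cis (a * x) * f x)) \<xi> = fourier_integral (truncate R f) (\<xi> - a)" for R \<xi>
    using fourier_integral_modulate[of a "truncate R f" \<xi>] by (simp add: truncate_def[abs_def])
  have "norm_L2 (\<lambda>\<xi>. fourier_integral (truncate R f) (\<xi> - a) - F (\<xi> - a)) = norm_L2 (\<lambda>\<xi>. fourier_integral (truncate R f) \<xi> - F \<xi>)" for R
    using norm_L2_translate[of "\<lambda>\<xi>. fourier_integral (truncate R f) \<xi> - F \<xi>" "-a"] by simp
  then show ?thesis
    unfolding has_fourier_transform_iff[OF L2_modulate[OF Lf(1)]] eq
    using L2_translate[OF Lf(2), of "-a"] has_fourier_transform_tendsto[OF f] by simp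
qed

lemma plancherel:
  assumes f: "fourier f F"
  shows "norm_L2 F = sqrt (2 * pi) * norm_L2 f"
proof (rule tendsto_unique[OF trivial_limit_at_top_linorder])
  note Lf = fourier_L2[OF f]
  have norm_tendsto: "((\<lambda>R. norm_L2 (u R)) \<longlongrightarrow> norm_L2 v) at_top"
    if "\<And>R. L2 (u R)" "L2 v" "((\<lambda>R. norm_L2 (\<lambda>x. u R x - v x)) \<longlongrightarrow> 0) at_top" for u :: "real \<Rightarrow> real \<Rightarrow> complex" and v
  proof -
    have "\<forall>R. norm (norm_L2 (u R) - norm_L2 v) \<le> norm_L2 (\<lambda>x. u R x - v x)"
      using norm_L2_diff_ge[OF that(1,2)] by simp
    then have "((\<lambda>R. norm_L2 (u R) - norm_L2 v) \<longlongrightarrow> 0) at_top"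
      by (rule Lim_null_comparison[OF always_eventually that(3)])
    then show ?thesis by (rule LIM_zero_cancel)
  qed
  show "((\<lambda>R. norm_L2 (fourier_integral (truncate R f))) \<longlongrightarrow> norm_L2 F) at_top"
    by (rule norm_tendsto[OF L2_fourier_truncate[OF Lf(1)] Lf(2) has_fourier_transform_tendsto[OF f]])
  show "((\<lambda>R. norm_L2 (fourier_integral (truncate R f))) \<longlongrightarrow> sqrt (2 * pi) * norm_L2 f) at_top"
    unfolding norm_fourier_integral_L2[OF truncate_integrable[OF Lf(1)] truncate_L2[OF Lf(1)]]
    by (intro tendsto_mult tendsto_const norm_tendsto truncate_L2 truncate_tendsto Lf)
qed

lemma Re_inner_polarization:
  fixes f g :: "real \<Rightarrow> complex"
  assumes "L2 f" "L2 g"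
  shows "2 * Re (LINT x|lborel. f x * cnj (g x)) = (norm_L2 (\<lambda>x. f x + g x))\<^sup>2 - (norm_L2 f)\<^sup>2 - (norm_L2 g)\<^sup>2"
proof -
  note i = L2_integrable_sq[OF assms(1)] L2_integrable_sq[OF assms(2)]
    L2_integrable_sq[OF L2_add[OF assms]] L2_mult_integrable[OF assms(1) L2_Re_Im_cnj(3)[OF assms(2)]]
  have "2 * Re (LINT x|lborel. f x * cnj (g x)) = (LINT x|lborel. 2 * Re (f x * cnj (g x)))"
    by (simp only: integral_mult_right_zero integral_Re[OF i(4)])
  also have "\<dots> = (LINT x|lborel. (norm (f x + g x))\<^sup>2 - (norm (f x))\<^sup>2 - (norm (g x))\<^sup>2)"
    by (intro integral_eqI) (simp add: cmod_power2 power2_sum)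
  finally show ?thesis using i by (simp add: norm_L2_sq)
qed

lemma Re_parseval:
  assumes f: "fourier f F" and g: "fourier g G"
  shows "Re (LINT \<xi>|lborel. F \<xi> * cnj (G \<xi>)) = 2 * pi * Re (LINT x|lborel. f x * cnj (g x))"
proof -
  have sq: "(norm_L2 K)\<^sup>2 = 2 * pi * (norm_L2 k)\<^sup>2" if "fourier k K" for k K
    unfolding plancherel[OF that] by (simp add: power_mult_distrib)
  have "2 * Re (LINT \<xi>|lborel. F \<xi> * cnj (G \<xi>)) = 2 * pi * (2 * Re (LINT x|lborel. f x * cnj (g x)))"
    unfolding Re_inner_polarization[OF fourier_L2(2)[OF f] fourier_L2(2)[OF g]]
      Re_inner_polarization[OF fourier_L2(1)[OF f] fourier_L2(1)[OF g]]
      sq[OF f] sq[OF g] sq[OF fourier_add[OF f g]] by (simp add: algebra_simps)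
  then show ?thesis by simp
qed

text \<open>Polarisation of Plancherel; the imaginary part is the real part for \<open>\<i> g\<close>.\<close>

theorem parseval:
  assumes f: "fourier f F" and g: "fourier g G"
  shows "(LINT \<xi>|lborel. F \<xi> * cnj (G \<xi>)) = 2 * pi * (LINT x|lborel. f x * cnj (g x))"
proof (rule complex_eqI)
  show "Re (LINT \<xi>|lborel. F \<xi> * cnj (G \<xi>)) = Re (2 * pi * (LINT x|lborel. f x * cnj (g x)))"
    using Re_parseval[OF f g] by simp
  have im: "Im (LINT x|lborel. u x * cnj (v x)) = Re (LINT x|lborel. u x * cnj (\<i> * v x))" for u v :: "real \<Rightarrow> complex"
  proof -
    have "(LINT x|lborel. u x * cnj (\<i> * v x)) = (LINT x|lborel. (- \<i>) * (u x * cnj (v x)))"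
      by (intro integral_eqI) simp
    also have "\<dots> = (- \<i>) * (LINT x|lborel. u x * cnj (v x))" by (rule integral_mult_right_zero)
    finally show ?thesis by simp
  qed
  show "Im (LINT \<xi>|lborel. F \<xi> * cnj (G \<xi>)) = Im (2 * pi * (LINT x|lborel. f x * cnj (g x)))"
    using Re_parseval[OF f fourier_cmult[OF g, of \<i>]] im[of F G] im[of f g] by simp
qed

lemma fourier_multiplication_formula:
  assumes f: "fourier f F" and g: "fourier g G"
  shows "(LINT x|lborel. F x * g x) = (LINT x|lborel. f x * G x)"
proof (rule tendsto_unique[OF trivial_limit_at_top_linorder])
  note Lf = fourier_L2[OF f] and Lg = fourier_L2[OF g]
  show "((\<lambda>R. LINT x|lborel. fourier_integral (truncate R f) x * truncate R g x) \<longlongrightarrow> (LINT x|lborel. F x * g x)) at_top"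
    by (intro tendsto_L2_mult always_eventually allI L2_fourier_truncate truncate_L2 Lf Lg
        has_fourier_transform_tendsto[OF f] truncate_tendsto)
  show "((\<lambda>R. LINT x|lborel. fourier_integral (truncate R f) x * truncate R g x) \<longlongrightarrow> (LINT x|lborel. f x * G x)) at_top"
    unfolding fourier_multiplication_formula_L1[OF truncate_integrable[OF Lf(1)] truncate_integrable[OF Lg(1)]]
    by (intro tendsto_L2_mult always_eventually allI L2_fourier_truncate truncate_L2 Lf Lg
        has_fourier_transform_tendsto[OF g] truncate_tendsto)
qed

lemma integral_mult_cnj_self: "(LINT x|lborel. f x * cnj (f x)) = complex_of_real ((norm_L2 f)\<^sup>2)"
  using autocorrelation_0[of f] by (simp add: autocorrelation_def)

text \<open>The transform is, up to a constant, its own inverse after conjugation. The candidate preimage \<open>f\<close> is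
  built accordingly; its transform \<open>G\<close> has the same norm as \<open>F\<close>, and the multiplication formula gives
  \<open>\<langle>G, F\<rangle> = \<langle>G, G\<rangle>\<close>, so \<open>G - F\<close> has norm \<open>0\<close>.\<close>

theorem fourier_transform_surj:
  assumes F: "L2 F"
  shows "\<exists>f. fourier f F"
proof -
  have LcF: "L2 (\<lambda>\<xi>. cnj (F \<xi>))" by (rule L2_Re_Im_cnj(3)[OF F])
  obtain k where k: "fourier (\<lambda>\<xi>. cnj (F \<xi>)) k" using fourier_transform_exists[OF LcF] by blast
  \<comment> \<open>inversion: conjugating, transforming twice and dividing by \<open>2 \<pi>\<close> returns \<open>F\<close>\<close>
  define f where "f x = cnj (k x) / (2 * pi)" for x
  have Lk: "L2 k" by (rule fourier_L2(2)[OF k])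
  have Lf: "L2 f" unfolding f_def using L2_cmult[OF L2_Re_Im_cnj(3)[OF Lk], of "1 / (2 * pi)"] by simp
  obtain G where G: "fourier f G" using fourier_transform_exists[OF Lf] by blast
  have LG: "L2 G" by (rule fourier_L2(2)[OF G])
  \<comment> \<open>pairing with an arbitrary transform \<open>P\<close> of \<open>p\<close> gives \<open>\<integral> P cnj (F) = \<integral> P cnj (G)\<close>\<close>
  have pair: "(LINT \<xi>|lborel. P \<xi> * cnj (F \<xi>)) = (LINT \<xi>|lborel. P \<xi> * cnj (G \<xi>))" if p: "fourier p P" for p P
  proof -
    have "(LINT \<xi>|lborel. P \<xi> * cnj (F \<xi>)) = (LINT x|lborel. p x * k x)"
      by (rule fourier_multiplication_formula[OF p k])
    also have "\<dots> = (LINT x|lborel. (2 * pi) * (p x * cnj (f x)))"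
      by (intro integral_eqI) (simp add: f_def)
    also have "\<dots> = 2 * pi * (LINT x|lborel. p x * cnj (f x))" by (rule integral_mult_right_zero)
    also have "\<dots> = (LINT \<xi>|lborel. P \<xi> * cnj (G \<xi>))" by (rule parseval[OF p G, symmetric])
    finally show ?thesis .
  qed
  have GF: "(LINT \<xi>|lborel. G \<xi> * cnj (F \<xi>)) = complex_of_real ((norm_L2 G)\<^sup>2)"
    using pair[OF G] by (simp only: integral_mult_cnj_self)
  have nk: "norm_L2 G = norm_L2 F"
  proof -
    have "norm_L2 f = norm_L2 k / (2 * pi)"
      unfolding f_def using norm_L2_cmult[of "complex_of_real (1 / (2 * pi))" "\<lambda>x. cnj (k x)"] by (simp add: norm_divide)
    then have "norm_L2 G = (sqrt (2 * pi) * sqrt (2 * pi)) * norm_L2 F / (2 * pi)"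
      using plancherel[OF G] plancherel[OF k] by (simp only: norm_L2_cnj mult.assoc times_divide_eq_right)
    then show ?thesis by simp
  qed
  have "(norm_L2 (\<lambda>\<xi>. G \<xi> + - F \<xi>))\<^sup>2 = (norm_L2 G)\<^sup>2 + (norm_L2 F)\<^sup>2 + 2 * Re (LINT x|lborel. G x * cnj (- F x))"
    using Re_inner_polarization[OF LG L2_uminus[OF F]] by simp
  also have "(LINT x|lborel. G x * cnj (- F x)) = - complex_of_real ((norm_L2 G)\<^sup>2)"
    using GF by simp
  finally have "(norm_L2 (\<lambda>\<xi>. G \<xi> - F \<xi>))\<^sup>2 = 0" by (simp add: nk)
  then have "AE x in lborel. G x - F x = 0" by (intro norm_L2_eq_0D L2_diff LG F) simp
  then have AE: "AE x in lborel. G x = F x" by simp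
  have "fourier f F" by (rule fourier_cong_AE[OF G _ AE]) (auto intro: L2_measurable Lf F)
  then show ?thesis by blast
qed

lemma fourier_inj:
  assumes "fourier f F" "fourier g F"
  shows "AE x in lborel. f x = g x"
proof -
  have "sqrt (2 * pi) * norm_L2 (\<lambda>x. f x - g x) = 0"
    using plancherel[OF fourier_diff[OF assms]] by simp
  then have "AE x in lborel. f x - g x = 0"
    by (intro norm_L2_eq_0D L2_diff fourier_L2(1)[OF assms(1)] fourier_L2(1)[OF assms(2)]) simp
  then show ?thesis by simp
qed

section \<open>Locally integrable functions and their primitives\<close>

lemma locally_integrableD: "locally_integrable f \<Longrightarrow> set_integrable lborel {a..b} f"
  by (simp add: locally_integrable_def)

lemma locally_integrable_measurable:
  assumes "locally_integrable f" shows "f \<in> borel_measurable borel"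
proof (rule borel_measurable_LIMSEQ_real)
  show "(\<lambda>x. indicator {- real n..real n} x *\<^sub>R f x) \<in> borel_measurable borel" for n
    using borel_measurable_integrable[OF locally_integrableD[OF assms, of "- real n" "real n", unfolded set_integrable_def]] by simp
  fix x :: real
  obtain k :: nat where "\<bar>x\<bar> \<le> real k" using real_arch_simple by blast
  then have "\<forall>\<^sub>F n in sequentially. indicator {- real n..real n} x *\<^sub>R f x = f x"
    unfolding eventually_sequentially by (intro exI[of _ k]) (auto simp: indicator_def)
  then show "(\<lambda>n. indicator {- real n..real n} x *\<^sub>R f x) \<longlonglongrightarrow> f x" by (rule tendsto_eventually)
qed

lemma locally_integrable_continuous: "continuous_on UNIV f \<Longrightarrow> locally_integrable f"
  unfolding locally_integrable_def by (auto intro!: borel_integrable_atLeastAtMost' intro: continuous_on_subset)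

lemma locally_integrable_mult_continuous:
  assumes f: "locally_integrable f" and g: "continuous_on UNIV g"
  shows "locally_integrable (\<lambda>x. f x * g x)"
  unfolding locally_integrable_def
proof (intro allI)
  fix a b :: real
  have "compact (g ` {a..b})" by (intro compact_continuous_image continuous_on_subset[OF g]) auto
  then obtain B where B: "\<forall>y\<in>g ` {a..b}. norm y \<le> B" using compact_imp_bounded bounded_iff by metis
  note [measurable] = locally_integrable_measurable[OF f] borel_measurable_continuous_onI[OF g]
  have i: "integrable lborel (\<lambda>x. \<bar>B\<bar> * (indicator {a..b} x *\<^sub>R f x))"
    using locally_integrableD[OF f, of a b] unfolding set_integrable_def by simp
  show "set_integrable lborel {a..b} (\<lambda>x. f x * g x)"
    unfolding set_integrable_def
  proof (rule Bochner_Integration.integrable_bound[OF i])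
    show "AE x in lborel. norm (indicator {a..b} x *\<^sub>R (f x * g x)) \<le> norm (\<bar>B\<bar> * (indicator {a..b} x *\<^sub>R f x))"
    proof (rule AE_I2)
      fix x
      show "norm (indicator {a..b} x *\<^sub>R (f x * g x)) \<le> norm (\<bar>B\<bar> * (indicator {a..b} x *\<^sub>R f x))"
      proof (cases "x \<in> {a..b}")
        case True
        then have "\<bar>g x\<bar> \<le> \<bar>B\<bar>" using B by force
        then have "\<bar>g x\<bar> * \<bar>f x\<bar> \<le> \<bar>B\<bar> * \<bar>f x\<bar>" by (rule mult_right_mono) simp
        then show ?thesis using True by (simp add: abs_mult mult.commute)
      qed simp
    qed
  qed measurable
qed

lemma locally_integrable_add: "locally_integrable f \<Longrightarrow> locally_integrable g \<Longrightarrow> locally_integrable (\<lambda>x. f x + g x)"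
  by (simp add: locally_integrable_def)

lemma locally_integrable_cmult: "locally_integrable f \<Longrightarrow> locally_integrable (\<lambda>x. c * f x)"
  by (simp add: locally_integrable_def)

lemma locally_integrable_L2:
  assumes "L2 f" shows "locally_integrable f"
  unfolding locally_integrable_def set_integrable_def
  using L2_mult_integrable[OF L2_indicator_Icc assms] by simp

text \<open>The sets over which the integral vanishes form a Dynkin system, which contains the intervals and thus
  all Borel sets, in particular the two where the sign of the function is constant.\<close>

lemma integral_zero_all_sets:
  fixes k :: "real \<Rightarrow> real"
  assumes k: "integrable lborel k" and tot: "(LINT x|lborel. k x) = 0"
    and I: "\<And>a b. (LINT x:{a..b}|lborel. k x) = 0"
  shows "AE x in lborel. k x = 0"
proof -
  note [measurable] = borel_measurable_integrable[OF k]
  let ?G = "range (\<lambda>(a, b). {a..b::real})"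
  have st: "Int_stable ?G"
  proof (rule Int_stableI)
    fix A B assume "A \<in> ?G" "B \<in> ?G"
    then obtain a b c d where "A = {a..b}" "B = {c..d}" by auto
    then have "A \<inter> B = {max a c..min b d}" by auto
    then show "A \<inter> B \<in> ?G" by (auto intro!: rev_image_eqI[of "(max a c, min b d)"])
  qed
  have si: "set_integrable lborel A k" if "A \<in> sets borel" for A
    unfolding set_integrable_def using integrable_mult_indicator[OF _ k] that by simp
  have all: "(LINT x:A|lborel. k x) = 0" if "A \<in> sets borel" for A
  proof -
    have "A \<in> sigma_sets UNIV ?G" using that unfolding borel_eq_atLeastAtMost by simp
    have "?G \<subseteq> Pow UNIV" by simp
    from st this \<open>A \<in> sigma_sets UNIV ?G\<close> show ?thesis
    proof (induction rule: sigma_sets_induct_disjoint)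
      case (basic A) then show ?case using I by auto
    next
      case empty show ?case by (simp add: set_lebesgue_integral_def)
    next
      case (compl A)
      then have A: "A \<in> sets borel" unfolding borel_eq_atLeastAtMost by simp
      have "(LINT x:UNIV - A|lborel. k x) = (LINT x|lborel. k x - indicator A x *\<^sub>R k x)"
        unfolding set_lebesgue_integral_def
        by (intro integral_eqI) (auto simp: indicator_def)
      also have "\<dots> = (LINT x|lborel. k x) - (LINT x:A|lborel. k x)"
        unfolding set_lebesgue_integral_def
        by (rule Bochner_Integration.integral_diff[OF k si[OF A, unfolded set_integrable_def]])
      finally show ?case using compl tot by simp
    next
      case (union A)
      have A: "A i \<in> sets lborel" for i using union(2) unfolding sets_lborel borel_eq_atLeastAtMost by auto
      have "(LINT x:(\<Union>i. A i)|lborel. k x) = (\<Sum>i. LINT x:A i|lborel. k x)"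
      proof (rule lebesgue_integral_countable_add)
        show "A i \<inter> A j = {}" if "i \<noteq> j" for i j using union(1) that by (auto simp: disjoint_family_on_def)
        show "set_integrable lborel (\<Union>i. A i) k" using A by (intro si) (auto simp: sets_lborel)
      qed (rule A)
      then show ?case using union(3) by simp
    qed
  qed
  have p: "{x. 0 \<le> k x} \<in> sets borel" "{x. k x \<le> 0} \<in> sets borel" by measurable
  have "(LINT x|lborel. norm (k x)) = (LINT x|lborel. indicator {x. 0 \<le> k x} x *\<^sub>R k x - indicator {x. k x \<le> 0} x *\<^sub>R k x)"
    by (intro integral_eqI) (auto simp: indicator_def)
  also have "\<dots> = (LINT x:{x. 0 \<le> k x}|lborel. k x) - (LINT x:{x. k x \<le> 0}|lborel. k x)"
    unfolding set_lebesgue_integral_def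
    by (rule Bochner_Integration.integral_diff) (use si[OF p(1)] si[OF p(2)] in \<open>simp_all add: set_integrable_def\<close>)
  also have "\<dots> = 0" using all[OF p(1)] all[OF p(2)] by simp
  finally have "AE x in lborel. norm (k x) = 0"
    by (subst (asm) integral_nonneg_eq_0_iff_AE) (use k in auto)
  then show ?thesis by simp
qed

lemma locally_integrable_eq_0:
  assumes f: "locally_integrable f" and I: "\<And>a b. a \<le> b \<Longrightarrow> (LINT x:{a..b}|lborel. f x) = 0"
  shows "AE x in lborel. f x = 0"
proof -
  have I': "(LINT x:{a..b}|lborel. f x) = 0" for a b
    using I[of a b] by (cases "a \<le> b") (auto simp: set_lebesgue_integral_def)
  have "AE x in lborel. indicator {- real n..real n} x *\<^sub>R f x = 0" for n :: nat
  proof (rule integral_zero_all_sets)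
    show "integrable lborel (\<lambda>x. indicator {- real n..real n} x *\<^sub>R f x)"
      using locally_integrableD[OF f] unfolding set_integrable_def .
    show "(LINT x|lborel. indicator {- real n..real n} x *\<^sub>R f x) = 0"
      using I' unfolding set_lebesgue_integral_def .
    fix a b
    have "(LINT x:{a..b}|lborel. indicator {- real n..real n} x *\<^sub>R f x) = (LINT x:{max a (- real n)..min b (real n)}|lborel. f x)"
      unfolding set_lebesgue_integral_def
      by (intro integral_eqI) (auto simp: indicator_def)
    then show "(LINT x:{a..b}|lborel. indicator {- real n..real n} x *\<^sub>R f x) = 0" using I' by simp
  qed
  then have "AE x in lborel. \<forall>n::nat. indicator {- real n..real n} x *\<^sub>R f x = 0"
    unfolding AE_all_countable by (rule allI)
  then show ?thesis
  proof eventually_elim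
    case (elim x)
    obtain k :: nat where "\<bar>x\<bar> \<le> real k" using real_arch_simple by blast
    then have x: "x \<in> {- real k..real k}" unfolding atLeastAtMost_iff by linarith
    have "indicator {- real k..real k} x *\<^sub>R f x = 0" by (rule spec[OF elim])
    then show ?case using x by (simp only: indicator_simps scaleR_one)
  qed
qed

text \<open>Absolute continuity, in the form of the fundamental theorem of calculus. Unlike a weakly
  differentiable function, such a \<open>U\<close> is determined pointwise.\<close>

definition primitive :: "(real \<Rightarrow> real) \<Rightarrow> (real \<Rightarrow> real) \<Rightarrow> bool" where
  "primitive U g \<longleftrightarrow> locally_integrable g \<and> (\<forall>a b. a \<le> b \<longrightarrow> U b - U a = (LINT x:{a..b}|lborel. g x))"

lemma primitive_locally_integrable: "primitive U g \<Longrightarrow> locally_integrable g"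
  by (simp add: primitive_def)

lemma primitiveD: "primitive U g \<Longrightarrow> a \<le> b \<Longrightarrow> (LINT x:{a..b}|lborel. g x) = U b - U a"
  by (simp add: primitive_def)

lemma primitive_continuous:
  assumes U: "primitive U g"
  shows "continuous_on UNIV U"
proof -
  have "isCont U x" for x
  proof -
    define a b where "a = x - 1" and "b = x + 1"
    have si: "set_integrable lborel {a..b} g" by (rule locally_integrableD[OF primitive_locally_integrable[OF U]])
    have ion: "g integrable_on {a..b}" by (rule set_borel_integral_eq_integral(1)[OF si])
    have eq: "U y = U a + integral {a..y} g" if "y \<in> {a..b}" for y
    proof -
      have "set_integrable lborel {a..y} g" by (rule locally_integrableD[OF primitive_locally_integrable[OF U]])
      from set_borel_integral_eq_integral(2)[OF this] show ?thesis
        using primitiveD[OF U, of a y] that by simp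
    qed
    have "continuous_on {a..b} (\<lambda>y. U a + integral {a..y} g)"
      by (intro continuous_intros indefinite_integral_continuous_1 ion)
    then have "continuous_on {a..b} U" by (rule continuous_on_eq) (rule eq[symmetric])
    then show ?thesis
      by (rule continuous_on_interior) (simp add: a_def b_def)
  qed
  then show ?thesis by (simp add: continuous_at_imp_continuous_on)
qed

lemma primitive_measurable: "primitive U g \<Longrightarrow> U \<in> borel_measurable borel"
  by (intro borel_measurable_continuous_onI primitive_continuous)

lemma primitive_C1:
  assumes D: "\<And>x. (U has_real_derivative u x) (at x)" and c: "continuous_on UNIV u"
  shows "primitive U u"
  unfolding primitive_def
proof (intro conjI allI impI)
  show "locally_integrable u" by (rule locally_integrable_continuous[OF c])
  fix a b :: real assume ab: "a \<le> b"
  have "(LINT x|lborel. indicator {a..b} x *\<^sub>R u x) = U b - U a"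
  proof (rule integral_FTC_atLeastAtMost[OF ab])
    show "(U has_vector_derivative u x) (at x within {a..b})" for x
      using D[of x] by (simp add: has_real_derivative_iff_has_vector_derivative has_vector_derivative_at_within)
  qed (rule continuous_on_subset[OF c], simp)
  then show "U b - U a = (LINT x:{a..b}|lborel. u x)" by (simp add: set_lebesgue_integral_def)
qed

lemma primitive_add: "primitive U g \<Longrightarrow> primitive V k \<Longrightarrow> primitive (\<lambda>x. U x + V x) (\<lambda>x. g x + k x)"
  unfolding primitive_def
proof (intro conjI allI impI; elim conjE)
  fix a b :: real
  assume ab: "a \<le> b" and g: "locally_integrable g" and k: "locally_integrable k"
    and UV: "\<forall>a b. a \<le> b \<longrightarrow> U b - U a = (LINT x:{a..b}|lborel. g x)"
      "\<forall>a b. a \<le> b \<longrightarrow> V b - V a = (LINT x:{a..b}|lborel. k x)"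
  have "U b + V b - (U a + V a) = (U b - U a) + (V b - V a)" by simp
  also have "\<dots> = (LINT x:{a..b}|lborel. g x + k x)"
    using UV ab set_integral_add(2)[OF locally_integrableD[OF g, of a b] locally_integrableD[OF k, of a b]] by simp
  finally show "U b + V b - (U a + V a) = (LINT x:{a..b}|lborel. g x + k x)" .
qed (rule locally_integrable_add)

lemma primitive_cmult: "primitive U g \<Longrightarrow> primitive (\<lambda>x. c * U x) (\<lambda>x. c * g x)"
  unfolding primitive_def by (auto simp: locally_integrable_cmult simp flip: right_diff_distrib)

lemma primitive_const: "primitive (\<lambda>x. c) (\<lambda>x. 0)"
  by (rule primitive_C1) auto

text \<open>The product of the two increments is a double integral over a square; cutting the square along its
  diagonal and integrating out one variable on each side gives the product rule.\<close>

lemma primitive_mult: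
  assumes U: "primitive U g" and V: "primitive V k"
  shows "primitive (\<lambda>x. U x * V x) (\<lambda>x. g x * V x + U x * k x)"
  unfolding primitive_def
proof (intro conjI allI impI)
  note lg = primitive_locally_integrable[OF U] and lk = primitive_locally_integrable[OF V]
  have l1: "locally_integrable (\<lambda>x. g x * V x)"
    by (rule locally_integrable_mult_continuous[OF lg primitive_continuous[OF V]])
  have l2: "locally_integrable (\<lambda>x. U x * k x)"
    using locally_integrable_mult_continuous[OF lk primitive_continuous[OF U]] by (simp add: mult.commute)
  show "locally_integrable (\<lambda>x. g x * V x + U x * k x)" by (rule locally_integrable_add[OF l1 l2])
  fix a b :: real assume ab: "a \<le> b"
  let ?G = "\<lambda>x. indicator {a..b} x * g x" and ?K = "\<lambda>x. indicator {a..b} x * k x"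
  have iG: "integrable lborel ?G" and iK: "integrable lborel ?K"
    using locally_integrableD[OF lg, of a b] locally_integrableD[OF lk, of a b] by (simp_all add: set_integrable_def)
  have IG: "(LINT x|lborel. ?G x) = U b - U a" and IK: "(LINT x|lborel. ?K x) = V b - V a"
    using primitiveD[OF U ab] primitiveD[OF V ab] by (simp_all add: set_lebesgue_integral_def)
  note [measurable] = locally_integrable_measurable[OF lg] locally_integrable_measurable[OF lk]
  let ?le = "\<lambda>x y. if y \<le> x then ?G x * ?K y else 0" and ?gt = "\<lambda>x y. if y \<le> x then 0 else ?G x * ?K y"
  note iP = integrable_prod[OF iG iK]
  have ile: "integrable (lborel \<Otimes>\<^sub>M lborel) (\<lambda>(x, y). ?le x y)"
  proof (rule Bochner_Integration.integrable_bound[OF iP])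
    show "AE p in lborel \<Otimes>\<^sub>M lborel. norm ((case p of (x, y) \<Rightarrow> ?le x y)) \<le> norm ((case p of (x, y) \<Rightarrow> ?G x * ?K y))"
      by (rule AE_I2) auto
  qed measurable
  have igt: "integrable (lborel \<Otimes>\<^sub>M lborel) (\<lambda>(x, y). ?gt x y)"
  proof (rule Bochner_Integration.integrable_bound[OF iP])
    show "AE p in lborel \<Otimes>\<^sub>M lborel. norm ((case p of (x, y) \<Rightarrow> ?gt x y)) \<le> norm ((case p of (x, y) \<Rightarrow> ?G x * ?K y))"
      by (rule AE_I2) auto
  qed measurable
  have le: "(LINT x|lborel. LINT y|lborel. ?le x y) = (LINT x:{a..b}|lborel. g x * (V x - V a))"
    unfolding set_lebesgue_integral_def
  proof (intro integral_eqI)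
    fix x
    have "(LINT y|lborel. ?le x y) = (LINT y|lborel. ?G x * (if y \<le> x then ?K y else 0))"
      by (intro integral_eqI) simp
    also have "\<dots> = ?G x * (LINT y|lborel. (if y \<le> x then ?K y else 0))" by (rule integral_mult_right_zero)
    also have "\<dots> = indicator {a..b} x *\<^sub>R (g x * (V x - V a))"
    proof (cases "x \<in> {a..b}")
      case True
      then have "(LINT y|lborel. (if y \<le> x then ?K y else 0)) = (LINT y:{a..x}|lborel. k y)"
        unfolding set_lebesgue_integral_def by (intro integral_eqI) (auto simp: indicator_def)
      then show ?thesis using True primitiveD[OF V, of a x] by simp
    qed simp
    finally show "(LINT y|lborel. ?le x y) = indicator {a..b} x *\<^sub>R (g x * (V x - V a))" .
  qed
  have gt: "(LINT y|lborel. LINT x|lborel. ?gt x y) = (LINT y:{a..b}|lborel. k y * (U y - U a))"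
    unfolding set_lebesgue_integral_def
  proof (intro integral_eqI)
    fix y
    have "(LINT x|lborel. ?gt x y) = (LINT x|lborel. ?K y * (if y \<le> x then 0 else ?G x))"
      by (intro integral_eqI) simp
    also have "\<dots> = ?K y * (LINT x|lborel. (if y \<le> x then 0 else ?G x))" by (rule integral_mult_right_zero)
    also have "\<dots> = indicator {a..b} y *\<^sub>R (k y * (U y - U a))"
    proof (cases "y \<in> {a..b}")
      case True
      have "(LINT x|lborel. (if y \<le> x then 0 else ?G x)) = (LINT x:{a..y}|lborel. g x)"
        unfolding set_lebesgue_integral_def
      proof (rule integral_cong_AE)
        show "AE x in lborel. (if y \<le> x then 0 else ?G x) = indicator {a..y} x *\<^sub>R g x"
          using AE_lborel_singleton[of y] by eventually_elim (use True in \<open>auto simp: indicator_def\<close>)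
      qed measurable
      then show ?thesis using True primitiveD[OF U, of a y] by simp
    qed simp
    finally show "(LINT x|lborel. ?gt x y) = indicator {a..b} y *\<^sub>R (k y * (U y - U a))" .
  qed
  have "(U b - U a) * (V b - V a) = (LINT x|lborel. LINT y|lborel. ?G x * ?K y)"
    using IG IK by simp
  also have "\<dots> = (LINT p|(lborel \<Otimes>\<^sub>M lborel). (case p of (x, y) \<Rightarrow> ?G x * ?K y))"
    by (rule lborel_pair.integral_fst[OF iP])
  also have "\<dots> = (LINT p|(lborel \<Otimes>\<^sub>M lborel). (case p of (x, y) \<Rightarrow> ?le x y) + (case p of (x, y) \<Rightarrow> ?gt x y))"
    by (intro integral_eqI) auto
  also have "\<dots> = (LINT p|(lborel \<Otimes>\<^sub>M lborel). (case p of (x, y) \<Rightarrow> ?le x y)) + (LINT p|(lborel \<Otimes>\<^sub>M lborel). (case p of (x, y) \<Rightarrow> ?gt x y))"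
    by (rule Bochner_Integration.integral_add[OF ile igt])
  also have "(LINT p|(lborel \<Otimes>\<^sub>M lborel). (case p of (x, y) \<Rightarrow> ?le x y)) = (LINT x|lborel. LINT y|lborel. ?le x y)"
    by (rule lborel_pair.integral_fst[OF ile, symmetric])
  also have "(LINT p|(lborel \<Otimes>\<^sub>M lborel). (case p of (x, y) \<Rightarrow> ?gt x y)) = (LINT y|lborel. LINT x|lborel. ?gt x y)"
    by (rule lborel_pair.integral_snd[OF igt, symmetric])
  finally have eq: "(U b - U a) * (V b - V a) = (LINT x:{a..b}|lborel. g x * (V x - V a)) + (LINT y:{a..b}|lborel. k y * (U y - U a))"
    unfolding le gt .
  have s1: "(LINT x:{a..b}|lborel. g x * (V x - V a)) = (LINT x:{a..b}|lborel. g x * V x) - V a * (U b - U a)"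
    using locally_integrableD[OF l1, of a b] locally_integrableD[OF lg, of a b] primitiveD[OF U ab]
    by (simp add: right_diff_distrib mult.commute[of "g _" "V a"])
  have s2: "(LINT y:{a..b}|lborel. k y * (U y - U a)) = (LINT x:{a..b}|lborel. U x * k x) - U a * (V b - V a)"
    using locally_integrableD[OF l2, of a b] locally_integrableD[OF lk, of a b] primitiveD[OF V ab]
    by (simp add: right_diff_distrib mult.commute[of "k _"])
  have "(LINT x:{a..b}|lborel. g x * V x + U x * k x) = (LINT x:{a..b}|lborel. g x * V x) + (LINT x:{a..b}|lborel. U x * k x)"
    by (rule set_integral_add) (rule locally_integrableD[OF l1], rule locally_integrableD[OF l2])
  then show "U b * V b - U a * V a = (LINT x:{a..b}|lborel. g x * V x + U x * k x)"
    using eq unfolding s1 s2 by (simp add: algebra_simps)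
qed

section \<open>Integrable primitives on the line\<close>

text \<open>The mass of an integrable function near \<open>h n\<close> tends to \<open>0\<close>, while its translates by \<open>h n\<close> tend to \<open>l\<close>.\<close>

lemma integrable_limit_at_infinity_eq_0:
  fixes U :: "real \<Rightarrow> real"
  assumes U: "integrable lborel U" and bd: "\<And>x. \<bar>U x\<bar> \<le> B"
    and h: "filterlim (\<lambda>n. \<bar>h n\<bar>) at_top sequentially" and lim: "\<And>x. (\<lambda>n. U (x + h n)) \<longlonglongrightarrow> l"
  shows "l = 0"
proof -
  note [measurable] = borel_measurable_integrable[OF U]
  let ?i = "\<lambda>x. indicator {0..1::real} x :: real"
  have ii: "integrable lborel (\<lambda>x. B * ?i x)"
    by (simp add: integrable_indicator_iff)
  have 1: "(\<lambda>n. LINT x|lborel. ?i x * U (x + h n)) \<longlonglongrightarrow> (LINT x|lborel. ?i x * l)"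
  proof (rule integral_dominated_convergence[OF _ _ ii])
    show "AE x in lborel. (\<lambda>n. ?i x * U (x + h n)) \<longlonglongrightarrow> ?i x * l"
      by (intro AE_I2 tendsto_mult tendsto_const lim)
    show "AE x in lborel. norm (?i x * U (x + h n)) \<le> B * ?i x" for n
      using bd[of "_ + h n"] by (intro AE_I2) (auto simp: indicator_def)
  qed measurable
  have 2: "(\<lambda>n. LINT x|lborel. ?i (x - h n) * U x) \<longlonglongrightarrow> (LINT x|(lborel::real measure). (0::real))"
  proof (rule integral_dominated_convergence)
    show "integrable lborel (\<lambda>x. \<bar>U x\<bar>)" using U by simp
    show "AE x in lborel. (\<lambda>n. ?i (x - h n) * U x) \<longlonglongrightarrow> 0"
    proof (rule AE_I2)
      fix x
      have "\<forall>\<^sub>F n in sequentially. \<bar>x\<bar> + 2 \<le> \<bar>h n\<bar>" using h by (simp add: filterlim_at_top)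
      then have "\<forall>\<^sub>F n in sequentially. ?i (x - h n) * U x = 0"
        by eventually_elim (auto simp: indicator_def)
      then show "(\<lambda>n. ?i (x - h n) * U x) \<longlonglongrightarrow> 0" by (rule tendsto_eventually)
    qed
    show "AE x in lborel. norm (?i (x - h n) * U x) \<le> \<bar>U x\<bar>" for n
      by (intro AE_I2) (auto simp: indicator_def)
  qed measurable
  have "(LINT x|lborel. ?i (x - h n) * U x) = (LINT x|lborel. ?i x * U (x + h n))" for n
    using translation_integral[of "\<lambda>x. ?i (x - h n) * U x" "h n"] by simp
  with 2 have "(\<lambda>n. LINT x|lborel. ?i x * U (x + h n)) \<longlonglongrightarrow> 0" by simp
  from LIMSEQ_unique[OF 1 this] show ?thesis by simp
qed

text \<open>An integrable absolutely continuous function with integrable derivative has limits at both ends, and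
  these can only be \<open>0\<close>.\<close>

lemma primitive_integrable:
  assumes U: "primitive U g" and iU: "integrable lborel U" and ig: "integrable lborel g"
  shows primitive_integrable_integral_eq_0: "(LINT x|lborel. g x) = 0"
    and primitive_integrable_bound: "\<And>x. \<bar>U x\<bar> \<le> (LINT x|lborel. \<bar>g x\<bar>)"
    and primitive_integrable_eq: "\<And>x. U x = (LINT y|lborel. indicator {..x} y * g y)"
proof -
  note [measurable] = borel_measurable_integrable[OF ig]
  define W where "W x = (LINT y|lborel. indicator {..x} y * g y)" for x
  have iW: "integrable lborel (\<lambda>y. indicator {..x} y * g y)" for x
    using integrable_mult_indicator[OF _ ig, of "{..x}"] by simp
  have W_bd: "\<bar>W x\<bar> \<le> (LINT x|lborel. \<bar>g x\<bar>)" for x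
  proof -
    have "\<bar>W x\<bar> \<le> (LINT y|lborel. \<bar>indicator {..x} y * g y\<bar>)"
      unfolding W_def using integral_norm_bound[of lborel "\<lambda>y. indicator {..x} y * g y"] by simp
    also have "\<dots> \<le> (LINT x|lborel. \<bar>g x\<bar>)"
      using iW[of x] ig by (intro integral_mono) (auto simp: indicator_def)
    finally show ?thesis .
  qed
  have diff: "U b - W b = U a - W a" if "a \<le> b" for a b
  proof -
    have "W b - W a = (LINT y|lborel. indicator {..b} y * g y - indicator {..a} y * g y)"
      unfolding W_def using iW by simp
    also have "\<dots> = (LINT y:{a..b}|lborel. g y)"
      unfolding set_lebesgue_integral_def
    proof (rule integral_cong_AE)
      show "AE y in lborel. indicator {..b} y * g y - indicator {..a} y * g y = indicator {a..b} y *\<^sub>R g y"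
        using AE_lborel_singleton[of a] by eventually_elim (use that in \<open>auto simp: indicator_def\<close>)
    qed measurable
    finally show ?thesis using primitiveD[OF U that] by simp
  qed
  define c where "c = U 0 - W 0"
  have UW: "U x = c + W x" for x
    using diff[of 0 x] diff[of x 0] by (cases "0 \<le> x") (auto simp: c_def)
  have U_bd: "\<bar>U x\<bar> \<le> \<bar>c\<bar> + (LINT x|lborel. \<bar>g x\<bar>)" for x
    unfolding UW using W_bd[of x] by linarith
  have Wlim: "(\<lambda>n. W (x + h n)) \<longlonglongrightarrow> (LINT y|lborel. l * g y)"
    if "\<And>y. \<forall>\<^sub>F n in sequentially. indicator {..x + h n} y = l" for x l and h :: "nat \<Rightarrow> real"
    unfolding W_def
  proof (rule integral_dominated_convergence)
    show "integrable lborel (\<lambda>x. \<bar>g x\<bar>)" using ig by simp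
    show "AE y in lborel. (\<lambda>n. indicator {..x + h n} y * g y) \<longlonglongrightarrow> l * g y"
      by (intro AE_I2 tendsto_mult tendsto_const tendsto_eventually that)
    show "AE y in lborel. norm (indicator {..x + h n} y * g y) \<le> \<bar>g y\<bar>" for n
      by (intro AE_I2) (auto simp: indicator_def)
  qed measurable
  have "c = 0"
  proof (rule integrable_limit_at_infinity_eq_0[OF iU U_bd])
    show "filterlim (\<lambda>n. \<bar>- real n\<bar>) at_top sequentially" by (simp add: filterlim_real_sequentially)
    fix x
    have "(\<lambda>n. W (x + - real n)) \<longlonglongrightarrow> (LINT y|lborel. 0 * g y)"
    proof (rule Wlim)
      fix y
      have "\<forall>\<^sub>F n in sequentially. x - y < real n"
        using filterlim_real_sequentially by (simp add: filterlim_at_top_dense)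
      then show "\<forall>\<^sub>F n in sequentially. indicator {..x + - real n} y = (0::real)"
        by eventually_elim (auto simp: indicator_def)
    qed
    then show "(\<lambda>n. U (x + - real n)) \<longlonglongrightarrow> c"
      unfolding UW using tendsto_add[OF tendsto_const[of c]] by fastforce
  qed
  have "c + (LINT y|lborel. g y) = 0"
  proof (rule integrable_limit_at_infinity_eq_0[OF iU U_bd])
    show "filterlim (\<lambda>n. \<bar>real n\<bar>) at_top sequentially" by (simp add: filterlim_real_sequentially)
    fix x
    have "(\<lambda>n. W (x + real n)) \<longlonglongrightarrow> (LINT y|lborel. 1 * g y)"
    proof (rule Wlim)
      fix y
      have "\<forall>\<^sub>F n in sequentially. y - x < real n"
        using filterlim_real_sequentially by (simp add: filterlim_at_top_dense)
      then show "\<forall>\<^sub>F n in sequentially. indicator {..x + real n} y = (1::real)"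
        by eventually_elim (auto simp: indicator_def)
    qed
    then show "(\<lambda>n. U (x + real n)) \<longlonglongrightarrow> c + (LINT y|lborel. g y)"
      unfolding UW by (intro tendsto_add tendsto_const) simp
  qed
  with \<open>c = 0\<close> show "(LINT x|lborel. g x) = 0" by simp
  show "\<bar>U x\<bar> \<le> (LINT x|lborel. \<bar>g x\<bar>)" for x using W_bd[of x] UW[of x] \<open>c = 0\<close> by simp
  show "U x = (LINT y|lborel. indicator {..x} y * g y)" for x using UW[of x] \<open>c = 0\<close> by (simp add: W_def)
qed

section \<open>Test functions\<close>

definition smooth :: "(real \<Rightarrow> real) \<Rightarrow> bool" where
  "smooth f \<longleftrightarrow> (\<forall>n x. (deriv ^^ n) f differentiable (at x))"

lemma smoothD: "smooth f \<Longrightarrow> (f has_real_derivative deriv f x) (at x)"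
  unfolding smooth_def by (metis funpow_0 DERIV_deriv_iff_real_differentiable)

lemma smooth_deriv: "smooth f \<Longrightarrow> smooth (deriv f)"
  unfolding smooth_def by (metis funpow_Suc_right comp_apply)

lemma smooth_antiderivative:
  assumes D: "\<And>x. (f has_real_derivative f' x) (at x)" and s: "smooth f'"
  shows "smooth f"
  unfolding smooth_def
proof (intro allI)
  fix n x
  have d: "deriv f = f'" using D by (intro ext DERIV_imp_deriv)
  show "(deriv ^^ n) f differentiable (at x)"
  proof (cases n)
    case 0 then show ?thesis using D real_differentiable_def by auto
  next
    case (Suc m)
    then have "(deriv ^^ n) f = (deriv ^^ m) f'" by (simp add: funpow_Suc_right d del: funpow.simps)
    then show ?thesis using s by (simp add: smooth_def)
  qed
qed

text \<open>Smoothness without computing higher derivatives: it is enough to exhibit a class of functions that is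
  stable under differentiation.\<close>

lemma smooth_class:
  assumes "P f" and step: "\<And>f. P f \<Longrightarrow> \<exists>f'. P f' \<and> (\<forall>x. (f has_real_derivative f' x) (at x))"
  shows "smooth f"
proof -
  have "\<forall>f. P f \<longrightarrow> (\<forall>x. (deriv ^^ n) f differentiable (at x))" for n
  proof (induction n)
    case 0 show ?case using step real_differentiable_def by fastforce
  next
    case (Suc n)
    show ?case
    proof (intro allI impI)
      fix f x assume "P f"
      from step[OF this] obtain f' where f': "P f'" "\<And>x. (f has_real_derivative f' x) (at x)" by blast
      have "deriv f = f'" using f'(2) by (intro ext DERIV_imp_deriv)
      then have "(deriv ^^ Suc n) f = (deriv ^^ n) f'" by (simp add: funpow_Suc_right del: funpow.simps)
      then show "(deriv ^^ Suc n) f differentiable (at x)" using Suc f'(1) by simp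
    qed
  qed
  then show ?thesis using \<open>P f\<close> by (simp add: smooth_def)
qed

text \<open>The functions \<open>p(1/y) exp (-1/y)\<close>, extended by \<open>0\<close>. Polynomials in \<open>1/y\<close> are admitted because derivatives of
  \<open>exp (-1/y)\<close> have this form.\<close>

definition flat :: "real poly \<Rightarrow> real \<Rightarrow> real" where
  "flat p y = (if 0 < y then poly p (1 / y) * exp (- (1 / y)) else 0)"

lemma poly_mult_power_div_exp_tendsto_0: "((\<lambda>z::real. z ^ k * poly p z / exp z) \<longlongrightarrow> 0) at_top"
proof (induction p arbitrary: k)
  case 0 then show ?case by simp
next
  case (pCons a p)
  have "((\<lambda>z. a * (z ^ k / exp z) + z ^ Suc k * poly p z / exp z) \<longlongrightarrow> a * 0 + 0) at_top"
    by (intro tendsto_add tendsto_mult tendsto_const tendsto_power_div_exp_0 pCons.IH)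
  moreover have "z ^ k * poly (pCons a p) z / exp z = a * (z ^ k / exp z) + z ^ Suc k * poly p z / exp z" for z :: real
    by (simp add: field_simps)
  ultimately show ?case by simp
qed

lemma flat_smult: "flat (smult c p) y = c * flat p y"
  by (simp add: flat_def)

lemma flat_has_derivative:
  "(flat p has_real_derivative flat ([:0, 0, 1:] * (p - pderiv p)) y) (at y)"
proof -
  consider "0 < y" | "y < 0" | "y = 0" by linarith
  then show ?thesis
  proof cases
    case 1
    have "((\<lambda>y. poly p (1 / y) * exp (- (1 / y))) has_real_derivative
        poly (pderiv p) (1 / y) * (- (1 / y\<^sup>2)) * exp (- (1 / y)) + poly p (1 / y) * (exp (- (1 / y)) * (1 / y\<^sup>2))) (at y)"
      using 1 by (auto intro!: derivative_eq_intros DERIV_chain2[OF poly_DERIV] simp: power2_eq_square field_simps)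
    moreover have "poly (pderiv p) (1 / y) * (- (1 / y\<^sup>2)) * exp (- (1 / y)) + poly p (1 / y) * (exp (- (1 / y)) * (1 / y\<^sup>2))
      = flat ([:0, 0, 1:] * (p - pderiv p)) y"
      using 1 by (simp add: flat_def power2_eq_square field_simps)
    ultimately have d: "((\<lambda>y. poly p (1 / y) * exp (- (1 / y))) has_real_derivative flat ([:0, 0, 1:] * (p - pderiv p)) y) (at y)"
      by (simp only:)
    show ?thesis
    proof (rule has_field_derivative_transform_within_open[OF d])
      show "open ({0<..} :: real set)" by (rule open_greaterThan)
      show "y \<in> {0<..}" using 1 by simp
      show "poly p (1 / x) * exp (- (1 / x)) = flat p x" if "x \<in> {0<..}" for x
        using that by (simp only: flat_def greaterThan_iff if_True)
    qed
  next
    case 2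
    then have "flat ([:0, 0, 1:] * (p - pderiv p)) y = 0" by (simp only: flat_def) simp
    then have d: "((\<lambda>y. 0) has_real_derivative flat ([:0, 0, 1:] * (p - pderiv p)) y) (at y)"
      by (simp only: DERIV_const)
    show ?thesis
    proof (rule has_field_derivative_transform_within_open[OF d])
      show "open ({..<0} :: real set)" by (rule open_lessThan)
      show "y \<in> {..<0}" using 2 by simp
      show "0 = flat p x" if "x \<in> {..<0}" for x
        using that by (simp add: flat_def)
    qed
  next
    case 3
    have "((\<lambda>h. flat p h / h) \<longlongrightarrow> 0) (at 0)"
      unfolding filterlim_at_split
    proof
      have "\<forall>\<^sub>F h in at_left 0. flat p h / h = (0::real)"
      proof -
        have "\<forall>\<^sub>F h in at_left 0. h \<in> {-1<..<0::real}" by (rule eventually_at_left_real) simp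
        then show ?thesis by eventually_elim (simp add: flat_def)
      qed
      then show "((\<lambda>h. flat p h / h) \<longlongrightarrow> 0) (at_left 0)" by (rule tendsto_eventually)
      have "((\<lambda>h::real. inverse h ^ 1 * poly p (inverse h) / exp (inverse h)) \<longlongrightarrow> 0) (at_right 0)"
        by (rule filterlim_compose[OF poly_mult_power_div_exp_tendsto_0 filterlim_inverse_at_top_right])
      moreover have "\<forall>\<^sub>F h in at_right 0. inverse h ^ 1 * poly p (inverse h) / exp (inverse h) = flat p h / (h::real)"
      proof -
        have "\<forall>\<^sub>F h in at_right 0. h \<in> {0<..<1::real}" by (rule eventually_at_right_real) simp
        then show ?thesis by eventually_elim (simp add: flat_def exp_minus field_simps)
      qed
      ultimately show "((\<lambda>h. flat p h / h) \<longlongrightarrow> 0) (at_right 0)" by (rule Lim_transform_eventually)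
    qed
    then show ?thesis using 3 by (simp add: has_field_derivative_iff flat_def)
  qed
qed

text \<open>The class is closed under differentiation, which is what makes its members smooth.\<close>

inductive flat_algebra :: "(real \<Rightarrow> real) \<Rightarrow> bool" where
  base: "flat_algebra (\<lambda>x. flat p (s * x + t))"
| add: "flat_algebra f \<Longrightarrow> flat_algebra g \<Longrightarrow> flat_algebra (\<lambda>x. f x + g x)"
| mult: "flat_algebra f \<Longrightarrow> flat_algebra g \<Longrightarrow> flat_algebra (\<lambda>x. f x * g x)"

lemma flat_algebra_smooth: "flat_algebra f \<Longrightarrow> smooth f"
proof (erule smooth_class)
  fix f assume "flat_algebra f"
  then show "\<exists>f'. flat_algebra f' \<and> (\<forall>x. (f has_real_derivative f' x) (at x))"
  proof induction
    case (base p s t)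
    let ?q = "smult s ([:0, 0, 1:] * (p - pderiv p))"
    have "((\<lambda>x. flat p (s * x + t)) has_real_derivative flat ?q (s * x + t)) (at x)" for x
    proof -
      have "((\<lambda>x. s * x + t) has_real_derivative s) (at x)" by (auto intro!: derivative_eq_intros)
      from DERIV_chain2[OF flat_has_derivative this]
      show ?thesis by (simp only: flat_smult mult.commute)
    qed
    then show ?case using flat_algebra.base[of ?q s t] by blast
  next
    case (add f g)
    then obtain f' g' where *: "flat_algebra f'" "flat_algebra g'" "\<And>x. (f has_real_derivative f' x) (at x)"
      "\<And>x. (g has_real_derivative g' x) (at x)" by blast
    then show ?case
      by (intro exI[of _ "\<lambda>x. f' x + g' x"]) (auto intro: flat_algebra.add DERIV_add)
  next
    case (mult f g)
    then obtain f' g' where *: "flat_algebra f'" "flat_algebra g'" "\<And>x. (f has_real_derivative f' x) (at x)"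
      "\<And>x. (g has_real_derivative g' x) (at x)" by blast
    have "flat_algebra (\<lambda>x. f' x * g x + g' x * f x)"
      using * mult.hyps by (intro flat_algebra.add flat_algebra.mult)
    then show ?case using DERIV_mult[OF *(3,4)] by blast
  qed
qed

text \<open>Vanishes outside \<open>{a<..<b}\<close> and tends to \<open>1\<close> inside as \<open>n\<close> grows, because \<open>exp (-1/y)\<close> does so as \<open>y\<close> tends
  to infinity.\<close>

definition bump :: "real \<Rightarrow> real \<Rightarrow> nat \<Rightarrow> real \<Rightarrow> real" where
  "bump a b n x = flat 1 (real (Suc n) * x + - (real (Suc n) * a)) * flat 1 (- real (Suc n) * x + real (Suc n) * b)"

lemma bump_smooth: "smooth (bump a b n)"
  unfolding bump_def[abs_def] by (intro flat_algebra_smooth flat_algebra.intros)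

lemma bump_eq: "bump a b n x = (if a < x \<and> x < b then exp (- (1 / (real (Suc n) * (x - a)))) * exp (- (1 / (real (Suc n) * (b - x)))) else 0)"
proof -
  have "real (Suc n) * x + - (real (Suc n) * a) = real (Suc n) * (x - a)"
    "- real (Suc n) * x + real (Suc n) * b = real (Suc n) * (b - x)" by (simp_all add: algebra_simps)
  then show ?thesis by (simp add: bump_def flat_def zero_less_mult_iff)
qed

lemma bump_bounds: "0 \<le> bump a b n x" "bump a b n x \<le> 1"
  by (auto simp: bump_eq intro!: mult_le_one)

lemma bump_tendsto: "(\<lambda>n. bump a b n x) \<longlonglongrightarrow> indicator {a<..<b} x"
proof (cases "a < x \<and> x < b")
  case True
  have l: "(\<lambda>n. 1 / (real (Suc n) * c)) \<longlonglongrightarrow> 0" for c :: real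
    using tendsto_mult[OF LIMSEQ_Suc[OF lim_1_over_n] tendsto_const[of "1/c"]] by simp
  have "(\<lambda>n. exp (- (1 / (real (Suc n) * (x - a)))) * exp (- (1 / (real (Suc n) * (b - x))))) \<longlonglongrightarrow> exp (- 0) * exp (- 0)"
    by (intro tendsto_mult tendsto_exp tendsto_minus l)
  then show ?thesis using True by (simp add: bump_eq)
next
  case False
  then show ?thesis by (auto simp: bump_eq)
qed

lemma test_function_smooth: "test_function \<psi> \<longleftrightarrow> smooth \<psi> \<and> (\<exists>R. \<forall>x. \<bar>x\<bar> > R \<longrightarrow> \<psi> x = 0)"
  by (simp add: test_function_def smooth_def)

lemma bump_test_function: "test_function (bump a b n)"
  unfolding test_function_smooth
  by (auto intro!: bump_smooth exI[of _ "\<bar>a\<bar> + \<bar>b\<bar>"] simp: bump_eq)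

lemma smooth_continuous: "smooth f \<Longrightarrow> continuous_on UNIV f"
  by (auto intro!: continuous_at_imp_continuous_on DERIV_isCont smoothD)

lemma deriv_eq_0_outside:
  assumes R: "\<And>x. \<bar>x\<bar> > R \<Longrightarrow> \<psi> x = 0" and x: "\<bar>x\<bar> > R"
  shows "deriv \<psi> x = (0::real)"
proof (rule DERIV_imp_deriv, rule has_field_derivative_transform_within_open[OF DERIV_const])
  show "open {y. R < \<bar>y\<bar>}" by (intro open_Collect_less continuous_intros)
  show "x \<in> {y. R < \<bar>y\<bar>}" using x by simp
  show "0 = \<psi> y" if "y \<in> {y. R < \<bar>y\<bar>}" for y using R that by simp
qed

section \<open>Weak derivatives and primitives\<close>

text \<open>The product rule for \<open>U \<psi>\<close>, integrated over an interval at whose ends \<open>\<psi>\<close> vanishes.\<close>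

lemma primitive_has_weak_deriv:
  assumes U: "primitive U g"
  shows "has_weak_deriv U g"
  unfolding has_weak_deriv_def
proof (intro conjI allI impI)
  show "locally_integrable U" by (rule locally_integrable_continuous[OF primitive_continuous[OF U]])
  show "locally_integrable g" by (rule primitive_locally_integrable[OF U])
  fix \<psi> assume "test_function \<psi>"
  then obtain R where s: "smooth \<psi>" and R: "\<And>x. \<bar>x\<bar> > R \<Longrightarrow> \<psi> x = 0"
    unfolding test_function_smooth by blast
  have P\<psi>: "primitive \<psi> (deriv \<psi>)"
    by (rule primitive_C1[OF smoothD[OF s] smooth_continuous[OF smooth_deriv[OF s]]])
  note P = primitive_mult[OF U P\<psi>]
  define S where "S = \<bar>R\<bar> + 1"
  note d0 = deriv_eq_0_outside[of R \<psi>, OF R]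
  have out: "x \<notin> {-S..S} \<Longrightarrow> R < \<bar>x\<bar>" for x by (auto simp: S_def)
  have eq: "(LINT x|lborel. f x * \<kappa> x) = (LINT x:{-S..S}|lborel. f x * \<kappa> x)"
    if "\<And>x. \<bar>x\<bar> > R \<Longrightarrow> \<kappa> x = 0" for f \<kappa> :: "real \<Rightarrow> real"
    unfolding set_lebesgue_integral_def
  proof (intro integral_eqI)
    fix x
    show "f x * \<kappa> x = indicator {-S..S} x *\<^sub>R (f x * \<kappa> x)"
      using that[OF out, of x] by (cases "x \<in> {-S..S}") simp_all
  qed
  have l1: "locally_integrable (\<lambda>x. g x * \<psi> x)"
    by (rule locally_integrable_mult_continuous[OF primitive_locally_integrable[OF U] smooth_continuous[OF s]])
  have l2: "locally_integrable (\<lambda>x. U x * deriv \<psi> x)"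
    by (rule locally_integrable_mult_continuous[OF locally_integrable_continuous[OF primitive_continuous[OF U]]
          smooth_continuous[OF smooth_deriv[OF s]]])
  have "(LINT x:{-S..S}|lborel. g x * \<psi> x) + (LINT x:{-S..S}|lborel. U x * deriv \<psi> x)
      = (LINT x:{-S..S}|lborel. g x * \<psi> x + U x * deriv \<psi> x)"
    by (rule set_integral_add(2)[symmetric]) (rule locally_integrableD[OF l1], rule locally_integrableD[OF l2])
  also have "\<dots> = U S * \<psi> S - U (-S) * \<psi> (-S)"
    by (rule primitiveD[OF P]) (simp add: S_def)
  also have "\<dots> = 0" using R[of S] R[of "-S"] by (simp add: S_def)
  finally show "(LINT x|lborel. U x * deriv \<psi> x) = - (LINT x|lborel. g x * \<psi> x)"
    using eq[where f=U and \<kappa>="deriv \<psi>", OF d0] eq[where f=g and \<kappa>=\<psi>, OF R] by simp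
qed

lemma has_weak_deriv_cong_AE:
  assumes w: "has_weak_deriv f g" and AE: "AE x in lborel. f x = f' x" "AE x in lborel. g x = g' x"
    and [measurable]: "f' \<in> borel_measurable borel" "g' \<in> borel_measurable borel"
  shows "has_weak_deriv f' g'"
proof -
  have li: "locally_integrable f" "locally_integrable g" using w by (simp_all add: has_weak_deriv_def)
  note [measurable] = li[THEN locally_integrable_measurable]
  have li': "locally_integrable k'" if "locally_integrable k" "AE x in lborel. k x = k' x" "k' \<in> borel_measurable borel" for k k' :: "real \<Rightarrow> real"
    unfolding locally_integrable_def set_integrable_def
  proof (intro allI)
    fix a b
    note [measurable] = that(3) locally_integrable_measurable[OF that(1)]
    show "integrable lborel (\<lambda>x. indicator {a..b} x *\<^sub>R k' x)"
      using locally_integrableD[OF that(1), of a b] unfolding set_integrable_def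
      by (rule integrable_cong_AE_imp) (measurable, use that(2) in eventually_elim, simp)
  qed
  have "(LINT x|lborel. k x * \<kappa> x) = (LINT x|lborel. k' x * \<kappa> x)"
    if "AE x in lborel. k x = k' x" "k \<in> borel_measurable borel" "k' \<in> borel_measurable borel" "continuous_on UNIV \<kappa>"
    for k k' \<kappa> :: "real \<Rightarrow> real"
  proof (rule integral_cong_AE)
    note [measurable] = that(2,3) borel_measurable_continuous_onI[OF that(4)]
    show "(\<lambda>x. k x * \<kappa> x) \<in> borel_measurable lborel" "(\<lambda>x. k' x * \<kappa> x) \<in> borel_measurable lborel" by measurable
    show "AE x in lborel. k x * \<kappa> x = k' x * \<kappa> x" using that(1) by eventually_elim simp
  qed
  note eq = this[OF AE(1)] this[OF AE(2)]
  show ?thesis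
    unfolding has_weak_deriv_def
  proof (intro conjI allI impI)
    show "locally_integrable f'" "locally_integrable g'"
      using li'[OF li(1) AE(1)] li'[OF li(2) AE(2)] by simp_all
    fix \<psi> assume t: "test_function \<psi>"
    then have s: "smooth \<psi>" by (simp add: test_function_smooth)
    have "(LINT x|lborel. f x * deriv \<psi> x) = - (LINT x|lborel. g x * \<psi> x)"
      using w t by (simp add: has_weak_deriv_def)
    then show "(LINT x|lborel. f' x * deriv \<psi> x) = - (LINT x|lborel. g' x * \<psi> x)"
      using eq(1)[OF _ _ smooth_continuous[OF smooth_deriv[OF s]]] eq(2)[OF _ _ smooth_continuous[OF s]] by simp
  qed
qed

lemma smooth_cmult: "smooth f \<Longrightarrow> smooth (\<lambda>x. c * f x)"
proof (rule smooth_class[where P = "\<lambda>h. \<exists>f. smooth f \<and> h = (\<lambda>x. c * f x)"])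
  fix h assume "\<exists>f. smooth f \<and> h = (\<lambda>x. c * f x)"
  then obtain f where f: "smooth f" "h = (\<lambda>x. c * f x)" by blast
  show "\<exists>h'. (\<exists>f. smooth f \<and> h' = (\<lambda>x. c * f x)) \<and> (\<forall>x. (h has_real_derivative h' x) (at x))"
    using smooth_deriv[OF f(1)] DERIV_cmult[OF smoothD[OF f(1)], of c] f(2) by blast
qed blast

lemma smooth_diff: "smooth f \<Longrightarrow> smooth g \<Longrightarrow> smooth (\<lambda>x. f x - g x)"
proof (rule smooth_class[where P = "\<lambda>h. \<exists>f g. smooth f \<and> smooth g \<and> h = (\<lambda>x. f x - g x)"])
  fix h assume "\<exists>f g. smooth f \<and> smooth g \<and> h = (\<lambda>x. f x - g x)"
  then obtain f g where f: "smooth f" "smooth g" "h = (\<lambda>x. f x - g x)" by blast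
  show "\<exists>h'. (\<exists>f g. smooth f \<and> smooth g \<and> h' = (\<lambda>x. f x - g x)) \<and> (\<forall>x. (h has_real_derivative h' x) (at x))"
    using smooth_deriv[OF f(1)] smooth_deriv[OF f(2)] DERIV_diff[OF smoothD[OF f(1)] smoothD[OF f(2)]] f(3) by blast
qed blast

text \<open>The primitive that vanishes to the left of the support is constant to its right, with value the integral.\<close>

lemma test_function_antiderivative:
  assumes s: "smooth \<kappa>" and R: "\<And>x. \<bar>x\<bar> > R \<Longrightarrow> \<kappa> x = 0" and I: "(LINT x|lborel. \<kappa> x) = 0"
  obtains \<psi> where "test_function \<psi>" "deriv \<psi> = \<kappa>"
proof -
  define S where "S = \<bar>R\<bar> + 1"
  have S: "R < S" "0 < S" by (auto simp: S_def)
  note c = smooth_continuous[OF s]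
  define \<psi> where "\<psi> x = integral {-S..x} \<kappa>" for x
  have eq: "\<psi> x = (LINT y:{-S..x}|lborel. \<kappa> y)" for x
    unfolding \<psi>_def by (rule set_borel_integral_eq_integral(2)[symmetric]) (rule locally_integrableD[OF locally_integrable_continuous[OF c]])
  have left: "\<psi> x = 0" if "x < - \<bar>R\<bar>" for x
  proof -
    have "\<psi> x = (LINT y|(lborel::real measure). 0)"
      unfolding eq set_lebesgue_integral_def
      by (rule Bochner_Integration.integral_cong[OF refl]) (use that in \<open>auto simp: indicator_def intro!: R\<close>)
    then show ?thesis by simp
  qed
  have right: "\<psi> x = 0" if "x > S" for x
  proof -
    have "\<psi> x = (LINT y|lborel. \<kappa> y)"
      unfolding eq set_lebesgue_integral_def
    proof (intro integral_eqI)
      fix y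
      show "indicator {-S..x} y *\<^sub>R \<kappa> y = \<kappa> y"
        using R[of y] that S by (cases "y \<in> {-S..x}") (auto simp: indicator_def)
    qed
    then show ?thesis using I by simp
  qed
  have D: "(\<psi> has_real_derivative \<kappa> x) (at x)" for x
  proof (cases "x < - \<bar>R\<bar>")
    case True
    have "(\<psi> has_real_derivative 0) (at x)"
    proof (rule has_field_derivative_transform_within_open[OF DERIV_const])
      show "open {..< - \<bar>R\<bar>}" by (rule open_lessThan)
      show "x \<in> {..< - \<bar>R\<bar>}" using True by simp
      show "0 = \<psi> y" if "y \<in> {..< - \<bar>R\<bar>}" for y using left that by simp
    qed
    moreover have "\<kappa> x = 0" using True by (intro R) auto
    ultimately show ?thesis by simp
  next
    case False
    then have x: "-S < x" by (simp add: S_def)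
    have "((\<lambda>y. integral {-S..y} \<kappa>) has_real_derivative \<kappa> x) (at x within {-S..x+1})"
      by (rule integral_has_real_derivative[OF continuous_on_subset[OF c]]) (use x in auto)
    moreover have "at x within {-S..x+1} = at x"
      by (rule at_within_interior) (use x in auto)
    ultimately show ?thesis unfolding \<psi>_def[abs_def] by simp
  qed
  show ?thesis
  proof (rule that)
    show "deriv \<psi> = \<kappa>" using D by (intro ext DERIV_imp_deriv)
    show "test_function \<psi>"
      unfolding test_function_smooth
    proof (intro conjI exI allI impI)
      show "smooth \<psi>" by (rule smooth_antiderivative[OF D s])
      fix x assume "\<bar>x\<bar> > S"
      then consider "x < - \<bar>R\<bar>" | "x > S" unfolding S_def by linarith
      then show "\<psi> x = 0" by cases (rule left, assumption, rule right, assumption)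
    qed
  qed
qed

lemma test_function_mult_integrable:
  assumes u: "locally_integrable u" and t: "continuous_on UNIV \<kappa>" and R: "\<And>x. \<bar>x\<bar> > R \<Longrightarrow> \<kappa> x = 0"
  shows "integrable lborel (\<lambda>x. u x * \<kappa> x)"
proof -
  have "set_integrable lborel {-R..R} (\<lambda>x. u x * \<kappa> x)"
    by (rule locally_integrableD[OF locally_integrable_mult_continuous[OF u t]])
  moreover have "indicator {-R..R} x *\<^sub>R (u x * \<kappa> x) = u x * \<kappa> x" for x
  proof (cases "R < \<bar>x\<bar>")
    case False
    then have "x \<in> {-R..R}" unfolding atLeastAtMost_iff by linarith
    then show ?thesis by simp
  qed (simp add: R)
  ultimately show ?thesis unfolding set_integrable_def by (simp only:)
qed

text \<open>Bump functions approximate indicators of intervals boundedly, so all integrals over intervals vanish.\<close>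

lemma integral_zero_of_test_functions:
  assumes u: "locally_integrable u" and Z: "\<And>\<eta>. test_function \<eta> \<Longrightarrow> (LINT x|lborel. u x * \<eta> x) = 0"
  shows "AE x in lborel. u x = 0"
proof (rule locally_integrable_eq_0[OF u])
  fix a b :: real
  assume "a \<le> b"
  note [measurable] = locally_integrable_measurable[OF u]
  have mb [measurable]: "bump a b n \<in> borel_measurable borel" for n
    by (rule borel_measurable_continuous_onI[OF smooth_continuous[OF bump_smooth]])
  have "(\<lambda>n. LINT x|lborel. u x * bump a b n x) \<longlonglongrightarrow> (LINT x|lborel. u x * indicator {a<..<b} x)"
  proof (rule integral_dominated_convergence)
    show "integrable lborel (\<lambda>x. \<bar>indicator {a..b} x *\<^sub>R u x\<bar>)"
      using locally_integrableD[OF u, of a b] unfolding set_integrable_def by (rule integrable_abs)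
    show "AE x in lborel. (\<lambda>n. u x * bump a b n x) \<longlonglongrightarrow> u x * indicator {a<..<b} x"
      by (intro AE_I2 tendsto_mult tendsto_const bump_tendsto)
    show "AE x in lborel. norm (u x * bump a b n x) \<le> \<bar>indicator {a..b} x *\<^sub>R u x\<bar>" for n
    proof (rule AE_I2)
      fix x
      show "norm (u x * bump a b n x) \<le> \<bar>indicator {a..b} x *\<^sub>R u x\<bar>"
      proof (cases "a < x \<and> x < b")
        case True
        then show ?thesis using mult_left_mono[OF bump_bounds(2)[of a b n x] abs_ge_zero[of "u x"]] bump_bounds(1)[of a b n x]
          by (simp add: abs_mult indicator_def)
      next
        case False
        then have "bump a b n x = 0" by (auto simp: bump_eq)
        then show ?thesis by simp
      qed
    qed
  qed measurable
  then have "(LINT x|lborel. u x * indicator {a<..<b} x) = 0"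
    using Z[OF bump_test_function] LIMSEQ_unique[OF _ tendsto_const] by simp
  moreover have "(LINT x:{a..b}|lborel. u x) = (LINT x|lborel. u x * indicator {a<..<b} x)"
    unfolding set_lebesgue_integral_def
  proof (rule integral_cong_AE)
    show "AE x in lborel. indicator {a..b} x *\<^sub>R u x = u x * indicator {a<..<b} x"
      using AE_lborel_singleton[of a] AE_lborel_singleton[of b]
      by eventually_elim (auto simp: indicator_def)
  qed measurable
  ultimately show "(LINT x:{a..b}|lborel. u x) = 0" by simp
qed

text \<open>An arbitrary test function minus a multiple of a fixed bump has mean zero, hence is the derivative of a
  test function; this tests \<open>u\<close> minus a constant against everything.\<close>

lemma du_Bois_Reymond:
  assumes u: "locally_integrable u" and Z: "\<And>\<psi>. test_function \<psi> \<Longrightarrow> (LINT x|lborel. u x * deriv \<psi> x) = 0"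
  obtains c where "AE x in lborel. u x = c"
proof -
  let ?b = "bump 0 1 0"
  have tI: "integrable lborel \<eta>" if t: "test_function \<eta>" for \<eta>
  proof -
    from t obtain R where s: "smooth \<eta>" and R: "\<And>x. \<bar>x\<bar> > R \<Longrightarrow> \<eta> x = 0" unfolding test_function_smooth by blast
    show ?thesis
      using test_function_mult_integrable[OF locally_integrable_continuous[OF continuous_on_const[of UNIV 1]] smooth_continuous[OF s] R]
      by simp
  qed
  have tuI: "integrable lborel (\<lambda>x. u x * \<eta> x)" if t: "test_function \<eta>" for \<eta>
  proof -
    from t obtain R where s: "smooth \<eta>" and R: "\<And>x. \<bar>x\<bar> > R \<Longrightarrow> \<eta> x = 0" unfolding test_function_smooth by blast
    show ?thesis by (rule test_function_mult_integrable[OF u smooth_continuous[OF s] R])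
  qed
  note tb = bump_test_function[of 0 1 0]
  define J where "J = (LINT x|lborel. ?b x)"
  have "J \<noteq> 0"
  proof
    assume "J = 0"
    then have "AE x in lborel. ?b x = 0"
      unfolding J_def by (subst (asm) integral_nonneg_eq_0_iff_AE) (use tI[OF tb] bump_bounds in auto)
    then have "AE x in lborel. x \<notin> {0<..<1::real}"
      by eventually_elim (auto simp: bump_eq)
    then have "emeasure lborel {0<..<1::real} = 0"
      by (subst (asm) AE_iff_measurable[of "{0<..<1}"]) auto
    then show False by simp
  qed
  define c where "c = (LINT x|lborel. u x * ?b x) / J"
  have "AE x in lborel. u x - c = 0"
  proof (rule integral_zero_of_test_functions)
    show "locally_integrable (\<lambda>x. u x - c)"
      using locally_integrable_add[OF u locally_integrable_continuous[of "\<lambda>_. - c"]] by simp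
    fix \<eta> assume t: "test_function \<eta>"
    define K where "K = (LINT x|lborel. \<eta> x)"
    let ?\<kappa> = "\<lambda>x. \<eta> x - K / J * ?b x"
    from t obtain R1 where R1: "smooth \<eta>" "\<And>x. \<bar>x\<bar> > R1 \<Longrightarrow> \<eta> x = 0" unfolding test_function_smooth by blast
    from tb obtain R2 where R2: "\<And>x. \<bar>x\<bar> > R2 \<Longrightarrow> ?b x = 0" unfolding test_function_smooth by blast
    have sk: "smooth ?\<kappa>" by (intro smooth_diff smooth_cmult bump_smooth R1)
    have Rk: "?\<kappa> x = 0" if "\<bar>x\<bar> > max R1 R2" for x using R1(2)[of x] R2[of x] that by simp
    have Ik: "(LINT x|lborel. ?\<kappa> x) = 0"
      using tI[OF t] tI[OF tb] \<open>J \<noteq> 0\<close> by (simp add: K_def[symmetric] J_def[symmetric])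
    obtain \<psi> where \<psi>: "test_function \<psi>" "deriv \<psi> = ?\<kappa>"
      by (rule test_function_antiderivative[OF sk Rk Ik])
    have "0 = (LINT x|lborel. u x * ?\<kappa> x)" using Z[OF \<psi>(1)] \<psi>(2) by simp
    also have "\<dots> = (LINT x|lborel. u x * \<eta> x - K / J * (u x * ?b x))"
      by (intro integral_eqI) (simp add: algebra_simps)
    also have "\<dots> = (LINT x|lborel. u x * \<eta> x) - c * K"
      using tuI[OF t] tuI[OF tb] by (simp add: c_def)
    also have "\<dots> = (LINT x|lborel. (u x - c) * \<eta> x)"
      using tuI[OF t] tI[OF t] by (simp add: left_diff_distrib K_def)
    finally show "(LINT x|lborel. (u x - c) * \<eta> x) = 0" by simp
  qed
  then have "AE x in lborel. u x = c" by simp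
  then show ?thesis by (rule that)
qed

lemma primitive_exists:
  assumes g: "locally_integrable g"
  shows "\<exists>P. primitive P g"
proof -
  define P where "P x = (LINT y:{0..x}|lborel. g y) - (LINT y:{x..0}|lborel. g y)" for x
  note [measurable] = locally_integrable_measurable[OF g]
  have split: "(LINT y:{a..c}|lborel. g y) = (LINT y:{a..b}|lborel. g y) + (LINT y:{b..c}|lborel. g y)"
    if "a \<le> b" "b \<le> c" for a b c
  proof -
    have "(LINT y:{a..c}|lborel. g y) = (LINT y|lborel. indicator {a..b} y *\<^sub>R g y + indicator {b..c} y *\<^sub>R g y)"
      unfolding set_lebesgue_integral_def
    proof (rule integral_cong_AE)
      show "AE y in lborel. indicator {a..c} y *\<^sub>R g y = indicator {a..b} y *\<^sub>R g y + indicator {b..c} y *\<^sub>R g y"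
        using AE_lborel_singleton[of b] by eventually_elim (use that in \<open>auto simp: indicator_def\<close>)
    qed measurable
    also have "\<dots> = (LINT y:{a..b}|lborel. g y) + (LINT y:{b..c}|lborel. g y)"
      unfolding set_lebesgue_integral_def
      by (rule Bochner_Integration.integral_add) (use locally_integrableD[OF g] in \<open>simp_all add: set_integrable_def\<close>)
    finally show ?thesis .
  qed
  have pt: "(LINT y:{b..a}|lborel. g y) = 0" if "a \<le> b" for a b
  proof (cases "a = b")
    case True
    have "(LINT y:{b..a}|lborel. g y) = (LINT y|(lborel::real measure). (0::real))"
      unfolding set_lebesgue_integral_def
    proof (rule integral_cong_AE)
      show "AE y in lborel. indicator {b..a} y *\<^sub>R g y = 0"
        using AE_lborel_singleton[of b] by eventually_elim (use True in \<open>auto simp: indicator_def\<close>)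
    qed measurable
    then show ?thesis by simp
  qed (use that in \<open>simp add: set_lebesgue_integral_def\<close>)
  have "P b - P a = (LINT y:{a..b}|lborel. g y)" if ab: "a \<le> b" for a b
  proof -
    consider "0 \<le> a" | "a \<le> 0" "0 \<le> b" | "b \<le> 0" by linarith
    then show ?thesis
    proof cases
      case 1 then show ?thesis using split[of 0 a b] pt[of 0 a] pt[of 0 b] ab by (simp add: P_def)
    next
      case 2 then show ?thesis using split[of a 0 b] pt[of a 0] pt[of 0 b] ab by (simp add: P_def)
    next
      case 3 then show ?thesis using split[of a b 0] pt[of a 0] pt[of b 0] ab by (simp add: P_def)
    qed
  qed
  then show ?thesis unfolding primitive_def using g by blast
qed

text \<open>The difference between \<open>f\<close> and an indefinite integral of \<open>g\<close> has weak derivative \<open>0\<close> and is therefore constant.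
  This representative reduces the calculus of weak derivatives to the fundamental theorem.\<close>

theorem has_weak_deriv_primitive:
  assumes w: "has_weak_deriv f g"
  obtains U where "primitive U g" "AE x in lborel. f x = U x"
proof -
  have li: "locally_integrable f" "locally_integrable g" using w by (simp_all add: has_weak_deriv_def)
  obtain P where P: "primitive P g" using primitive_exists[OF li(2)] by blast
  have lP: "locally_integrable P" by (rule locally_integrable_continuous[OF primitive_continuous[OF P]])
  have "(LINT x|lborel. (f x - P x) * deriv \<psi> x) = 0" if t: "test_function \<psi>" for \<psi>
  proof -
    from t obtain R where s: "smooth \<psi>" and R: "\<And>x. \<bar>x\<bar> > R \<Longrightarrow> \<psi> x = 0" unfolding test_function_smooth by blast
    note d0 = deriv_eq_0_outside[of R \<psi>, OF R]
    note i = test_function_mult_integrable[OF _ smooth_continuous[OF smooth_deriv[OF s]] d0]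
    have "(LINT x|lborel. (f x - P x) * deriv \<psi> x) = (LINT x|lborel. f x * deriv \<psi> x) - (LINT x|lborel. P x * deriv \<psi> x)"
      using i[OF li(1)] i[OF lP] by (simp add: left_diff_distrib)
    also have "\<dots> = 0"
      using w primitive_has_weak_deriv[OF P] t by (simp add: has_weak_deriv_def)
    finally show ?thesis .
  qed
  moreover have "locally_integrable (\<lambda>x. f x - P x)"
    using locally_integrable_add[OF li(1) locally_integrable_cmult[OF lP, of "-1"]] by simp
  ultimately obtain c where c: "AE x in lborel. f x - P x = c"
    using du_Bois_Reymond by blast
  show ?thesis
  proof (rule that)
    show "primitive (\<lambda>x. P x + c) g" using primitive_add[OF P primitive_const[of c]] by simp
    show "AE x in lborel. f x = P x + c" using c by eventually_elim simp
  qed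
qed

lemma has_weak_deriv_unique:
  assumes "has_weak_deriv f g" "has_weak_deriv f k"
  shows "AE x in lborel. g x = k x"
proof -
  have li: "locally_integrable g" "locally_integrable k" using assms by (simp_all add: has_weak_deriv_def)
  have "AE x in lborel. g x - k x = 0"
  proof (rule integral_zero_of_test_functions)
    show "locally_integrable (\<lambda>x. g x - k x)"
      using locally_integrable_add[OF li(1) locally_integrable_cmult[OF li(2), of "-1"]] by simp
    fix \<eta> assume t: "test_function \<eta>"
    then obtain R where s: "smooth \<eta>" and R: "\<And>x. \<bar>x\<bar> > R \<Longrightarrow> \<eta> x = 0" unfolding test_function_smooth by blast
    note i = test_function_mult_integrable[OF _ smooth_continuous[OF s] R]
    have "(LINT x|lborel. f x * deriv \<eta> x) = - (LINT x|lborel. g x * \<eta> x)"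
      "(LINT x|lborel. f x * deriv \<eta> x) = - (LINT x|lborel. k x * \<eta> x)"
      using assms t unfolding has_weak_deriv_def by blast+
    then have "(LINT x|lborel. g x * \<eta> x) = (LINT x|lborel. k x * \<eta> x)" by linarith
    then show "(LINT x|lborel. (g x - k x) * \<eta> x) = 0"
      using i[OF li(1)] i[OF li(2)] by (simp add: left_diff_distrib)
  qed
  then show ?thesis by simp
qed

section \<open>Calculus of weak derivatives\<close>

abbreviation wd :: "(real \<Rightarrow> real) \<Rightarrow> (real \<Rightarrow> real) \<Rightarrow> bool" where
  "wd \<equiv> has_weak_deriv"

lemma wd_measurable:
  "wd u v \<Longrightarrow> u \<in> borel_measurable borel" "wd u v \<Longrightarrow> v \<in> borel_measurable borel"
  by (auto simp: has_weak_deriv_def intro: locally_integrable_measurable)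

lemma wd_mult:
  assumes u: "wd u u'" and v: "wd v v'"
  shows "wd (\<lambda>x. u x * v x) (\<lambda>x. u' x * v x + u x * v' x)"
proof -
  obtain U where U: "primitive U u'" "AE x in lborel. u x = U x" by (rule has_weak_deriv_primitive[OF u])
  obtain V where V: "primitive V v'" "AE x in lborel. v x = V x" by (rule has_weak_deriv_primitive[OF v])
  note [measurable] = wd_measurable[OF u] wd_measurable[OF v]
  show ?thesis
  proof (rule has_weak_deriv_cong_AE[OF primitive_has_weak_deriv[OF primitive_mult[OF U(1) V(1)]]])
    show "AE x in lborel. U x * V x = u x * v x" using U(2) V(2) by eventually_elim simp
    show "AE x in lborel. u' x * V x + U x * v' x = u' x * v x + u x * v' x" using U(2) V(2) by eventually_elim simp
  qed measurable
qed

lemma wd_add: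
  assumes u: "wd u u'" and v: "wd v v'"
  shows "wd (\<lambda>x. u x + v x) (\<lambda>x. u' x + v' x)"
proof -
  obtain U where U: "primitive U u'" "AE x in lborel. u x = U x" by (rule has_weak_deriv_primitive[OF u])
  obtain V where V: "primitive V v'" "AE x in lborel. v x = V x" by (rule has_weak_deriv_primitive[OF v])
  note [measurable] = wd_measurable[OF u] wd_measurable[OF v]
  show ?thesis
  proof (rule has_weak_deriv_cong_AE[OF primitive_has_weak_deriv[OF primitive_add[OF U(1) V(1)]]])
    show "AE x in lborel. U x + V x = u x + v x" using U(2) V(2) by eventually_elim simp
    show "AE x in lborel. u' x + v' x = u' x + v' x" by simp
  qed measurable
qed

lemma wd_cmult:
  assumes u: "wd u u'"
  shows "wd (\<lambda>x. c * u x) (\<lambda>x. c * u' x)"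
proof -
  obtain U where U: "primitive U u'" "AE x in lborel. u x = U x" by (rule has_weak_deriv_primitive[OF u])
  note [measurable] = wd_measurable[OF u]
  show ?thesis
  proof (rule has_weak_deriv_cong_AE[OF primitive_has_weak_deriv[OF primitive_cmult[OF U(1)]]])
    show "AE x in lborel. c * U x = c * u x" using U(2) by eventually_elim simp
    show "AE x in lborel. c * u' x = c * u' x" by simp
  qed measurable
qed

lemma wd_diff: "wd u u' \<Longrightarrow> wd v v' \<Longrightarrow> wd (\<lambda>x. u x - v x) (\<lambda>x. u' x - v' x)"
  using wd_add[OF _ wd_cmult[of v v' "-1"], of u u'] by simp

lemma wd_C1: "(\<And>x. (U has_real_derivative u x) (at x)) \<Longrightarrow> continuous_on UNIV u \<Longrightarrow> wd U u"
  by (intro primitive_has_weak_deriv primitive_C1)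

lemma wd_integral_eq_0:
  assumes w: "wd w w'" and i: "integrable lborel w" "integrable lborel w'"
  shows "(LINT x|lborel. w' x) = 0"
proof -
  obtain W where W: "primitive W w'" "AE x in lborel. w x = W x" by (rule has_weak_deriv_primitive[OF w])
  have "integrable lborel W"
    by (rule integrable_cong_AE_imp[OF i(1)]) (use W(2) primitive_measurable[OF W(1)] in auto)
  from primitive_integrable_integral_eq_0[OF W(1) this i(2)] show ?thesis .
qed

lemma L2_mult2_integrable: "L2 u \<Longrightarrow> integrable lborel (\<lambda>x. (u x)\<^sup>2)" for u :: "real \<Rightarrow> real"
  using L2_integrable_sq[of u] by simp

lemma norm_L2_sq_real: "(norm_L2 u)\<^sup>2 = (LINT x|lborel. (u x)\<^sup>2)" for u :: "real \<Rightarrow> real"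
  by (simp add: norm_L2_sq)

text \<open>Applied to \<open>U\<^sup>2\<close>, which is integrable with integrable derivative \<open>2 U v\<close>.\<close>

lemma primitive_L2_sq_bound:
  assumes U: "primitive U v" and L: "L2 U" "L2 v"
  shows "\<bar>U x\<bar> \<le> norm_L2 U + norm_L2 v"
    and "(\<lambda>n. U (real n)) \<longlonglongrightarrow> 0" "(\<lambda>n. U (- real n)) \<longlonglongrightarrow> 0"
proof -
  have P: "primitive (\<lambda>x. U x * U x) (\<lambda>x. v x * U x + U x * v x)" by (rule primitive_mult[OF U U])
  have iU: "integrable lborel (\<lambda>x. U x * U x)" by (rule L2_mult_integrable[OF L(1) L(1)])
  have iv: "integrable lborel (\<lambda>x. v x * U x + U x * v x)"
    by (intro Bochner_Integration.integrable_add L2_mult_integrable L)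
  note [measurable] = L2_measurable[OF L(1)] L2_measurable[OF L(2)]
  have "U x * U x \<le> (LINT x|lborel. \<bar>v x * U x + U x * v x\<bar>)"
    using primitive_integrable_bound[OF P iU iv, of x] by simp
  also have "\<dots> \<le> (LINT x|lborel. 2 * (norm (U x) * norm (v x)))"
  proof (rule integral_mono)
    show "integrable lborel (\<lambda>x. \<bar>v x * U x + U x * v x\<bar>)" using iv by (rule integrable_abs)
    show "integrable lborel (\<lambda>x. 2 * (norm (U x) * norm (v x)))"
      by (intro integrable_mult_right L2_mult_integrable L2_norm L)
    show "\<bar>v x * U x + U x * v x\<bar> \<le> 2 * (norm (U x) * norm (v x))" for x
      by (simp add: abs_mult mult.commute)
  qed
  also have "\<dots> \<le> 2 * (norm_L2 U * norm_L2 v)"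
    using Cauchy_Schwarz_L2_norm[OF L] by simp
  also have "\<dots> \<le> (norm_L2 U + norm_L2 v)\<^sup>2"
    by (simp add: power2_sum)
  finally have "\<bar>U x\<bar>\<^sup>2 \<le> (norm_L2 U + norm_L2 v)\<^sup>2" by (simp add: power2_eq_square)
  then show "\<bar>U x\<bar> \<le> norm_L2 U + norm_L2 v" by (rule power2_le_imp_le) simp
  have lim: "(\<lambda>n. U (h n)) \<longlonglongrightarrow> 0" if h: "\<And>y. \<forall>\<^sub>F n in sequentially. indicator {..h n} y = c" for h and c :: real
  proof -
    have conv: "(\<lambda>n. LINT y|lborel. indicator {..h n} y * (v y * U y + U y * v y)) \<longlonglongrightarrow> (LINT y|lborel. c * (v y * U y + U y * v y))"
    proof (rule integral_dominated_convergence)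
      show "integrable lborel (\<lambda>y. \<bar>v y * U y + U y * v y\<bar>)" using iv by (rule integrable_abs)
      show "AE y in lborel. (\<lambda>n. indicator {..h n} y * (v y * U y + U y * v y)) \<longlonglongrightarrow> c * (v y * U y + U y * v y)"
        by (intro AE_I2 tendsto_mult tendsto_const tendsto_eventually h)
      show "AE y in lborel. norm (indicator {..h n} y * (v y * U y + U y * v y)) \<le> \<bar>v y * U y + U y * v y\<bar>" for n
        by (intro AE_I2) (auto simp: indicator_def)
    qed measurable
    have "(LINT y|lborel. c * (v y * U y + U y * v y)) = c * (LINT y|lborel. v y * U y + U y * v y)"
      by (rule integral_mult_right_zero)
    then have "(LINT y|lborel. c * (v y * U y + U y * v y)) = 0"
      unfolding primitive_integrable_integral_eq_0[OF P iU iv] by simp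
    from conv[unfolded this primitive_integrable_eq[OF P iU iv, symmetric]]
    have "(\<lambda>n. U (h n) * U (h n)) \<longlonglongrightarrow> 0" .
    then have "(\<lambda>n. sqrt (U (h n) * U (h n))) \<longlonglongrightarrow> sqrt 0" by (rule tendsto_real_sqrt)
    then show ?thesis by (simp add: tendsto_rabs_zero_iff)
  qed
  show "(\<lambda>n. U (real n)) \<longlonglongrightarrow> 0"
  proof (rule lim[where c=1])
    fix y
    have "\<forall>\<^sub>F n in sequentially. y < real n"
      using filterlim_real_sequentially by (simp add: filterlim_at_top_dense)
    then show "\<forall>\<^sub>F n in sequentially. indicator {..real n} y = (1::real)"
      by eventually_elim (auto simp: indicator_def)
  qed
  show "(\<lambda>n. U (- real n)) \<longlonglongrightarrow> 0"
  proof (rule lim[where c=0])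
    fix y
    have "\<forall>\<^sub>F n in sequentially. - y < real n"
      using filterlim_real_sequentially by (simp add: filterlim_at_top_dense)
    then show "\<forall>\<^sub>F n in sequentially. indicator {..- real n} y = (0::real)"
      by eventually_elim (auto simp: indicator_def)
  qed
qed

text \<open>The Sobolev embedding of \<open>H\<^sup>1\<close> into \<open>L\<^sup>\<infinity>\<close>.\<close>

lemma wd_sup_bound:
  assumes w: "wd u v" and L: "L2 u" "L2 v"
  shows "AE x in lborel. \<bar>u x\<bar> \<le> norm_L2 u + norm_L2 v"
proof -
  obtain U where U: "primitive U v" "AE x in lborel. u x = U x" by (rule has_weak_deriv_primitive[OF w])
  have LU: "L2 U" by (rule L2_cong_AE[OF U(2) primitive_measurable[OF U(1)] L(1)])
  have "norm_L2 U = norm_L2 u"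
    by (rule norm_L2_cong_AE) (use U(2) L2_measurable[OF LU] L2_measurable[OF L(1)] in auto)
  then show ?thesis using primitive_L2_sq_bound(1)[OF U(1) LU L(2)] U(2) by auto
qed

section \<open>The Fourier transform of a weak derivative\<close>

abbreviation rfourier :: "(real \<Rightarrow> real) \<Rightarrow> (real \<Rightarrow> complex) \<Rightarrow> bool" where
  "rfourier u \<equiv> has_fourier_transform (\<lambda>x. complex_of_real (u x))"

lemma rfourier_L2: "rfourier u U \<Longrightarrow> L2 u" "rfourier u U \<Longrightarrow> L2 U"
  using fourier_L2 L2_of_real_iff by blast+

lemma rfourier_exists: "L2 u \<Longrightarrow> \<exists>U. rfourier u U"
  by (intro fourier_transform_exists L2_of_real)

lemma rfourier_cong_AE:
  assumes u: "rfourier u U" and AE: "AE x in lborel. u x = v x" and m: "v \<in> borel_measurable borel"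
  shows "rfourier v U"
  by (rule fourier_cong_AE[OF u]) (use AE m L2_measurable[OF rfourier_L2(2)[OF u]] in auto)

lemma parseval_real:
  assumes u: "rfourier u U" and v: "rfourier v V"
  shows "complex_of_real (2 * pi * (LINT x|lborel. u x * v x)) = (LINT \<xi>|lborel. U \<xi> * cnj (V \<xi>))"
proof -
  have "(LINT x|lborel. complex_of_real (u x) * cnj (complex_of_real (v x))) = (LINT x|lborel. complex_of_real (u x * v x))"
    by simp
  also have "\<dots> = complex_of_real (LINT x|lborel. u x * v x)" by (rule integral_complex_of_real)
  finally show ?thesis using parseval[OF u v] by simp
qed

text \<open>Integration by parts on \<open>{-n..n}\<close>, carried out separately against \<open>cos\<close> and \<open>sin\<close> since primitives are real.\<close>

lemma fourier_boundary_formula: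
  assumes U: "primitive U v" and L: "L2 U" "L2 v" and n: "0 \<le> n"
  shows "fourier_integral (truncate n (\<lambda>x. complex_of_real (v x))) \<xi>
    = cis (- (n * \<xi>)) * U n - cis (n * \<xi>) * U (- n) + \<i> * \<xi> * fourier_integral (truncate n (\<lambda>x. complex_of_real (U x))) \<xi>"
proof -
  have Pc: "primitive (\<lambda>x. cos (x * \<xi>)) (\<lambda>x. - \<xi> * sin (x * \<xi>))"
    by (rule primitive_C1) (auto intro!: derivative_eq_intros continuous_intros)
  have Ps: "primitive (\<lambda>x. sin (x * \<xi>)) (\<lambda>x. \<xi> * cos (x * \<xi>))"
    by (rule primitive_C1) (auto intro!: derivative_eq_intros continuous_intros)
  have re_im: "Re (fourier_integral (truncate n (\<lambda>x. complex_of_real (f x))) \<xi>) = (LINT x:{-n..n}|lborel. f x * cos (x * \<xi>))"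
      "Im (fourier_integral (truncate n (\<lambda>x. complex_of_real (f x))) \<xi>) = - (LINT x:{-n..n}|lborel. f x * sin (x * \<xi>))"
    if f: "L2 f" for f
  proof -
    note i = fourier_integrable[OF truncate_integrable[OF L2_of_real[OF f], of n], of \<xi>]
    have "Re (fourier_integral (truncate n (\<lambda>x. complex_of_real (f x))) \<xi>)
      = (LINT x|lborel. Re (cis (- (x * \<xi>)) * truncate n (\<lambda>x. complex_of_real (f x)) x))"
      unfolding fourier_integral_def by (rule integral_Re[OF i, symmetric])
    also have "\<dots> = (LINT x:{-n..n}|lborel. f x * cos (x * \<xi>))"
      unfolding set_lebesgue_integral_def by (intro integral_eqI) (simp add: truncate_def)
    finally show "Re (fourier_integral (truncate n (\<lambda>x. complex_of_real (f x))) \<xi>) = (LINT x:{-n..n}|lborel. f x * cos (x * \<xi>))" .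
    have "Im (fourier_integral (truncate n (\<lambda>x. complex_of_real (f x))) \<xi>)
      = (LINT x|lborel. Im (cis (- (x * \<xi>)) * truncate n (\<lambda>x. complex_of_real (f x)) x))"
      unfolding fourier_integral_def by (rule integral_Im[OF i, symmetric])
    also have "\<dots> = (LINT x|lborel. - (indicator {-n..n} x *\<^sub>R (f x * sin (x * \<xi>))))"
      by (intro integral_eqI) (simp add: truncate_def)
    also have "\<dots> = - (LINT x:{-n..n}|lborel. f x * sin (x * \<xi>))"
      unfolding set_lebesgue_integral_def by (rule Bochner_Integration.integral_minus)
    finally show "Im (fourier_integral (truncate n (\<lambda>x. complex_of_real (f x))) \<xi>) = - (LINT x:{-n..n}|lborel. f x * sin (x * \<xi>))" .
  qed
  have li: "set_integrable lborel {-n..n} (\<lambda>x. f x * k x)" if "L2 f" "continuous_on UNIV k" for f k :: "real \<Rightarrow> real"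
    by (rule locally_integrableD[OF locally_integrable_mult_continuous[OF locally_integrable_L2[OF that(1)] that(2)]])
  have cc: "continuous_on UNIV (\<lambda>x. cos (x * \<xi>))" "continuous_on UNIV (\<lambda>x. sin (x * \<xi>))"
    by (auto intro!: continuous_intros)
  have ibp: "(LINT x:{-n..n}|lborel. v x * k x) = U n * k n - U (-n) * k (-n) - c * (LINT x:{-n..n}|lborel. U x * k' x)"
    if P: "primitive k (\<lambda>x. c * k' x)" and ck: "continuous_on UNIV k'" for k k' c
  proof -
    have ck0: "continuous_on UNIV k" by (rule primitive_continuous[OF P])
    have "U n * k n - U (-n) * k (-n) = (LINT x:{-n..n}|lborel. v x * k x + U x * (c * k' x))"
      by (rule primitiveD[OF primitive_mult[OF U P], symmetric]) (use n in simp)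
    also have "\<dots> = (LINT x:{-n..n}|lborel. v x * k x + c * (U x * k' x))"
      by (simp only: mult.left_commute)
    also have "\<dots> = (LINT x:{-n..n}|lborel. v x * k x) + (LINT x:{-n..n}|lborel. c * (U x * k' x))"
      by (rule set_integral_add(2)) (use li[OF L(2) ck0] li[OF L(1) ck] in simp_all)
    finally show ?thesis by simp
  qed
  show ?thesis
  proof (rule complex_eqI)
    show "Re (fourier_integral (truncate n (\<lambda>x. complex_of_real (v x))) \<xi>)
      = Re (cis (- (n * \<xi>)) * U n - cis (n * \<xi>) * U (- n) + \<i> * \<xi> * fourier_integral (truncate n (\<lambda>x. complex_of_real (U x))) \<xi>)"
      using re_im[OF L(1)] re_im[OF L(2)] ibp[OF Pc cc(2)] by (simp add: algebra_simps)
    show "Im (fourier_integral (truncate n (\<lambda>x. complex_of_real (v x))) \<xi>)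
      = Im (cis (- (n * \<xi>)) * U n - cis (n * \<xi>) * U (- n) + \<i> * \<xi> * fourier_integral (truncate n (\<lambda>x. complex_of_real (U x))) \<xi>)"
      using re_im[OF L(1)] re_im[OF L(2)] ibp[OF Ps cc(1)] by (simp add: algebra_simps)
  qed
qed

lemma mult_gauss_bound: "\<bar>\<xi> * exp (- \<xi>\<^sup>2 / 2)\<bar> \<le> (1::real)"
proof -
  have "2 * \<bar>\<xi>\<bar> \<le> 1 + \<xi>\<^sup>2" using sum_squares_bound[of 1 "\<bar>\<xi>\<bar>"] by simp
  then have "\<bar>\<xi>\<bar> \<le> 1 + \<xi>\<^sup>2 / 2" by simp
  also have "\<dots> \<le> exp (\<xi>\<^sup>2 / 2)" by (rule exp_ge_add_one_self)
  finally show ?thesis by (simp add: abs_mult exp_minus field_simps)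
qed

text \<open>The boundary terms of the truncated transforms tend to \<open>0\<close> because \<open>U\<close> does. Since \<open>\<xi> F\<close> is not known to
  be square integrable beforehand, both sides are compared after multiplication by a Gaussian, which has no zeros.\<close>

theorem fourier_weak_deriv:
  assumes w: "wd u v" and f: "rfourier u F" and g: "rfourier v G"
  shows "AE \<xi> in lborel. G \<xi> = \<i> * \<xi> * F \<xi>"
proof -
  obtain U where U: "primitive U v" "AE x in lborel. u x = U x" by (rule has_weak_deriv_primitive[OF w])
  note L = rfourier_L2[OF f] rfourier_L2[OF g]
  have fU: "rfourier U F" by (rule rfourier_cong_AE[OF f U(2) primitive_measurable[OF U(1)]])
  have LU: "L2 U" by (rule rfourier_L2(1)[OF fU])
  let ?T = "\<lambda>f n. fourier_integral (truncate (real n) (\<lambda>x. complex_of_real (f x)))"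
  let ?w = "\<lambda>\<xi>::real. exp (- \<xi>\<^sup>2 / 2)"
  note [measurable] = L2_measurable[OF L(2)] L2_measurable[OF L(4)]
  have LT: "L2 (?T f n)" if "L2 f" for f n by (rule L2_fourier_truncate[OF L2_of_real[OF that]])
  have b1: "L2 (\<lambda>\<xi>. of_real (?w \<xi>) * f \<xi>) \<and> norm_L2 (\<lambda>\<xi>. of_real (?w \<xi>) * f \<xi>) \<le> \<bar>1\<bar> * norm_L2 f" if "L2 f" for f :: "real \<Rightarrow> complex"
    by (rule L2_mult_bounded[OF that]) auto
  have b2: "L2 (\<lambda>\<xi>. (\<i> * of_real (\<xi> * ?w \<xi>)) * f \<xi>) \<and> norm_L2 (\<lambda>\<xi>. (\<i> * of_real (\<xi> * ?w \<xi>)) * f \<xi>) \<le> \<bar>1\<bar> * norm_L2 f" if "L2 f" for f :: "real \<Rightarrow> complex"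
    by (rule L2_mult_bounded[OF that]) (measurable, rule AE_I2, simp only: norm_mult norm_ii norm_of_real mult_1 mult_gauss_bound)
  have lim: "(\<lambda>n. norm_L2 (\<lambda>\<xi>. ?T f n \<xi> - K \<xi>)) \<longlonglongrightarrow> 0" if "rfourier f K" for f K
    using filterlim_compose[OF has_fourier_transform_tendsto[OF that] filterlim_real_sequentially] .
  have "AE \<xi> in lborel. of_real (?w \<xi>) * G \<xi> = (\<i> * of_real (\<xi> * ?w \<xi>)) * F \<xi>"
  proof (rule tendsto_norm_L2_unique[where u="\<lambda>n \<xi>. of_real (?w \<xi>) * ?T v n \<xi>", OF sequentially_bot])
    show "L2 (\<lambda>\<xi>. of_real (?w \<xi>) * ?T v n \<xi>)" for n using b1[OF LT[OF L(3)]] by blast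
    show "L2 (\<lambda>\<xi>. of_real (?w \<xi>) * G \<xi>)" using b1[OF L(4)] by blast
    show "L2 (\<lambda>\<xi>. (\<i> * of_real (\<xi> * ?w \<xi>)) * F \<xi>)" using b2[OF L(2)] by blast
    show "(\<lambda>n. norm_L2 (\<lambda>\<xi>. of_real (?w \<xi>) * ?T v n \<xi> - of_real (?w \<xi>) * G \<xi>)) \<longlonglongrightarrow> 0"
    proof (rule Lim_null_comparison[OF always_eventually lim[OF g]], rule allI)
      fix n
      show "norm (norm_L2 (\<lambda>\<xi>. of_real (?w \<xi>) * ?T v n \<xi> - of_real (?w \<xi>) * G \<xi>)) \<le> norm_L2 (\<lambda>\<xi>. ?T v n \<xi> - G \<xi>)"
        using b1[OF L2_diff[OF LT[OF L(3)] L(4)], of n] by (simp add: right_diff_distrib)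
    qed
    have Lw: "L2 (\<lambda>\<xi>. complex_of_real (?w \<xi>))" by (rule L2_of_real[OF L2_gauss])
    let ?B = "\<lambda>n \<xi>. (cis (- (real n * \<xi>)) * U (real n) - cis (real n * \<xi>) * U (- real n)) * of_real (?w \<xi>)"
    have B: "L2 (?B n) \<and> norm_L2 (?B n) \<le> \<bar>\<bar>U (real n)\<bar> + \<bar>U (- real n)\<bar>\<bar> * norm_L2 (\<lambda>\<xi>. complex_of_real (?w \<xi>))" for n
    proof (rule L2_mult_bounded[OF Lw])
      show "AE \<xi> in lborel. norm (cis (- (real n * \<xi>)) * U (real n) - cis (real n * \<xi>) * U (- real n)) \<le> \<bar>U (real n)\<bar> + \<bar>U (- real n)\<bar>"
        by (rule AE_I2) (rule order_trans[OF norm_triangle_ineq4], simp add: norm_mult)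
    qed measurable
    show "(\<lambda>n. norm_L2 (\<lambda>\<xi>. of_real (?w \<xi>) * ?T v n \<xi> - (\<i> * of_real (\<xi> * ?w \<xi>)) * F \<xi>)) \<longlonglongrightarrow> 0"
    proof (rule Lim_null_comparison[OF always_eventually], rule allI)
      fix n
      have eq: "of_real (?w \<xi>) * ?T v n \<xi> - (\<i> * of_real (\<xi> * ?w \<xi>)) * F \<xi>
         = ?B n \<xi> + (\<i> * of_real (\<xi> * ?w \<xi>)) * (?T U n \<xi> - F \<xi>)" for \<xi>
        unfolding fourier_boundary_formula[OF U(1) LU L(3) of_nat_0_le_iff, of n \<xi>] by (simp add: algebra_simps)
      note b2' = b2[OF L2_diff[OF LT[OF LU] L(2)], of n]
      have "norm_L2 (\<lambda>\<xi>. of_real (?w \<xi>) * ?T v n \<xi> - (\<i> * of_real (\<xi> * ?w \<xi>)) * F \<xi>)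
        \<le> norm_L2 (?B n) + norm_L2 (\<lambda>\<xi>. (\<i> * of_real (\<xi> * ?w \<xi>)) * (?T U n \<xi> - F \<xi>))"
        unfolding eq by (rule norm_L2_triangle[OF conjunct1[OF B] conjunct1[OF b2']])
      also have "\<dots> \<le> \<bar>\<bar>U (real n)\<bar> + \<bar>U (- real n)\<bar>\<bar> * norm_L2 (\<lambda>\<xi>. complex_of_real (?w \<xi>)) + \<bar>1\<bar> * norm_L2 (\<lambda>\<xi>. ?T U n \<xi> - F \<xi>)"
        by (rule add_mono[OF conjunct2[OF B] conjunct2[OF b2']])
      finally show "norm (norm_L2 (\<lambda>\<xi>. of_real (?w \<xi>) * ?T v n \<xi> - (\<i> * of_real (\<xi> * ?w \<xi>)) * F \<xi>))
         \<le> \<bar>\<bar>U (real n)\<bar> + \<bar>U (- real n)\<bar>\<bar> * norm_L2 (\<lambda>\<xi>. complex_of_real (?w \<xi>)) + \<bar>1\<bar> * norm_L2 (\<lambda>\<xi>. ?T U n \<xi> - F \<xi>)"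
        unfolding real_norm_def abs_of_nonneg[OF norm_L2_nonneg] .
    next
      have "(\<lambda>n. \<bar>\<bar>U (real n)\<bar> + \<bar>U (- real n)\<bar>\<bar> * norm_L2 (\<lambda>\<xi>. complex_of_real (?w \<xi>)) + \<bar>1\<bar> * norm_L2 (\<lambda>\<xi>. ?T U n \<xi> - F \<xi>))
        \<longlonglongrightarrow> \<bar>\<bar>0\<bar> + \<bar>0\<bar>\<bar> * norm_L2 (\<lambda>\<xi>. complex_of_real (?w \<xi>)) + \<bar>1\<bar> * 0"
        by (intro tendsto_intros primitive_L2_sq_bound(2,3)[OF U(1) LU L(3)] lim[OF fU])
      then show "(\<lambda>n. \<bar>\<bar>U (real n)\<bar> + \<bar>U (- real n)\<bar>\<bar> * norm_L2 (\<lambda>\<xi>. complex_of_real (?w \<xi>)) + \<bar>1\<bar> * norm_L2 (\<lambda>\<xi>. ?T U n \<xi> - F \<xi>)) \<longlonglongrightarrow> 0"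
        by simp
    qed
  qed
  then show ?thesis by eventually_elim simp
qed

section \<open>The Hilbert transform\<close>

abbreviation hsymbol :: "real \<Rightarrow> complex" where
  "hsymbol \<xi> \<equiv> - \<i> * complex_of_real (sgn \<xi>)"

lemma norm_hsymbol_le: "norm (hsymbol \<xi>) \<le> 1"
  by (simp add: norm_mult sgn_if)

lemma L2_hsymbol: "L2 F \<Longrightarrow> L2 (\<lambda>\<xi>. hsymbol \<xi> * F \<xi>)" for F :: "real \<Rightarrow> complex"
  using L2_mult_bounded[of F hsymbol 1] norm_hsymbol_le by simp

lemma has_hilbert_transform_alt:
  "has_hilbert_transform f g \<longleftrightarrow> (\<exists>F. rfourier f F \<and> rfourier g (\<lambda>\<xi>. hsymbol \<xi> * F \<xi>))"
  by (simp add: has_hilbert_transform_def)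

text \<open>Every square-integrable function is a Fourier transform; what needs proof is that the preimage of the
  multiplied transform is real.\<close>

theorem hilbert_transform_exists:
  assumes f: "L2 f"
  shows "\<exists>g. has_hilbert_transform f g"
proof -
  obtain F where F: "rfourier f F" using rfourier_exists[OF f] by blast
  let ?Q = "\<lambda>\<xi>. hsymbol \<xi> * F \<xi>"
  have LQ: "L2 ?Q" by (rule L2_hsymbol[OF rfourier_L2(2)[OF F]])
  obtain g where g: "fourier g ?Q" using fourier_transform_surj[OF LQ] by blast
  have sym: "AE \<xi> in lborel. cnj (F (- \<xi>)) = F \<xi>"
    using fourier_unique[OF fourier_cnj[OF F]] F by simp
  \<comment> \<open>the symbol is odd and imaginary, so the multiplier preserves the symmetry of transforms of real functions\<close>
  have "AE x in lborel. cnj (g x) = g x"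
  proof (rule fourier_inj[OF _ g])
    note [measurable] = L2_measurable[OF fourier_L2(1)[OF g]] L2_measurable[OF LQ]
    show "fourier (\<lambda>x. cnj (g x)) ?Q"
    proof (rule fourier_cong_AE[OF fourier_cnj[OF g]])
      show "AE \<xi> in lborel. cnj (hsymbol (- \<xi>) * F (- \<xi>)) = ?Q \<xi>"
        using sym by eventually_elim (simp add: sgn_minus)
      show "?Q \<in> borel_measurable borel" by (rule L2_measurable[OF LQ])
    qed (simp, measurable)
  qed
  then have "AE x in lborel. g x = complex_of_real (Re (g x))"
    by eventually_elim (simp add: complex_eq_iff)
  then have "rfourier (\<lambda>x. Re (g x)) ?Q"
    by (rule fourier_cong_AE[OF g]) (use L2_measurable[OF fourier_L2(1)[OF g]] L2_measurable[OF LQ] in auto)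
  with F show ?thesis unfolding has_hilbert_transform_alt by (intro exI[of _ "\<lambda>x. Re (g x)"] exI[of _ F] conjI)
qed

lemma hilbert_rfourier:
  assumes F: "rfourier f F"
  shows "rfourier (hilbert f) (\<lambda>\<xi>. hsymbol \<xi> * F \<xi>)"
proof -
  have "has_hilbert_transform f (hilbert f)"
    unfolding hilbert_def by (rule someI_ex[OF hilbert_transform_exists[OF rfourier_L2(1)[OF F]]])
  then obtain G where G: "rfourier f G" "rfourier (hilbert f) (\<lambda>\<xi>. hsymbol \<xi> * G \<xi>)"
    unfolding has_hilbert_transform_alt by blast
  show ?thesis
  proof (rule fourier_cong_AE[OF G(2)])
    show "AE \<xi> in lborel. hsymbol \<xi> * G \<xi> = hsymbol \<xi> * F \<xi>"
      using fourier_unique[OF G(1) F] by eventually_elim simp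
  qed (use L2_measurable[OF rfourier_L2(1)[OF G(2)]] L2_measurable[OF L2_hsymbol[OF rfourier_L2(2)[OF F]]] in auto)
qed

lemma hilbert_L2: "L2 f \<Longrightarrow> L2 (hilbert f)"
  using rfourier_exists hilbert_rfourier rfourier_L2 by blast

lemma rfourier_inj:
  assumes "rfourier f F" "rfourier g G" "AE \<xi> in lborel. F \<xi> = G \<xi>"
  shows "AE x in lborel. f x = g x"
proof -
  have "rfourier f G"
    by (rule fourier_cong_AE[OF assms(1) _ assms(3)])
       (use L2_measurable[OF rfourier_L2(1)[OF assms(1)]] L2_measurable[OF rfourier_L2(2)[OF assms(2)]] in auto)
  from fourier_inj[OF this assms(2)] show ?thesis by simp
qed

lemma hilbert_unique:
  assumes F: "rfourier f F" and g: "rfourier g G" "AE \<xi> in lborel. G \<xi> = hsymbol \<xi> * F \<xi>"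
  shows "AE x in lborel. hilbert f x = g x"
  by (rule rfourier_inj[OF hilbert_rfourier[OF F] g(1)]) (use g(2) in eventually_elim, simp)

lemma rfourier_add: "rfourier f F \<Longrightarrow> rfourier g G \<Longrightarrow> rfourier (\<lambda>x. f x + g x) (\<lambda>\<xi>. F \<xi> + G \<xi>)"
  using fourier_add[of "\<lambda>x. complex_of_real (f x)" F "\<lambda>x. complex_of_real (g x)" G] by simp

lemma rfourier_diff: "rfourier f F \<Longrightarrow> rfourier g G \<Longrightarrow> rfourier (\<lambda>x. f x - g x) (\<lambda>\<xi>. F \<xi> - G \<xi>)"
  using fourier_diff[of "\<lambda>x. complex_of_real (f x)" F "\<lambda>x. complex_of_real (g x)" G] by simp

lemma rfourier_cmult: "rfourier f F \<Longrightarrow> rfourier (\<lambda>x. c * f x) (\<lambda>\<xi>. complex_of_real c * F \<xi>)"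
  using fourier_cmult[of "\<lambda>x. complex_of_real (f x)" F "complex_of_real c"] by simp

lemma hilbert_add:
  assumes "L2 f" "L2 g"
  shows "AE x in lborel. hilbert (\<lambda>x. f x + g x) x = hilbert f x + hilbert g x"
proof -
  obtain F where F: "rfourier f F" using rfourier_exists[OF assms(1)] by blast
  obtain G where G: "rfourier g G" using rfourier_exists[OF assms(2)] by blast
  show ?thesis
    by (rule hilbert_unique[OF rfourier_add[OF F G] rfourier_add[OF hilbert_rfourier[OF F] hilbert_rfourier[OF G]]])
       (rule AE_I2, simp only: distrib_left)
qed

lemma hilbert_cmult:
  assumes "L2 f"
  shows "AE x in lborel. hilbert (\<lambda>x. c * f x) x = c * hilbert f x"
proof -
  obtain F where F: "rfourier f F" using rfourier_exists[OF assms] by blast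
  show ?thesis
    by (rule hilbert_unique[OF rfourier_cmult[OF F] rfourier_cmult[OF hilbert_rfourier[OF F]]])
       (rule AE_I2, simp only: mult.left_commute)
qed

lemma hilbert_diff:
  assumes "L2 f" "L2 g"
  shows "AE x in lborel. hilbert (\<lambda>x. f x - g x) x = hilbert f x - hilbert g x"
proof -
  obtain F where F: "rfourier f F" using rfourier_exists[OF assms(1)] by blast
  obtain G where G: "rfourier g G" using rfourier_exists[OF assms(2)] by blast
  show ?thesis
    by (rule hilbert_unique[OF rfourier_diff[OF F G] rfourier_diff[OF hilbert_rfourier[OF F] hilbert_rfourier[OF G]]])
       (rule AE_I2, simp only: right_diff_distrib)
qed

lemma hilbert_hilbert:
  assumes "L2 f"
  shows "AE x in lborel. hilbert (hilbert f) x = - f x"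
proof -
  obtain F where F: "rfourier f F" using rfourier_exists[OF assms] by blast
  have "AE x in lborel. hilbert (hilbert f) x = -1 * f x"
  proof (rule hilbert_unique[OF hilbert_rfourier[OF F] rfourier_cmult[OF F]])
    show "AE \<xi> in lborel. complex_of_real (-1) * F \<xi> = hsymbol \<xi> * (hsymbol \<xi> * F \<xi>)"
      using AE_lborel_singleton[of "0::real"] by eventually_elim (simp add: sgn_if)
  qed
  then show ?thesis by simp
qed

lemma two_pi_cancel:
  assumes "2 * pi * a = - (2 * pi * b)" shows "a = - b"
proof -
  have "2 * pi * (a + b) = 0" using assms by (simp add: distrib_left)
  then show ?thesis by simp
qed

text \<open>The symbol is purely imaginary.\<close>

lemma hilbert_antisym:
  assumes "L2 f" "L2 g"
  shows "(LINT x|lborel. hilbert f x * g x) = - (LINT x|lborel. f x * hilbert g x)"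
proof -
  obtain F where F: "rfourier f F" using rfourier_exists[OF assms(1)] by blast
  obtain G where G: "rfourier g G" using rfourier_exists[OF assms(2)] by blast
  have "complex_of_real (2 * pi * (LINT x|lborel. hilbert f x * g x)) = (LINT \<xi>|lborel. hsymbol \<xi> * F \<xi> * cnj (G \<xi>))"
    by (rule parseval_real[OF hilbert_rfourier[OF F] G])
  also have "\<dots> = (LINT \<xi>|lborel. - (F \<xi> * cnj (hsymbol \<xi> * G \<xi>)))"
    by (intro integral_eqI) simp
  also have "\<dots> = - (LINT \<xi>|lborel. F \<xi> * cnj (hsymbol \<xi> * G \<xi>))" by (rule Bochner_Integration.integral_minus)
  also have "\<dots> = - complex_of_real (2 * pi * (LINT x|lborel. f x * hilbert g x))"
    by (simp only: parseval_real[OF F hilbert_rfourier[OF G]])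
  finally have "complex_of_real (2 * pi * (LINT x|lborel. hilbert f x * g x)) = complex_of_real (- (2 * pi * (LINT x|lborel. f x * hilbert g x)))"
    by simp
  then show ?thesis unfolding of_real_eq_iff by (rule two_pi_cancel)
qed

text \<open>The symbol has modulus \<open>1\<close> almost everywhere.\<close>

lemma hilbert_inner:
  assumes "L2 f" "L2 g"
  shows "(LINT x|lborel. hilbert f x * hilbert g x) = (LINT x|lborel. f x * g x)"
proof -
  have 1: "(LINT x|lborel. hilbert f x * hilbert g x) = - (LINT x|lborel. f x * hilbert (hilbert g) x)"
    by (rule hilbert_antisym[OF assms(1) hilbert_L2[OF assms(2)]])
  note [measurable] = L2_measurable[OF assms(1)] L2_measurable[OF assms(2)] L2_measurable[OF hilbert_L2[OF hilbert_L2[OF assms(2)]]]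
  have "(LINT x|lborel. f x * hilbert (hilbert g) x) = (LINT x|lborel. - (f x * g x))"
  proof (rule integral_cong_AE)
    show "AE x in lborel. f x * hilbert (hilbert g) x = - (f x * g x)"
      using hilbert_hilbert[OF assms(2)] by eventually_elim simp
  qed measurable
  with 1 show ?thesis by simp
qed

lemma norm_L2_eq_integral_mult: "norm_L2 f = sqrt (LINT x|lborel. f x * f x)" for f :: "real \<Rightarrow> real"
  by (simp add: norm_L2_def power2_eq_square)

lemma norm_L2_hilbert: "L2 f \<Longrightarrow> norm_L2 (hilbert f) = norm_L2 f"
  unfolding norm_L2_eq_integral_mult by (simp add: hilbert_inner)

lemma test_function_L2:
  assumes "test_function \<psi>"
  shows "L2 \<psi>" "L2 (deriv \<psi>)" "wd \<psi> (deriv \<psi>)"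
proof -
  from assms obtain R where s: "smooth \<psi>" and R: "\<And>x. \<bar>x\<bar> > R \<Longrightarrow> \<psi> x = 0" unfolding test_function_smooth by blast
  note d0 = deriv_eq_0_outside[of R \<psi>, OF R]
  have "L2 \<kappa>" if c: "continuous_on UNIV \<kappa>" and z: "\<And>x. \<bar>x\<bar> > R \<Longrightarrow> \<kappa> x = 0" for \<kappa> :: "real \<Rightarrow> real"
  proof (rule L2_I)
    show "\<kappa> \<in> borel_measurable borel" by (rule borel_measurable_continuous_onI[OF c])
    show "integrable lborel (\<lambda>x. (norm (\<kappa> x))\<^sup>2)"
      using test_function_mult_integrable[OF locally_integrable_continuous[OF c] c z] by (simp add: power2_eq_square)
  qed
  note L = this
  show "L2 \<psi>" by (rule L[OF smooth_continuous[OF s] R])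
  show "L2 (deriv \<psi>)" by (rule L[OF smooth_continuous[OF smooth_deriv[OF s]] d0])
  show "wd \<psi> (deriv \<psi>)" by (rule wd_C1[OF smoothD[OF s] smooth_continuous[OF smooth_deriv[OF s]]])
qed

text \<open>On the Fourier side both \<open>\<partial>\<^sub>x\<close> and \<open>H\<close> are multiplications, so they commute.\<close>

theorem wd_hilbert:
  assumes w: "wd u v" and L: "L2 u" "L2 v"
  shows "wd (hilbert u) (hilbert v)"
  unfolding has_weak_deriv_def
proof (intro conjI allI impI)
  show "locally_integrable (hilbert u)" "locally_integrable (hilbert v)"
    by (intro locally_integrable_L2 hilbert_L2 L)+
  fix \<psi> assume t: "test_function \<psi>"
  note Lp = test_function_L2[OF t]
  obtain U where U: "rfourier u U" using rfourier_exists[OF L(1)] by blast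
  obtain V where V: "rfourier v V" using rfourier_exists[OF L(2)] by blast
  obtain P where P: "rfourier \<psi> P" using rfourier_exists[OF Lp(1)] by blast
  obtain Q where Q: "rfourier (deriv \<psi>) Q" using rfourier_exists[OF Lp(2)] by blast
  note [measurable] = rfourier_L2(2)[OF U, THEN L2_measurable] rfourier_L2(2)[OF V, THEN L2_measurable]
      rfourier_L2(2)[OF P, THEN L2_measurable] rfourier_L2(2)[OF Q, THEN L2_measurable]
  have "complex_of_real (2 * pi * (LINT x|lborel. hilbert u x * deriv \<psi> x)) = (LINT \<xi>|lborel. hsymbol \<xi> * U \<xi> * cnj (Q \<xi>))"
    by (rule parseval_real[OF hilbert_rfourier[OF U] Q])
  also have "\<dots> = (LINT \<xi>|lborel. - (hsymbol \<xi> * V \<xi> * cnj (P \<xi>)))"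
  proof (rule integral_cong_AE)
    show "AE \<xi> in lborel. hsymbol \<xi> * U \<xi> * cnj (Q \<xi>) = - (hsymbol \<xi> * V \<xi> * cnj (P \<xi>))"
      using fourier_weak_deriv[OF w U V] fourier_weak_deriv[OF Lp(3) P Q] by eventually_elim simp
  qed measurable
  also have "\<dots> = - (LINT \<xi>|lborel. hsymbol \<xi> * V \<xi> * cnj (P \<xi>))" by (rule Bochner_Integration.integral_minus)
  also have "\<dots> = - complex_of_real (2 * pi * (LINT x|lborel. hilbert v x * \<psi> x))"
    by (simp only: parseval_real[OF hilbert_rfourier[OF V] P])
  finally have "complex_of_real (2 * pi * (LINT x|lborel. hilbert u x * deriv \<psi> x)) = complex_of_real (- (2 * pi * (LINT x|lborel. hilbert v x * \<psi> x)))"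
    by simp
  then show "(LINT x|lborel. hilbert u x * deriv \<psi> x) = - (LINT x|lborel. hilbert v x * \<psi> x)"
    unfolding of_real_eq_iff by (rule two_pi_cancel)
qed

lemma wd_integration_by_parts:
  assumes u: "wd u u'" "L2 u" "L2 u'" and v: "wd v v'" "L2 v" "L2 v'"
  shows "(LINT x|lborel. u' x * v x) = - (LINT x|lborel. u x * v' x)"
proof -
  note i = L2_mult_integrable[OF u(3) v(2)] L2_mult_integrable[OF u(2) v(3)]
  have "(LINT x|lborel. u' x * v x + u x * v' x) = 0"
    by (rule wd_integral_eq_0[OF wd_mult[OF u(1) v(1)]]) (intro L2_mult_integrable Bochner_Integration.integrable_add i u v)+
  then show ?thesis using i by simp
qed

text \<open>\<open>H \<partial>\<^sub>x\<close> is symmetric, being the multiplier with the even real symbol \<open>\<bar>\<xi>\<bar>\<close>.\<close>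

lemma hilbert_deriv_symmetric:
  assumes u: "wd u u'" "L2 u" "L2 u'" and v: "wd v v'" "L2 v" "L2 v'"
  shows "(LINT x|lborel. hilbert u' x * v x) = (LINT x|lborel. u x * hilbert v' x)"
proof -
  have "(LINT x|lborel. hilbert u' x * v x) = - (LINT x|lborel. hilbert u x * v' x)"
    by (rule wd_integration_by_parts[OF wd_hilbert[OF u] hilbert_L2 hilbert_L2 v]) (rule u)+
  then show ?thesis using hilbert_antisym[OF u(2) v(3)] by simp
qed

section \<open>A bounded substitute for the weight and its commutator with the Hilbert transform\<close>

text \<open>A bounded substitute for the weight \<open>x\<close>, to which it converges as \<open>e\<close> tends to \<open>0\<close>. The sine is chosen
  because multiplication by it shifts frequencies by exactly \<open>\<plusminus>e\<close>.\<close>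

definition sw :: "real \<Rightarrow> real \<Rightarrow> real" where
  "sw e x = sin (e * x) / e"

lemma sw_measurable [measurable]: "sw e \<in> borel_measurable borel"
  unfolding sw_def[abs_def] by measurable

lemma abs_sw_le: "\<bar>sw e x\<bar> \<le> 1 / \<bar>e\<bar>"
  by (simp add: sw_def abs_divide divide_right_mono)

lemma abs_sw_le_abs: "\<bar>sw e x\<bar> \<le> \<bar>x\<bar>"
proof (cases "e = 0")
  case False
  have "\<bar>sin (e * x)\<bar> \<le> \<bar>e * x\<bar>" by (rule abs_sin_x_le_abs_x)
  then show ?thesis using False by (simp add: sw_def abs_divide abs_mult divide_le_eq mult.commute)
qed (simp add: sw_def)

text \<open>Scales in \<open>(0, 1]\<close> tending to \<open>0\<close>, as a sequence so that dominated convergence applies.\<close>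

definition ew :: "nat \<Rightarrow> real" where
  "ew n = 1 / real (Suc n)"

lemma ew_pos: "0 < ew n" and ew_le_1: "ew n \<le> 1"
  by (simp_all add: ew_def)

lemma ew_tendsto: "ew \<longlonglongrightarrow> 0"
  unfolding ew_def[abs_def] by (rule LIMSEQ_Suc[OF lim_1_over_n])

lemma sw_tendsto: "(\<lambda>n. sw (ew n) x) \<longlonglongrightarrow> x"
proof -
  have "((\<lambda>e. sin (e * x) / e) \<longlongrightarrow> x) (at 0)"
  proof -
    have "((\<lambda>e. sin (e * x)) has_real_derivative x) (at 0)"
      by (auto intro!: derivative_eq_intros)
    then show ?thesis by (simp add: has_field_derivative_iff)
  qed
  moreover have "filterlim ew (at 0) sequentially"
    using ew_tendsto ew_pos by (auto simp: filterlim_at less_imp_neq[symmetric] intro!: always_eventually)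
  ultimately show ?thesis unfolding sw_def by (rule filterlim_compose)
qed

lemma sw_has_derivative: "e \<noteq> 0 \<Longrightarrow> (sw e has_real_derivative cos (e * x)) (at x)"
  unfolding sw_def[abs_def] by (auto intro!: derivative_eq_intros)

lemma cos_has_derivative: "((\<lambda>x. cos (e * x)) has_real_derivative - e * sin (e * x)) (at x)"
  by (auto intro!: derivative_eq_intros)

lemma wd_sw: "e \<noteq> 0 \<Longrightarrow> wd (sw e) (\<lambda>x. cos (e * x))"
  by (rule wd_C1[OF sw_has_derivative]) (auto intro!: continuous_intros)

lemma wd_cos: "wd (\<lambda>x. cos (e * x)) (\<lambda>x. - e * sin (e * x))"
  by (rule wd_C1[OF cos_has_derivative]) (auto intro!: continuous_intros)

lemma L2_sw: "L2 u \<Longrightarrow> L2 (\<lambda>x. sw e x * u x)"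
  using L2_mult_bounded[of u "sw e" "1 / \<bar>e\<bar>"] by (simp add: abs_sw_le)

definition sw_symbol :: "real \<Rightarrow> (real \<Rightarrow> complex) \<Rightarrow> real \<Rightarrow> complex" where
  "sw_symbol e U \<xi> = (U (\<xi> - e) - U (\<xi> + e)) / (2 * \<i> * complex_of_real e)"

lemma rfourier_sw:
  assumes u: "rfourier u U"
  shows "rfourier (\<lambda>x. sw e x * u x) (sw_symbol e U)"
proof -
  let ?c = "1 / (2 * \<i> * complex_of_real e)"
  have "fourier (\<lambda>x. ?c * (cis (e * x) * u x - cis (- e * x) * u x)) (\<lambda>\<xi>. ?c * (U (\<xi> - e) - U (\<xi> - - e)))"
    by (intro fourier_cmult fourier_diff fourier_modulate u)
  moreover have "?c * (cis (e * x) * u x - cis (- e * x) * u x) = complex_of_real (sw e x * u x)" for x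
  proof -
    have "cis (e * x) - cis (- e * x) = 2 * \<i> * complex_of_real (sin (e * x))" by (simp add: complex_eq_iff)
    then have "?c * (cis (e * x) * u x - cis (- e * x) * u x) = ?c * (2 * \<i> * complex_of_real (sin (e * x))) * u x"
      by (simp only: left_diff_distrib[symmetric] mult.assoc)
    also have "?c * (2 * \<i> * complex_of_real (sin (e * x))) = complex_of_real (sw e x)"
      by (simp add: sw_def)
    finally show ?thesis by simp
  qed
  moreover have "?c * (U (\<xi> - e) - U (\<xi> - - e)) = sw_symbol e U \<xi>" for \<xi>
    by (simp add: sw_symbol_def)
  ultimately show ?thesis by simp
qed

definition commutator :: "real \<Rightarrow> (real \<Rightarrow> real) \<Rightarrow> real \<Rightarrow> real" where
  "commutator e u x = hilbert (\<lambda>x. sw e x * u x) x - sw e x * hilbert u x"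

definition commutator_symbol :: "real \<Rightarrow> (real \<Rightarrow> complex) \<Rightarrow> real \<Rightarrow> complex" where
  "commutator_symbol e U \<xi> = hsymbol \<xi> * sw_symbol e U \<xi> - sw_symbol e (\<lambda>\<xi>. hsymbol \<xi> * U \<xi>) \<xi>"

lemma commutator_rfourier: "rfourier u U \<Longrightarrow> rfourier (commutator e u) (commutator_symbol e U)"
  unfolding commutator_def[abs_def] commutator_symbol_def[abs_def]
  by (intro rfourier_diff hilbert_rfourier rfourier_sw)

lemma commutator_L2: "L2 u \<Longrightarrow> L2 (commutator e u)"
  unfolding commutator_def[abs_def] by (intro L2_diff hilbert_L2 L2_sw)

text \<open>The symbol of \<open>H\<close> differs at \<open>\<xi>\<close> and \<open>\<xi> \<plusminus> e\<close> only if these lie on different sides of \<open>0\<close>, so only frequencies of size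
  at most \<open>e\<close> of the function contribute.\<close>

lemma norm_commutator_symbol_le:
  assumes e: "0 < e"
  shows "norm (commutator_symbol e U \<xi>) \<le>
     (indicator {-e..e} (\<xi> - e) * norm (U (\<xi> - e)) + indicator {-e..e} (\<xi> + e) * norm (U (\<xi> + e))) / e"
proof -
  have eq: "commutator_symbol e U \<xi> = ((hsymbol \<xi> - hsymbol (\<xi> - e)) * U (\<xi> - e) - (hsymbol \<xi> - hsymbol (\<xi> + e)) * U (\<xi> + e)) / (2 * \<i> * complex_of_real e)"
    by (simp add: commutator_symbol_def sw_symbol_def algebra_simps diff_divide_distrib add_divide_distrib)
  have h: "norm ((hsymbol \<xi> - hsymbol \<eta>) * U \<eta>) \<le> 2 * (indicator {-e..e} \<eta> * norm (U \<eta>))"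
    if "\<xi> = \<eta> + e \<or> \<xi> = \<eta> - e" for \<eta>
  proof (cases "\<eta> \<in> {-e..e}")
    case True
    have "norm (hsymbol \<xi> - hsymbol \<eta>) \<le> 2"
      using norm_triangle_ineq4[of "hsymbol \<xi>" "hsymbol \<eta>"] norm_hsymbol_le[of \<xi>] norm_hsymbol_le[of \<eta>] by linarith
    then have "norm (hsymbol \<xi> - hsymbol \<eta>) * norm (U \<eta>) \<le> 2 * norm (U \<eta>)" by (rule mult_right_mono) simp
    then show ?thesis using True by (simp only: norm_mult indicator_simps mult_1)
  next
    case False
    have "sgn \<xi> = sgn \<eta>"
    proof (cases "\<eta> < - e")
      case True then have "\<eta> < 0" "\<xi> < 0" using that e by auto
      then show ?thesis by simp
    next
      case F: False
      with False have "\<eta> > e" by simp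
      then have "\<eta> > 0" "\<xi> > 0" using that e by auto
      then show ?thesis by simp
    qed
    then show ?thesis by simp
  qed
  have "norm (commutator_symbol e U \<xi>) \<le> (norm ((hsymbol \<xi> - hsymbol (\<xi> - e)) * U (\<xi> - e)) + norm ((hsymbol \<xi> - hsymbol (\<xi> + e)) * U (\<xi> + e))) / (2 * e)"
    unfolding eq norm_divide using e by (simp only: norm_mult[of "2 * \<i>"] norm_of_real) (simp add: divide_right_mono norm_triangle_ineq4)
  also have "\<dots> \<le> (2 * (indicator {-e..e} (\<xi> - e) * norm (U (\<xi> - e))) + 2 * (indicator {-e..e} (\<xi> + e) * norm (U (\<xi> + e)))) / (2 * e)"
    using e by (intro divide_right_mono add_mono h) auto
  also have "\<dots> = (indicator {-e..e} (\<xi> - e) * norm (U (\<xi> - e)) + indicator {-e..e} (\<xi> + e) * norm (U (\<xi> + e))) / e"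
    using e by (simp add: field_simps)
  finally show ?thesis .
qed

text \<open>The derivative compensates the factor \<open>1 / e\<close> on the frequencies of size at most \<open>e\<close>.\<close>

lemma commutator_deriv_low_frequency:
  assumes e: "0 < e" and w: "wd v v'" "L2 v'" and V: "rfourier v V"
  shows "norm_L2 (commutator e v') \<le> 2 * norm_L2 (\<lambda>\<xi>. indicator {-e..e} \<xi> * norm (V \<xi>))"
proof -
  let ?V1 = "\<lambda>\<xi>. \<i> * complex_of_real \<xi> * V \<xi>" and ?low = "\<lambda>\<xi>. indicator {-e..e} \<xi> * norm (V \<xi>)"
  obtain V' where V': "rfourier v' V'" using rfourier_exists[OF w(2)] by blast
  note [measurable] = L2_measurable[OF rfourier_L2(2)[OF V]]
  have V1: "rfourier v' ?V1"
  proof (rule fourier_cong_AE[OF V' _ fourier_weak_deriv[OF w(1) V V']])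
    show "(\<lambda>x. complex_of_real (v' x)) \<in> borel_measurable borel" by (rule L2_measurable[OF L2_of_real[OF w(2)]])
  qed (simp, measurable)
  have Llow: "L2 ?low"
    by (rule L2_bound[OF rfourier_L2(2)[OF V]]) (auto simp: indicator_def)
  have Lsum: "L2 (\<lambda>\<xi>. ?low (\<xi> + - e) + ?low (\<xi> + e))"
    by (intro L2_add L2_translate Llow)
  have pt: "norm (commutator_symbol e ?V1 \<xi>) \<le> norm (?low (\<xi> + - e) + ?low (\<xi> + e))" for \<xi>
  proof -
    have l: "indicator {-e..e} \<eta> * norm (?V1 \<eta>) \<le> e * ?low \<eta>" for \<eta>
      by (auto simp: indicator_def norm_mult intro!: mult_right_mono)
    have "norm (commutator_symbol e ?V1 \<xi>) \<le> (e * ?low (\<xi> - e) + e * ?low (\<xi> + e)) / e"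
      by (rule order_trans[OF norm_commutator_symbol_le[OF e]]) (use e in \<open>intro divide_right_mono add_mono l, simp\<close>)
    also have "\<dots> = ?low (\<xi> + - e) + ?low (\<xi> + e)" using e by (simp add: field_simps)
    finally show ?thesis by simp
  qed
  note K = commutator_rfourier[OF V1, of e]
  have "norm_L2 (commutator_symbol e ?V1) \<le> norm_L2 (\<lambda>\<xi>. ?low (\<xi> + - e) + ?low (\<xi> + e))"
    by (rule norm_L2_mono[OF Lsum L2_measurable[OF rfourier_L2(2)[OF K]]]) (rule AE_I2, rule pt)
  also have "\<dots> \<le> norm_L2 (\<lambda>\<xi>. ?low (\<xi> + - e)) + norm_L2 (\<lambda>\<xi>. ?low (\<xi> + e))"
    by (rule norm_L2_triangle[OF L2_translate[OF Llow] L2_translate[OF Llow]])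
  also have "\<dots> = 2 * norm_L2 ?low" unfolding norm_L2_translate[of ?low] by simp
  finally have "norm_L2 (commutator_symbol e ?V1) \<le> 2 * norm_L2 ?low" .
  moreover have "norm_L2 (commutator_symbol e ?V1) = sqrt (2 * pi) * norm_L2 (commutator e v')"
    using plancherel[OF K] by simp
  moreover have "1 * norm_L2 (commutator e v') \<le> sqrt (2 * pi) * norm_L2 (commutator e v')"
    using pi_ge_two by (intro mult_right_mono) (auto simp: real_le_rsqrt)
  ultimately show ?thesis by linarith
qed

text \<open>The constant is \<open>2 \<cdot> 3\<close>, with \<open>3\<close> bounding the factor \<open>sqrt (2 \<pi>)\<close> of the Plancherel identity.\<close>

lemma commutator_deriv_bound:
  assumes e: "0 < e" and w: "wd v v'" "L2 v" "L2 v'"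
  shows "norm_L2 (commutator e v') \<le> 6 * norm_L2 v"
proof -
  obtain V where V: "rfourier v V" using rfourier_exists[OF w(2)] by blast
  note [measurable] = L2_measurable[OF rfourier_L2(2)[OF V]]
  have "norm_L2 (\<lambda>\<xi>. indicator {-e..e} \<xi> * norm (V \<xi>)) \<le> norm_L2 V"
    by (rule norm_L2_mono[OF rfourier_L2(2)[OF V]]) (auto simp: indicator_def)
  also have "\<dots> = sqrt (2 * pi) * norm_L2 v" using plancherel[OF V] by simp
  also have "\<dots> \<le> 3 * norm_L2 v"
    using pi_less_4 by (intro mult_right_mono) (auto intro!: real_le_lsqrt)
  finally show ?thesis using commutator_deriv_low_frequency[OF e w(1,3) V] by simp
qed

text \<open>The frequencies that contribute shrink to the null set \<open>{0}\<close>.\<close>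

lemma commutator_deriv_tendsto:
  assumes w: "wd v v'" "L2 v" "L2 v'"
  shows "(\<lambda>n. norm_L2 (commutator (ew n) v')) \<longlonglongrightarrow> 0"
proof -
  obtain V where V: "rfourier v V" using rfourier_exists[OF w(2)] by blast
  note [measurable] = L2_measurable[OF rfourier_L2(2)[OF V]]
  have "(\<lambda>n. norm_L2 (\<lambda>\<xi>. indicator {- ew n..ew n} \<xi> * norm (V \<xi>) - 0)) \<longlonglongrightarrow> 0"
  proof (rule dominated_convergence_L2(2)[OF rfourier_L2(2)[OF V]])
    show "AE \<xi> in lborel. (\<lambda>n. indicator {- ew n..ew n} \<xi> * norm (V \<xi>)) \<longlonglongrightarrow> 0"
      using AE_lborel_singleton[of "0::real"]
    proof eventually_elim
      case (elim \<xi>)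
      then have "\<forall>\<^sub>F n in sequentially. ew n < \<bar>\<xi>\<bar>"
        using order_tendstoD(2)[OF ew_tendsto, of "\<bar>\<xi>\<bar>"] by simp
      then have "\<forall>\<^sub>F n in sequentially. indicator {- ew n..ew n} \<xi> * norm (V \<xi>) = 0"
        by eventually_elim (auto simp: indicator_def)
      then show ?case by (rule tendsto_eventually)
    qed
    show "AE \<xi> in lborel. norm (indicator {- ew n..ew n} \<xi> * norm (V \<xi>)) \<le> norm (V \<xi>)" for n
      by (rule AE_I2) (auto simp: indicator_def)
  qed measurable
  then have z: "(\<lambda>n. 2 * norm_L2 (\<lambda>\<xi>. indicator {- ew n..ew n} \<xi> * norm (V \<xi>))) \<longlonglongrightarrow> 0"
    using tendsto_mult_right_zero[of _ _ 2] by simp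
  have "\<forall>n. norm (norm_L2 (commutator (ew n) v')) \<le> 2 * norm_L2 (\<lambda>\<xi>. indicator {- ew n..ew n} \<xi> * norm (V \<xi>))"
    unfolding real_norm_def abs_of_nonneg[OF norm_L2_nonneg]
    using commutator_deriv_low_frequency[OF ew_pos w(1,3) V] by (rule allI)
  then show ?thesis by (rule Lim_null_comparison[OF always_eventually z])
qed

section \<open>Functions with nonnegative frequencies\<close>

text \<open>By Parseval the integral pairs the frequency \<open>\<xi>\<close> of one factor with \<open>-\<xi>\<close> of the other.\<close>

lemma hardy_product_integral_eq_0:
  assumes f: "fourier f F" and g: "fourier g G" and z: "\<And>\<xi>. \<xi> < 0 \<Longrightarrow> F \<xi> = 0" "\<And>\<xi>. \<xi> < 0 \<Longrightarrow> G \<xi> = 0"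
  shows "(LINT x|lborel. f x * g x) = 0"
proof -
  have "(LINT \<xi>|lborel. F \<xi> * cnj (cnj (G (- \<xi>)))) = 2 * pi * (LINT x|lborel. f x * cnj (cnj (g x)))"
    by (rule parseval[OF f fourier_cnj[OF g]])
  moreover have "(LINT \<xi>|lborel. F \<xi> * cnj (cnj (G (- \<xi>)))) = 0"
  proof (rule integral_eq_zero_AE)
    show "AE \<xi> in lborel. F \<xi> * cnj (cnj (G (- \<xi>))) = 0"
      using AE_lborel_singleton[of "0::real"]
    proof eventually_elim
      case (elim \<xi>)
      then show ?case using z(1)[of \<xi>] z(2)[of "-\<xi>"] by (cases "\<xi> < 0") auto
    qed
  qed
  ultimately show ?thesis by simp
qed

text \<open>On nonnegative frequencies \<open>H\<close> is multiplication by \<open>-\<i>\<close>, and it maps real functions to real functions.\<close>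

lemma hardy_hilbert_Re:
  assumes g: "fourier g G" and z: "\<And>\<xi>. \<xi> < 0 \<Longrightarrow> G \<xi> = 0"
  shows "AE x in lborel. hilbert (\<lambda>x. Re (g x)) x = Im (g x)"
proof -
  have 1: "fourier (\<lambda>x. (1/2) * (g x + cnj (g x))) (\<lambda>\<xi>. (1/2) * (G \<xi> + cnj (G (- \<xi>))))"
    by (intro fourier_cmult fourier_add fourier_cnj g)
  have 2: "fourier (\<lambda>x. (1/(2*\<i>)) * (g x - cnj (g x))) (\<lambda>\<xi>. (1/(2*\<i>)) * (G \<xi> - cnj (G (- \<xi>))))"
    by (intro fourier_cmult fourier_diff fourier_cnj g)
  have "(1/2) * (c + cnj c) = complex_of_real (Re c)" "(1/(2*\<i>)) * (c - cnj c) = complex_of_real (Im c)" for c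
    by (simp_all add: complex_eq_iff Re_divide Im_divide)
  with 1 2 have R: "rfourier (\<lambda>x. Re (g x)) (\<lambda>\<xi>. (1/2) * (G \<xi> + cnj (G (- \<xi>))))"
    and I: "rfourier (\<lambda>x. Im (g x)) (\<lambda>\<xi>. (1/(2*\<i>)) * (G \<xi> - cnj (G (- \<xi>))))" by simp_all
  show ?thesis
  proof (rule hilbert_unique[OF R I])
    show "AE \<xi> in lborel. (1/(2*\<i>)) * (G \<xi> - cnj (G (- \<xi>))) = hsymbol \<xi> * ((1/2) * (G \<xi> + cnj (G (- \<xi>))))"
      using AE_lborel_singleton[of "0::real"]
    proof eventually_elim
      case (elim \<xi>)
      have i: "1 / (2 * \<i>) = - \<i> / 2" by (simp add: complex_eq_iff)
      show ?case
        using elim z[of \<xi>] z[of "-\<xi>"] unfolding i by (cases "\<xi> < 0") (auto simp: sgn_if)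
    qed
  qed
qed

lemma L2_mult_AE_bounded:
  fixes u v :: "real \<Rightarrow> real"
  assumes u: "AE x in lborel. \<bar>u x\<bar> \<le> M" "u \<in> borel_measurable borel" and v: "L2 v"
  shows "L2 (\<lambda>x. u x * v x)" "norm_L2 (\<lambda>x. u x * v x) \<le> \<bar>M\<bar> * norm_L2 v"
  using L2_mult_bounded[OF v u(2), of M] u(1) by simp_all

text \<open>The function \<open>f = u + \<i> H u\<close> has only nonnegative frequencies, and so has \<open>f\<^sup>2\<close>, whose real and imaginary
  parts are the two functions in the statement. Boundedness puts \<open>f\<^sup>2\<close> into \<open>L\<^sup>2\<close>.\<close>

theorem cotlar:
  assumes u: "L2 u" and b: "AE x in lborel. \<bar>u x\<bar> \<le> M" "AE x in lborel. \<bar>hilbert u x\<bar> \<le> N"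
  shows "AE x in lborel. hilbert (\<lambda>x. (u x)\<^sup>2 - (hilbert u x)\<^sup>2) x = 2 * u x * hilbert u x"
proof -
  obtain U where U: "rfourier u U" using rfourier_exists[OF u] by blast
  note Lh = hilbert_L2[OF u]
  note [measurable] = L2_measurable[OF u] L2_measurable[OF Lh]
  define f where "f x = complex_of_real (u x) + \<i> * complex_of_real (hilbert u x)" for x
  define F where "F \<xi> = U \<xi> + \<i> * (hsymbol \<xi> * U \<xi>)" for \<xi>
  have fF: "fourier f F" unfolding f_def F_def by (intro fourier_add fourier_cmult U hilbert_rfourier)
  have F0: "F \<xi> = 0" if "\<xi> < 0" for \<xi> using that by (simp add: F_def)
  have Lf: "L2 f" by (rule fourier_L2(1)[OF fF])
  note [measurable] = L2_measurable[OF Lf]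
  have fb: "AE x in lborel. norm (f x) \<le> M + N"
    using b by eventually_elim (auto simp: f_def norm_mult intro!: order_trans[OF norm_triangle_ineq])
  have Lff: "L2 (\<lambda>x. f x * f x)" using L2_mult_bounded[OF Lf _ fb] by simp
  have iff: "integrable lborel (\<lambda>x. f x * f x)" by (rule L2_mult_integrable[OF Lf Lf])
  have z: "fourier_integral (\<lambda>x. f x * f x) \<xi> = 0" if "\<xi> < 0" for \<xi>
  proof -
    have "fourier_integral (\<lambda>x. f x * f x) \<xi> = (LINT x|lborel. (cis (- \<xi> * x) * f x) * f x)"
      unfolding fourier_integral_def by (intro integral_eqI) (simp add: mult_ac)
    also have "\<dots> = 0"
      by (rule hardy_product_integral_eq_0[OF fourier_modulate[OF fF] fF]) (use that F0 in auto)
    finally show ?thesis .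
  qed
  have Re: "Re (f x * f x) = (u x)\<^sup>2 - (hilbert u x)\<^sup>2" and Im: "Im (f x * f x) = 2 * u x * hilbert u x" for x
    by (simp_all add: f_def power2_eq_square)
  show ?thesis using hardy_hilbert_Re[OF fourier_L1[OF iff Lff] z] unfolding Re Im .
qed

section \<open>Polynomial identities for a function and its Hilbert transform\<close>

text \<open>\<open>\<bar>u\<bar> \<le> 1 / (1 + x\<^sup>2) + (1 + x\<^sup>2) u\<^sup>2\<close> by the inequality between the means.\<close>

lemma integrable_of_weighted_L2:
  fixes u :: "real \<Rightarrow> real"
  assumes u: "L2 u" and xu: "L2 (\<lambda>x. x * u x)"
  shows "integrable lborel u"
proof -
  note [measurable] = L2_measurable[OF u]
  have "integrable lborel (\<lambda>x::real. inverse (1 + x\<^sup>2))"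
    using integrable_inverse_1_plus_square by (simp add: set_integrable_def)
  then have w: "integrable lborel (\<lambda>x::real. inverse (1 + x\<^sup>2) + ((u x)\<^sup>2 + (x * u x)\<^sup>2))"
    using L2_mult2_integrable[OF u] L2_mult2_integrable[OF xu] by simp
  show ?thesis
  proof (rule Bochner_Integration.integrable_bound[OF w])
    show "AE x in lborel. norm (u x) \<le> norm (inverse (1 + x\<^sup>2) + ((u x)\<^sup>2 + (x * u x)\<^sup>2))"
    proof (rule AE_I2)
      fix x :: real
      define a where "a = 1 + x\<^sup>2"
      have a: "1 \<le> a" by (simp add: a_def)
      have "2 * (1 * (\<bar>u x\<bar> * a)) \<le> 1\<^sup>2 + (\<bar>u x\<bar> * a)\<^sup>2" using sum_squares_bound[of 1 "\<bar>u x\<bar> * a"] by simp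
      then have "\<bar>u x\<bar> * a \<le> 1 + (u x)\<^sup>2 * a\<^sup>2"
        using mult_nonneg_nonneg[OF abs_ge_zero[of "u x"] order_trans[OF zero_le_one a]]
        unfolding power_mult_distrib power2_abs mult_1 one_power2 by linarith
      then have "\<bar>u x\<bar> * a * inverse a \<le> (1 + (u x)\<^sup>2 * a\<^sup>2) * inverse a" using a by (intro mult_right_mono) auto
      then have "\<bar>u x\<bar> \<le> inverse a + (u x)\<^sup>2 * a" using a by (simp add: field_simps power2_eq_square)
      also have "(u x)\<^sup>2 * a = (u x)\<^sup>2 + (x * u x)\<^sup>2" by (simp add: a_def power_mult_distrib algebra_simps)
      finally show "norm (u x) \<le> norm (inverse (1 + x\<^sup>2) + ((u x)\<^sup>2 + (x * u x)\<^sup>2))" by (simp add: a_def)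
    qed
  qed measurable
qed

lemma L2_of_bounded_mult: "L2 u \<Longrightarrow> L2 v \<Longrightarrow> AE x in lborel. \<bar>u x\<bar> \<le> M \<Longrightarrow> L2 (\<lambda>x. u x * v x)" for u v :: "real \<Rightarrow> real"
  by (rule L2_mult_AE_bounded(1)[OF _ L2_measurable])

lemma integral_hilbert_self: "L2 u \<Longrightarrow> (LINT x|lborel. u x * hilbert u x) = 0"
  using hilbert_antisym[of u u] by (simp add: mult.commute)

text \<open>The transform of the commutator is bounded by a constant over \<open>e\<close> and supported on frequencies of size at most
  \<open>2 e\<close>, so the pairing is bounded by a constant times the maximum of the transform of \<open>b\<close> there. That transform is continuous and vanishes at
  \<open>0\<close> as \<open>b\<close> has mean zero.\<close>

lemma commutator_pairing_tendsto_0: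
  assumes u: "L2 u" "integrable lborel u" and b: "L2 b" "integrable lborel b" "(LINT x|lborel. b x) = 0"
  shows "(\<lambda>n. LINT x|lborel. commutator (ew n) u x * b x) \<longlonglongrightarrow> 0"
proof -
  let ?U = "fourier_integral (\<lambda>x. complex_of_real (u x))" and ?B = "fourier_integral (\<lambda>x. complex_of_real (b x))"
  have iu: "integrable lborel (\<lambda>x. complex_of_real (u x))" and ib: "integrable lborel (\<lambda>x. complex_of_real (b x))"
    using u b by (simp_all add: integrable_of_real)
  have U: "rfourier u ?U" by (rule fourier_L1[OF iu L2_of_real[OF u(1)]])
  have B: "rfourier b ?B" by (rule fourier_L1[OF ib L2_of_real[OF b(1)]])
  note [measurable] = L2_measurable[OF rfourier_L2(2)[OF U]] L2_measurable[OF rfourier_L2(2)[OF B]]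
  have B0: "?B 0 = 0"
    unfolding fourier_integral_def using b(3) by simp
  have contB: "isCont ?B 0"
    unfolding continuous_at_sequentially comp_def using fourier_integral_continuous[OF ib] by blast
  define M where "M = (LINT x|lborel. norm (complex_of_real (u x)))"
  have M: "norm (?U \<xi>) \<le> M" for \<xi> unfolding M_def by (rule norm_fourier_integral_le)
  have M0: "0 \<le> M" unfolding M_def by simp
  have bound: "\<bar>LINT x|lborel. commutator e u x * b x\<bar> \<le> 4 * M * d"
    if e: "0 < e" and d: "\<And>\<xi>. \<bar>\<xi>\<bar> \<le> 2 * e \<Longrightarrow> norm (?B \<xi>) \<le> d" for e d
  proof -
    have d0: "0 \<le> d" using order_trans[OF norm_ge_zero d[of 0]] e by simp
    note K = commutator_rfourier[OF U, of e]
    let ?K = "commutator_symbol e ?U"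
    have pt: "norm (?K \<xi> * cnj (?B \<xi>)) \<le> 2 * M * d / e * indicator {- (2 * e)..2 * e} \<xi>" for \<xi>
    proof (cases "\<bar>\<xi>\<bar> \<le> 2 * e")
      case True
      have "norm (?K \<xi>) \<le> (indicator {-e..e} (\<xi> - e) * norm (?U (\<xi> - e)) + indicator {-e..e} (\<xi> + e) * norm (?U (\<xi> + e))) / e"
        by (rule norm_commutator_symbol_le[OF e])
      also have "\<dots> \<le> (1 * M + 1 * M) / e"
        using e M M0 by (intro divide_right_mono add_mono mult_mono) (auto simp: indicator_def)
      finally have "norm (?K \<xi>) * norm (?B \<xi>) \<le> ((1 * M + 1 * M) / e) * d"
        using d[OF True] M0 e by (intro mult_mono) auto
      then show ?thesis using True by (simp add: norm_mult abs_le_iff)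
    next
      case False
      have "norm (?K \<xi>) \<le> (indicator {-e..e} (\<xi> - e) * norm (?U (\<xi> - e)) + indicator {-e..e} (\<xi> + e) * norm (?U (\<xi> + e))) / e"
        by (rule norm_commutator_symbol_le[OF e])
      also have "\<dots> = 0" using False e by (auto simp: indicator_def)
      finally show ?thesis using M0 d0 e by simp
    qed
    have ii: "integrable lborel (\<lambda>\<xi>. 2 * M * d / e * indicator {- (2 * e)..2 * e} \<xi> :: real)"
      using emeasure_bounded_finite[OF bounded_closed_interval, of "- (2 * e)" "2 * e"]
      by (intro integrable_mult_right) (simp add: integrable_indicator_iff)
    have "complex_of_real (2 * pi * (LINT x|lborel. commutator e u x * b x)) = (LINT \<xi>|lborel. ?K \<xi> * cnj (?B \<xi>))"
      by (rule parseval_real[OF K B])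
    from arg_cong[where f=norm, OF this]
    have "\<bar>2 * pi * (LINT x|lborel. commutator e u x * b x)\<bar> = norm (LINT \<xi>|lborel. ?K \<xi> * cnj (?B \<xi>))"
      by (simp only: norm_of_real)
    also have "\<dots> \<le> (LINT \<xi>|lborel. norm (?K \<xi> * cnj (?B \<xi>)))" by (rule integral_norm_bound)
    also have "\<dots> \<le> (LINT \<xi>|lborel. 2 * M * d / e * indicator {- (2 * e)..2 * e} \<xi>)"
      by (rule integral_mono[OF _ ii pt])
         (intro integrable_norm L2_mult_integrable rfourier_L2(2)[OF K] L2_Re_Im_cnj(3) rfourier_L2(2)[OF B])
    also have "\<dots> = 8 * M * d" using e by simp
    finally have "2 * pi * \<bar>LINT x|lborel. commutator e u x * b x\<bar> \<le> 8 * M * d" by (simp add: abs_mult)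
    moreover have "2 * 1 * \<bar>LINT x|lborel. commutator e u x * b x\<bar> \<le> 2 * pi * \<bar>LINT x|lborel. commutator e u x * b x\<bar>"
      using pi_ge_two by (intro mult_right_mono) auto
    ultimately show ?thesis by simp
  qed
  show ?thesis
  proof (rule LIMSEQ_I)
    fix r :: real assume r: "0 < r"
    define d where "d = r / (4 * M + 1) / 2"
    have d: "0 < d" using r M0 by (simp add: d_def)
    obtain s where s: "0 < s" "\<And>\<xi>. dist \<xi> 0 < s \<Longrightarrow> dist (?B \<xi>) (?B 0) < d"
      using contB[unfolded continuous_at_eps_delta, rule_format, OF d] by blast
    have "\<forall>\<^sub>F n in sequentially. ew n < s / 2"
      using order_tendstoD(2)[OF ew_tendsto, of "s/2"] s(1) by simp
    then obtain N where N: "\<And>n. n \<ge> N \<Longrightarrow> ew n < s / 2" unfolding eventually_sequentially by blast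
    have "norm ((LINT x|lborel. commutator (ew n) u x * b x) - 0) < r" if "n \<ge> N" for n
    proof -
      have "\<bar>LINT x|lborel. commutator (ew n) u x * b x\<bar> \<le> 4 * M * d"
      proof (rule bound[OF ew_pos])
        fix \<xi> :: real assume "\<bar>\<xi>\<bar> \<le> 2 * ew n"
        then have "dist \<xi> 0 < s" using N[OF that] by (simp add: dist_real_def)
        from s(2)[OF this] show "norm (?B \<xi>) \<le> d" by (simp add: B0)
      qed
      also have "\<dots> \<le> (4 * M + 1) * d" using d by (simp add: distrib_right)
      also have "\<dots> = r / 2"
      proof -
        have "c * (r / c / 2) = r / 2" if "c \<noteq> 0" for c :: real using that by simp
        from this[of "4 * M + 1"] show ?thesis unfolding d_def using M0 by linarith
      qed
      finally show ?thesis using r by simp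
    qed
    then show "\<exists>no. \<forall>n\<ge>no. norm ((LINT x|lborel. commutator (ew n) u x * b x) - 0) < r" by blast
  qed
qed

lemma sw_integral_tendsto:
  assumes f: "integrable lborel (\<lambda>x. x * f x)" and [measurable]: "f \<in> borel_measurable borel"
  shows "(\<lambda>n. LINT x|lborel. sw (ew n) x * f x) \<longlonglongrightarrow> (LINT x|lborel. x * f x)"
proof (rule integral_dominated_convergence)
  show "integrable lborel (\<lambda>x. \<bar>x * f x\<bar>)" using f by (rule integrable_abs)
  show "AE x in lborel. (\<lambda>n. sw (ew n) x * f x) \<longlonglongrightarrow> x * f x"
    by (intro AE_I2 tendsto_mult tendsto_const sw_tendsto)
  show "AE x in lborel. norm (sw (ew n) x * f x) \<le> \<bar>x * f x\<bar>" for n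
    by (intro AE_I2) (auto simp: abs_mult intro!: mult_right_mono abs_sw_le_abs)
qed measurable

text \<open>Boundedness of both functions puts \<open>u\<^sup>2\<close>, \<open>u h\<close> and \<open>h\<^sup>2\<close> into \<open>L\<^sup>2\<close>.\<close>

locale bounded_pair =
  fixes u h :: "real \<Rightarrow> real" and M :: real
  assumes u: "L2 u" and hh: "h = hilbert u"
    and bu: "AE x in lborel. \<bar>u x\<bar> \<le> M" and bh: "AE x in lborel. \<bar>h x\<bar> \<le> M"
begin

lemma Lh: "L2 h" unfolding hh by (rule hilbert_L2[OF u])

lemma measurable_uh [measurable]: "u \<in> borel_measurable borel" "h \<in> borel_measurable borel"
  using u Lh by (auto dest: L2_measurable)

lemma Luu: "L2 (\<lambda>x. (u x)\<^sup>2)" and Luh: "L2 (\<lambda>x. u x * h x)" and Lhh: "L2 (\<lambda>x. (h x)\<^sup>2)"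
  unfolding power2_eq_square by (rule L2_of_bounded_mult[OF u u bu] L2_of_bounded_mult[OF u Lh bu] L2_of_bounded_mult[OF Lh Lh bh])+

lemma La: "L2 (\<lambda>x. (u x)\<^sup>2 - (h x)\<^sup>2)" and Lb: "L2 (\<lambda>x. 2 * u x * h x)"
  using L2_diff[OF Luu Lhh] L2_cmult[OF Luh, of 2] by (simp_all add: mult.assoc)

lemma hilbert_a: "AE x in lborel. hilbert (\<lambda>x. (u x)\<^sup>2 - (h x)\<^sup>2) x = 2 * u x * h x"
  using cotlar[OF u bu bh[unfolded hh]] unfolding hh .

lemma inner_hilbert_a:
  assumes v: "L2 v"
  shows "(LINT x|lborel. v x * ((u x)\<^sup>2 - (h x)\<^sup>2)) = (LINT x|lborel. hilbert v x * (2 * u x * h x))"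
proof -
  note [measurable] = L2_measurable[OF hilbert_L2[OF v]] L2_measurable[OF hilbert_L2[OF La]]
  have "(LINT x|lborel. v x * ((u x)\<^sup>2 - (h x)\<^sup>2)) = (LINT x|lborel. hilbert v x * hilbert (\<lambda>x. (u x)\<^sup>2 - (h x)\<^sup>2) x)"
    by (rule hilbert_inner[OF v La, symmetric])
  also have "\<dots> = (LINT x|lborel. hilbert v x * (2 * u x * h x))"
  proof (rule integral_cong_AE)
    show "AE x in lborel. hilbert v x * hilbert (\<lambda>x. (u x)\<^sup>2 - (h x)\<^sup>2) x = hilbert v x * (2 * u x * h x)"
      using hilbert_a by eventually_elim simp
  qed measurable
  finally show ?thesis .
qed

text \<open>The vanishing of the real part of \<open>\<integral> (u + \<i> h)\<^sup>3\<close>.\<close>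

lemma cubic_identity: "(LINT x|lborel. u x ^ 3) = 3 * (LINT x|lborel. u x * (h x)\<^sup>2)"
proof -
  have i: "integrable lborel (\<lambda>x. u x * (u x)\<^sup>2)" "integrable lborel (\<lambda>x. u x * (h x)\<^sup>2)"
    by (rule L2_mult_integrable[OF u Luu] L2_mult_integrable[OF u Lhh])+
  have "(LINT x|lborel. u x * (u x)\<^sup>2) - (LINT x|lborel. u x * (h x)\<^sup>2) = (LINT x|lborel. u x * ((u x)\<^sup>2 - (h x)\<^sup>2))"
    using i by (simp add: right_diff_distrib)
  also have "\<dots> = (LINT x|lborel. h x * (2 * u x * h x))"
    using inner_hilbert_a[OF u] by (simp add: hh)
  also have "\<dots> = (LINT x|lborel. 2 * (u x * (h x)\<^sup>2))"
    by (intro integral_eqI) (simp add: power2_eq_square)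
  also have "\<dots> = 2 * (LINT x|lborel. u x * (h x)\<^sup>2)" by simp
  finally show ?thesis by (simp add: power3_eq_cube power2_eq_square mult.assoc)
qed

text \<open>The vanishing of the real part of \<open>\<integral> (u + \<i> h)\<^sup>4\<close>.\<close>

lemma quartic_identity:
  "(LINT x|lborel. u x ^ 4) + (LINT x|lborel. h x ^ 4) = 6 * (LINT x|lborel. (u x)\<^sup>2 * (h x)\<^sup>2)"
proof -
  have i: "integrable lborel (\<lambda>x. (u x)\<^sup>2 * (u x)\<^sup>2)" "integrable lborel (\<lambda>x. (u x)\<^sup>2 * (h x)\<^sup>2)" "integrable lborel (\<lambda>x. (h x)\<^sup>2 * (h x)\<^sup>2)"
    by (rule L2_mult_integrable[OF Luu Luu] L2_mult_integrable[OF Luu Lhh] L2_mult_integrable[OF Lhh Lhh])+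
  note [measurable] = L2_measurable[OF hilbert_L2[OF La]]
  have "(LINT x|lborel. ((u x)\<^sup>2 - (h x)\<^sup>2) * ((u x)\<^sup>2 - (h x)\<^sup>2)) = (LINT x|lborel. hilbert (\<lambda>x. (u x)\<^sup>2 - (h x)\<^sup>2) x * (2 * u x * h x))"
    by (rule inner_hilbert_a[OF La])
  also have "\<dots> = (LINT x|lborel. 4 * ((u x)\<^sup>2 * (h x)\<^sup>2))"
  proof (rule integral_cong_AE)
    show "AE x in lborel. hilbert (\<lambda>x. (u x)\<^sup>2 - (h x)\<^sup>2) x * (2 * u x * h x) = 4 * ((u x)\<^sup>2 * (h x)\<^sup>2)"
      using hilbert_a by eventually_elim (simp add: power2_eq_square)
  qed measurable
  also have "(\<lambda>x. ((u x)\<^sup>2 - (h x)\<^sup>2) * ((u x)\<^sup>2 - (h x)\<^sup>2)) = (\<lambda>x. (u x)\<^sup>2 * (u x)\<^sup>2 - 2 * ((u x)\<^sup>2 * (h x)\<^sup>2) + (h x)\<^sup>2 * (h x)\<^sup>2)"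
    by (rule ext) (simp add: algebra_simps)
  finally have "(LINT x|lborel. (u x)\<^sup>2 * (u x)\<^sup>2) + (LINT x|lborel. (h x)\<^sup>2 * (h x)\<^sup>2) = 6 * (LINT x|lborel. (u x)\<^sup>2 * (h x)\<^sup>2)"
    using i by simp
  then show ?thesis by (simp add: power4_eq_xxxx power2_eq_square mult.assoc)
qed

text \<open>Cotlar's identity is paired with \<open>w u\<close> for the bounded weight \<open>w\<close>, and moving \<open>w\<close> through \<open>H\<close> produces a
  commutator. This disappears in the limit because \<open>u h\<close> has mean zero.\<close>

lemma weighted_cubic_identity:
  assumes xu: "L2 (\<lambda>x. x * u x)"
  shows "(LINT x|lborel. x * u x ^ 3) = 3 * (LINT x|lborel. x * u x * (h x)\<^sup>2)"
proof -
  let ?a = "\<lambda>x. (u x)\<^sup>2 - (h x)\<^sup>2" and ?b = "\<lambda>x. 2 * u x * h x"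
  have i: "integrable lborel (\<lambda>x. (x * u x) * (u x)\<^sup>2)" "integrable lborel (\<lambda>x. (x * u x) * (h x)\<^sup>2)"
    by (rule L2_mult_integrable[OF xu Luu] L2_mult_integrable[OF xu Lhh])+
  have ib: "integrable lborel ?b" using L2_mult_integrable[OF u Lh] by (simp add: mult.assoc)
  have b0: "(LINT x|lborel. ?b x) = 0" using integral_hilbert_self[OF u] by (simp add: hh mult.assoc)
  have eq: "(LINT x|lborel. sw e x * (u x * ?a x)) = (LINT x|lborel. sw e x * (2 * (u x * (h x)\<^sup>2))) + (LINT x|lborel. commutator e u x * ?b x)" for e
  proof -
    have LK: "L2 (commutator e u)" by (rule commutator_L2[OF u])
    have "(LINT x|lborel. sw e x * (u x * ?a x)) = (LINT x|lborel. (sw e x * u x) * ?a x)"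
      by (simp only: mult.assoc)
    also have "\<dots> = (LINT x|lborel. hilbert (\<lambda>x. sw e x * u x) x * ?b x)"
      by (rule inner_hilbert_a[OF L2_sw[OF u]])
    also have "\<dots> = (LINT x|lborel. (sw e x * h x) * ?b x + commutator e u x * ?b x)"
      by (intro integral_eqI) (simp add: commutator_def hh algebra_simps)
    also have "\<dots> = (LINT x|lborel. (sw e x * h x) * ?b x) + (LINT x|lborel. commutator e u x * ?b x)"
      by (rule Bochner_Integration.integral_add[OF L2_mult_integrable[OF L2_sw[OF Lh] Lb] L2_mult_integrable[OF LK Lb]])
    also have "(LINT x|lborel. (sw e x * h x) * ?b x) = (LINT x|lborel. sw e x * (2 * (u x * (h x)\<^sup>2)))"
      by (intro integral_eqI) (simp add: power2_eq_square)
    finally show ?thesis .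
  qed
  have l1: "(\<lambda>n. LINT x|lborel. sw (ew n) x * (u x * ?a x)) \<longlonglongrightarrow> (LINT x|lborel. x * (u x * ?a x))"
  proof (rule sw_integral_tendsto)
    show "integrable lborel (\<lambda>x. x * (u x * ?a x))"
      using L2_mult_integrable[OF xu La] by (simp add: mult.assoc)
  qed measurable
  have l2: "(\<lambda>n. LINT x|lborel. sw (ew n) x * (2 * (u x * (h x)\<^sup>2))) \<longlonglongrightarrow> (LINT x|lborel. x * (2 * (u x * (h x)\<^sup>2)))"
  proof (rule sw_integral_tendsto)
    show "integrable lborel (\<lambda>x. x * (2 * (u x * (h x)\<^sup>2)))"
      using integrable_mult_right[OF i(2), of 2] by (simp add: mult_ac)
  qed measurable
  have l3: "(\<lambda>n. LINT x|lborel. commutator (ew n) u x * ?b x) \<longlonglongrightarrow> 0"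
    by (rule commutator_pairing_tendsto_0[OF u integrable_of_weighted_L2[OF u xu] Lb ib b0])
  have "(\<lambda>n. LINT x|lborel. sw (ew n) x * (u x * ?a x)) \<longlonglongrightarrow> (LINT x|lborel. x * (2 * (u x * (h x)\<^sup>2))) + 0"
    unfolding eq by (rule tendsto_add[OF l2 l3])
  from LIMSEQ_unique[OF l1 this]
  have "(LINT x|lborel. x * (u x * ?a x)) = (LINT x|lborel. x * (2 * (u x * (h x)\<^sup>2)))" by simp
  moreover have "(LINT x|lborel. x * (u x * ?a x)) = (LINT x|lborel. (x * u x) * (u x)\<^sup>2 - (x * u x) * (h x)\<^sup>2)"
    by (intro integral_eqI) (simp add: algebra_simps)
  moreover have "(LINT x|lborel. x * (2 * (u x * (h x)\<^sup>2))) = (LINT x|lborel. 2 * ((x * u x) * (h x)\<^sup>2))"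
    by (intro integral_eqI) (simp add: mult_ac)
  ultimately have "(LINT x|lborel. (x * u x) * (u x)\<^sup>2) - (LINT x|lborel. (x * u x) * (h x)\<^sup>2) = 2 * (LINT x|lborel. (x * u x) * (h x)\<^sup>2)"
    using i by simp
  then show ?thesis by (simp add: power3_eq_cube power2_eq_square mult.assoc)
qed

end

section \<open>Continuous curves in \<open>L\<^sup>2\<close>\<close>

text \<open>Square integrable and essentially bounded. These functions form an algebra, which is where the nonlinear
  terms live.\<close>

definition BL :: "(real \<Rightarrow> real) \<Rightarrow> bool" where
  "BL u \<longleftrightarrow> L2 u \<and> (\<exists>M. AE x in lborel. \<bar>u x\<bar> \<le> M)"

lemma BL_L2: "BL u \<Longrightarrow> L2 u"
  by (simp add: BL_def)

lemma BL_mult_L2: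
  assumes "BL u" "L2 v" shows "L2 (\<lambda>x. u x * v x)"
proof -
  obtain M where "AE x in lborel. \<bar>u x\<bar> \<le> M" using assms(1) unfolding BL_def by blast
  then show ?thesis by (rule L2_of_bounded_mult[OF BL_L2[OF assms(1)] assms(2)])
qed

lemma BL_mult:
  assumes "BL u" "BL v" shows "BL (\<lambda>x. u x * v x)"
proof -
  obtain M where M: "AE x in lborel. \<bar>u x\<bar> \<le> M" using assms(1) unfolding BL_def by blast
  obtain N where N: "AE x in lborel. \<bar>v x\<bar> \<le> N" using assms(2) unfolding BL_def by blast
  have "AE x in lborel. \<bar>u x * v x\<bar> \<le> M * N"
    using M N
  proof eventually_elim
    case (elim x)
    then show ?case unfolding abs_mult by (intro mult_mono) auto
  qed
  then show ?thesis unfolding BL_def using BL_mult_L2[OF assms(1) BL_L2[OF assms(2)]] by blast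
qed

lemma BL_cmult:
  assumes "BL u" shows "BL (\<lambda>x. c * u x)"
proof -
  obtain M where M: "AE x in lborel. \<bar>u x\<bar> \<le> M" using assms(1) unfolding BL_def by blast
  have "AE x in lborel. \<bar>c * u x\<bar> \<le> \<bar>c\<bar> * M"
    using M by eventually_elim (auto simp: abs_mult intro: mult_left_mono)
  then show ?thesis unfolding BL_def using L2_cmult[OF BL_L2[OF assms]] by blast
qed

lemma BL_diff:
  assumes "BL u" "BL v" shows "BL (\<lambda>x. u x - v x)"
proof -
  obtain M where M: "AE x in lborel. \<bar>u x\<bar> \<le> M" using assms(1) unfolding BL_def by blast
  obtain N where N: "AE x in lborel. \<bar>v x\<bar> \<le> N" using assms(2) unfolding BL_def by blast
  have "AE x in lborel. \<bar>u x - v x\<bar> \<le> M + N"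
    using M N by eventually_elim linarith
  then show ?thesis unfolding BL_def using L2_diff[OF BL_L2[OF assms(1)] BL_L2[OF assms(2)]] by blast
qed

lemma BL_wd: "wd u u' \<Longrightarrow> L2 u \<Longrightarrow> L2 u' \<Longrightarrow> BL u"
  unfolding BL_def using wd_sup_bound by blast

lemma L2_cos: "L2 u \<Longrightarrow> L2 (\<lambda>x. cos (e * x) * u x)" and norm_L2_cos: "L2 u \<Longrightarrow> norm_L2 (\<lambda>x. cos (e * x) * u x) \<le> norm_L2 u"
  using L2_mult_bounded[of u "\<lambda>x. cos (e * x)" 1] by simp_all

lemma L2_sin: "L2 u \<Longrightarrow> L2 (\<lambda>x. sin (e * x) * u x)" and norm_L2_sin: "L2 u \<Longrightarrow> norm_L2 (\<lambda>x. sin (e * x) * u x) \<le> norm_L2 u"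
  using L2_mult_bounded[of u "\<lambda>x. sin (e * x)" 1] by simp_all

lemma continuous_L2_iff:
  "continuous_L2 u \<longleftrightarrow> (\<forall>t. L2 (u t)) \<and> (\<forall>t. ((\<lambda>s. norm_L2 (\<lambda>x. u s x - u t x)) \<longlongrightarrow> 0) (at t))"
  unfolding continuous_L2_def tendsto_L2_def by (auto intro!: always_eventually L2_diff)

lemma continuous_L2D:
  "continuous_L2 u \<Longrightarrow> L2 (u t)"
  "continuous_L2 u \<Longrightarrow> ((\<lambda>s. norm_L2 (\<lambda>x. u s x - u t x)) \<longlongrightarrow> 0) (at t)"
  by (simp_all add: continuous_L2_iff)

lemma continuous_L2_I:
  assumes L: "\<And>t. L2 (u t)" and b: "\<And>s t. norm_L2 (\<lambda>x. u s x - u t x) \<le> B t s"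
    and z: "\<And>t. (B t \<longlongrightarrow> 0) (at t)"
  shows "continuous_L2 u"
  unfolding continuous_L2_iff
proof (intro conjI allI L)
  fix t
  have "\<forall>s. norm (norm_L2 (\<lambda>x. u s x - u t x)) \<le> B t s"
    unfolding real_norm_def abs_of_nonneg[OF norm_L2_nonneg] using b by blast
  then show "((\<lambda>s. norm_L2 (\<lambda>x. u s x - u t x)) \<longlongrightarrow> 0) (at t)"
    by (rule Lim_null_comparison[OF always_eventually z])
qed

lemma continuous_L2_const: "L2 f \<Longrightarrow> continuous_L2 (\<lambda>t. f)"
  by (simp add: continuous_L2_iff)

lemma continuous_L2_add:
  assumes u: "continuous_L2 u" and v: "continuous_L2 v"
  shows "continuous_L2 (\<lambda>t x. u t x + v t x)"
proof (rule continuous_L2_I)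
  show "L2 (\<lambda>x. u t x + v t x)" for t by (intro L2_add continuous_L2D(1) u v)
  show "norm_L2 (\<lambda>x. u s x + v s x - (u t x + v t x)) \<le> norm_L2 (\<lambda>x. u s x - u t x) + norm_L2 (\<lambda>x. v s x - v t x)" for s t
    using norm_L2_triangle[OF L2_diff[OF continuous_L2D(1)[OF u] continuous_L2D(1)[OF u]] L2_diff[OF continuous_L2D(1)[OF v] continuous_L2D(1)[OF v]], of s t s t]
    by (simp add: algebra_simps)
  show "((\<lambda>s. norm_L2 (\<lambda>x. u s x - u t x) + norm_L2 (\<lambda>x. v s x - v t x)) \<longlongrightarrow> 0) (at t)" for t
    using tendsto_add[OF continuous_L2D(2)[OF u] continuous_L2D(2)[OF v]] by simp
qed

lemma continuous_L2_bounded_mult: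
  assumes u: "continuous_L2 u" and w: "w \<in> borel_measurable borel" "\<And>x. \<bar>w x\<bar> \<le> c"
  shows "continuous_L2 (\<lambda>t x. w x * u t x)"
proof (rule continuous_L2_I)
  have b: "L2 f \<Longrightarrow> L2 (\<lambda>x. w x * f x) \<and> norm_L2 (\<lambda>x. w x * f x) \<le> \<bar>c\<bar> * norm_L2 f" for f
    by (rule L2_mult_bounded[OF _ w(1)]) (auto simp: w(2))
  show "L2 (\<lambda>x. w x * u t x)" for t using b[OF continuous_L2D(1)[OF u]] by blast
  show "norm_L2 (\<lambda>x. w x * u s x - w x * u t x) \<le> \<bar>c\<bar> * norm_L2 (\<lambda>x. u s x - u t x)" for s t
    using b[OF L2_diff[OF continuous_L2D(1)[OF u] continuous_L2D(1)[OF u]], of s t] by (simp add: right_diff_distrib)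
  show "((\<lambda>s. \<bar>c\<bar> * norm_L2 (\<lambda>x. u s x - u t x)) \<longlongrightarrow> 0) (at t)" for t
    by (rule tendsto_mult_right_zero[OF continuous_L2D(2)[OF u]])
qed

lemma continuous_L2_cmult: "continuous_L2 u \<Longrightarrow> continuous_L2 (\<lambda>t x. c * u t x)"
  by (rule continuous_L2_bounded_mult[where c="\<bar>c\<bar>"]) auto

lemma continuous_L2_diff: "continuous_L2 u \<Longrightarrow> continuous_L2 v \<Longrightarrow> continuous_L2 (\<lambda>t x. u t x - v t x)"
  using continuous_L2_add[OF _ continuous_L2_cmult[of v "-1"], of u] by simp

lemma continuous_L2_hilbert:
  assumes u: "continuous_L2 u"
  shows "continuous_L2 (\<lambda>t. hilbert (u t))"
proof (rule continuous_L2_I)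
  note L = continuous_L2D(1)[OF u]
  show "L2 (hilbert (u t))" for t by (rule hilbert_L2[OF L])
  show "norm_L2 (\<lambda>x. hilbert (u s) x - hilbert (u t) x) \<le> norm_L2 (\<lambda>x. u s x - u t x)" for s t
  proof -
    have "norm_L2 (\<lambda>x. hilbert (u s) x - hilbert (u t) x) = norm_L2 (hilbert (\<lambda>x. u s x - u t x))"
    proof (rule norm_L2_cong_AE)
      show "AE x in lborel. hilbert (u s) x - hilbert (u t) x = hilbert (\<lambda>x. u s x - u t x) x"
        using hilbert_diff[OF L L, of s t] by eventually_elim simp
      show "(\<lambda>x. hilbert (u s) x - hilbert (u t) x) \<in> borel_measurable borel"
        by (rule L2_measurable[OF L2_diff[OF hilbert_L2[OF L] hilbert_L2[OF L]]])
      show "hilbert (\<lambda>x. u s x - u t x) \<in> borel_measurable borel"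
        by (rule L2_measurable[OF hilbert_L2[OF L2_diff[OF L L]]])
    qed
    then show ?thesis using norm_L2_hilbert[OF L2_diff[OF L L]] by simp
  qed
qed (rule continuous_L2D(2)[OF u])

lemma continuous_L2_norm:
  assumes u: "continuous_L2 u"
  shows "continuous_on UNIV (\<lambda>t. norm_L2 (u t))"
proof -
  have "((\<lambda>s. norm_L2 (u s) - norm_L2 (u t)) \<longlongrightarrow> 0) (at t)" for t
    by (rule Lim_null_comparison[OF always_eventually continuous_L2D(2)[OF u]])
       (simp add: norm_L2_diff_ge[OF continuous_L2D(1)[OF u] continuous_L2D(1)[OF u]])
  from LIM_zero_cancel[OF this] show ?thesis
    by (auto intro!: continuous_at_imp_continuous_on simp: isCont_def)
qed

text \<open>Multiplication by a family that is continuous into \<open>H\<^sup>1\<close>, hence into \<open>L\<^sup>\<infinity>\<close>.\<close>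

lemma continuous_L2_H1_mult:
  assumes u: "continuous_L2 u" "continuous_L2 u'" "\<And>t. wd (u t) (u' t)" and v: "continuous_L2 v"
  shows "continuous_L2 (\<lambda>t x. u t x * v t x)"
proof (rule continuous_L2_I)
  note Lu = continuous_L2D(1)[OF u(1)] and Lu' = continuous_L2D(1)[OF u(2)] and Lv = continuous_L2D(1)[OF v]
  let ?S = "\<lambda>s. norm_L2 (u s) + norm_L2 (u' s)"
    and ?d = "\<lambda>t s. norm_L2 (\<lambda>x. u s x - u t x) + norm_L2 (\<lambda>x. u' s x - u' t x)"
  show "L2 (\<lambda>x. u t x * v t x)" for t by (rule BL_mult_L2[OF BL_wd[OF u(3) Lu Lu'] Lv])
  show "norm_L2 (\<lambda>x. u s x * v s x - u t x * v t x) \<le> ?S s * norm_L2 (\<lambda>x. v s x - v t x) + ?d t s * norm_L2 (v t)" for s t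
  proof -
    have 1: "L2 (\<lambda>x. u s x * (v s x - v t x))" "norm_L2 (\<lambda>x. u s x * (v s x - v t x)) \<le> \<bar>?S s\<bar> * norm_L2 (\<lambda>x. v s x - v t x)"
      by (rule L2_mult_AE_bounded[OF wd_sup_bound[OF u(3) Lu Lu'] L2_measurable[OF Lu] L2_diff[OF Lv Lv]])+
    have 2: "L2 (\<lambda>x. (u s x - u t x) * v t x)" "norm_L2 (\<lambda>x. (u s x - u t x) * v t x) \<le> \<bar>?d t s\<bar> * norm_L2 (v t)"
      by (rule L2_mult_AE_bounded[OF wd_sup_bound[OF wd_diff[OF u(3) u(3)] L2_diff[OF Lu Lu] L2_diff[OF Lu' Lu']] L2_measurable[OF L2_diff[OF Lu Lu]] Lv])+
    have "norm_L2 (\<lambda>x. u s x * v s x - u t x * v t x) = norm_L2 (\<lambda>x. u s x * (v s x - v t x) + (u s x - u t x) * v t x)"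
      by (simp add: algebra_simps)
    also have "\<dots> \<le> norm_L2 (\<lambda>x. u s x * (v s x - v t x)) + norm_L2 (\<lambda>x. (u s x - u t x) * v t x)"
      by (rule norm_L2_triangle[OF 1(1) 2(1)])
    also have "\<dots> \<le> \<bar>?S s\<bar> * norm_L2 (\<lambda>x. v s x - v t x) + \<bar>?d t s\<bar> * norm_L2 (v t)"
      by (rule add_mono[OF 1(2) 2(2)])
    finally show ?thesis by simp
  qed
  show "((\<lambda>s. ?S s * norm_L2 (\<lambda>x. v s x - v t x) + ?d t s * norm_L2 (v t)) \<longlongrightarrow> 0) (at t)" for t
  proof -
    have c: "((\<lambda>s. norm_L2 (w s)) \<longlongrightarrow> norm_L2 (w t)) (at t)" if "continuous_L2 w" for w
      using continuous_L2_norm[OF that] by (simp add: continuous_on_eq_continuous_at isCont_def)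
    have "((\<lambda>s. ?S s * norm_L2 (\<lambda>x. v s x - v t x) + ?d t s * norm_L2 (v t)) \<longlongrightarrow> ?S t * 0 + (0 + 0) * norm_L2 (v t)) (at t)"
      by (intro tendsto_add tendsto_mult tendsto_const c u continuous_L2D(2)[OF u(1)] continuous_L2D(2)[OF u(2)] continuous_L2D(2)[OF v])
    then show ?thesis by simp
  qed
qed

lemma continuous_L2_scale:
  assumes u: "continuous_L2 u" and c: "continuous_on UNIV c"
  shows "continuous_L2 (\<lambda>t x. c t * u t x)"
proof (rule continuous_L2_I)
  note L = continuous_L2D(1)[OF u]
  show "L2 (\<lambda>x. c t * u t x)" for t by (rule L2_cmult[OF L])
  show "norm_L2 (\<lambda>x. c s * u s x - c t * u t x) \<le> \<bar>c s\<bar> * norm_L2 (\<lambda>x. u s x - u t x) + \<bar>c s - c t\<bar> * norm_L2 (u t)" for s t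
  proof -
    have "norm_L2 (\<lambda>x. c s * u s x - c t * u t x) = norm_L2 (\<lambda>x. c s * (u s x - u t x) + (c s - c t) * u t x)"
      by (simp add: algebra_simps)
    also have "\<dots> \<le> norm_L2 (\<lambda>x. c s * (u s x - u t x)) + norm_L2 (\<lambda>x. (c s - c t) * u t x)"
      by (intro norm_L2_triangle L2_cmult L2_diff L)
    finally show ?thesis by (simp add: norm_L2_cmult)
  qed
  show "((\<lambda>s. \<bar>c s\<bar> * norm_L2 (\<lambda>x. u s x - u t x) + \<bar>c s - c t\<bar> * norm_L2 (u t)) \<longlongrightarrow> 0) (at t)" for t
  proof -
    have ct: "(c \<longlongrightarrow> c t) (at t)" using c by (simp add: continuous_on_eq_continuous_at isCont_def)
    have "((\<lambda>s. \<bar>c s\<bar> * norm_L2 (\<lambda>x. u s x - u t x) + \<bar>c s - c t\<bar> * norm_L2 (u t)) \<longlongrightarrow> \<bar>c t\<bar> * 0 + \<bar>c t - c t\<bar> * norm_L2 (u t)) (at t)"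
      by (intro tendsto_add tendsto_mult tendsto_const tendsto_rabs tendsto_diff ct continuous_L2D(2)[OF u])
    then show ?thesis by simp
  qed
qed

text \<open>Differentiating a functional that is only quadratic or polynomial in \<open>\<phi>\<close>: it suffices that its
  increments are pairings of the increment of \<open>\<phi>\<close> with a family that is continuous in \<open>L\<^sup>2\<close>.\<close>

lemma derivative_of_pairing:
  assumes d: "has_L2_deriv u v t" and W: "continuous_L2 W"
    and X: "\<And>s. X s - X t = (LINT x|lborel. (u s x - u t x) * W s x)"
  shows "(X has_real_derivative (LINT x|lborel. v x * W t x)) (at t)"
  unfolding DERIV_def
proof (rule Lim_transform_eventually)
  let ?q = "\<lambda>h x. (u (t + h) x - u t x) / h"
  have Lv: "L2 v" and ev: "\<forall>\<^sub>F h in at 0. L2 (\<lambda>x. ?q h x - v x)" and lim: "((\<lambda>h. norm_L2 (\<lambda>x. ?q h x - v x)) \<longlongrightarrow> 0) (at 0)"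
    using d unfolding has_L2_deriv_def tendsto_L2_def by auto
  show "((\<lambda>h. LINT x|lborel. ?q h x * W (t + h) x) \<longlongrightarrow> (LINT x|lborel. v x * W t x)) (at 0)"
  proof (rule tendsto_L2_mult[OF _ _ Lv continuous_L2D(1)[OF W] lim])
    show "\<forall>\<^sub>F h in at 0. L2 (?q h)"
      using ev
    proof eventually_elim
      case (elim h)
      from L2_add[OF elim Lv] show ?case by simp
    qed
    show "\<forall>\<^sub>F h in at 0. L2 (W (t + h))" by (intro always_eventually allI continuous_L2D(1)[OF W])
    show "((\<lambda>h. norm_L2 (\<lambda>x. W (t + h) x - W t x)) \<longlongrightarrow> 0) (at 0)"
      by (rule LIM_offset_zero[OF continuous_L2D(2)[OF W]])
  qed
  show "\<forall>\<^sub>F h in at 0. (LINT x|lborel. ?q h x * W (t + h) x) = (X (t + h) - X t) / h"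
  proof (rule always_eventually, rule allI)
    fix h
    have "(LINT x|lborel. ?q h x * W (t + h) x) = (LINT x|lborel. (u (t + h) x - u t x) * W (t + h) x / h)"
      by (intro integral_eqI) simp
    also have "\<dots> = (X (t + h) - X t) / h" unfolding X by simp
    finally show "(LINT x|lborel. ?q h x * W (t + h) x) = (X (t + h) - X t) / h" .
  qed
qed

text \<open>Passing to the limit in \<open>X\<^sub>n b - X\<^sub>n a = \<integral> D\<^sub>n\<close>; gauge integrals need no measurability in time.\<close>

lemma limit_of_derivatives:
  fixes X :: "nat \<Rightarrow> real \<Rightarrow> real"
  assumes ab: "a \<le> b" and d: "\<And>n t. t \<in> {a..b} \<Longrightarrow> (X n has_real_derivative D n t) (at t)"
    and bd: "\<And>n t. t \<in> {a..b} \<Longrightarrow> \<bar>D n t\<bar> \<le> C"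
    and l: "\<And>t. t \<in> {a..b} \<Longrightarrow> (\<lambda>n. D n t) \<longlonglongrightarrow> d t" and L: "\<And>t. t \<in> {a..b} \<Longrightarrow> (\<lambda>n. X n t) \<longlonglongrightarrow> x t"
  shows "x b - x a = integral {a..b} d"
proof -
  have hi: "(D n has_integral X n b - X n a) {a..b}" for n
  proof (rule fundamental_theorem_of_calculus[OF ab])
    fix t assume "t \<in> {a..b}"
    from d[OF this] show "(X n has_vector_derivative D n t) (at t within {a..b})"
      by (simp add: has_real_derivative_iff_has_vector_derivative has_vector_derivative_at_within)
  qed
  have "(\<lambda>n. integral {a..b} (D n)) \<longlonglongrightarrow> integral {a..b} d"
  proof (rule dominated_convergence(2))
    show "D n integrable_on {a..b}" for n using hi by blast
    show "(\<lambda>_. C) integrable_on {a..b}" by (rule integrable_const_ivl)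
    show "norm (D n t) \<le> C" if "t \<in> {a..b}" for n t using bd[OF that] by simp
    show "(\<lambda>n. D n t) \<longlonglongrightarrow> d t" if "t \<in> {a..b}" for t by (rule l[OF that])
  qed
  then have "(\<lambda>n. X n b - X n a) \<longlonglongrightarrow> integral {a..b} d"
    using integral_unique[OF hi] by simp
  moreover have "(\<lambda>n. X n b - X n a) \<longlonglongrightarrow> x b - x a"
    using ab by (intro tendsto_diff L) auto
  ultimately show ?thesis using LIMSEQ_unique by blast
qed

section \<open>The flow in \<open>H\<^sup>2\<close>\<close>

lemma momentum_increment_split: "(a - 1/3 * b) - (c - 1/3 * d) = (a - m) + (m - c) - 1/3 * (b - d :: real)"
  by (simp add: field_simps)

text \<open>The evolution equation for a curve \<open>f\<close> with given first and second weak derivatives \<open>f1\<close> and \<open>f2\<close>, all of them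
  continuous in \<open>L\<^sup>2\<close>. Having the derivatives as parameters avoids the choice of representatives in \<open>weak_deriv\<close>.\<close>

locale bo_flow =
  fixes f f1 f2 :: "real \<Rightarrow> real \<Rightarrow> real"
  assumes cf: "continuous_L2 f" and cf1: "continuous_L2 f1" and cf2: "continuous_L2 f2"
    and wf: "wd (f t) (f1 t)" and wf1: "wd (f1 t) (f2 t)"
    and evolution: "has_L2_deriv f (\<lambda>x. - hilbert (f2 t) x + f t x * f1 t x) t"
begin

text \<open>With \<open>f = \<phi>\<close>, the functions \<open>g\<close>, \<open>g1\<close> and \<open>v\<close> are \<open>H \<phi>\<^sub>x\<close>, \<open>H \<phi>\<^sub>x\<^sub>x\<close> and \<open>\<phi>\<^sub>t\<close>.\<close>

abbreviation "g t \<equiv> hilbert (f1 t)"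
abbreviation "g1 t \<equiv> hilbert (f2 t)"
abbreviation "v t x \<equiv> - g1 t x + f t x * f1 t x"

lemma Lf: "L2 (f t)" and Lf1: "L2 (f1 t)" and Lf2: "L2 (f2 t)"
  by (rule continuous_L2D(1)[OF cf] continuous_L2D(1)[OF cf1] continuous_L2D(1)[OF cf2])+

lemma Lg: "L2 (g t)" and Lg1: "L2 (g1 t)"
  by (rule hilbert_L2[OF Lf1] hilbert_L2[OF Lf2])+

lemma wg: "wd (g t) (g1 t)"
  by (rule wd_hilbert[OF wf1 Lf1 Lf2])

lemma whf: "wd (hilbert (f t)) (g t)"
  by (rule wd_hilbert[OF wf Lf Lf1])

lemma Bf: "BL (f t)" and Bf1: "BL (f1 t)" and Bg: "BL (g t)" and Bh: "BL (hilbert (f t))"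
  by (rule BL_wd[OF wf Lf Lf1] BL_wd[OF wf1 Lf1 Lf2] BL_wd[OF wg Lg Lg1] BL_wd[OF whf hilbert_L2[OF Lf] Lg])+

lemma meas [measurable]: "f t \<in> borel_measurable borel" "f1 t \<in> borel_measurable borel" "f2 t \<in> borel_measurable borel"
  "g t \<in> borel_measurable borel" "g1 t \<in> borel_measurable borel" "hilbert (f t) \<in> borel_measurable borel"
  using Lf Lf1 Lf2 Lg Lg1 hilbert_L2[OF Lf] by (auto dest: L2_measurable)

lemma Lv: "L2 (v t)"
  by (intro L2_add L2_uminus Lg1 BL_mult_L2[OF Bf Lf1])

lemma cg: "continuous_L2 g" by (rule continuous_L2_hilbert[OF cf1])
lemma cg1: "continuous_L2 g1" by (rule continuous_L2_hilbert[OF cf2])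

definition H2_size :: "real \<Rightarrow> real" where
  "H2_size t = norm_L2 (f t) + norm_L2 (f1 t) + norm_L2 (f2 t)"

lemma H2_size_nonneg: "0 \<le> H2_size t" by (simp add: H2_size_def)

lemma norm_le_H2_size: "norm_L2 (f t) \<le> H2_size t" "norm_L2 (f1 t) \<le> H2_size t" "norm_L2 (f2 t) \<le> H2_size t" "norm_L2 (g t) \<le> H2_size t" "norm_L2 (g1 t) \<le> H2_size t"
  by (simp_all add: H2_size_def norm_L2_hilbert[OF Lf1] norm_L2_hilbert[OF Lf2])

lemma sup_le_H2_size: "AE x in lborel. \<bar>f t x\<bar> \<le> H2_size t" "AE x in lborel. \<bar>f1 t x\<bar> \<le> H2_size t"
  "AE x in lborel. \<bar>g t x\<bar> \<le> H2_size t" "AE x in lborel. \<bar>hilbert (f t) x\<bar> \<le> H2_size t"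
proof -
  have m: "AE x in lborel. \<bar>u x\<bar> \<le> H2_size t" if "AE x in lborel. \<bar>u x\<bar> \<le> c" "c \<le> H2_size t" for u c
    using that(1) by eventually_elim (use that(2) in linarith)
  show "AE x in lborel. \<bar>f t x\<bar> \<le> H2_size t" by (rule m[OF wd_sup_bound[OF wf Lf Lf1]]) (simp add: H2_size_def)
  show "AE x in lborel. \<bar>f1 t x\<bar> \<le> H2_size t" by (rule m[OF wd_sup_bound[OF wf1 Lf1 Lf2]]) (simp add: H2_size_def)
  show "AE x in lborel. \<bar>g t x\<bar> \<le> H2_size t" by (rule m[OF wd_sup_bound[OF wg Lg Lg1]]) (simp add: H2_size_def norm_L2_hilbert[OF Lf1] norm_L2_hilbert[OF Lf2])
  show "AE x in lborel. \<bar>hilbert (f t) x\<bar> \<le> H2_size t"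
    by (rule m[OF wd_sup_bound[OF whf hilbert_L2[OF Lf] Lg]]) (simp add: H2_size_def norm_L2_hilbert[OF Lf] norm_L2_hilbert[OF Lf1])
qed

lemma H2_size_locally_bounded: obtains B where "\<And>t. t \<in> {a..b} \<Longrightarrow> H2_size t \<le> B"
proof -
  have "continuous_on {a..b} H2_size"
    unfolding H2_size_def[abs_def]
    by (intro continuous_on_add continuous_on_subset[OF continuous_L2_norm] cf cf1 cf2) auto
  then have "bounded (H2_size ` {a..b})" by (intro compact_imp_bounded compact_continuous_image) auto
  then obtain B where B: "\<forall>y\<in>H2_size ` {a..b}. norm y \<le> B" unfolding bounded_iff by blast
  show ?thesis
  proof (rule that)
    fix t assume "t \<in> {a..b}"
    then have "norm (H2_size t) \<le> B" using B by blast
    then show "H2_size t \<le> B" by simp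
  qed
qed

lemma pair_f: "bounded_pair (f t) (hilbert (f t)) (H2_size t)"
  by unfold_locales (rule Lf refl sup_le_H2_size(1) sup_le_H2_size(4))+

lemma pair_f1: "bounded_pair (f1 t) (g t) (H2_size t)"
  by unfold_locales (rule Lf1 refl sup_le_H2_size(2) sup_le_H2_size(3))+

subsection \<open>The truncated second moment\<close>

definition mass_moment :: "real \<Rightarrow> real \<Rightarrow> real" where
  "mass_moment e t = (LINT x|lborel. (sw e x * f t x)\<^sup>2)"

text \<open>The part of \<open>\<partial>\<^sub>x\<^sup>2 (w f)\<close>, for the weight \<open>w = sw e\<close>, in which the weight is differentiated.\<close>

definition leibniz_rest :: "real \<Rightarrow> real \<Rightarrow> real \<Rightarrow> real" where
  "leibniz_rest e t x = 2 * (cos (e * x) * f1 t x) - e * (sin (e * x) * f t x)"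

text \<open>The time derivative of the truncated moment, written so that it can be bounded by the moment itself,
  uniformly in \<open>e\<close>: the second derivative of \<open>f\<close> occurs only inside the commutator.\<close>

definition mass_moment_deriv :: "real \<Rightarrow> real \<Rightarrow> real" where
  "mass_moment_deriv e t = 2 * (LINT x|lborel. (sw e x * f t x) * (hilbert (leibniz_rest e t) x + commutator e (f2 t) x))
     + 2 * (LINT x|lborel. (sw e x * f t x) * (sw e x * f t x * f1 t x))"

lemma mass_moment_nonneg: "0 \<le> mass_moment e t" by (simp add: mass_moment_def)

lemma sqrt_mass_moment: "norm_L2 (\<lambda>x. sw e x * f t x) = sqrt (mass_moment e t)"
  by (simp add: norm_L2_def mass_moment_def)

lemma Lr: "L2 (leibniz_rest e t)"
  unfolding leibniz_rest_def[abs_def] by (intro L2_diff L2_cmult L2_cos L2_sin Lf Lf1)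

lemma norm_leibniz_rest_le:
  assumes "0 < e" "e \<le> 1" shows "norm_L2 (leibniz_rest e t) \<le> 3 * H2_size t"
proof -
  have "norm_L2 (leibniz_rest e t) \<le> norm_L2 (\<lambda>x. 2 * (cos (e * x) * f1 t x)) + norm_L2 (\<lambda>x. e * (sin (e * x) * f t x))"
    unfolding leibniz_rest_def[abs_def] by (intro norm_L2_triangle_diff L2_cmult L2_cos L2_sin Lf Lf1)
  also have "\<dots> = 2 * norm_L2 (\<lambda>x. cos (e * x) * f1 t x) + e * norm_L2 (\<lambda>x. sin (e * x) * f t x)"
    using assms by (simp add: norm_L2_cmult)
  also have "\<dots> \<le> 2 * H2_size t + 1 * H2_size t"
    using assms norm_L2_cos[OF Lf1, of e t] norm_L2_sin[OF Lf, of e t] norm_le_H2_size[of t] H2_size_nonneg[of t]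
    by (intro add_mono mult_mono) auto
  finally show ?thesis by simp
qed

text \<open>With \<open>u = sw e f\<close> the pairing of \<open>u\<close> with \<open>H u\<^sub>x\<^sub>x\<close> vanishes, since \<open>\<integral> u\<^sub>x H u\<^sub>x = 0\<close>. Expanding \<open>u\<^sub>x\<^sub>x\<close> and
  moving the weight through \<open>H\<close> leaves the terms on the right.\<close>

lemma weighted_antisymmetry:
  assumes e: "e \<noteq> 0"
  shows "(LINT x|lborel. (sw e x * f t x) * (sw e x * g1 t x))
     = - (LINT x|lborel. (sw e x * f t x) * (hilbert (leibniz_rest e t) x + commutator e (f2 t) x))"
proof -
  let ?u = "\<lambda>x. sw e x * f t x" and ?p = "\<lambda>x. cos (e * x) * f t x + sw e x * f1 t x"
    and ?q = "\<lambda>x. sw e x * f2 t x + leibniz_rest e t x"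
  have wu: "wd ?u ?p" by (rule wd_mult[OF wd_sw[OF e] wf])
  have "wd ?p (\<lambda>x. (- e * sin (e * x) * f t x + cos (e * x) * f1 t x) + (cos (e * x) * f1 t x + sw e x * f2 t x))"
    by (rule wd_add[OF wd_mult[OF wd_cos wf] wd_mult[OF wd_sw[OF e] wf1]])
  moreover have "(- e * sin (e * x) * f t x + cos (e * x) * f1 t x) + (cos (e * x) * f1 t x + sw e x * f2 t x) = ?q x" for x
    by (simp add: leibniz_rest_def)
  ultimately have wp: "wd ?p ?q" by (simp only:)
  have Lu: "L2 ?u" by (rule L2_sw[OF Lf])
  have Lp: "L2 ?p" by (intro L2_add L2_cos L2_sw Lf Lf1)
  have Lq: "L2 ?q" by (intro L2_add L2_sw Lf2 Lr)
  have "(LINT x|lborel. ?p x * hilbert ?p x) = - (LINT x|lborel. ?u x * hilbert ?q x)"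
    by (rule wd_integration_by_parts[OF wu Lu Lp wd_hilbert[OF wp Lp Lq] hilbert_L2[OF Lp] hilbert_L2[OF Lq]])
  then have 0: "(LINT x|lborel. ?u x * hilbert ?q x) = 0" using integral_hilbert_self[OF Lp] by simp
  let ?k = "\<lambda>x. hilbert (leibniz_rest e t) x + commutator e (f2 t) x"
  have Lk: "L2 ?k" by (intro L2_add hilbert_L2 Lr commutator_L2 Lf2)
  note [measurable] = L2_measurable[OF hilbert_L2[OF Lq]] L2_measurable[OF Lk]
  have "0 = (LINT x|lborel. ?u x * hilbert ?q x)" using 0 by simp
  also have "\<dots> = (LINT x|lborel. ?u x * (sw e x * g1 t x) + ?u x * ?k x)"
  proof (rule integral_cong_AE)
    show "AE x in lborel. ?u x * hilbert ?q x = ?u x * (sw e x * g1 t x) + ?u x * ?k x"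
      using hilbert_add[OF L2_sw[OF Lf2] Lr, of e t e t]
      by eventually_elim (simp add: commutator_def algebra_simps)
  qed measurable
  also have "\<dots> = (LINT x|lborel. ?u x * (sw e x * g1 t x)) + (LINT x|lborel. ?u x * ?k x)"
    by (rule Bochner_Integration.integral_add[OF L2_mult_integrable[OF Lu L2_sw[OF Lg1]] L2_mult_integrable[OF Lu Lk]])
  finally show ?thesis by simp
qed

lemma mass_moment_has_derivative:
  assumes e: "e \<noteq> 0"
  shows "(mass_moment e has_real_derivative mass_moment_deriv e t) (at t)"
proof -
  let ?W = "\<lambda>s x. sw e x * (sw e x * f s x) + sw e x * (sw e x * f t x)"
  have b: "\<And>x. \<bar>sw e x\<bar> \<le> 1 / \<bar>e\<bar>" by (rule abs_sw_le)
  have "continuous_L2 ?W"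
    by (intro continuous_L2_add continuous_L2_const continuous_L2_bounded_mult[OF _ sw_measurable b] cf L2_sw Lf)
  then have "(mass_moment e has_real_derivative (LINT x|lborel. v t x * ?W t x)) (at t)"
  proof (rule derivative_of_pairing[OF evolution])
    fix s
    have "mass_moment e s - mass_moment e t = (LINT x|lborel. (sw e x * f s x)\<^sup>2 - (sw e x * f t x)\<^sup>2)"
      unfolding mass_moment_def using L2_mult2_integrable[OF L2_sw[OF Lf]] by simp
    also have "\<dots> = (LINT x|lborel. (f s x - f t x) * ?W s x)"
      by (intro integral_eqI) (simp add: power2_eq_square algebra_simps)
    finally show "mass_moment e s - mass_moment e t = (LINT x|lborel. (f s x - f t x) * ?W s x)" .
  qed
  moreover have "(LINT x|lborel. v t x * ?W t x) = mass_moment_deriv e t"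
  proof -
    let ?u = "\<lambda>x. sw e x * f t x"
    have Lu: "L2 ?u" by (rule L2_sw[OF Lf])
    have Luf: "L2 (\<lambda>x. ?u x * f1 t x)" using L2_sw[OF BL_mult_L2[OF Bf[of t] Lf1[of t]], of e] by (simp add: mult.assoc)
    have "(LINT x|lborel. v t x * ?W t x) = (LINT x|lborel. 2 * (?u x * (?u x * f1 t x)) - 2 * (?u x * (sw e x * g1 t x)))"
      by (intro integral_eqI) (simp add: algebra_simps)
    also have "\<dots> = 2 * (LINT x|lborel. ?u x * (?u x * f1 t x)) - 2 * (LINT x|lborel. ?u x * (sw e x * g1 t x))"
      using L2_mult_integrable[OF Lu Luf] L2_mult_integrable[OF Lu L2_sw[OF Lg1, of e t]] by simp
    finally show ?thesis unfolding weighted_antisymmetry[OF e] mass_moment_deriv_def by simp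
  qed
  ultimately show ?thesis by simp
qed

text \<open>Linear in \<open>mass_moment\<close> with a constant uniform in \<open>e\<close>, as needed for Gronwall's inequality; \<open>11\<close> is \<open>9\<close> from the
  linear part, \<open>3\<close> for \<open>leibniz_rest\<close> and \<open>6\<close> for the commutator, plus \<open>2\<close> from the nonlinearity.\<close>

lemma mass_moment_deriv_bound:
  assumes e: "0 < e" "e \<le> 1"
  shows "\<bar>mass_moment_deriv e t\<bar> \<le> 11 * H2_size t * (1 + mass_moment e t)"
proof -
  let ?u = "\<lambda>x. sw e x * f t x" and ?k = "\<lambda>x. hilbert (leibniz_rest e t) x + commutator e (f2 t) x"
  have Lu: "L2 ?u" by (rule L2_sw[OF Lf])
  have Lk: "L2 ?k" by (intro L2_add hilbert_L2 Lr commutator_L2 Lf2)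
  have "norm_L2 ?k \<le> norm_L2 (hilbert (leibniz_rest e t)) + norm_L2 (commutator e (f2 t))"
    by (intro norm_L2_triangle hilbert_L2 Lr commutator_L2 Lf2)
  also have "\<dots> \<le> 3 * H2_size t + 6 * H2_size t"
    using norm_leibniz_rest_le[OF e, of t] norm_L2_hilbert[OF Lr, of e t] commutator_deriv_bound[OF e(1) wf1 Lf1 Lf2, of t] norm_le_H2_size(2)[of t] by linarith
  finally have nk: "norm_L2 ?k \<le> 9 * H2_size t" by simp
  have "\<bar>LINT x|lborel. ?u x * ?k x\<bar> \<le> sqrt (mass_moment e t) * (9 * H2_size t)"
    using Cauchy_Schwarz_L2_real[OF Lu Lk] mult_left_mono[OF nk, of "sqrt (mass_moment e t)"] mass_moment_nonneg[of e t] unfolding sqrt_mass_moment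
    by (meson order_trans real_sqrt_ge_zero)
  also have "\<dots> \<le> ((1 + mass_moment e t) / 2) * (9 * H2_size t)"
  proof (rule mult_right_mono)
    have "2 * (1 * sqrt (mass_moment e t)) \<le> 1\<^sup>2 + (sqrt (mass_moment e t))\<^sup>2" using sum_squares_bound[of 1 "sqrt (mass_moment e t)"] by simp
    then show "sqrt (mass_moment e t) \<le> (1 + mass_moment e t) / 2" using mass_moment_nonneg[of e t] by simp
  qed (use H2_size_nonneg[of t] in simp)
  finally have 1: "\<bar>LINT x|lborel. ?u x * ?k x\<bar> \<le> ((1 + mass_moment e t) / 2) * (9 * H2_size t)" .
  have Lw: "L2 (\<lambda>x. ?u x * f1 t x)" "norm_L2 (\<lambda>x. ?u x * f1 t x) \<le> H2_size t * sqrt (mass_moment e t)"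
    using L2_mult_AE_bounded[OF sup_le_H2_size(2)[of t] _ Lu] H2_size_nonneg[of t] by (simp_all add: mult.commute[of _ "f1 t _"] sqrt_mass_moment)
  have "\<bar>LINT x|lborel. ?u x * (?u x * f1 t x)\<bar> \<le> sqrt (mass_moment e t) * (H2_size t * sqrt (mass_moment e t))"
    using Cauchy_Schwarz_L2_real[OF Lu Lw(1)] mult_left_mono[OF Lw(2), of "sqrt (mass_moment e t)"] mass_moment_nonneg[of e t] unfolding sqrt_mass_moment
    by (meson order_trans real_sqrt_ge_zero)
  also have "\<dots> = H2_size t * mass_moment e t" using mass_moment_nonneg[of e t] by simp
  finally have 2: "\<bar>LINT x|lborel. ?u x * (?u x * f1 t x)\<bar> \<le> H2_size t * mass_moment e t" .
  have "\<bar>mass_moment_deriv e t\<bar> \<le> 2 * \<bar>LINT x|lborel. ?u x * ?k x\<bar> + 2 * \<bar>LINT x|lborel. ?u x * (?u x * f1 t x)\<bar>"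
    unfolding mass_moment_deriv_def by linarith
  also have "\<dots> \<le> 2 * (((1 + mass_moment e t) / 2) * (9 * H2_size t)) + 2 * (H2_size t * mass_moment e t)" using 1 2 by linarith
  also have "\<dots> \<le> 11 * H2_size t * (1 + mass_moment e t)"
    using H2_size_nonneg[of t] by (simp add: algebra_simps)
  finally show ?thesis .
qed

text \<open>Gronwall's inequality, as a Lipschitz bound for the logarithm; this form also covers times before \<open>s\<close>.\<close>

lemma mass_moment_growth:
  assumes e: "0 < e" "e \<le> 1" and B: "\<And>s. s \<in> {a..b} \<Longrightarrow> H2_size s \<le> B" and st: "s \<in> {a..b}" "t \<in> {a..b}"
  shows "1 + mass_moment e t \<le> (1 + mass_moment e s) * exp (11 * B * \<bar>t - s\<bar>)"
proof -
  have pos: "0 < 1 + mass_moment e z" for z using mass_moment_nonneg[of e z] by linarith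
  have "norm (ln (1 + mass_moment e t) - ln (1 + mass_moment e s)) \<le> 11 * B * norm (t - s)"
  proof (rule field_differentiable_bound[of "{a..b}" _ "\<lambda>z. mass_moment_deriv e z / (1 + mass_moment e z)"])
    fix z assume z: "z \<in> {a..b}"
    have "((\<lambda>z. ln (1 + mass_moment e z)) has_real_derivative mass_moment_deriv e z / (1 + mass_moment e z)) (at z)"
      using e pos[of z] by (auto intro!: derivative_eq_intros mass_moment_has_derivative)
    then show "((\<lambda>z. ln (1 + mass_moment e z)) has_field_derivative mass_moment_deriv e z / (1 + mass_moment e z)) (at z within {a..b})"
      by (rule has_field_derivative_at_within)
    have "\<bar>mass_moment_deriv e z\<bar> \<le> 11 * B * (1 + mass_moment e z)"
      using mass_moment_deriv_bound[OF e, of z] mult_right_mono[of "11 * H2_size z" "11 * B" "1 + mass_moment e z"] B[OF z] pos[of z] by linarith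
    then show "norm (mass_moment_deriv e z / (1 + mass_moment e z)) \<le> 11 * B" using pos[of z] by (simp add: abs_divide divide_le_eq)
  qed (use st in auto)
  then have "ln (1 + mass_moment e t) \<le> ln (1 + mass_moment e s) + 11 * B * \<bar>t - s\<bar>" by simp
  then have "exp (ln (1 + mass_moment e t)) \<le> exp (ln (1 + mass_moment e s) + 11 * B * \<bar>t - s\<bar>)" by simp
  then show ?thesis using pos[of t] pos[of s] by (simp add: exp_add)
qed

subsection \<open>The truncated first moment of the momentum\<close>

definition momentum_moment :: "real \<Rightarrow> real \<Rightarrow> real" where
  "momentum_moment e t = (LINT x|lborel. sw e x * f t x * g t x) - 1/3 * (LINT x|lborel. sw e x * f t x * (f t x * f t x))"

text \<open>The equation reads \<open>f\<^sub>t + \<partial>\<^sub>x flux = 0\<close>.\<close>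

abbreviation "flux t x \<equiv> g t x - 1/2 * (f t x * f t x)"

definition momentum_moment_deriv :: "real \<Rightarrow> real \<Rightarrow> real" where
  "momentum_moment_deriv e t = (LINT x|lborel. cos (e * x) * flux t x * flux t x)
     + (LINT x|lborel. v t x * (hilbert (\<lambda>x. cos (e * x) * f t x) x + commutator e (f1 t) x))"

lemma Bhh: "BL (flux t)" by (intro BL_diff BL_cmult BL_mult Bg Bf)

lemma whh: "wd (flux t) (\<lambda>x. - v t x)"
proof -
  have "wd (flux t) (\<lambda>x. g1 t x - 1/2 * (f1 t x * f t x + f t x * f1 t x))"
    by (intro wd_diff wg wd_cmult wd_mult wf)
  then show ?thesis by (simp add: mult.commute)
qed

text \<open>The variational derivative of the momentum is twice the flux, up to the terms in which \<open>H \<partial>\<^sub>x\<close> meets the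
  weight. As \<open>v\<close> is minus the derivative of the flux, \<open>2 v w flux\<close> integrates by parts to \<open>w' flux\<^sup>2\<close>.\<close>

lemma momentum_moment_has_derivative:
  assumes e: "e \<noteq> 0"
  shows "(momentum_moment e has_real_derivative momentum_moment_deriv e t) (at t)"
proof -
  let ?p = "\<lambda>x. cos (e * x) * f t x + sw e x * f1 t x"
  let ?F = "\<lambda>s x. f s x * f s x + f t x * f s x + f t x * f t x"
  let ?W = "\<lambda>s x. sw e x * g s x + hilbert ?p x - 1/3 * (sw e x * ?F s x)"
  have b: "\<And>x. \<bar>sw e x\<bar> \<le> 1 / \<bar>e\<bar>" by (rule abs_sw_le)
  have Lp: "L2 ?p" by (intro L2_add L2_cos L2_sw Lf Lf1)
  have wu: "wd (\<lambda>x. sw e x * f t x) ?p" by (rule wd_mult[OF wd_sw[OF e] wf])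
  have cm: "continuous_L2 (\<lambda>s x. f s x * u s x)" if "continuous_L2 u" for u
    by (rule continuous_L2_H1_mult[OF cf cf1 wf that])
  have cm': "continuous_L2 (\<lambda>s x. f t x * u s x)" if "continuous_L2 u" for u
    by (rule continuous_L2_H1_mult[OF continuous_L2_const[OF Lf] continuous_L2_const[OF Lf1] wf that])
  have cF: "continuous_L2 ?F"
    by (intro continuous_L2_add cm cm' cf continuous_L2_const Lf)
  have "continuous_L2 ?W"
    by (intro continuous_L2_add continuous_L2_diff continuous_L2_cmult continuous_L2_const hilbert_L2 Lp
        continuous_L2_bounded_mult[OF _ sw_measurable b] cg cF)
  then have "(momentum_moment e has_real_derivative (LINT x|lborel. v t x * ?W t x)) (at t)"
  proof (rule derivative_of_pairing[OF evolution])
    fix s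
    let ?d = "\<lambda>x. f s x - f t x"
    have Ld: "L2 ?d" "L2 (\<lambda>x. f1 s x - f1 t x)" and wdd: "wd ?d (\<lambda>x. f1 s x - f1 t x)"
      by (intro L2_diff Lf Lf1 wd_diff wf)+
    note Lu = L2_sw[OF Lf, of e]
    have LF: "L2 (\<lambda>x. sw e x * ?F s x)" by (intro L2_sw continuous_L2D(1)[OF cF])
    have sym: "(LINT x|lborel. (sw e x * f t x) * hilbert (\<lambda>x. f1 s x - f1 t x) x) = (LINT x|lborel. ?d x * hilbert ?p x)"
      using hilbert_deriv_symmetric[OF wdd Ld wu Lu Lp] by (simp add: mult.commute)
    have h: "(LINT x|lborel. (sw e x * f t x) * hilbert (\<lambda>x. f1 s x - f1 t x) x)
        = (LINT x|lborel. sw e x * f t x * g s x) - (LINT x|lborel. sw e x * f t x * g t x)"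
    proof -
      note [measurable] = L2_measurable[OF hilbert_L2[OF Ld(2)]]
      have "(LINT x|lborel. (sw e x * f t x) * hilbert (\<lambda>x. f1 s x - f1 t x) x) = (LINT x|lborel. sw e x * f t x * g s x - sw e x * f t x * g t x)"
      proof (rule integral_cong_AE)
        show "AE x in lborel. (sw e x * f t x) * hilbert (\<lambda>x. f1 s x - f1 t x) x = sw e x * f t x * g s x - sw e x * f t x * g t x"
          using hilbert_diff[OF Lf1 Lf1, of s t]
        proof eventually_elim
          case (elim x)
          show ?case unfolding elim by (simp add: algebra_simps)
        qed
      qed measurable
      then show ?thesis using L2_mult_integrable[OF Lu Lg, of t s] L2_mult_integrable[OF Lu Lg, of t t] by simp
    qed
    have c: "(LINT x|lborel. sw e x * f s x * (f s x * f s x)) - (LINT x|lborel. sw e x * f t x * (f t x * f t x)) = (LINT x|lborel. ?d x * (sw e x * ?F s x))"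
    proof -
      have i: "integrable lborel (\<lambda>x. sw e x * f t x * (f t x * f t x))" for t
        by (rule L2_mult_integrable[OF Lu BL_mult_L2[OF Bf Lf]])
      have "(LINT x|lborel. sw e x * f s x * (f s x * f s x)) - (LINT x|lborel. sw e x * f t x * (f t x * f t x))
          = (LINT x|lborel. sw e x * f s x * (f s x * f s x) - sw e x * f t x * (f t x * f t x))"
        by (rule Bochner_Integration.integral_diff[OF i i, symmetric])
      also have "\<dots> = (LINT x|lborel. ?d x * (sw e x * ?F s x))"
        by (intro integral_eqI) (simp add: algebra_simps)
      finally show ?thesis .
    qed
    have q: "(LINT x|lborel. sw e x * f s x * g s x) - (LINT x|lborel. sw e x * f t x * g s x) = (LINT x|lborel. ?d x * (sw e x * g s x))"
    proof -
      have "(LINT x|lborel. sw e x * f s x * g s x) - (LINT x|lborel. sw e x * f t x * g s x)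
          = (LINT x|lborel. sw e x * f s x * g s x - sw e x * f t x * g s x)"
        by (rule Bochner_Integration.integral_diff[OF L2_mult_integrable[OF Lu Lg] L2_mult_integrable[OF Lu Lg], symmetric])
      also have "\<dots> = (LINT x|lborel. ?d x * (sw e x * g s x))"
        by (intro integral_eqI) (simp add: algebra_simps)
      finally show ?thesis .
    qed
    have "momentum_moment e s - momentum_moment e t = (LINT x|lborel. ?d x * (sw e x * g s x)) + (LINT x|lborel. ?d x * hilbert ?p x) - 1/3 * (LINT x|lborel. ?d x * (sw e x * ?F s x))"
      unfolding momentum_moment_def q[symmetric] sym[symmetric] h c[symmetric] by (rule momentum_increment_split)
    also have "\<dots> = (LINT x|lborel. ?d x * (sw e x * g s x) + ?d x * hilbert ?p x - 1/3 * (?d x * (sw e x * ?F s x)))"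
      using L2_mult_integrable[OF Ld(1) L2_sw[OF Lg, of e s]] L2_mult_integrable[OF Ld(1) hilbert_L2[OF Lp]] L2_mult_integrable[OF Ld(1) LF]
      by simp
    also have "\<dots> = (LINT x|lborel. ?d x * ?W s x)"
      by (intro integral_eqI) (simp add: field_simps)
    finally show "momentum_moment e s - momentum_moment e t = (LINT x|lborel. ?d x * ?W s x)" .
  qed
  moreover have "(LINT x|lborel. v t x * ?W t x) = momentum_moment_deriv e t"
  proof -
    let ?k = "\<lambda>x. hilbert (\<lambda>x. cos (e * x) * f t x) x + commutator e (f1 t) x"
    have Lk: "L2 ?k" by (intro L2_add hilbert_L2 L2_cos Lf commutator_L2 Lf1)
    have Ls: "L2 (\<lambda>x. sw e x * flux t x)" by (rule L2_sw[OF BL_L2[OF Bhh]])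
    note [measurable] = L2_measurable[OF hilbert_L2[OF Lp]] L2_measurable[OF Lk]
    have "(LINT x|lborel. v t x * ?W t x) = (LINT x|lborel. 2 * (v t x * (sw e x * flux t x)) + v t x * ?k x)"
    proof (rule integral_cong_AE)
      show "AE x in lborel. v t x * ?W t x = 2 * (v t x * (sw e x * flux t x)) + v t x * ?k x"
        using hilbert_add[OF L2_cos[OF Lf] L2_sw[OF Lf1], of e t e t]
      proof eventually_elim
        case (elim x)
        have "?W t x = 2 * (sw e x * flux t x) + ?k x"
          unfolding elim commutator_def by (simp add: algebra_simps)
        then show ?case by (simp only: distrib_left mult.left_commute)
      qed
    qed measurable
    also have "\<dots> = 2 * (LINT x|lborel. v t x * (sw e x * flux t x)) + (LINT x|lborel. v t x * ?k x)"
      using L2_mult_integrable[OF Lv Ls] L2_mult_integrable[OF Lv Lk] by simp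
    also have "2 * (LINT x|lborel. v t x * (sw e x * flux t x)) = (LINT x|lborel. cos (e * x) * flux t x * flux t x)"
    proof -
      let ?w' = "\<lambda>x. (cos (e * x) * flux t x + sw e x * - v t x) * flux t x + sw e x * flux t x * - v t x"
      have w: "wd (\<lambda>x. sw e x * flux t x * flux t x) ?w'"
        by (rule wd_mult[OF wd_mult[OF wd_sw[OF e] whh] whh])
      have i1: "integrable lborel (\<lambda>x. cos (e * x) * flux t x * flux t x)"
        by (rule L2_mult_integrable[OF L2_cos[OF BL_L2[OF Bhh]] BL_L2[OF Bhh]])
      have i2: "integrable lborel (\<lambda>x. v t x * (sw e x * flux t x))" by (rule L2_mult_integrable[OF Lv Ls])
      have eq: "?w' = (\<lambda>x. cos (e * x) * flux t x * flux t x - 2 * (v t x * (sw e x * flux t x)))"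
        by (rule ext) (simp add: field_simps)
      have "(LINT x|lborel. ?w' x) = 0"
      proof (rule wd_integral_eq_0[OF w])
        show "integrable lborel (\<lambda>x. sw e x * flux t x * flux t x)" by (rule L2_mult_integrable[OF Ls BL_L2[OF Bhh]])
        show "integrable lborel ?w'" unfolding eq using i1 i2 by simp
      qed
      then show ?thesis unfolding eq using i1 i2 by simp
    qed
    finally show ?thesis unfolding momentum_moment_deriv_def .
  qed
  ultimately show ?thesis by simp
qed

end

section \<open>Conservation of the energy\<close>

lemma tendsto_L2_mult_fixed:
  fixes w a :: "real \<Rightarrow> real"
  assumes "\<And>i. L2 (u i)" "L2 a" "L2 w" "((\<lambda>i. norm_L2 (\<lambda>x. u i x - a x)) \<longlongrightarrow> 0) F"
  shows "((\<lambda>i. LINT x|lborel. u i x * w x) \<longlongrightarrow> (LINT x|lborel. a x * w x)) F"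
    and "((\<lambda>i. LINT x|lborel. w x * u i x) \<longlongrightarrow> (LINT x|lborel. w x * a x)) F"
proof -
  show "((\<lambda>i. LINT x|lborel. u i x * w x) \<longlongrightarrow> (LINT x|lborel. a x * w x)) F"
    by (rule tendsto_L2_mult[OF _ _ assms(2,3,4)]) (use assms in simp_all)
  then show "((\<lambda>i. LINT x|lborel. w x * u i x) \<longlongrightarrow> (LINT x|lborel. w x * a x)) F"
    by (simp add: mult.commute)
qed

lemma energy_increment_split: "(a - 3/4 * b + 1/8 * c) - (a' - 3/4 * b' + 1/8 * c') = (a - a') - 3/4 * (b - b') + 1/8 * (c - c' :: real)"
  by (simp add: field_simps)

context bo_flow begin

definition energy :: "real \<Rightarrow> real" where
  "energy t = (LINT x|lborel. f1 t x * f1 t x) - 3/4 * (LINT x|lborel. f t x * f t x * g t x)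
     + 1/8 * (LINT x|lborel. (f t x * f t x) * (f t x * f t x))"

lemma Bff: "BL (\<lambda>x. f t x * f t x)" by (intro BL_mult Bf)

lemma wff: "wd (\<lambda>x. f t x * f t x) (\<lambda>x. 2 * (f t x * f1 t x))"
proof -
  have "wd (\<lambda>x. f t x * f t x) (\<lambda>x. f1 t x * f t x + f t x * f1 t x)" by (rule wd_mult[OF wf wf])
  then show ?thesis by (simp add: mult.commute)
qed

lemma Lff1: "L2 (\<lambda>x. 2 * (f t x * f1 t x))" by (intro L2_cmult BL_mult_L2 Bf Lf1)

text \<open>The variational derivative of the energy.\<close>

definition energy_gradient :: "real \<Rightarrow> real \<Rightarrow> real" where
  "energy_gradient t x = - 2 * f2 t x - 3/2 * (f t x * g t x) - 3/4 * hilbert (\<lambda>x. 2 * (f t x * f1 t x)) x + 1/2 * (f t x * (f t x * f t x))"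

lemma energy_has_derivative: "(energy has_real_derivative (LINT x|lborel. v t x * energy_gradient t x)) (at t)"
proof -
  \<comment> \<open>\<open>?q\<close> and \<open>?m\<close> are the difference quotients of \<open>f\<^sup>4\<close> and, with respect to the undifferentiated factors, of \<open>f\<^sup>2 H f\<^sub>x\<close>\<close>
  let ?q = "\<lambda>s x. f s x * (f s x * f s x) + f t x * (f s x * f s x) + f t x * (f t x * f s x) + f t x * (f t x * f t x)"
  let ?m = "\<lambda>s x. f s x * g s x + f t x * g s x"
  let ?H = "hilbert (\<lambda>x. 2 * (f t x * f1 t x))"
  let ?W = "\<lambda>s x. -1 * (f2 s x + f2 t x) - 3/4 * (?m s x + ?H x) + 1/8 * ?q s x"
  have cm: "continuous_L2 (\<lambda>s x. f s x * u s x)" if "continuous_L2 u" for u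
    by (rule continuous_L2_H1_mult[OF cf cf1 wf that])
  have cm': "continuous_L2 (\<lambda>s x. f t x * u s x)" if "continuous_L2 u" for u
    by (rule continuous_L2_H1_mult[OF continuous_L2_const[OF Lf] continuous_L2_const[OF Lf1] wf that])
  have LH: "L2 ?H" by (rule hilbert_L2[OF Lff1])
  have cq: "continuous_L2 ?q" by (intro continuous_L2_add cm cm' cf continuous_L2_const Lf)
  have cmm: "continuous_L2 ?m" by (intro continuous_L2_add cm cm' cg)
  have cW: "continuous_L2 ?W"
    by (intro continuous_L2_add continuous_L2_diff continuous_L2_cmult cq cmm cf2 continuous_L2_const Lf2 LH)
  then have "(energy has_real_derivative (LINT x|lborel. v t x * ?W t x)) (at t)"
  proof (rule derivative_of_pairing[OF evolution])
    fix s
    let ?d = "\<lambda>x. f s x - f t x" and ?d1 = "\<lambda>x. f1 s x - f1 t x"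
    have Ld: "L2 ?d" "L2 ?d1" and wdd: "wd ?d ?d1" by (intro L2_diff Lf Lf1 wd_diff wf)+
    note iff = L2_mult_integrable[OF Lf1 Lf1] and im = L2_mult_integrable[OF BL_L2[OF Bff] Lg] and iq = L2_mult_integrable[OF BL_L2[OF Bff] BL_L2[OF Bff]]
    have 1: "(LINT x|lborel. f1 s x * f1 s x) - (LINT x|lborel. f1 t x * f1 t x) = - (LINT x|lborel. ?d x * (f2 s x + f2 t x))"
    proof -
      have "(LINT x|lborel. f1 s x * f1 s x) - (LINT x|lborel. f1 t x * f1 t x) = (LINT x|lborel. f1 s x * f1 s x - f1 t x * f1 t x)"
        by (rule Bochner_Integration.integral_diff[OF iff iff, symmetric])
      also have "\<dots> = (LINT x|lborel. ?d1 x * (f1 s x + f1 t x))"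
        by (intro integral_eqI) (simp add: algebra_simps)
      also have "\<dots> = - (LINT x|lborel. ?d x * (f2 s x + f2 t x))"
        by (rule wd_integration_by_parts[OF wdd Ld wd_add[OF wf1 wf1] L2_add[OF Lf1 Lf1] L2_add[OF Lf2 Lf2]])
      finally show ?thesis .
    qed
    have 2: "(LINT x|lborel. f s x * f s x * g s x) - (LINT x|lborel. f t x * f t x * g t x) = (LINT x|lborel. ?d x * (?m s x + ?H x))"
    proof -
      have Lm: "L2 (?m s)" by (rule continuous_L2D(1)[OF cmm])
      have "(LINT x|lborel. hilbert ?d1 x * (f t x * f t x)) = (LINT x|lborel. ?d x * ?H x)"
        by (rule hilbert_deriv_symmetric[OF wdd Ld wff BL_L2[OF Bff] Lff1])
      moreover have "(LINT x|lborel. ?d x * (?m s x + ?H x)) = (LINT x|lborel. ?d x * ?m s x) + (LINT x|lborel. ?d x * ?H x)"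
        using L2_mult_integrable[OF Ld(1) Lm] L2_mult_integrable[OF Ld(1) LH] by (simp add: distrib_left)
      moreover have "(LINT x|lborel. f s x * f s x * g s x) - (LINT x|lborel. f t x * f t x * g t x)
          = (LINT x|lborel. ?d x * ?m s x) + (LINT x|lborel. hilbert ?d1 x * (f t x * f t x))"
      proof -
        have i2: "integrable lborel (\<lambda>x. hilbert ?d1 x * (f t x * f t x))"
          by (rule L2_mult_integrable[OF hilbert_L2[OF Ld(2)] BL_L2[OF Bff]])
        have "(LINT x|lborel. f s x * f s x * g s x) - (LINT x|lborel. f t x * f t x * g t x)
          = (LINT x|lborel. f s x * f s x * g s x - f t x * f t x * g t x)"
          by (rule Bochner_Integration.integral_diff[OF im im, symmetric])
        also have "\<dots> = (LINT x|lborel. ?d x * ?m s x + hilbert ?d1 x * (f t x * f t x))"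
        proof (rule integral_cong_AE)
          note [measurable] = L2_measurable[OF hilbert_L2[OF Ld(2)]]
          show "(\<lambda>x. ?d x * ?m s x + hilbert ?d1 x * (f t x * f t x)) \<in> borel_measurable lborel" by measurable
          show "AE x in lborel. f s x * f s x * g s x - f t x * f t x * g t x = ?d x * ?m s x + hilbert ?d1 x * (f t x * f t x)"
            using hilbert_diff[OF Lf1 Lf1, of s t]
          proof eventually_elim
            case (elim x)
            show ?case unfolding elim by (simp add: algebra_simps)
          qed
        qed measurable
        also have "\<dots> = (LINT x|lborel. ?d x * ?m s x) + (LINT x|lborel. hilbert ?d1 x * (f t x * f t x))"
          by (rule Bochner_Integration.integral_add[OF L2_mult_integrable[OF Ld(1) Lm] i2])
        finally show ?thesis .
      qed
      ultimately show ?thesis by simp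
    qed
    have 3: "(LINT x|lborel. (f s x * f s x) * (f s x * f s x)) - (LINT x|lborel. (f t x * f t x) * (f t x * f t x)) = (LINT x|lborel. ?d x * ?q s x)"
    proof -
      have "(LINT x|lborel. (f s x * f s x) * (f s x * f s x)) - (LINT x|lborel. (f t x * f t x) * (f t x * f t x))
        = (LINT x|lborel. (f s x * f s x) * (f s x * f s x) - (f t x * f t x) * (f t x * f t x))"
        by (rule Bochner_Integration.integral_diff[OF iq iq, symmetric])
      also have "\<dots> = (LINT x|lborel. ?d x * ?q s x)"
        by (intro integral_eqI) (simp add: algebra_simps)
      finally show ?thesis .
    qed
    have i: "integrable lborel (\<lambda>x. ?d x * (f2 s x + f2 t x))" "integrable lborel (\<lambda>x. ?d x * (?m s x + ?H x))" "integrable lborel (\<lambda>x. ?d x * ?q s x)"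
      by (rule L2_mult_integrable[OF Ld(1) L2_add[OF Lf2 Lf2]] L2_mult_integrable[OF Ld(1) L2_add[OF continuous_L2D(1)[OF cmm] LH]]
          L2_mult_integrable[OF Ld(1) continuous_L2D(1)[OF cq]])+
    have "energy s - energy t = - (LINT x|lborel. ?d x * (f2 s x + f2 t x)) - 3/4 * (LINT x|lborel. ?d x * (?m s x + ?H x)) + 1/8 * (LINT x|lborel. ?d x * ?q s x)"
      unfolding energy_def 1[symmetric] 2[symmetric] 3[symmetric] by (rule energy_increment_split)
    also have "\<dots> = (LINT x|lborel. -1 * (?d x * (f2 s x + f2 t x)) - 3/4 * (?d x * (?m s x + ?H x)) + 1/8 * (?d x * ?q s x))"
      using i by simp
    also have "\<dots> = (LINT x|lborel. ?d x * ?W s x)"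
      by (intro integral_eqI) (simp add: field_simps)
    finally show "energy s - energy t = (LINT x|lborel. ?d x * ?W s x)" .
  qed
  moreover have "?W t x = energy_gradient t x" for x
    by (simp add: energy_gradient_def field_simps)
  ultimately show ?thesis by simp
qed

text \<open>Sorted by homogeneity in \<open>\<phi>\<close>, the quadratic, quartic and quintic contributions vanish by antisymmetry
  of \<open>H\<close> and integration by parts. The cubic one reduces to \<open>\<integral> \<phi>\<^sub>x\<^sup>3 - 3 \<phi>\<^sub>x (H \<phi>\<^sub>x)\<^sup>2\<close>, which vanishes because
  \<open>(\<phi>\<^sub>x + \<i> H \<phi>\<^sub>x)\<^sup>3\<close> has mean zero.\<close>

lemma energy_derivative_eq_0: "(LINT x|lborel. v t x * energy_gradient t x) = 0"
proof -
  let ?F = "\<lambda>x. f t x" and ?F1 = "\<lambda>x. f1 t x" and ?F2 = "\<lambda>x. f2 t x" and ?g = "\<lambda>x. g t x" and ?g1 = "\<lambda>x. g1 t x"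
  let ?p = "\<lambda>x. 2 * (f t x * f1 t x)"
  let ?H = "hilbert ?p"
  have LH: "L2 ?H" by (rule hilbert_L2[OF Lff1])
  have Bf3: "BL (\<lambda>x. f t x * (f t x * f t x))" by (intro BL_mult Bf)
  have Bfg: "BL (\<lambda>x. f t x * g t x)" by (intro BL_mult Bf Bg)
  have Bff1: "BL (\<lambda>x. f t x * f1 t x)" by (intro BL_mult Bf Bf1)
  note i11 = L2_mult_integrable[OF Lg1[of t] Lf2[of t]] and i12 = L2_mult_integrable[OF Lg1[of t] BL_L2[OF Bfg]]
    and i13 = L2_mult_integrable[OF Lg1[of t] LH] and i14 = L2_mult_integrable[OF Lg1[of t] BL_L2[OF Bf3]]
    and i21 = L2_mult_integrable[OF BL_L2[OF Bff1] Lf2[of t]] and i22 = L2_mult_integrable[OF BL_L2[OF Bff1] BL_L2[OF Bfg]]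
    and i23 = L2_mult_integrable[OF BL_L2[OF Bff1] LH] and i24 = L2_mult_integrable[OF BL_L2[OF Bff1] BL_L2[OF Bf3]]
  define I11 where "I11 = (LINT x|lborel. ?g1 x * ?F2 x)"
  define I12 where "I12 = (LINT x|lborel. ?g1 x * (f t x * g t x))"
  define I13 where "I13 = (LINT x|lborel. ?g1 x * ?H x)"
  define I14 where "I14 = (LINT x|lborel. ?g1 x * (f t x * (f t x * f t x)))"
  define I21 where "I21 = (LINT x|lborel. f t x * f1 t x * ?F2 x)"
  define I22 where "I22 = (LINT x|lborel. f t x * f1 t x * (f t x * g t x))"
  define I23 where "I23 = (LINT x|lborel. f t x * f1 t x * ?H x)"
  define I24 where "I24 = (LINT x|lborel. f t x * f1 t x * (f t x * (f t x * f t x)))"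
  have "(LINT x|lborel. v t x * energy_gradient t x) = (LINT x|lborel.
      2 * (?g1 x * ?F2 x) + 3/2 * (?g1 x * (f t x * g t x)) + 3/4 * (?g1 x * ?H x) - 1/2 * (?g1 x * (f t x * (f t x * f t x)))
      - 2 * (f t x * f1 t x * ?F2 x) - 3/2 * (f t x * f1 t x * (f t x * g t x)) - 3/4 * (f t x * f1 t x * ?H x) + 1/2 * (f t x * f1 t x * (f t x * (f t x * f t x))))"
    by (intro integral_eqI) (simp add: energy_gradient_def field_simps)
  also have "\<dots> = 2 * I11 + 3/2 * I12 + 3/4 * I13 - 1/2 * I14 - 2 * I21 - 3/2 * I22 - 3/4 * I23 + 1/2 * I24"
    unfolding I11_def I12_def I13_def I14_def I21_def I22_def I23_def I24_def
    using i11 i12 i13 i14 i21 i22 i23 i24 by simp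
  finally have total: "(LINT x|lborel. v t x * energy_gradient t x) = 2 * I11 + 3/2 * I12 + 3/4 * I13 - 1/2 * I14 - 2 * I21 - 3/2 * I22 - 3/4 * I23 + 1/2 * I24" .
  have e11: "I11 = 0" unfolding I11_def using integral_hilbert_self[OF Lf2, of t] by (simp add: mult.commute)
  have e13: "I13 = 2 * I21"
  proof -
    have "I13 = (LINT x|lborel. ?F2 x * ?p x)" unfolding I13_def by (rule hilbert_inner[OF Lf2 Lff1])
    also have "\<dots> = (LINT x|lborel. 2 * (f t x * f1 t x * ?F2 x))"
      by (intro integral_eqI) simp
    finally show ?thesis unfolding I21_def by simp
  qed
  have e23: "I23 = 0"
  proof -
    have "(LINT x|lborel. 2 * (f t x * f1 t x * ?H x)) = 0"
      using integral_hilbert_self[OF Lff1, of t] by (simp add: mult.assoc)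
    then show ?thesis unfolding I23_def by simp
  qed
  have w3: "wd (\<lambda>x. f t x * (f t x * f t x)) (\<lambda>x. 3 * (f t x * (f t x * f1 t x)))"
  proof -
    have "wd (\<lambda>x. f t x * (f t x * f t x)) (\<lambda>x. f1 t x * (f t x * f t x) + f t x * (2 * (f t x * f1 t x)))"
      by (rule wd_mult[OF wf wff])
    moreover have "f1 t x * (f t x * f t x) + f t x * (2 * (f t x * f1 t x)) = 3 * (f t x * (f t x * f1 t x))" for x
      by (simp add: algebra_simps)
    ultimately show ?thesis by simp
  qed
  have Bfff1: "BL (\<lambda>x. 3 * (f t x * (f t x * f1 t x)))" by (intro BL_cmult BL_mult Bf Bf1)
  have e14: "I14 = - 3 * I22"
  proof -
    have "I14 = - (LINT x|lborel. ?g x * (3 * (f t x * (f t x * f1 t x))))"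
      unfolding I14_def by (rule wd_integration_by_parts[OF wg Lg Lg1 w3 BL_L2[OF Bf3] BL_L2[OF Bfff1]])
    also have "(LINT x|lborel. ?g x * (3 * (f t x * (f t x * f1 t x)))) = (LINT x|lborel. 3 * (f t x * f1 t x * (f t x * g t x)))"
      by (intro integral_eqI) simp
    finally show ?thesis unfolding I22_def by simp
  qed
  have e24: "I24 = 0"
  proof -
    have w5: "wd (\<lambda>x. (f t x * f t x) * (f t x * (f t x * f t x))) (\<lambda>x. (2 * (f t x * f1 t x)) * (f t x * (f t x * f t x)) + (f t x * f t x) * (3 * (f t x * (f t x * f1 t x))))"
      by (rule wd_mult[OF wff w3])
    have eq: "(2 * (f t x * f1 t x)) * (f t x * (f t x * f t x)) + (f t x * f t x) * (3 * (f t x * (f t x * f1 t x))) = 5 * (f t x * f1 t x * (f t x * (f t x * f t x)))" for x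
      by (simp add: algebra_simps)
    have "(LINT x|lborel. 5 * (f t x * f1 t x * (f t x * (f t x * f t x)))) = 0"
      using wd_integral_eq_0[OF w5 L2_mult_integrable[OF BL_L2[OF Bff] BL_L2[OF Bf3]]] i24 unfolding eq by simp
    then show ?thesis unfolding I24_def by simp
  qed
  define C where "C = (LINT x|lborel. f1 t x * (f1 t x * f1 t x))"
  define K where "K = (LINT x|lborel. f1 t x * (g t x * g t x))"
  have iC: "integrable lborel (\<lambda>x. f1 t x * (f1 t x * f1 t x))" by (rule L2_mult_integrable[OF Lf1 BL_mult_L2[OF Bf1 Lf1]])
  have iK: "integrable lborel (\<lambda>x. f1 t x * (g t x * g t x))" by (rule L2_mult_integrable[OF Lf1 BL_mult_L2[OF Bg Lg]])
  have e21: "2 * I21 = - C"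
  proof -
    have w: "wd (\<lambda>x. f t x * (f1 t x * f1 t x)) (\<lambda>x. f1 t x * (f1 t x * f1 t x) + f t x * (f2 t x * f1 t x + f1 t x * f2 t x))"
      by (rule wd_mult[OF wf wd_mult[OF wf1 wf1]])
    have eq: "f1 t x * (f1 t x * f1 t x) + f t x * (f2 t x * f1 t x + f1 t x * f2 t x) = f1 t x * (f1 t x * f1 t x) + 2 * (f t x * f1 t x * f2 t x)" for x
      by (simp add: algebra_simps)
    have "(LINT x|lborel. f1 t x * (f1 t x * f1 t x) + 2 * (f t x * f1 t x * f2 t x)) = 0"
      using wd_integral_eq_0[OF w L2_mult_integrable[OF Lf BL_mult_L2[OF Bf1 Lf1]]] iC i21 unfolding eq by simp
    then show ?thesis unfolding I21_def C_def using iC i21 by simp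
  qed
  have e12: "2 * I12 = - K"
  proof -
    have w: "wd (\<lambda>x. f t x * (g t x * g t x)) (\<lambda>x. f1 t x * (g t x * g t x) + f t x * (g1 t x * g t x + g t x * g1 t x))"
      by (rule wd_mult[OF wf wd_mult[OF wg wg]])
    have eq: "f1 t x * (g t x * g t x) + f t x * (g1 t x * g t x + g t x * g1 t x) = f1 t x * (g t x * g t x) + 2 * (g1 t x * (f t x * g t x))" for x
      by (simp add: algebra_simps)
    have "(LINT x|lborel. f1 t x * (g t x * g t x) + 2 * (g1 t x * (f t x * g t x))) = 0"
      using wd_integral_eq_0[OF w L2_mult_integrable[OF Lf BL_mult_L2[OF Bg Lg]]] iK i12 unfolding eq by simp
    then show ?thesis unfolding I12_def K_def using iK i12 by simp
  qed
  interpret b: bounded_pair "f1 t" "g t" "H2_size t" by (rule pair_f1)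
  have "C = 3 * K" using b.cubic_identity by (simp add: C_def K_def power3_eq_cube power2_eq_square mult.assoc)
  then show ?thesis unfolding total using e11 e13 e23 e14 e24 e21 e12 by linarith
qed

lemma energy_const: "energy s = energy t"
proof -
  have "(energy has_real_derivative 0) (at x)" for x
    using energy_has_derivative[of x] unfolding energy_derivative_eq_0 .
  then show ?thesis by (intro DERIV_isconst_all allI)
qed

end

section \<open>Persistence of the weight\<close>

text \<open>Only the datum at time \<open>0\<close> is assumed to be localised; \<open>xf_L2\<close> extends this to all times.\<close>

locale bo_weighted = bo_flow +
  assumes xf0: "L2 (\<lambda>x. x * f 0 x)"
begin

lemma sw_f_tendsto: "L2 (\<lambda>x. x * f t x) \<Longrightarrow> (\<lambda>n. norm_L2 (\<lambda>x. sw (ew n) x * f t x - x * f t x)) \<longlonglongrightarrow> 0"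
  by (rule dominated_convergence_L2(2))
     (auto intro!: AE_I2 tendsto_mult sw_tendsto mult_right_mono abs_sw_le_abs simp: abs_mult)

lemma norm_sw_le: "L2 (\<lambda>x. x * f t x) \<Longrightarrow> norm_L2 (\<lambda>x. sw e x * f t x) \<le> norm_L2 (\<lambda>x. x * f t x)"
  by (rule norm_L2_mono) (auto intro!: AE_I2 mult_right_mono abs_sw_le_abs simp: abs_mult)

lemma mass_moment_eq_norm: "mass_moment e t = (norm_L2 (\<lambda>x. sw e x * f t x))\<^sup>2"
  by (simp add: mass_moment_def norm_L2_sq)

lemma mass_moment_uniform_bound: obtains C where "\<And>n t. t \<in> {-T..T} \<Longrightarrow> mass_moment (ew n) t \<le> C"
proof (cases "0 \<le> T")
  case False
  then show ?thesis by (intro that[of 0]) auto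
next
  case True
  obtain B where B: "\<And>t. t \<in> {-T..T} \<Longrightarrow> H2_size t \<le> B" using H2_size_locally_bounded[of "-T" T] by blast
  have B_nonneg: "0 \<le> B" using B[of 0] H2_size_nonneg[of 0] True by simp
  let ?full_mass_moment = "(norm_L2 (\<lambda>x. x * f 0 x))\<^sup>2"
  show ?thesis
  proof (rule that)
    fix n t assume t: "t \<in> {-T..T}"
    have "1 + mass_moment (ew n) t \<le> (1 + mass_moment (ew n) 0) * exp (11 * B * \<bar>t - 0\<bar>)"
      by (rule mass_moment_growth[OF ew_pos ew_le_1 B]) (use t True in auto)
    also have "\<dots> \<le> (1 + ?full_mass_moment) * exp (11 * B * T)"
      using t True B_nonneg mass_moment_nonneg[of "ew n" 0] norm_sw_le[OF xf0, of "ew n"]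
      by (intro mult_mono) (auto simp: mass_moment_eq_norm abs_le_iff intro!: mult_left_mono power_mono)
    finally show "mass_moment (ew n) t \<le> (1 + ?full_mass_moment) * exp (11 * B * T)" by linarith
  qed
qed

text \<open>Fatou's lemma for the truncated weights.\<close>

theorem xf_L2: "L2 (\<lambda>x. x * f t x)"
proof -
  obtain C where C: "\<And>n s. s \<in> {-\<bar>t\<bar>..\<bar>t\<bar>} \<Longrightarrow> mass_moment (ew n) s \<le> C" using mass_moment_uniform_bound by blast
  show ?thesis
  proof (rule Fatou_L2(1)[where s="\<lambda>n x. sw (ew n) x * f t x" and c="sqrt C"])
    show "L2 (\<lambda>x. sw (ew n) x * f t x)" for n by (rule L2_sw[OF Lf])
    show "AE x in lborel. (\<lambda>n. sw (ew n) x * f t x) \<longlonglongrightarrow> x * f t x"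
      by (intro AE_I2 tendsto_mult tendsto_const sw_tendsto)
    have "norm_L2 (\<lambda>x. sw (ew n) x * f t x) \<le> sqrt C" for n
      unfolding sqrt_mass_moment by (intro real_sqrt_le_mono C) auto
    then show "\<forall>\<^sub>F n in sequentially. norm_L2 (\<lambda>x. sw (ew n) x * f t x) \<le> sqrt C" by simp
  qed measurable
qed

definition full_mass_moment :: "real \<Rightarrow> real" where
  "full_mass_moment t = (LINT x|lborel. (x * f t x) * (x * f t x))"

definition full_momentum_moment :: "real \<Rightarrow> real" where
  "full_momentum_moment t = (LINT x|lborel. (x * f t x) * g t x) - 1/3 * (LINT x|lborel. (x * f t x) * (f t x * f t x))"

lemma mass_moment_tendsto: "(\<lambda>n. mass_moment (ew n) t) \<longlonglongrightarrow> full_mass_moment t"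
  unfolding mass_moment_def full_mass_moment_def power2_eq_square
  by (rule tendsto_L2_mult[OF _ _ xf_L2 xf_L2 sw_f_tendsto[OF xf_L2] sw_f_tendsto[OF xf_L2]]) (simp_all add: L2_sw[OF Lf])

lemma momentum_moment_tendsto: "(\<lambda>n. momentum_moment (ew n) t) \<longlonglongrightarrow> full_momentum_moment t"
proof -
  have "(\<lambda>n. LINT x|lborel. (sw (ew n) x * f t x) * w x) \<longlonglongrightarrow> (LINT x|lborel. (x * f t x) * w x)" if "L2 w" for w
    by (rule tendsto_L2_mult_fixed(1)[OF L2_sw[OF Lf] xf_L2 that sw_f_tendsto[OF xf_L2]])
  note l = this
  show ?thesis unfolding momentum_moment_def full_momentum_moment_def
    by (intro tendsto_diff tendsto_mult tendsto_const l Lg BL_L2[OF Bff])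
qed

text \<open>In the limit the derivative is \<open>\<integral> flux\<^sup>2 + flux H f\<^sub>x\<close>, and expanding this gives twice the energy.\<close>

lemma momentum_moment_deriv_tendsto: "(\<lambda>n. momentum_moment_deriv (ew n) t) \<longlonglongrightarrow> 2 * energy t"
proof -
  have cosl: "(\<lambda>n. norm_L2 (\<lambda>x. cos (ew n * x) * u x - u x)) \<longlonglongrightarrow> 0" if u: "L2 u" for u
  proof (rule dominated_convergence_L2(2)[OF u])
    note [measurable] = L2_measurable[OF u]
    show "(\<lambda>x. cos (ew n * x) * u x) \<in> borel_measurable borel" for n by measurable
    show "u \<in> borel_measurable borel" by measurable
    show "AE x in lborel. (\<lambda>n. cos (ew n * x) * u x) \<longlonglongrightarrow> u x"
    proof (rule AE_I2)
      fix x
      have "(\<lambda>n. cos (ew n * x) * u x) \<longlonglongrightarrow> cos (0 * x) * u x"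
        by (intro tendsto_intros ew_tendsto)
      then show "(\<lambda>n. cos (ew n * x) * u x) \<longlonglongrightarrow> u x" by simp
    qed
    show "AE x in lborel. norm (cos (ew n * x) * u x) \<le> norm (u x)" for n
      by (rule AE_I2) (simp add: abs_mult mult_left_le_one_le)
  qed
  let ?k = "\<lambda>n x. hilbert (\<lambda>x. cos (ew n * x) * f t x) x + commutator (ew n) (f1 t) x"
  have Lk: "L2 (?k n)" for n by (intro L2_add hilbert_L2 L2_cos Lf commutator_L2 Lf1)
  have Lh: "L2 (hilbert (f t))" by (rule hilbert_L2[OF Lf])
  have kl: "(\<lambda>n. norm_L2 (\<lambda>x. ?k n x - hilbert (f t) x)) \<longlonglongrightarrow> 0"
  proof (rule Lim_null_comparison[OF always_eventually], rule allI)
    fix n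
    have Lc: "L2 (\<lambda>x. cos (ew n * x) * f t x)" by (rule L2_cos[OF Lf])
    note [measurable] = L2_measurable[OF Lk[of n]] L2_measurable[OF commutator_L2[OF Lf1, of "ew n" t]]
      L2_measurable[OF hilbert_L2[OF L2_diff[OF Lc Lf], of t]]
    have "norm_L2 (\<lambda>x. ?k n x - hilbert (f t) x) = norm_L2 (\<lambda>x. hilbert (\<lambda>x. cos (ew n * x) * f t x - f t x) x + commutator (ew n) (f1 t) x)"
    proof (rule norm_L2_cong_AE)
      show "AE x in lborel. ?k n x - hilbert (f t) x = hilbert (\<lambda>x. cos (ew n * x) * f t x - f t x) x + commutator (ew n) (f1 t) x"
        using hilbert_diff[OF Lc Lf, of t] by eventually_elim simp
    qed measurable
    also have "\<dots> \<le> norm_L2 (hilbert (\<lambda>x. cos (ew n * x) * f t x - f t x)) + norm_L2 (commutator (ew n) (f1 t))"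
      by (intro norm_L2_triangle hilbert_L2 L2_diff Lc Lf commutator_L2 Lf1)
    also have "norm_L2 (hilbert (\<lambda>x. cos (ew n * x) * f t x - f t x)) = norm_L2 (\<lambda>x. cos (ew n * x) * f t x - f t x)"
      by (rule norm_L2_hilbert[OF L2_diff[OF Lc Lf]])
    finally show "norm (norm_L2 (\<lambda>x. ?k n x - hilbert (f t) x)) \<le> norm_L2 (\<lambda>x. cos (ew n * x) * f t x - f t x) + norm_L2 (commutator (ew n) (f1 t))"
      unfolding real_norm_def abs_of_nonneg[OF norm_L2_nonneg] .
  next
    show "(\<lambda>n. norm_L2 (\<lambda>x. cos (ew n * x) * f t x - f t x) + norm_L2 (commutator (ew n) (f1 t))) \<longlonglongrightarrow> 0"
      using tendsto_add[OF cosl[OF Lf] commutator_deriv_tendsto[OF wf Lf Lf1]] by simp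
  qed
  have 1: "(\<lambda>n. LINT x|lborel. cos (ew n * x) * flux t x * flux t x) \<longlonglongrightarrow> (LINT x|lborel. flux t x * flux t x)"
    by (rule tendsto_L2_mult_fixed(1)[OF L2_cos[OF BL_L2[OF Bhh]] BL_L2[OF Bhh] BL_L2[OF Bhh] cosl[OF BL_L2[OF Bhh]]])
  have 2: "(\<lambda>n. LINT x|lborel. v t x * ?k n x) \<longlonglongrightarrow> (LINT x|lborel. v t x * hilbert (f t) x)"
    by (rule tendsto_L2_mult_fixed(2)[OF Lk Lh Lv kl])
  have vh: "(LINT x|lborel. v t x * hilbert (f t) x) = (LINT x|lborel. flux t x * g t x)"
  proof -
    have "(LINT x|lborel. - v t x * hilbert (f t) x) = - (LINT x|lborel. flux t x * g t x)"
      by (rule wd_integration_by_parts[OF whh BL_L2[OF Bhh] L2_uminus[OF Lv] whf Lh Lg])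
    moreover have "(LINT x|lborel. - v t x * hilbert (f t) x) = - (LINT x|lborel. v t x * hilbert (f t) x)"
      by (simp only: mult_minus_left Bochner_Integration.integral_minus)
    ultimately show ?thesis by linarith
  qed
  have gg: "(LINT x|lborel. g t x * g t x) = (LINT x|lborel. f1 t x * f1 t x)" by (rule hilbert_inner[OF Lf1 Lf1])
  have "(LINT x|lborel. flux t x * flux t x) + (LINT x|lborel. flux t x * g t x) = (LINT x|lborel. flux t x * flux t x + flux t x * g t x)"
    using L2_mult_integrable[OF BL_L2[OF Bhh] BL_L2[OF Bhh], of t t] L2_mult_integrable[OF BL_L2[OF Bhh] Lg, of t t] by simp
  also have "\<dots> = (LINT x|lborel. 2 * (g t x * g t x) - 3/2 * (f t x * f t x * g t x) + 1/4 * ((f t x * f t x) * (f t x * f t x)))"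
    by (intro integral_eqI) (simp add: field_simps)
  also have "\<dots> = 2 * (LINT x|lborel. g t x * g t x) - 3/2 * (LINT x|lborel. f t x * f t x * g t x) + 1/4 * (LINT x|lborel. (f t x * f t x) * (f t x * f t x))"
    using L2_mult_integrable[OF Lg Lg, of t t] L2_mult_integrable[OF BL_L2[OF Bff] Lg, of t t] L2_mult_integrable[OF BL_L2[OF Bff] BL_L2[OF Bff], of t t] by simp
  also have "\<dots> = 2 * energy t" unfolding gg energy_def by simp
  finally have "(LINT x|lborel. flux t x * flux t x) + (LINT x|lborel. v t x * hilbert (f t) x) = 2 * energy t" unfolding vh .
  then show ?thesis unfolding momentum_moment_deriv_def using tendsto_add[OF 1 2] by simp
qed

end

section \<open>The weighted functional\<close>

context bo_weighted begin

text \<open>The limit is \<open>4 \<integral> x f H f\<^sub>x + 2 \<integral> x\<^sup>2 f\<^sup>2 f\<^sub>x\<close>, whose last term is a derivative up to \<open>- 4/3 \<integral> x f\<^sup>3\<close>.\<close>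

lemma mass_moment_deriv_tendsto: "(\<lambda>n. mass_moment_deriv (ew n) t) \<longlonglongrightarrow> 4 * full_momentum_moment t"
proof -
  have gl: "(\<lambda>n. norm_L2 (\<lambda>x. (hilbert (leibniz_rest (ew n) t) x + commutator (ew n) (f2 t) x) - 2 * g t x)) \<longlonglongrightarrow> 0"
  proof (rule Lim_null_comparison[OF always_eventually], rule allI)
    fix n
    have L2f1: "L2 (\<lambda>x. 2 * f1 t x)" by (rule L2_cmult[OF Lf1])
    note Lc = commutator_L2[OF Lf2, of "ew n" t]
    note [measurable] = L2_measurable[OF Lc] L2_measurable[OF hilbert_L2[OF Lr[of "ew n" t]]]
      L2_measurable[OF hilbert_L2[OF L2_diff[OF Lr[of "ew n" t] L2f1]]]
    have "norm_L2 (\<lambda>x. (hilbert (leibniz_rest (ew n) t) x + commutator (ew n) (f2 t) x) - 2 * g t x)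
       = norm_L2 (\<lambda>x. hilbert (\<lambda>x. leibniz_rest (ew n) t x - 2 * f1 t x) x + commutator (ew n) (f2 t) x)"
    proof (rule norm_L2_cong_AE)
      show "AE x in lborel. (hilbert (leibniz_rest (ew n) t) x + commutator (ew n) (f2 t) x) - 2 * g t x
          = hilbert (\<lambda>x. leibniz_rest (ew n) t x - 2 * f1 t x) x + commutator (ew n) (f2 t) x"
        using hilbert_diff[OF Lr L2f1, of "ew n" t] hilbert_cmult[OF Lf1, of 2 t] by eventually_elim simp
    qed measurable
    also have "\<dots> \<le> norm_L2 (hilbert (\<lambda>x. leibniz_rest (ew n) t x - 2 * f1 t x)) + norm_L2 (commutator (ew n) (f2 t))"
      by (rule norm_L2_triangle[OF hilbert_L2[OF L2_diff[OF Lr L2f1]] Lc])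
    also have "norm_L2 (hilbert (\<lambda>x. leibniz_rest (ew n) t x - 2 * f1 t x)) = norm_L2 (\<lambda>x. leibniz_rest (ew n) t x - 2 * f1 t x)"
      by (rule norm_L2_hilbert[OF L2_diff[OF Lr L2f1]])
    finally show "norm (norm_L2 (\<lambda>x. (hilbert (leibniz_rest (ew n) t) x + commutator (ew n) (f2 t) x) - 2 * g t x))
       \<le> norm_L2 (\<lambda>x. leibniz_rest (ew n) t x - 2 * f1 t x) + norm_L2 (commutator (ew n) (f2 t))"
      unfolding real_norm_def abs_of_nonneg[OF norm_L2_nonneg] .
  next
    have Lw: "L2 (\<lambda>x. 2 * norm (f1 t x) + norm (f t x))" by (intro L2_add L2_cmult L2_norm Lf Lf1)
    have "(\<lambda>n. norm_L2 (\<lambda>x. leibniz_rest (ew n) t x - 2 * f1 t x)) \<longlonglongrightarrow> 0"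
    proof (rule dominated_convergence_L2(2)[OF Lw])
      show "leibniz_rest (ew n) t \<in> borel_measurable borel" for n by (rule L2_measurable[OF Lr])
      show "AE x in lborel. (\<lambda>n. leibniz_rest (ew n) t x) \<longlonglongrightarrow> 2 * f1 t x"
      proof (rule AE_I2)
        fix x
        have "(\<lambda>n. leibniz_rest (ew n) t x) \<longlonglongrightarrow> 2 * (cos (0 * x) * f1 t x) - 0 * (sin (0 * x) * f t x)"
          unfolding leibniz_rest_def by (intro tendsto_intros ew_tendsto)
        then show "(\<lambda>n. leibniz_rest (ew n) t x) \<longlonglongrightarrow> 2 * f1 t x" by simp
      qed
      show "AE x in lborel. norm (leibniz_rest (ew n) t x) \<le> norm (2 * norm (f1 t x) + norm (f t x))" for n
      proof (rule AE_I2)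
        fix x
        have "\<bar>cos (ew n * x)\<bar> * \<bar>f1 t x\<bar> \<le> 1 * \<bar>f1 t x\<bar>" by (intro mult_right_mono) auto
        moreover have "ew n * (\<bar>sin (ew n * x)\<bar> * \<bar>f t x\<bar>) \<le> 1 * (1 * \<bar>f t x\<bar>)"
          using ew_pos[of n] ew_le_1[of n] by (intro mult_mono) auto
        moreover have "\<bar>leibniz_rest (ew n) t x\<bar> \<le> 2 * (\<bar>cos (ew n * x)\<bar> * \<bar>f1 t x\<bar>) + ew n * (\<bar>sin (ew n * x)\<bar> * \<bar>f t x\<bar>)"
          unfolding leibniz_rest_def using ew_pos[of n] by (intro order_trans[OF abs_triangle_ineq4]) (simp add: abs_mult)
        ultimately show "norm (leibniz_rest (ew n) t x) \<le> norm (2 * norm (f1 t x) + norm (f t x))" by simp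
      qed
    qed measurable
    then show "(\<lambda>n. norm_L2 (\<lambda>x. leibniz_rest (ew n) t x - 2 * f1 t x) + norm_L2 (commutator (ew n) (f2 t))) \<longlonglongrightarrow> 0"
      using tendsto_add[OF _ commutator_deriv_tendsto[OF wf1 Lf1 Lf2]] by fastforce
  qed
  have Lk: "L2 (\<lambda>x. hilbert (leibniz_rest e t) x + commutator e (f2 t) x)" for e by (intro L2_add hilbert_L2 Lr commutator_L2 Lf2)
  have L2g: "L2 (\<lambda>x. 2 * g t x)" by (rule L2_cmult[OF Lg])
  have 1: "(\<lambda>n. LINT x|lborel. (sw (ew n) x * f t x) * (hilbert (leibniz_rest (ew n) t) x + commutator (ew n) (f2 t) x)) \<longlonglongrightarrow> (LINT x|lborel. (x * f t x) * (2 * g t x))"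
    by (rule tendsto_L2_mult[OF _ _ xf_L2 L2g sw_f_tendsto[OF xf_L2] gl]) (simp_all add: L2_sw[OF Lf] Lk)
  have bxf: "L2 (\<lambda>x. (x * f t x) * f1 t x)"
    using BL_mult_L2[OF Bf1 xf_L2, of t t] by (simp add: mult.commute)
  have bsw: "L2 (\<lambda>x. (sw e x * f t x) * f1 t x)" for e
    using BL_mult_L2[OF Bf1 L2_sw[OF Lf], of t e t] by (simp add: mult.commute)
  have sl: "(\<lambda>n. norm_L2 (\<lambda>x. (sw (ew n) x * f t x) * f1 t x - (x * f t x) * f1 t x)) \<longlonglongrightarrow> 0"
  proof (rule Lim_null_comparison[OF always_eventually tendsto_mult_right_zero[OF sw_f_tendsto[OF xf_L2], of "\<bar>H2_size t\<bar>" t]], rule allI)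
    fix n
    have "norm_L2 (\<lambda>x. f1 t x * (sw (ew n) x * f t x - x * f t x)) \<le> \<bar>H2_size t\<bar> * norm_L2 (\<lambda>x. sw (ew n) x * f t x - x * f t x)"
      by (rule L2_mult_AE_bounded(2)[OF sup_le_H2_size(2) meas(2) L2_diff[OF L2_sw[OF Lf] xf_L2]])
    then show "norm (norm_L2 (\<lambda>x. (sw (ew n) x * f t x) * f1 t x - (x * f t x) * f1 t x)) \<le> \<bar>H2_size t\<bar> * norm_L2 (\<lambda>x. sw (ew n) x * f t x - x * f t x)"
      by (simp add: algebra_simps)
  qed
  have 2: "(\<lambda>n. LINT x|lborel. (sw (ew n) x * f t x) * ((sw (ew n) x * f t x) * f1 t x)) \<longlonglongrightarrow> (LINT x|lborel. (x * f t x) * ((x * f t x) * f1 t x))"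
    by (rule tendsto_L2_mult[OF _ _ xf_L2 bxf sw_f_tendsto[OF xf_L2] sl]) (simp_all add: L2_sw[OF Lf] bsw)
  have i1: "integrable lborel (\<lambda>x. (x * f t x) * (f t x * f t x))" by (rule L2_mult_integrable[OF xf_L2 BL_L2[OF Bff]])
  have i2: "integrable lborel (\<lambda>x. (x * f t x) * ((x * f t x) * f1 t x))" by (rule L2_mult_integrable[OF xf_L2 bxf])
  have wx: "wd (\<lambda>x. x) (\<lambda>x. 1)" by (rule wd_C1) auto
  have wxf: "wd (\<lambda>x. x * f t x) (\<lambda>x. 1 * f t x + x * f1 t x)" by (rule wd_mult[OF wx wf])
  have w: "wd (\<lambda>x. (x * f t x) * (x * f t x) * f t x)
      (\<lambda>x. ((1 * f t x + x * f1 t x) * (x * f t x) + (x * f t x) * (1 * f t x + x * f1 t x)) * f t x + (x * f t x) * (x * f t x) * f1 t x)"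
    by (rule wd_mult[OF wd_mult[OF wxf wxf] wf])
  have eq: "((1 * f t x + x * f1 t x) * (x * f t x) + (x * f t x) * (1 * f t x + x * f1 t x)) * f t x + (x * f t x) * (x * f t x) * f1 t x
      = 2 * ((x * f t x) * (f t x * f t x)) + 3 * ((x * f t x) * ((x * f t x) * f1 t x))" for x
    by (simp add: algebra_simps)
  have iw: "integrable lborel (\<lambda>x. (x * f t x) * (x * f t x) * f t x)"
    using L2_mult_integrable[OF xf_L2 BL_mult_L2[OF Bf xf_L2], of t t t] by (simp add: mult_ac)
  have "(LINT x|lborel. 2 * ((x * f t x) * (f t x * f t x)) + 3 * ((x * f t x) * ((x * f t x) * f1 t x))) = 0"
    using wd_integral_eq_0[OF w iw] i1 i2 unfolding eq by simp
  then have ibp: "3 * (LINT x|lborel. (x * f t x) * ((x * f t x) * f1 t x)) = - 2 * (LINT x|lborel. (x * f t x) * (f t x * f t x))"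
    using i1 i2 by simp
  have m2: "(LINT x|lborel. (x * f t x) * (2 * g t x)) = 2 * (LINT x|lborel. (x * f t x) * g t x)"
    by (simp add: mult.left_commute[of _ 2])
  have "(\<lambda>n. mass_moment_deriv (ew n) t) \<longlonglongrightarrow> 2 * (LINT x|lborel. (x * f t x) * (2 * g t x)) + 2 * (LINT x|lborel. (x * f t x) * ((x * f t x) * f1 t x))"
    unfolding mass_moment_deriv_def by (intro tendsto_add tendsto_mult tendsto_const 1 2)
  moreover have "2 * (LINT x|lborel. (x * f t x) * (2 * g t x)) + 2 * (LINT x|lborel. (x * f t x) * ((x * f t x) * f1 t x)) = 4 * full_momentum_moment t"
    unfolding m2 full_momentum_moment_def using ibp by simp
  ultimately show ?thesis by simp
qed

lemma momentum_moment_deriv_bound: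
  assumes e: "0 < e" "e \<le> 1"
  shows "\<bar>momentum_moment_deriv e t\<bar> \<le> (norm_L2 (flux t))\<^sup>2 + norm_L2 (v t) * (7 * H2_size t)"
proof -
  let ?k = "\<lambda>x. hilbert (\<lambda>x. cos (e * x) * f t x) x + commutator e (f1 t) x"
  note Lh = BL_L2[OF Bhh, of t]
  have Lc: "L2 (\<lambda>x. cos (e * x) * f t x)" by (rule L2_cos[OF Lf])
  have Lk: "L2 ?k" by (intro L2_add hilbert_L2 Lc commutator_L2 Lf1)
  have "norm_L2 ?k \<le> norm_L2 (hilbert (\<lambda>x. cos (e * x) * f t x)) + norm_L2 (commutator e (f1 t))"
    by (intro norm_L2_triangle hilbert_L2 Lc commutator_L2 Lf1)
  also have "\<dots> \<le> H2_size t + 6 * H2_size t"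
    using norm_L2_hilbert[OF Lc] norm_L2_cos[OF Lf, of e t] commutator_deriv_bound[OF e(1) wf Lf Lf1, of t] norm_le_H2_size(1)[of t] by linarith
  finally have k: "norm_L2 ?k \<le> 7 * H2_size t" by simp
  have 1: "\<bar>LINT x|lborel. cos (e * x) * flux t x * flux t x\<bar> \<le> (norm_L2 (flux t))\<^sup>2"
    using order_trans[OF Cauchy_Schwarz_L2_real[OF L2_cos[OF Lh] Lh] mult_right_mono[OF norm_L2_cos[OF Lh] norm_L2_nonneg]]
    unfolding power2_eq_square .
  have 2: "\<bar>LINT x|lborel. v t x * ?k x\<bar> \<le> norm_L2 (v t) * (7 * H2_size t)"
    by (rule order_trans[OF Cauchy_Schwarz_L2_real[OF Lv Lk] mult_left_mono[OF k norm_L2_nonneg]])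
  show ?thesis unfolding momentum_moment_deriv_def using 1 2 by linarith
qed

lemma continuous_bounded_Icc:
  fixes h :: "real \<Rightarrow> real"
  assumes "continuous_on UNIV h" obtains C where "\<And>t. t \<in> {a..b} \<Longrightarrow> h t \<le> C"
proof -
  have "bounded (h ` {a..b})"
    by (intro compact_imp_bounded compact_continuous_image continuous_on_subset[OF assms]) auto
  then obtain B where B: "\<forall>y\<in>h ` {a..b}. norm y \<le> B" unfolding bounded_iff by blast
  show ?thesis
  proof (rule that)
    fix t assume "t \<in> {a..b}"
    then have "norm (h t) \<le> B" using B by blast
    then show "h t \<le> B" by simp
  qed
qed

lemma continuous_H2_size: "continuous_on UNIV H2_size"
  unfolding H2_size_def[abs_def] by (intro continuous_on_add continuous_L2_norm cf cf1 cf2)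

lemma full_momentum_moment_diff:
  assumes ab: "a \<le> b" shows "full_momentum_moment b - full_momentum_moment a = 2 * energy 0 * (b - a)"
proof -
  have cff: "continuous_L2 (\<lambda>t x. f t x * u t x)" if "continuous_L2 u" for u
    by (rule continuous_L2_H1_mult[OF cf cf1 wf that])
  have "continuous_L2 (\<lambda>t. flux t)" by (intro continuous_L2_diff cg continuous_L2_cmult cff cf)
  moreover have "continuous_L2 (\<lambda>t x. f t x * f1 t x - g1 t x)" by (intro continuous_L2_diff cff cf1 cg1)
  then have "continuous_L2 (\<lambda>t. v t)" by simp
  ultimately have c: "continuous_on UNIV (\<lambda>t. (norm_L2 (flux t))\<^sup>2 + norm_L2 (v t) * (7 * H2_size t))"
    by (intro continuous_intros continuous_H2_size continuous_L2_norm)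
  obtain C where C: "\<And>t. t \<in> {a..b} \<Longrightarrow> (norm_L2 (flux t))\<^sup>2 + norm_L2 (v t) * (7 * H2_size t) \<le> C"
    by (rule continuous_bounded_Icc[OF c, of a b]) blast
  have "full_momentum_moment b - full_momentum_moment a = integral {a..b} (\<lambda>t. 2 * energy 0)"
  proof (rule limit_of_derivatives[OF ab])
    show "(momentum_moment (ew n) has_real_derivative momentum_moment_deriv (ew n) t) (at t)" for n t
      by (rule momentum_moment_has_derivative) (use ew_pos[of n] in simp)
    show "\<bar>momentum_moment_deriv (ew n) t\<bar> \<le> C" if "t \<in> {a..b}" for n t
      using momentum_moment_deriv_bound[OF ew_pos ew_le_1, of n t] C[OF that] by linarith
    show "(\<lambda>n. momentum_moment_deriv (ew n) t) \<longlonglongrightarrow> 2 * energy 0" for t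
      using momentum_moment_deriv_tendsto[of t] energy_const[of t 0] by simp
    show "(\<lambda>n. momentum_moment (ew n) t) \<longlonglongrightarrow> full_momentum_moment t" for t by (rule momentum_moment_tendsto)
  qed
  then show ?thesis using ab by simp
qed

lemma full_momentum_moment_eq: "full_momentum_moment t = full_momentum_moment 0 + 2 * energy 0 * t"
  using full_momentum_moment_diff[of 0 t] full_momentum_moment_diff[of t 0] by (cases "0 \<le> t") (auto simp: algebra_simps)

lemma full_mass_moment_diff:
  assumes ab: "a \<le> b" shows "full_mass_moment b - full_mass_moment a = (4 * full_momentum_moment 0 * b + 4 * energy 0 * b\<^sup>2) - (4 * full_momentum_moment 0 * a + 4 * energy 0 * a\<^sup>2)"
proof -
  define T where "T = max \<bar>a\<bar> \<bar>b\<bar>"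
  have sub: "t \<in> {-T..T}" if "t \<in> {a..b}" for t using that by (auto simp: T_def)
  obtain C where C: "\<And>n t. t \<in> {-T..T} \<Longrightarrow> mass_moment (ew n) t \<le> C" using mass_moment_uniform_bound[of T] by blast
  obtain K where K: "\<And>t. t \<in> {a..b} \<Longrightarrow> H2_size t \<le> K" using H2_size_locally_bounded[of a b] by blast
  have "full_mass_moment b - full_mass_moment a = integral {a..b} (\<lambda>t. 4 * full_momentum_moment t)"
  proof (rule limit_of_derivatives[OF ab])
    show "(mass_moment (ew n) has_real_derivative mass_moment_deriv (ew n) t) (at t)" for n t
      by (rule mass_moment_has_derivative) (use ew_pos[of n] in simp)
    show "\<bar>mass_moment_deriv (ew n) t\<bar> \<le> 11 * K * (1 + C)" if t: "t \<in> {a..b}" for n t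
    proof -
      have "11 * H2_size t * (1 + mass_moment (ew n) t) \<le> 11 * K * (1 + C)"
        using K[OF t] C[OF sub[OF t], of n] H2_size_nonneg[of t] mass_moment_nonneg[of "ew n" t] by (intro mult_mono) auto
      then show ?thesis using mass_moment_deriv_bound[OF ew_pos ew_le_1, of n t] by linarith
    qed
    show "(\<lambda>n. mass_moment_deriv (ew n) t) \<longlonglongrightarrow> 4 * full_momentum_moment t" for t by (rule mass_moment_deriv_tendsto)
    show "(\<lambda>n. mass_moment (ew n) t) \<longlonglongrightarrow> full_mass_moment t" for t by (rule mass_moment_tendsto)
  qed
  moreover have "((\<lambda>t. 4 * full_momentum_moment t) has_integral (4 * full_momentum_moment 0 * b + 4 * energy 0 * b\<^sup>2) - (4 * full_momentum_moment 0 * a + 4 * energy 0 * a\<^sup>2)) {a..b}"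
  proof (rule fundamental_theorem_of_calculus[OF ab])
    fix t
    have "((\<lambda>t. 4 * full_momentum_moment 0 * t + 4 * energy 0 * t\<^sup>2) has_real_derivative 4 * full_momentum_moment t) (at t)"
      unfolding full_momentum_moment_eq[of t] by (auto intro!: derivative_eq_intros)
    then show "((\<lambda>t. 4 * full_momentum_moment 0 * t + 4 * energy 0 * t\<^sup>2) has_vector_derivative 4 * full_momentum_moment t) (at t within {a..b})"
      by (simp add: has_real_derivative_iff_has_vector_derivative has_vector_derivative_at_within)
  qed
  ultimately show ?thesis using integral_unique by metis
qed

lemma full_mass_moment_eq: "full_mass_moment t = full_mass_moment 0 + 4 * full_momentum_moment 0 * t + 4 * energy 0 * t\<^sup>2"
  using full_mass_moment_diff[of 0 t] full_mass_moment_diff[of t 0] by (cases "0 \<le> t") auto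

theorem G_conserved: "full_mass_moment t - 4 * t * full_momentum_moment t + 4 * t\<^sup>2 * energy t = full_mass_moment 0"
  unfolding full_mass_moment_eq[of t] full_momentum_moment_eq[of t] energy_const[of t 0] by (simp add: algebra_simps power2_eq_square)

text \<open>Strong continuity from weak lower semicontinuity: by the parallelogram law it is enough to bound the
  norm of \<open>x (\<phi>(s) + \<phi>(t))\<close> from below, which the truncated weights do.\<close>

theorem continuous_xf: "continuous_L2 (\<lambda>t x. x * f t x)"
  unfolding continuous_L2_iff
proof (intro conjI allI xf_L2)
  fix t
  have A0n: "full_mass_moment s = (norm_L2 (\<lambda>x. x * f s x))\<^sup>2" for s unfolding full_mass_moment_def norm_L2_sq_real by (simp only: power2_eq_square)
  let ?q = "\<lambda>n s. norm_L2 (\<lambda>x. sw (ew n) x * f s x + sw (ew n) x * f t x)"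
  have bd: "(norm_L2 (\<lambda>x. x * f s x - x * f t x))\<^sup>2 \<le> 2 * full_mass_moment s + 2 * full_mass_moment t - (?q n s)\<^sup>2" for n s
  proof -
    let ?a = "\<lambda>x. x * f s x" and ?b = "\<lambda>x. x * f t x"
    have i: "integrable lborel (\<lambda>x. ?a x * ?a x)" "integrable lborel (\<lambda>x. ?b x * ?b x)" "integrable lborel (\<lambda>x. (?a x + ?b x)\<^sup>2)"
      by (intro L2_mult_integrable xf_L2 L2_mult2_integrable L2_add)+
    have "(norm_L2 (\<lambda>x. ?a x - ?b x))\<^sup>2 = (LINT x|lborel. 2 * (?a x * ?a x) + 2 * (?b x * ?b x) - (?a x + ?b x)\<^sup>2)"
      unfolding norm_L2_sq_real by (intro integral_eqI) (simp add: power2_eq_square algebra_simps)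
    also have "\<dots> = 2 * full_mass_moment s + 2 * full_mass_moment t - (norm_L2 (\<lambda>x. ?a x + ?b x))\<^sup>2"
      unfolding full_mass_moment_def norm_L2_sq_real using i by simp
    finally have e: "(norm_L2 (\<lambda>x. ?a x - ?b x))\<^sup>2 = 2 * full_mass_moment s + 2 * full_mass_moment t - (norm_L2 (\<lambda>x. ?a x + ?b x))\<^sup>2" .
    have "?q n s \<le> norm_L2 (\<lambda>x. ?a x + ?b x)"
    proof (rule norm_L2_mono[OF L2_add[OF xf_L2 xf_L2]])
      show "AE x in lborel. norm (sw (ew n) x * f s x + sw (ew n) x * f t x) \<le> norm (?a x + ?b x)"
      proof (rule AE_I2)
        fix x
        have "\<bar>sw (ew n) x\<bar> * \<bar>f s x + f t x\<bar> \<le> \<bar>x\<bar> * \<bar>f s x + f t x\<bar>" by (intro mult_right_mono abs_sw_le_abs) simp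
        then show "norm (sw (ew n) x * f s x + sw (ew n) x * f t x) \<le> norm (?a x + ?b x)"
          unfolding real_norm_def distrib_left[symmetric] abs_mult .
      qed
    qed measurable
    then have "(?q n s)\<^sup>2 \<le> (norm_L2 (\<lambda>x. ?a x + ?b x))\<^sup>2" by (intro power_mono) auto
    then show ?thesis using e by linarith
  qed
  have cA: "(full_mass_moment \<longlongrightarrow> full_mass_moment t) (at t)"
  proof -
    have "((\<lambda>s. full_mass_moment 0 + 4 * full_momentum_moment 0 * s + 4 * energy 0 * s\<^sup>2) \<longlongrightarrow> full_mass_moment 0 + 4 * full_momentum_moment 0 * t + 4 * energy 0 * t\<^sup>2) (at t)"
      by (intro tendsto_intros)
    then show ?thesis unfolding full_mass_moment_eq[symmetric] .
  qed
  have cq: "((\<lambda>s. 2 * full_mass_moment s + 2 * full_mass_moment t - (?q n s)\<^sup>2) \<longlongrightarrow> 4 * full_mass_moment t - 4 * mass_moment (ew n) t) (at t)" for n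
  proof -
    have b: "\<And>x. \<bar>sw (ew n) x\<bar> \<le> 1 / \<bar>ew n\<bar>" by (rule abs_sw_le)
    have "continuous_L2 (\<lambda>s x. sw (ew n) x * f s x + sw (ew n) x * f t x)"
      by (intro continuous_L2_add continuous_L2_const continuous_L2_bounded_mult[OF _ sw_measurable b] cf L2_sw Lf)
    from continuous_L2_norm[OF this] have "(?q n \<longlongrightarrow> ?q n t) (at t)"
      unfolding continuous_on_eq_continuous_at[OF open_UNIV] isCont_def by blast
    then have "((\<lambda>s. 2 * full_mass_moment s + 2 * full_mass_moment t - (?q n s)\<^sup>2) \<longlongrightarrow> 2 * full_mass_moment t + 2 * full_mass_moment t - (?q n t)\<^sup>2) (at t)"
      by (intro tendsto_intros cA)
    moreover have "(?q n t)\<^sup>2 = 4 * mass_moment (ew n) t"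
    proof -
      have "(?q n t)\<^sup>2 = (LINT x|lborel. 4 * (sw (ew n) x * f t x)\<^sup>2)"
        unfolding norm_L2_sq_real by (intro integral_eqI) (simp add: power2_eq_square)
      then show ?thesis unfolding mass_moment_def by simp
    qed
    ultimately show ?thesis by simp
  qed
  have "((\<lambda>s. (norm_L2 (\<lambda>x. x * f s x - x * f t x))\<^sup>2) \<longlongrightarrow> 0) (at t)"
  proof (rule tendstoI)
    fix e :: real assume e: "0 < e"
    have "(\<lambda>n. 4 * full_mass_moment t - 4 * mass_moment (ew n) t) \<longlonglongrightarrow> 4 * full_mass_moment t - 4 * full_mass_moment t"
      by (intro tendsto_intros mass_moment_tendsto)
    then have "\<forall>\<^sub>F n in sequentially. 4 * full_mass_moment t - 4 * mass_moment (ew n) t < e" using e by (intro order_tendstoD(2)) auto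
    then obtain n where n: "4 * full_mass_moment t - 4 * mass_moment (ew n) t < e" using eventually_happens'[OF sequentially_bot] by auto
    have "\<forall>\<^sub>F s in at t. 2 * full_mass_moment s + 2 * full_mass_moment t - (?q n s)\<^sup>2 < e" by (rule order_tendstoD(2)[OF cq n])
    then show "\<forall>\<^sub>F s in at t. dist ((norm_L2 (\<lambda>x. x * f s x - x * f t x))\<^sup>2) 0 < e"
    proof eventually_elim
      case (elim s)
      show ?case using le_less_trans[OF bd elim] by simp
    qed
  qed
  then have "((\<lambda>s. sqrt ((norm_L2 (\<lambda>x. x * f s x - x * f t x))\<^sup>2)) \<longlongrightarrow> sqrt 0) (at t)" by (rule tendsto_real_sqrt)
  then show "((\<lambda>s. norm_L2 (\<lambda>x. x * f s x - x * f t x)) \<longlongrightarrow> 0) (at t)" by simp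
qed

theorem continuous_Lop: "continuous_L2 (\<lambda>t x. x * f t x - 2 * t * g t x)"
proof -
  have "continuous_L2 (\<lambda>t x. (2 * t) * g t x)"
    by (rule continuous_L2_scale[OF cg]) (intro continuous_intros)
  then show ?thesis by (rule continuous_L2_diff[OF continuous_xf])
qed

abbreviation "h t \<equiv> hilbert (f t)"
abbreviation "LNL t x \<equiv> x * f t x - 2 * t * (g t x - 1/8 * (3 * (f t x)\<^sup>2 - (h t x)\<^sup>2))"
text \<open>The density of \<open>G\<close>.\<close>

abbreviation "Gd t x \<equiv> x\<^sup>2 * (f t x)\<^sup>2 - 4 * x * t * (f t x * g t x - 1/3 * (f t x) ^ 3)
   + 4 * t\<^sup>2 * ((f1 t x)\<^sup>2 - 3/4 * (f t x)\<^sup>2 * g t x + 1/8 * (f t x) ^ 4)"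

lemma Gd_integral: "integrable lborel (Gd t)" "(LINT x|lborel. Gd t x) = full_mass_moment t - 4 * t * full_momentum_moment t + 4 * t\<^sup>2 * energy t"
proof -
  have eq: "Gd t = (\<lambda>x. (x * f t x) * (x * f t x) - 4 * t * ((x * f t x) * g t x) + 4/3 * t * ((x * f t x) * (f t x * f t x))
     + 4 * t\<^sup>2 * (f1 t x * f1 t x) - 3 * t\<^sup>2 * (f t x * f t x * g t x) + 1/2 * t\<^sup>2 * ((f t x * f t x) * (f t x * f t x)))"
    by (rule ext) (simp add: power2_eq_square power3_eq_cube power4_eq_xxxx field_simps)
  note i = L2_mult_integrable[OF xf_L2 xf_L2, of t t] L2_mult_integrable[OF xf_L2 Lg, of t t] L2_mult_integrable[OF xf_L2 BL_L2[OF Bff], of t t]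
    L2_mult_integrable[OF Lf1 Lf1, of t t] L2_mult_integrable[OF BL_L2[OF Bff] Lg, of t t] L2_mult_integrable[OF BL_L2[OF Bff] BL_L2[OF Bff], of t t]
  show "integrable lborel (Gd t)" unfolding eq using i by simp
  have "(LINT x|lborel. Gd t x) = (LINT x|lborel. (x * f t x) * (x * f t x)) - 4 * t * (LINT x|lborel. (x * f t x) * g t x)
     + 4/3 * t * (LINT x|lborel. (x * f t x) * (f t x * f t x)) + 4 * t\<^sup>2 * (LINT x|lborel. f1 t x * f1 t x)
     - 3 * t\<^sup>2 * (LINT x|lborel. f t x * f t x * g t x) + 1/2 * t\<^sup>2 * (LINT x|lborel. (f t x * f t x) * (f t x * f t x))"
    unfolding eq using i by simp
  also have "\<dots> = full_mass_moment t - 4 * t * full_momentum_moment t + 4 * t\<^sup>2 * energy t"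
    unfolding full_mass_moment_def full_momentum_moment_def energy_def by (simp add: field_simps)
  finally show "(LINT x|lborel. Gd t x) = full_mass_moment t - 4 * t * full_momentum_moment t + 4 * t\<^sup>2 * energy t" .
qed

text \<open>Expanding the square produces \<open>\<integral> x f (H f)\<^sup>2\<close>, \<open>\<integral> f\<^sup>2 (H f)\<^sup>2\<close> and \<open>\<integral> (H f)\<^sup>4\<close>, which the cubic and quartic identities
  eliminate, and \<open>\<integral> (H f)\<^sup>2 H f\<^sub>x = 0\<close>.\<close>

lemma LNL_norm: "L2 (LNL t)" "(norm_L2 (LNL t))\<^sup>2 = full_mass_moment t - 4 * t * full_momentum_moment t + 4 * t\<^sup>2 * energy t"
proof -
  interpret b: bounded_pair "f t" "h t" "H2_size t" by (rule pair_f)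
  let ?m = "\<lambda>x. 3 * (f t x * f t x) - h t x * h t x"
  have Lh: "L2 (h t)" by (rule hilbert_L2[OF Lf])
  have Bm: "BL ?m" by (intro BL_diff BL_cmult BL_mult Bf Bh)
  have eqL: "LNL t = (\<lambda>x. x * f t x - 2 * t * (g t x - 1/8 * ?m x))"
    by (simp add: power2_eq_square)
  show "L2 (LNL t)" unfolding eqL by (intro L2_diff L2_cmult xf_L2 Lg BL_L2[OF Bm])
  have Bhh2: "BL (\<lambda>x. h t x * h t x)" by (intro BL_mult Bh)
  note i = L2_mult_integrable[OF xf_L2 xf_L2, of t t] L2_mult_integrable[OF xf_L2 Lg, of t t] L2_mult_integrable[OF xf_L2 BL_L2[OF Bff], of t t]
    L2_mult_integrable[OF xf_L2 BL_L2[OF Bhh2], of t]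
    L2_mult_integrable[OF Lg Lg, of t t] L2_mult_integrable[OF BL_L2[OF Bff] Lg, of t t] L2_mult_integrable[OF BL_L2[OF Bhh2] Lg, of t]
    L2_mult_integrable[OF BL_L2[OF Bff] BL_L2[OF Bff], of t t] L2_mult_integrable[OF BL_L2[OF Bff] BL_L2[OF Bhh2], of t]
    L2_mult_integrable[OF BL_L2[OF Bhh2] BL_L2[OF Bhh2]]
  have wh: "wd (h t) (g t)" by (rule whf)
  have ghh: "(LINT x|lborel. h t x * h t x * g t x) = 0"
  proof -
    have w: "wd (\<lambda>x. h t x * (h t x * h t x)) (\<lambda>x. g t x * (h t x * h t x) + h t x * (g t x * h t x + h t x * g t x))"
      by (rule wd_mult[OF wh wd_mult[OF wh wh]])
    have eq: "g t x * (h t x * h t x) + h t x * (g t x * h t x + h t x * g t x) = 3 * (h t x * h t x * g t x)" for x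
      by (simp add: algebra_simps)
    have "(LINT x|lborel. 3 * (h t x * h t x * g t x)) = 0"
      using wd_integral_eq_0[OF w L2_mult_integrable[OF Lh BL_L2[OF Bhh2]]] i(7) unfolding eq by simp
    then show ?thesis by simp
  qed
  have gg: "(LINT x|lborel. g t x * g t x) = (LINT x|lborel. f1 t x * f1 t x)" by (rule hilbert_inner[OF Lf1 Lf1])
  have cub: "(LINT x|lborel. (x * f t x) * (f t x * f t x)) = 3 * (LINT x|lborel. (x * f t x) * (h t x * h t x))"
    using b.weighted_cubic_identity[OF xf_L2] by (simp add: power2_eq_square power3_eq_cube mult.assoc)
  have quart: "(LINT x|lborel. (f t x * f t x) * (f t x * f t x)) + (LINT x|lborel. (h t x * h t x) * (h t x * h t x))
      = 6 * (LINT x|lborel. (f t x * f t x) * (h t x * h t x))"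
    using b.quartic_identity by (simp add: power2_eq_square power4_eq_xxxx mult.assoc)
  have "(norm_L2 (LNL t))\<^sup>2 = (LINT x|lborel. (x * f t x) * (x * f t x) - 4 * t * ((x * f t x) * g t x)
      + 3/2 * t * ((x * f t x) * (f t x * f t x)) - 1/2 * t * ((x * f t x) * (h t x * h t x))
      + 4 * t\<^sup>2 * (g t x * g t x) - 3 * t\<^sup>2 * (f t x * f t x * g t x) + t\<^sup>2 * (h t x * h t x * g t x)
      + 9/16 * t\<^sup>2 * ((f t x * f t x) * (f t x * f t x)) - 3/8 * t\<^sup>2 * ((f t x * f t x) * (h t x * h t x)) + 1/16 * t\<^sup>2 * ((h t x * h t x) * (h t x * h t x)))"
    unfolding norm_L2_sq_real eqL
    by (intro integral_eqI) (simp add: power2_eq_square field_simps)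
  also have "\<dots> = (LINT x|lborel. (x * f t x) * (x * f t x)) - 4 * t * (LINT x|lborel. (x * f t x) * g t x)
      + 3/2 * t * (LINT x|lborel. (x * f t x) * (f t x * f t x)) - 1/2 * t * (LINT x|lborel. (x * f t x) * (h t x * h t x))
      + 4 * t\<^sup>2 * (LINT x|lborel. g t x * g t x) - 3 * t\<^sup>2 * (LINT x|lborel. f t x * f t x * g t x) + t\<^sup>2 * (LINT x|lborel. h t x * h t x * g t x)
      + 9/16 * t\<^sup>2 * (LINT x|lborel. (f t x * f t x) * (f t x * f t x)) - 3/8 * t\<^sup>2 * (LINT x|lborel. (f t x * f t x) * (h t x * h t x))
      + 1/16 * t\<^sup>2 * (LINT x|lborel. (h t x * h t x) * (h t x * h t x))"
    using i by simp
  finally have total: "(norm_L2 (LNL t))\<^sup>2 = \<dots>" .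
  define c where "c = (LINT x|lborel. (x * f t x) * (h t x * h t x))"
  define q where "q = (LINT x|lborel. (f t x * f t x) * (f t x * f t x))"
  define m where "m = (LINT x|lborel. (f t x * f t x) * (h t x * h t x))"
  have hq: "(LINT x|lborel. (h t x * h t x) * (h t x * h t x)) = 6 * m - q" using quart by (simp add: q_def m_def)
  show "(norm_L2 (LNL t))\<^sup>2 = full_mass_moment t - 4 * t * full_momentum_moment t + 4 * t\<^sup>2 * energy t"
    unfolding total ghh gg cub hq full_mass_moment_def full_momentum_moment_def energy_def q_def[symmetric] m_def[symmetric] c_def[symmetric]
    by (simp add: field_simps)
qed

end

section \<open>Solutions of the Benjamin-Ono equation\<close>

text \<open>\<open>weak_deriv\<close> is an arbitrary choice, but any two weak derivatives agree almost everywhere.\<close>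

lemma weak_deriv_wd:
  assumes "wd f f'"
  shows "wd f (weak_deriv f)" and "AE x in lborel. weak_deriv f x = f' x"
proof -
  show w: "wd f (weak_deriv f)" unfolding weak_deriv_def by (rule someI[of "\<lambda>g. wd f g", OF assms])
  show "AE x in lborel. weak_deriv f x = f' x" by (rule has_weak_deriv_unique[OF w assms])
qed

lemma weak_deriv_L2:
  assumes "wd f f'" "L2 f'" shows "L2 (weak_deriv f)"
proof (rule L2_cong_AE[OF _ wd_measurable(2)[OF weak_deriv_wd(1)[OF assms(1)]] assms(2)])
  show "AE x in lborel. f' x = weak_deriv f x"
    using weak_deriv_wd(2)[OF assms(1)] by eventually_elim simp
qed

lemma wd_weak_deriv:
  assumes "wd f f'" "wd f' f''" shows "wd (weak_deriv f) f''"
proof (rule has_weak_deriv_cong_AE[OF assms(2)])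
  show "AE x in lborel. f' x = weak_deriv f x"
    using weak_deriv_wd(2)[OF assms(1)] by eventually_elim simp
  show "AE x in lborel. f'' x = f'' x" by simp
  show "weak_deriv f \<in> borel_measurable borel" by (rule wd_measurable(2)[OF weak_deriv_wd(1)[OF assms(1)]])
  show "f'' \<in> borel_measurable borel" by (rule wd_measurable(2)[OF assms(2)])
qed

lemma sobolev_2D:
  assumes "sobolev 2 f"
  shows "L2 f" "L2 (weak_deriv f)" "L2 (weak_deriv (weak_deriv f))"
    "wd f (weak_deriv f)" "wd (weak_deriv f) (weak_deriv (weak_deriv f))"
proof -
  obtain f' f'' where w: "L2 f" "wd f f'" "L2 f'" "wd f' f''" "L2 f''"
    using assms by (auto simp: numeral_2_eq_2)
  note w1 = wd_weak_deriv[OF w(2,4)]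
  show "L2 f" by (rule w)
  show "wd f (weak_deriv f)" by (rule weak_deriv_wd(1)[OF w(2)])
  show "L2 (weak_deriv f)" by (rule weak_deriv_L2[OF w(2,3)])
  show "wd (weak_deriv f) (weak_deriv (weak_deriv f))" by (rule weak_deriv_wd(1)[OF w1])
  show "L2 (weak_deriv (weak_deriv f))" by (rule weak_deriv_L2[OF w1 w(5)])
qed

lemma norm_L2_weak_deriv_le_norm_sobolev:
  assumes "j \<le> k" shows "norm_L2 ((weak_deriv ^^ j) f) \<le> norm_sobolev k f"
proof -
  have "(norm_L2 ((weak_deriv ^^ j) f))\<^sup>2 \<le> (\<Sum>j\<le>k. (norm_L2 ((weak_deriv ^^ j) f))\<^sup>2)"
    by (rule member_le_sum) (use assms in auto)
  then show ?thesis unfolding norm_sobolev_def by (intro real_le_rsqrt)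
qed

text \<open>The Sobolev norm of a difference involves the weak derivatives chosen for the difference, which agree with
  the differences of the chosen ones only almost everywhere.\<close>

lemma weak_deriv_diff_AE:
  assumes f: "sobolev 2 f" and k: "sobolev 2 k"
  shows "AE x in lborel. weak_deriv (\<lambda>x. f x - k x) x = weak_deriv f x - weak_deriv k x"
    and "AE x in lborel. weak_deriv (weak_deriv (\<lambda>x. f x - k x)) x = weak_deriv (weak_deriv f) x - weak_deriv (weak_deriv k) x"
proof -
  note w1 = wd_diff[OF sobolev_2D(4)[OF f] sobolev_2D(4)[OF k]]
  note w2 = wd_diff[OF sobolev_2D(5)[OF f] sobolev_2D(5)[OF k]]
  show "AE x in lborel. weak_deriv (\<lambda>x. f x - k x) x = weak_deriv f x - weak_deriv k x"
    by (rule weak_deriv_wd(2)[OF w1])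
  show "AE x in lborel. weak_deriv (weak_deriv (\<lambda>x. f x - k x)) x = weak_deriv (weak_deriv f) x - weak_deriv (weak_deriv k) x"
    by (rule weak_deriv_wd(2)[OF wd_weak_deriv[OF w1 w2]])
qed

lemma continuous_sobolev_2D:
  assumes "continuous_sobolev 2 u"
  shows "continuous_L2 u" "continuous_L2 (\<lambda>t. weak_deriv (u t))" "continuous_L2 (\<lambda>t. weak_deriv (weak_deriv (u t)))"
proof -
  have so: "sobolev 2 (u t)" for t using assms by (simp add: continuous_sobolev_def)
  have lim: "((\<lambda>s. norm_sobolev 2 (\<lambda>x. u s x - u t x)) \<longlongrightarrow> 0) (at t)" for t
    using assms by (simp add: continuous_sobolev_def)
  have c: "continuous_L2 w" if L: "\<And>t. L2 (w t)"
      and le: "\<And>s t. norm_L2 (\<lambda>x. w s x - w t x) \<le> norm_sobolev 2 (\<lambda>x. u s x - u t x)" for w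
    unfolding continuous_L2_iff
  proof (intro conjI allI L)
    fix t
    show "((\<lambda>s. norm_L2 (\<lambda>x. w s x - w t x)) \<longlongrightarrow> 0) (at t)"
      by (rule tendsto_sandwich[OF _ _ tendsto_const lim]) (simp_all add: le)
  qed
  show "continuous_L2 u"
    by (rule c[OF sobolev_2D(1)[OF so]]) (use norm_L2_weak_deriv_le_norm_sobolev[of 0 2] in simp)
  show "continuous_L2 (\<lambda>t. weak_deriv (u t))"
  proof (rule c[OF sobolev_2D(2)[OF so]])
    fix s t
    note w = wd_diff[OF sobolev_2D(4)[OF so[of s]] sobolev_2D(4)[OF so[of t]]]
    have "norm_L2 (weak_deriv (\<lambda>x. u s x - u t x)) = norm_L2 (\<lambda>x. weak_deriv (u s) x - weak_deriv (u t) x)"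
      by (rule norm_L2_cong_AE[OF weak_deriv_diff_AE(1)[OF so so] wd_measurable(2)[OF weak_deriv_wd(1)[OF w]] wd_measurable(2)[OF w]])
    then show "norm_L2 (\<lambda>x. weak_deriv (u s) x - weak_deriv (u t) x) \<le> norm_sobolev 2 (\<lambda>x. u s x - u t x)"
      using norm_L2_weak_deriv_le_norm_sobolev[of 1 2 "\<lambda>x. u s x - u t x"] by simp
  qed
  show "continuous_L2 (\<lambda>t. weak_deriv (weak_deriv (u t)))"
  proof (rule c[OF sobolev_2D(3)[OF so]])
    fix s t
    note w = wd_diff[OF sobolev_2D(4)[OF so[of s]] sobolev_2D(4)[OF so[of t]]]
    note w2 = wd_diff[OF sobolev_2D(5)[OF so[of s]] sobolev_2D(5)[OF so[of t]]]
    have "norm_L2 (weak_deriv (weak_deriv (\<lambda>x. u s x - u t x))) = norm_L2 (\<lambda>x. weak_deriv (weak_deriv (u s)) x - weak_deriv (weak_deriv (u t)) x)"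
      by (rule norm_L2_cong_AE[OF weak_deriv_diff_AE(2)[OF so so] wd_measurable(2)[OF weak_deriv_wd(1)[OF wd_weak_deriv[OF w w2]]] wd_measurable(2)[OF w2]])
    then show "norm_L2 (\<lambda>x. weak_deriv (weak_deriv (u s)) x - weak_deriv (weak_deriv (u t)) x) \<le> norm_sobolev 2 (\<lambda>x. u s x - u t x)"
      using norm_L2_weak_deriv_le_norm_sobolev[of 2 2 "\<lambda>x. u s x - u t x"] by (simp add: numeral_2_eq_2)
  qed
qed

lemma has_L2_deriv_cong_AE:
  assumes d: "has_L2_deriv u v t" and u: "\<And>t. u t \<in> borel_measurable borel"
    and AE: "AE x in lborel. v x = w x" and m: "w \<in> borel_measurable borel"
  shows "has_L2_deriv u w t"
proof -
  let ?q = "\<lambda>h x. (u (t + h) x - u t x) / h"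
  have v: "L2 v" using d by (simp add: has_L2_deriv_def)
  note [measurable] = u m L2_measurable[OF v]
  have e: "norm_L2 (\<lambda>x. ?q h x - v x) = norm_L2 (\<lambda>x. ?q h x - w x)" for h
    by (rule norm_L2_cong_AE) (use AE in auto)
  have l: "\<forall>\<^sub>F h in at 0. L2 (\<lambda>x. ?q h x - v x)" "((\<lambda>h. norm_L2 (\<lambda>x. ?q h x - v x)) \<longlongrightarrow> 0) (at 0)"
    using d by (simp_all add: has_L2_deriv_def tendsto_L2_def)
  have "\<forall>\<^sub>F h in at 0. L2 (\<lambda>x. ?q h x - w x)"
    using l(1)
  proof eventually_elim
    case (elim h)
    show ?case by (rule L2_cong_AE[OF _ _ elim]) (use AE in auto)
  qed
  then show ?thesis
    using l(2) L2_cong_AE[OF AE m v] unfolding has_L2_deriv_def tendsto_L2_def e by blast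
qed

text \<open>The product rule identifies the weak derivative of \<open>\<phi>\<^sup>2\<close>, and the time derivative in \<open>L\<^sup>2\<close> may be changed on a
  null set.\<close>

lemma benjamin_ono_bo_flow:
  assumes "benjamin_ono_solution \<phi>"
  shows "bo_flow \<phi> (\<lambda>t. weak_deriv (\<phi> t)) (\<lambda>t. weak_deriv (weak_deriv (\<phi> t)))"
proof
  have c: "continuous_sobolev 2 \<phi>" using assms by (simp add: benjamin_ono_solution_def)
  then have so: "sobolev 2 (\<phi> t)" for t by (simp add: continuous_sobolev_def)
  note S = sobolev_2D[OF so]
  show "continuous_L2 \<phi>" "continuous_L2 (\<lambda>t. weak_deriv (\<phi> t))" "continuous_L2 (\<lambda>t. weak_deriv (weak_deriv (\<phi> t)))"
    by (rule continuous_sobolev_2D[OF c])+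
  show "wd (\<phi> t) (weak_deriv (\<phi> t))" "wd (weak_deriv (\<phi> t)) (weak_deriv (weak_deriv (\<phi> t)))" for t by (rule S)+
  fix t
  obtain \<phi>t where d: "has_L2_deriv \<phi> \<phi>t t"
    and eq: "AE x in lborel. \<phi>t x + hilbert ((weak_deriv ^^ 2) (\<phi> t)) x = 1/2 * weak_deriv (\<lambda>y. (\<phi> t y)\<^sup>2) x"
    using assms by (auto simp: benjamin_ono_solution_def)
  have w: "wd (\<lambda>y. (\<phi> t y)\<^sup>2) (\<lambda>x. weak_deriv (\<phi> t) x * \<phi> t x + \<phi> t x * weak_deriv (\<phi> t) x)"
    unfolding power2_eq_square by (rule wd_mult[OF S(4) S(4)])
  show "has_L2_deriv \<phi> (\<lambda>x. - hilbert (weak_deriv (weak_deriv (\<phi> t))) x + \<phi> t x * weak_deriv (\<phi> t) x) t"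
  proof (rule has_L2_deriv_cong_AE[OF d])
    note [measurable] = L2_measurable[OF S(1)] L2_measurable[OF S(2)] L2_measurable[OF hilbert_L2[OF S(3)]]
    show "\<phi> s \<in> borel_measurable borel" for s by measurable
    show "(\<lambda>x. - hilbert (weak_deriv (weak_deriv (\<phi> t))) x + \<phi> t x * weak_deriv (\<phi> t) x) \<in> borel_measurable borel"
      by measurable
    show "AE x in lborel. \<phi>t x = - hilbert (weak_deriv (weak_deriv (\<phi> t))) x + \<phi> t x * weak_deriv (\<phi> t) x"
      using eq weak_deriv_wd(2)[OF w]
    proof eventually_elim
      case (elim x)
      show ?case using elim(1) unfolding elim(2) by (simp add: numeral_2_eq_2 field_simps)
    qed
  qed
qed

theorem proposition7p1:
  fixes \<phi> :: "real \<Rightarrow> real \<Rightarrow> real" and \<phi>\<^sub>0 :: "real \<Rightarrow> real"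
  assumes solution: "benjamin_ono_solution \<phi>"
    and initial: "AE x in lborel. \<phi> 0 x = \<phi>\<^sub>0 x"
    and data_H2: "sobolev 2 \<phi>\<^sub>0"
    and data_weighted: "square_integrable (\<lambda>x. x * \<phi>\<^sub>0 x)"
  shows "continuous_L2 (L_op \<phi>)
    \<and> ((\<forall>t. integrable lborel (G_density \<phi> t)) \<and>
       (\<forall>s t. G_functional \<phi> s = G_functional \<phi> t))
    \<and> (\<forall>t. square_integrable (L_NL \<phi> t) \<and>
           G_functional \<phi> t = (norm_L2 (L_NL \<phi> t))\<^sup>2)"
proof -
  interpret bo_flow \<phi> "\<lambda>t. weak_deriv (\<phi> t)" "\<lambda>t. weak_deriv (weak_deriv (\<phi> t))"
    by (rule benjamin_ono_bo_flow[OF solution])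
  interpret bo_weighted \<phi> "\<lambda>t. weak_deriv (\<phi> t)" "\<lambda>t. weak_deriv (weak_deriv (\<phi> t))"
  proof
    show "L2 (\<lambda>x. x * \<phi> 0 x)"
    proof (rule L2_cong_AE[OF _ _ data_weighted])
      show "AE x in lborel. x * \<phi>\<^sub>0 x = x * \<phi> 0 x" using initial by eventually_elim simp
      note [measurable] = L2_measurable[OF Lf]
      show "(\<lambda>x. x * \<phi> 0 x) \<in> borel_measurable borel" by measurable
    qed
  qed
  have L: "L_op \<phi> = (\<lambda>t x. x * \<phi> t x - 2 * t * hilbert (weak_deriv (\<phi> t)) x)"
    by (intro ext) (simp add: L_op_def)
  have G: "G_density \<phi> t = Gd t" for t
    by (rule ext) (simp add: G_density_def mass_density_def momentum_density_def energy_density_def)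
  have NL: "L_NL \<phi> t = LNL t" for t
    by (rule ext) (simp add: L_NL_def)
  have GF: "G_functional \<phi> t = full_mass_moment t - 4 * t * full_momentum_moment t + 4 * t\<^sup>2 * energy t" for t
    unfolding G_functional_def G by (rule Gd_integral(2))
  have "continuous_L2 (L_op \<phi>)" unfolding L by (rule continuous_Lop)
  moreover have "integrable lborel (G_density \<phi> t)" for t unfolding G by (rule Gd_integral(1))
  moreover have "G_functional \<phi> s = G_functional \<phi> t" for s t unfolding GF G_conserved ..
  moreover have "square_integrable (L_NL \<phi> t)" for t unfolding NL by (rule LNL_norm(1))
  moreover have "G_functional \<phi> t = (norm_L2 (L_NL \<phi> t))\<^sup>2" for t unfolding NL GF by (rule LNL_norm(2)[symmetric])
  ultimately show ?thesis by blast
qed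

end
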